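(* Let $R$ be a regular local ring of dimension two with maximal ideal $\mathfrak m_R$, residue field $\mathfrak k=R/\mathfrak m_R$, coefficient set $CS$ and regular parameters $x,y$. Let $\nu$ be a rank 2 valuation of the quotient field of $R$ which dominates $R$, and suppose that $\nu(x)=\nu(\mathfrak m_R)$. Let $P_0=x,P_1=y,P_2,\ldots$, together with $\Omega$, $\overline n_i$, $d_i$, $n_i$, $\alpha_i$, be a sequence constructed from $\nu,x,y$ by the algorithm described in the context. Let $I_\nu$ be the height one prime ideal in $V_\nu$. Then one of the following three cases holds: 1. $I_\nu\cap R=\mathfrak m_R$, and a) the finite set $\{\mathrm{in}_\nu(x)\}\cup\{\mathrm{in}_\nu(P_i)\mid i\ge1,\ n_i>1\}$ minimally generates $\mathrm{gr}_\nu(R)$ as a $\mathfrak k$-algebra; b) the finite set $\{\nu(x)\}\cup\{\nu(P_i)\mid i\ge1,\ \overline n_i>1\}$ minimally generates the semigroup $S^R(\nu)$; c) $V_\nu/\mathfrak m_\nu=\mathfrak k(\alpha_i\mid d_i>1)$. 2. $I_\nu\cap R=(P_\Omega)$ (with $\Omega<\infty$) is a height one prime ideal in $R$, and a) the finite set $\{\mathrm{in}_\nu(x)\}\cup\{\mathrm{in}_\nu(P_i)\mid i\ge1,\ n_i>1\}$ minimally generates $\mathrm{gr}_\nu(R)$ as a $\mathfrak k$-algebra; b) the finite set $\{\nu(x)\}\cup\{\nu(P_i)\mid i\ge1,\ \overline n_i>1\}$ minimally generates the semigroup $S^R(\nu)$; c) $V_\nu/\mathfrak m_\nu=\mathfrak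 k(\alpha_i\mid d_i>1)$. 3. $I_\nu\cap R=(g)$ is a height one prime ideal in $R$ (for some $g\in R$), and a) the finite set $\{\mathrm{in}_\nu(x)\}\cup\{\mathrm{in}_\nu(P_i)\mid i\ge1,\ n_i>1\}\cup\{\mathrm{in}_\nu(g)\}$ minimally generates $\mathrm{gr}_\nu(R)$ as a $\mathfrak k$-algebra; b) the finite set $\{\nu(x)\}\cup\{\nu(P_i)\mid i\ge1,\ \overline n_i>1\}\cup\{\nu(g)\}$ minimally generates the semigroup $S^R(\nu)$; c) $V_\nu/\mathfrak m_\nu=\mathfrak k(\alpha_i\mid d_i>1)$.
   Context: $\mathbb N=\{0,1,2,\ldots\}$. $V_\nu$ is the valuation ring of $\nu$, with maximal ideal $\mathfrak m_\nu$; $\nu$ dominates $R$ if $R\subset V_\nu$ and $\mathfrak m_\nu\cap R=\mathfrak m_R$. $S^R(\nu)=\{\nu(f)\mid f\in R\setminus\{0\}\}$ (it contains $0$; generation means by nonnegative integer combinations). For an ideal $I$, $\nu(I)=\min\{\nu(f)\mid f\in I\setminus\{0\}\}$. For $\varphi$ in the value group $\Gamma_\nu$, put $\mathcal P_\varphi(R)=\{f\in R\mid\nu(f)\ge\varphi\}$, $\mathcal P^+_\varphi(R)=\{f\in R\mid\nu(f)>\varphi\}$, $\mathrm{gr}_\nu(R)=\bigoplus_{\varphi\in\Gamma_\nu}\mathcal P_\varphi(R)/\mathcal P^+_\varphi(R)$, and for $0\neq f\in R$ with $\nu(f)=\varphi$, $\mathrm{in}_\nu(f)=f+\mathcal P^+_\varphi(R)$.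 "Minimally generates" means that the set generates and no proper subset does. $[f]$ denotes the class of $f\in V_\nu$ in $V_\nu/\mathfrak m_\nu$. $G(z_1,\ldots,z_n)$ is the subgroup generated by $z_1,\ldots,z_n$. A coefficient set of $R$ is a subset $CS\subset R$ with $0,1\in CS$ mapping bijectively to $\mathfrak k$. The algorithm. Set $P_0=x$, $P_1=y$. Given $P_0,\ldots,P_i$ ($i\ge1$), let $\overline n_i=[G(\nu(P_0),\ldots,\nu(P_i)):G(\nu(P_0),\ldots,\nu(P_{i-1}))]$. If $\overline n_i=\infty$, stop: $\Omega=i$, and set $\alpha_i=1$, $d_i=1$, $n_i=\infty$. If $\overline n_i<\infty$, choose a monomial $U_i=P_0^{w_0(i)}\cdots P_{i-1}^{w_{i-1}(i)}$ with $w_j(i)\in\mathbb N$, $w_j(i)<n_j$ for $1\le j\le i-1$, and $\nu(U_i)=\overline n_i\nu(P_i)$; let $\alpha_i=[P_i^{\overline n_i}/U_i]$ and $d_i=[\mathfrak k(\alpha_1,\ldots,\alpha_i):\mathfrak k(\alpha_1,\ldots,\alpha_{i-1})]$. If $d_i=\infty$, stop: $\Omega=i$, $n_i=\infty$. Otherwise let $n_i=\overline n_id_i$, let $f_i(u)=u^{d_i}+b_{i,d_i-1}u^{d_i-1}+\cdots+b_{i,0}$ be the minimal polynomial of $\alpha_i$ over $\mathfrak k(\alpha_1,\ldots,\alpha_{i-1})$, and choose finitely many $a_{s,t}\in CS$ and exponents $j_k(s,t)\in\mathbb N$ ($0\le t<d_i$, $1\le s\le\lambda_t$, $0\le k\le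 i-1$) with $j_k(s,t)<n_k$ for $k\ge1$, $\nu(P_0^{j_0(s,t)}\cdots P_{i-1}^{j_{i-1}(s,t)}P_i^{t\overline n_i})=n_i\nu(P_i)$ for all $s,t$, and $b_{i,t}=\left[\sum_{s}a_{s,t}P_0^{j_0(s,t)}\cdots P_{i-1}^{j_{i-1}(s,t)}/U_i^{d_i-t}\right]$ for $0\le t\le d_i-1$; then set $$P_{i+1}=P_i^{n_i}+\sum_{t=0}^{d_i-1}\Big(\sum_{s=1}^{\lambda_t}a_{s,t}P_0^{j_0(s,t)}\cdots P_{i-1}^{j_{i-1}(s,t)}\Big)P_i^{t\overline n_i}.$$ Such choices are always possible. If the procedure never stops, $\Omega=\infty$. The sequence is $(P_i)_{0\le i\le\Omega}$ if $\Omega<\infty$ and $(P_i)_{i\ge0}$ if $\Omega=\infty$. *)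

theory Defs
  imports "HOL-Algebra.Algebra" "HOL-Computational_Algebra.Group_Closure" "HOL-Library.Extended_Nat"
begin

section \<open>Dimension, height, regular local rings\<close>

definition krull_dim :: "('a, 'b) ring_scheme \<Rightarrow> enat" where
  "krull_dim R = Sup {enat n | n. \<exists>C :: nat \<Rightarrow> 'a set.
      (\<forall>i\<le>n. primeideal (C i) R) \<and> (\<forall>i<n. C i \<subset> C (Suc i))}"

definition ideal_height :: "('a, 'b) ring_scheme \<Rightarrow> 'a set \<Rightarrow> enat" where
  "ideal_height R Q = Sup {enat n | n. \<exists>C :: nat \<Rightarrow> 'a set.
      (\<forall>i\<le>n. primeideal (C i) R) \<and> (\<forall>i<n. C i \<subset> C (Suc i)) \<and> C n = Q}"

definition height_one_prime :: "('a, 'b) ring_scheme \<Rightarrow> 'a set \<Rightarrow> bool" where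
  "height_one_prime R Q \<longleftrightarrow> primeideal Q R \<and> ideal_height R Q = 1"

text \<open>\<open>local_ring R m\<close>: \<open>R\<close> is a Noetherian local ring with maximal ideal \<open>m\<close>.\<close>

definition local_ring :: "('a, 'b) ring_scheme \<Rightarrow> 'a set \<Rightarrow> bool" where
  "local_ring R m \<longleftrightarrow> cring R \<and> noetherian_ring R \<and> maximalideal m R \<and>
     (\<forall>m'. maximalideal m' R \<longrightarrow> m' = m)"

definition regular_local_ring :: "('a, 'b) ring_scheme \<Rightarrow> 'a set \<Rightarrow> bool" where
  "regular_local_ring R m \<longleftrightarrow> local_ring R m \<and>
     (\<exists>S \<subseteq> carrier R. finite S \<and> enat (card S) = krull_dim R \<and> m = Idl\<^bsub>R\<^esub> S)"

definition coefficient_set :: "('a, 'b) ring_scheme \<Rightarrow> 'a set \<Rightarrow> 'a set \<Rightarrow> bool" where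
  "coefficient_set R m CS \<longleftrightarrow> CS \<subseteq> carrier R \<and> \<zero>\<^bsub>R\<^esub> \<in> CS \<and> \<one>\<^bsub>R\<^esub> \<in> CS \<and>
     bij_betw (\<lambda>c. m +>\<^bsub>R\<^esub> c) CS (carrier (R Quot m))"

text \<open>A domain is given as a subset \<open>R\<close> of its quotient field \<open>K\<close>; as a ring it is
  \<open>K\<lparr>carrier := R\<rparr>\<close>.\<close>

definition quotient_field :: "('a, 'b) ring_scheme \<Rightarrow> 'a set \<Rightarrow> bool" where
  "quotient_field K R \<longleftrightarrow> field K \<and> subring R K \<and>
     (\<forall>f\<in>carrier K. \<exists>a\<in>R. \<exists>b\<in>R - {\<zero>\<^bsub>K\<^esub>}. f = a \<otimes>\<^bsub>K\<^esub> inv\<^bsub>K\<^esub> b)"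


section \<open>Valuations\<close>

text \<open>A valuation is a function into a totally ordered abelian group. It need not be surjective,
  and its value at \<open>\<zero>\<close> (conventionally infinite) is arbitrary and never used: every definition
  below treats \<open>\<zero>\<close> separately.\<close>

definition valuation :: "('a, 'b) ring_scheme \<Rightarrow> ('a \<Rightarrow> 'g::linordered_ab_group_add) \<Rightarrow> bool" where
  "valuation K \<nu> \<longleftrightarrow>
     (\<forall>f\<in>carrier K - {\<zero>\<^bsub>K\<^esub>}. \<forall>g\<in>carrier K - {\<zero>\<^bsub>K\<^esub>}.
        \<nu> (f \<otimes>\<^bsub>K\<^esub> g) = \<nu> f + \<nu> g \<and>
        (f \<oplus>\<^bsub>K\<^esub> g \<noteq> \<zero>\<^bsub>K\<^esub> \<longrightarrow> min (\<nu> f) (\<nu> g) \<le> \<nu> (f \<oplus>\<^bsub>K\<^esub> g)))"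

definition value_group :: "('a, 'b) ring_scheme \<Rightarrow> ('a \<Rightarrow> 'g::linordered_ab_group_add) \<Rightarrow> 'g set" where
  "value_group K \<nu> = \<nu> ` (carrier K - {\<zero>\<^bsub>K\<^esub>})"

definition valuation_ring ::
    "('a, 'b) ring_scheme \<Rightarrow> ('a \<Rightarrow> 'g::linordered_ab_group_add) \<Rightarrow> ('a, 'b) ring_scheme" where
  "valuation_ring K \<nu> = K\<lparr>carrier := {f \<in> carrier K. f = \<zero>\<^bsub>K\<^esub> \<or> 0 \<le> \<nu> f}\<rparr>"

definition valuation_ideal ::
    "('a, 'b) ring_scheme \<Rightarrow> ('a \<Rightarrow> 'g::linordered_ab_group_add) \<Rightarrow> 'a set" where
  "valuation_ideal K \<nu> = {f \<in> carrier K. f = \<zero>\<^bsub>K\<^esub> \<or> 0 < \<nu> f}"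

definition valuation_rank ::
    "('a, 'b) ring_scheme \<Rightarrow> ('a \<Rightarrow> 'g::linordered_ab_group_add) \<Rightarrow> enat" where
  "valuation_rank K \<nu> = krull_dim (valuation_ring K \<nu>)"

definition dominates ::
    "('a, 'b) ring_scheme \<Rightarrow> ('a \<Rightarrow> 'g::linordered_ab_group_add) \<Rightarrow> 'a set \<Rightarrow> 'a set \<Rightarrow> bool" where
  "dominates K \<nu> R m \<longleftrightarrow> R \<subseteq> carrier (valuation_ring K \<nu>) \<and> valuation_ideal K \<nu> \<inter> R = m"

definition residue_field ::
    "('a, 'b) ring_scheme \<Rightarrow> ('a \<Rightarrow> 'g::linordered_ab_group_add) \<Rightarrow> 'a set ring" where
  "residue_field K \<nu> = valuation_ring K \<nu> Quot valuation_ideal K \<nu>"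

definition residue_class ::
    "('a, 'b) ring_scheme \<Rightarrow> ('a \<Rightarrow> 'g::linordered_ab_group_add) \<Rightarrow> 'a \<Rightarrow> 'a set" where
  "residue_class K \<nu> f = valuation_ideal K \<nu> +>\<^bsub>valuation_ring K \<nu>\<^esub> f"

text \<open>The value \<open>\<nu>(I)\<close> of an ideal; the minimum exists for nonzero ideals of a Noetherian ring
  on which \<open>\<nu>\<close> is nonnegative.\<close>

definition ideal_value ::
    "('a, 'b) ring_scheme \<Rightarrow> ('a \<Rightarrow> 'g::linordered_ab_group_add) \<Rightarrow> 'a set \<Rightarrow> 'g" where
  "ideal_value K \<nu> I = (LEAST \<phi>. \<phi> \<in> \<nu> ` (I - {\<zero>\<^bsub>K\<^esub>}))"

definition value_semigroup ::
    "('a, 'b) ring_scheme \<Rightarrow> ('a \<Rightarrow> 'g::linordered_ab_group_add) \<Rightarrow> 'a set \<Rightarrow> 'g set" where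
  "value_semigroup K \<nu> R = \<nu> ` (R - {\<zero>\<^bsub>K\<^esub>})"


section \<open>The associated graded ring\<close>

definition val_ge ::
    "('a, 'b) ring_scheme \<Rightarrow> ('a \<Rightarrow> 'g::linordered_ab_group_add) \<Rightarrow> 'a set \<Rightarrow> 'g \<Rightarrow> 'a set" where
  "val_ge K \<nu> R \<phi> = {f \<in> R. f = \<zero>\<^bsub>K\<^esub> \<or> \<phi> \<le> \<nu> f}"

definition val_gt ::
    "('a, 'b) ring_scheme \<Rightarrow> ('a \<Rightarrow> 'g::linordered_ab_group_add) \<Rightarrow> 'a set \<Rightarrow> 'g \<Rightarrow> 'a set" where
  "val_gt K \<nu> R \<phi> = {f \<in> R. f = \<zero>\<^bsub>K\<^esub> \<or> \<phi> < \<nu> f}"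

definition gr_piece ::
    "('a, 'b) ring_scheme \<Rightarrow> ('a \<Rightarrow> 'g::linordered_ab_group_add) \<Rightarrow> 'a set \<Rightarrow> 'g \<Rightarrow> 'a set monoid" where
  "gr_piece K \<nu> R \<phi> = K\<lparr>carrier := val_ge K \<nu> R \<phi>\<rparr> A_Mod val_gt K \<nu> R \<phi>"

definition gr_embed ::
    "('a, 'b) ring_scheme \<Rightarrow> ('a \<Rightarrow> 'g::linordered_ab_group_add) \<Rightarrow> 'a set \<Rightarrow> 'g \<Rightarrow> 'a set \<Rightarrow> ('g \<Rightarrow> 'a set)" where
  "gr_embed K \<nu> R \<phi> C = (\<lambda>\<psi>\<in>value_group K \<nu>. if \<psi> = \<phi> then C else \<one>\<^bsub>gr_piece K \<nu> R \<psi>\<^esub>)"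

text \<open>The additive group of \<open>gr\<^sub>\<nu>(R)\<close> is the direct sum of the (multiplicatively written) groups
  \<open>gr_piece\<close>. The product extends \<open>(f + P\<^sup>+\<^sub>\<alpha>)(g + P\<^sup>+\<^sub>\<beta>) = fg + P\<^sup>+\<^sub>\<alpha>\<^sub>+\<^sub>\<beta>\<close> bilinearly; its \<open>\<phi>\<close>-component
  is a sum over the finitely many \<open>\<alpha>\<close> for which both factors are nonzero.\<close>

definition gr_ring ::
    "('a, 'b) ring_scheme \<Rightarrow> ('a \<Rightarrow> 'g::linordered_ab_group_add) \<Rightarrow> 'a set \<Rightarrow> ('g \<Rightarrow> 'a set) ring" where
  "gr_ring K \<nu> R =
    (let \<Gamma> = value_group K \<nu>; S = sum_group \<Gamma> (gr_piece K \<nu> R) in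
     \<lparr>carrier = carrier S,
      monoid.mult = (\<lambda>F G. \<lambda>\<phi>\<in>\<Gamma>.
         finprod (gr_piece K \<nu> R \<phi>)
           (\<lambda>\<alpha>. rcoset_mult K (val_gt K \<nu> R \<phi>) (F \<alpha>) (G (\<phi> - \<alpha>)))
           {\<alpha>\<in>\<Gamma>. F \<alpha> \<noteq> \<one>\<^bsub>gr_piece K \<nu> R \<alpha>\<^esub> \<and> G (\<phi> - \<alpha>) \<noteq> \<one>\<^bsub>gr_piece K \<nu> R (\<phi> - \<alpha>)\<^esub>}),
      monoid.one = gr_embed K \<nu> R 0 (val_gt K \<nu> R 0 +>\<^bsub>K\<^esub> \<one>\<^bsub>K\<^esub>),
      ring.zero = \<one>\<^bsub>S\<^esub>,
      ring.add = monoid.mult S\<rparr>)"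

definition initial_form ::
    "('a, 'b) ring_scheme \<Rightarrow> ('a \<Rightarrow> 'g::linordered_ab_group_add) \<Rightarrow> 'a set \<Rightarrow> 'a \<Rightarrow> ('g \<Rightarrow> 'a set)" where
  "initial_form K \<nu> R f = gr_embed K \<nu> R (\<nu> f) (val_gt K \<nu> R (\<nu> f) +>\<^bsub>K\<^esub> f)"

text \<open>The \<open>R/m\<close>-subalgebra of \<open>gr\<^sub>\<nu>(R)\<close> generated by \<open>E\<close>. If \<open>\<nu>\<close> dominates \<open>R\<close>, the degree
  zero piece is \<open>R/m\<close> itself, so the structure map is \<open>gr_embed \<dots> 0\<close>.\<close>

definition gr_subalgebra ::
    "('a, 'b) ring_scheme \<Rightarrow> ('a \<Rightarrow> 'g::linordered_ab_group_add) \<Rightarrow> 'a set \<Rightarrow> 'a set \<Rightarrow>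
     ('g \<Rightarrow> 'a set) set \<Rightarrow> ('g \<Rightarrow> 'a set) set" where
  "gr_subalgebra K \<nu> R m E =
     generate_ring (gr_ring K \<nu> R) (gr_embed K \<nu> R 0 ` carrier (K\<lparr>carrier := R\<rparr> Quot m) \<union> E)"

definition nat_combinations :: "'g::comm_monoid_add set \<Rightarrow> 'g set" where
  "nat_combinations E = {\<Sum>\<^sub># M | M. set_mset M \<subseteq> E}"

definition minimally_generates :: "('e set \<Rightarrow> 'e set) \<Rightarrow> 'e set \<Rightarrow> 'e set \<Rightarrow> bool" where
  "minimally_generates gen E A \<longleftrightarrow> gen E = A \<and> (\<forall>E'. E' \<subset> E \<longrightarrow> gen E' \<noteq> A)"


section \<open>The algorithm\<close>

definition subgroup_index :: "'g::ab_group_add set \<Rightarrow> 'g set \<Rightarrow> enat" where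
  "subgroup_index G H =
     (let cosets = (\<lambda>g. (+) g ` H) ` G in if finite cosets then enat (card cosets) else \<infinity>)"

text \<open>The degree \<open>[E : F]\<close> of subfields \<open>F \<subseteq> E\<close> of \<open>L\<close>.\<close>

definition extension_degree :: "('a, 'b) ring_scheme \<Rightarrow> 'a set \<Rightarrow> 'a set \<Rightarrow> enat" where
  "extension_degree L E F =
     (if ring.finite_dimension L F E then enat (ring.dim L F E) else \<infinity>)"

definition nat_multiple :: "nat \<Rightarrow> 'g::comm_monoid_add \<Rightarrow> 'g" where
  "nat_multiple k \<phi> = (\<Sum>_<k. \<phi>)"

text \<open>The monomial \<open>P\<^sub>0\<^bsup>w 0\<^esup> \<cdots> P\<^bsub>i-1\<^esub>\<^bsup>w (i-1)\<^esup>\<close>.\<close>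

definition monomial :: "('a, 'b) ring_scheme \<Rightarrow> (nat \<Rightarrow> 'a) \<Rightarrow> nat \<Rightarrow> (nat \<Rightarrow> nat) \<Rightarrow> 'a" where
  "monomial K P i w = (\<Otimes>\<^bsub>K\<^esub>k\<in>{..<i}. P k [^]\<^bsub>K\<^esub> w k)"

text \<open>The field \<open>k(\<alpha>\<^sub>j | j \<in> J)\<close> inside the residue field of \<open>\<nu>\<close>, where \<open>k\<close> is the image of \<open>R\<close>.\<close>

definition residue_adjoin ::
    "('a, 'b) ring_scheme \<Rightarrow> ('a \<Rightarrow> 'g::linordered_ab_group_add) \<Rightarrow> 'a set \<Rightarrow> (nat \<Rightarrow> 'a set) \<Rightarrow> nat set \<Rightarrow> 'a set set" where
  "residue_adjoin K \<nu> R \<alpha> J =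
     generate_field (residue_field K \<nu>) (residue_class K \<nu> ` R \<union> \<alpha> ` J)"

definition admissible_monomial ::
    "('a, 'b) ring_scheme \<Rightarrow> ('a \<Rightarrow> 'g::linordered_ab_group_add) \<Rightarrow> (nat \<Rightarrow> 'a) \<Rightarrow>
     (nat \<Rightarrow> enat) \<Rightarrow> (nat \<Rightarrow> enat) \<Rightarrow> nat \<Rightarrow> 'a \<Rightarrow> bool" where
  "admissible_monomial K \<nu> P nbar n i U \<longleftrightarrow>
     (\<exists>w :: nat \<Rightarrow> nat. U = monomial K P i w \<and> (\<forall>j\<in>{1..<i}. enat (w j) < n j) \<and>
        \<nu> U = nat_multiple (the_enat (nbar i)) (\<nu> (P i)))"

text \<open>\<open>P (Suc i)\<close> arises from \<open>P 0, \<dots>, P i\<close> by lifting the minimal polynomial of \<open>\<alpha> i\<close>, for some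
  choice of the coefficients \<open>a s t\<close> and exponents \<open>j s t k\<close>; only used when \<open>nbar i\<close>, \<open>d i\<close> and
  \<open>n i\<close> are finite.\<close>

definition next_element ::
    "('a, 'b) ring_scheme \<Rightarrow> ('a \<Rightarrow> 'g::linordered_ab_group_add) \<Rightarrow> 'a set \<Rightarrow> 'a set \<Rightarrow> (nat \<Rightarrow> 'a) \<Rightarrow>
     (nat \<Rightarrow> enat) \<Rightarrow> (nat \<Rightarrow> enat) \<Rightarrow> (nat \<Rightarrow> enat) \<Rightarrow> (nat \<Rightarrow> 'a set) \<Rightarrow> nat \<Rightarrow> 'a \<Rightarrow> bool" where
  "next_element K \<nu> R CS P nbar d n \<alpha> i U \<longleftrightarrow>
    (let L = residue_field K \<nu>;
         f = ring.Irr L (residue_adjoin K \<nu> R \<alpha> {1..<i}) (\<alpha> i);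
         N = the_enat (nbar i); D = the_enat (d i)
     in \<exists>(lam :: nat \<Rightarrow> nat) (a :: nat \<Rightarrow> nat \<Rightarrow> 'a) (j :: nat \<Rightarrow> nat \<Rightarrow> nat \<Rightarrow> nat).
       (\<forall>t<D. \<forall>s\<in>{1..lam t}.
          a s t \<in> CS \<and>
          (\<forall>k\<in>{1..<i}. enat (j s t k) < n k) \<and>
          \<nu> (monomial K P i (j s t) \<otimes>\<^bsub>K\<^esub> P i [^]\<^bsub>K\<^esub> (t * N)) =
            nat_multiple (the_enat (n i)) (\<nu> (P i))) \<and>
       (\<forall>t<D. ring.coeff L f t =
          residue_class K \<nu>
            ((\<Oplus>\<^bsub>K\<^esub>s\<in>{1..lam t}. a s t \<otimes>\<^bsub>K\<^esub> monomial K P i (j s t)) \<otimes>\<^bsub>K\<^esub>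
             inv\<^bsub>K\<^esub> (U [^]\<^bsub>K\<^esub> (D - t)))) \<and>
       P (Suc i) =
         P i [^]\<^bsub>K\<^esub> the_enat (n i) \<oplus>\<^bsub>K\<^esub>
         (\<Oplus>\<^bsub>K\<^esub>t\<in>{..<D}.
            (\<Oplus>\<^bsub>K\<^esub>s\<in>{1..lam t}. a s t \<otimes>\<^bsub>K\<^esub> monomial K P i (j s t)) \<otimes>\<^bsub>K\<^esub>
            P i [^]\<^bsub>K\<^esub> (t * N)))"

text \<open>\<open>P\<close>, \<open>\<Omega>\<close>, \<open>nbar\<close>, \<open>d\<close>, \<open>n\<close>, \<open>\<alpha>\<close> record a run of the algorithm. The entries \<open>P i\<close> with
  \<open>i > \<Omega>\<close> and \<open>nbar i\<close>, \<open>d i\<close>, \<open>n i\<close>, \<open>\<alpha> i\<close> with \<open>i = 0\<close> or \<open>i > \<Omega>\<close> are meaningless.\<close>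

definition algorithm_run ::
    "('a, 'b) ring_scheme \<Rightarrow> ('a \<Rightarrow> 'g::linordered_ab_group_add) \<Rightarrow> 'a set \<Rightarrow> 'a set \<Rightarrow> 'a \<Rightarrow> 'a \<Rightarrow>
     (nat \<Rightarrow> 'a) \<Rightarrow> enat \<Rightarrow> (nat \<Rightarrow> enat) \<Rightarrow> (nat \<Rightarrow> enat) \<Rightarrow> (nat \<Rightarrow> enat) \<Rightarrow> (nat \<Rightarrow> 'a set) \<Rightarrow> bool" where
  "algorithm_run K \<nu> R CS x y P \<Omega> nbar d n \<alpha> \<longleftrightarrow>
     P 0 = x \<and> P 1 = y \<and> 1 \<le> \<Omega> \<and>
     (\<forall>i\<ge>1. enat i \<le> \<Omega> \<longrightarrow>
        nbar i = subgroup_index (group_closure (\<nu> ` P ` {..i})) (group_closure (\<nu> ` P ` {..<i})) \<and>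
        (if nbar i = \<infinity> then \<Omega> = enat i \<and> \<alpha> i = \<one>\<^bsub>residue_field K \<nu>\<^esub> \<and> d i = 1 \<and> n i = \<infinity>
         else (\<exists>U. admissible_monomial K \<nu> P nbar n i U \<and>
            \<alpha> i = residue_class K \<nu> (P i [^]\<^bsub>K\<^esub> the_enat (nbar i) \<otimes>\<^bsub>K\<^esub> inv\<^bsub>K\<^esub> U) \<and>
            d i = extension_degree (residue_field K \<nu>)
                    (residue_adjoin K \<nu> R \<alpha> {1..i}) (residue_adjoin K \<nu> R \<alpha> {1..<i}) \<and>
            (if d i = \<infinity> then \<Omega> = enat i \<and> n i = \<infinity>
             else enat i < \<Omega> \<and> n i = nbar i * d i \<and>
                  next_element K \<nu> R CS P nbar d n \<alpha> i U))))"

end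

theory Submission
  imports Defs
begin

text \<open>Values of elements of \<open>R\<close> are of two kinds: those bounded by a multiple of \<open>\<nu>(x)\<close> (the
  predicate \<open>finv\<close>) and the others. An element of the first kind has the same initial form as a
  normal form in some \<open>P\<^sub>0, \<dots>, P\<^bsub>i-1\<^esub>\<close>, with the exponent of \<open>P\<^sub>k\<close> below \<open>n\<^sub>k\<close> for \<open>k \<ge> 1\<close>. No
  cancellation occurs among the terms of a normal form: terms whose exponents of \<open>P\<^sub>k\<close> differ modulo
  \<open>nbar\<^sub>k\<close> have different values, and the powers of \<open>\<alpha>\<^sub>k\<close> below \<open>d\<^sub>k\<close> are linearly independent over
  \<open>k(\<alpha>\<^sub>1, \<dots>, \<alpha>\<^bsub>k-1\<^esub>)\<close>. So the \<open>P\<^sub>i\<close> account for all values, residues and initial forms of the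
  first kind.

  If \<open>x \<in> I\<close>, there are no other values. Otherwise \<open>I \<inter> R\<close> consists of \<open>0\<close> and the elements of the
  second kind, it is a principal prime ideal \<open>(g)\<close> of height one, and every \<open>f \<noteq> 0\<close> is \<open>g\<^sup>k f'\<close> with
  \<open>f'\<close> of the first kind. Modulo \<open>x\<close>, \<open>P\<^sub>i\<close> is the power of \<open>y\<close> with exponent \<open>n\<^sub>1 \<cdots> n\<^bsub>i-1\<^esub>\<close>, and
  approximating \<open>g \<notin> (x)\<close> by normal forms shows that \<open>P\<^sub>\<Omega>\<close> generates \<open>I \<inter> R\<close> if \<open>\<Omega> < \<infinity>\<close>, and
  that almost all \<open>n\<^sub>i\<close> are \<open>1\<close> if \<open>\<Omega> = \<infinity>\<close>.

  A generator of the graded ring is indispensable because a suitable system of subgroups of the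
  filtration, closed under products, contains the other generators but not this one.\<close>

section \<open>Two-dimensional regular local rings\<close>

text \<open>R need not be complete, so an element is studied through approximations: dividing
  repeatedly by x and by P_i leaves an error of value at least M \<nu>(x), because \<nu>(x) is the
  least value on m and \<nu>(P_i) \<ge> \<nu>(x). Hence the multiples of \<nu>(x) are the yardstick.
  In rank two they single out a prime of the valuation ring: the elements beyond all multiples of
  \<nu>(x) form I itself if x \<notin> I, and only 0 if x \<in> I. Dimension two is used as the
  existence of a prime strictly between 0 and m. It keeps every power of y out of xR, so that R/xR
  behaves like a discrete valuation ring with uniformizer y; a stationary chain of ideals takes the
  place of Krull's intersection theorem and of unique factorization. The order in y modulo x is thus
  a second measure besides the value. A generator g of the contracted prime has finite order in y
  modulo x, whereas every good approximation of g has large value; the conflict of the two drives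
  the arguments about g.\<close>

context cring
begin

lemma PIdl_iff:
  assumes "g \<in> carrier R"
  shows "f \<in> PIdl g \<longleftrightarrow> (\<exists>c\<in>carrier R. f = g \<otimes> c)"
  using assms by (auto simp: cgenideal_def m_comm)

lemma PIdl_minus_cancel:
  assumes "g \<in> carrier R" "a \<in> carrier R" "b \<in> carrier R" "a \<oplus> b \<in> PIdl g" "b \<in> PIdl g"
  shows "a \<in> PIdl g"
proof -
  interpret J: ideal "PIdl g" R by (rule cgenideal_ideal[OF assms(1)])
  have "(a \<oplus> b) \<ominus> b \<in> PIdl g"
    using J.a_closed[OF assms(4) J.a_inv_closed[OF assms(5)]] by (simp add: a_minus_def)
  moreover have "(a \<oplus> b) \<ominus> b = a" using assms(2,3) by algebra
  ultimately show ?thesis by simp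
qed

end

lemma (in noetherian_ring) ascending_ideals_stationary:
  assumes id: "\<And>n :: nat. ideal (D n) R" and Suc: "\<And>n. D n \<subseteq> D (Suc n)"
  shows "\<exists>k. \<forall>i. D i \<subseteq> D k"
proof -
  have "D i \<subseteq> D j \<or> D j \<subseteq> D i" for i j
    using lift_Suc_mono_le[of D, OF Suc] nat_le_linear by blast
  then have "subset.chain {I. ideal I R} (range D)"
    unfolding subset.chain_def using id by blast
  then have "\<Union>(range D) \<in> range D" by (intro ideal_chain_is_trivial) auto
  then show ?thesis by auto
qed

text \<open>By Noetherianness the union of a chain of ideals belongs to the chain, so Zorn's lemma
  applies to the proper ideals above J and yields a maximal ideal, which can only be m.\<close>

lemma (in noetherian_ring) proper_ideal_sub_maximal:
  assumes local: "\<And>m'. maximalideal m' R \<Longrightarrow> m' = m" and J: "ideal J R" "\<one> \<notin> J"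
  shows "J \<subseteq> m"
proof -
  define S where "S = {Z. ideal Z R \<and> J \<subseteq> Z \<and> \<one> \<notin> Z}"
  have "J \<in> S" using J by (simp add: S_def)
  moreover have "\<Union>C \<in> S" if "C \<noteq> {}" "subset.chain S C" for C
  proof -
    have "subset.chain {I. ideal I R} C" using that(2) unfolding subset.chain_def S_def by blast
    then have "\<Union>C \<in> C" using ideal_chain_is_trivial that(1) by blast
    then show ?thesis using that(2) unfolding subset.chain_def by blast
  qed
  ultimately obtain Z where Z: "Z \<in> S" "\<And>Y. Y \<in> S \<Longrightarrow> Z \<subseteq> Y \<Longrightarrow> Y = Z"
    using subset_Zorn_nonempty[of S] by blast
  have "maximalideal Z R"
  proof (rule maximalidealI)
    show "ideal Z R" using Z(1) by (simp add: S_def)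
    show "carrier R \<noteq> Z" using Z(1) one_closed by (auto simp: S_def)
    fix Y assume Y: "ideal Y R" "Z \<subseteq> Y" "Y \<subseteq> carrier R"
    show "Y = Z \<or> Y = carrier R"
    proof (cases "\<one> \<in> Y")
      case True
      then show ?thesis using ideal.one_imp_carrier[OF Y(1)] by blast
    next
      case False
      then have "Y \<in> S" using Y Z(1) by (auto simp: S_def)
      then show ?thesis using Z(2) Y by blast
    qed
  qed
  then have "Z = m" by (rule local)
  then show ?thesis using Z(1) by (simp add: S_def)
qed

text \<open>The working form of a two-dimensional regular local ring.
  \<open>intermediate_prime\<close> is what dimension two contributes; the assumptions are symmetric
  in x and y.\<close>

locale local_parameters = noetherian_domain +
  fixes m :: "'a set" and x y :: 'a
  assumes max: "maximalideal m R"
    and local: "\<And>m'. maximalideal m' R \<Longrightarrow> m' = m"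
    and x_in [simp, intro]: "x \<in> carrier R" and y_in [simp, intro]: "y \<in> carrier R"
    and m_eq: "m = Idl {x, y}"
    and intermediate_prime: "\<exists>q. primeideal q R \<and> q \<noteq> {\<zero>} \<and> q \<subset> m"
begin

sublocale M: maximalideal m R by (rule max)

lemma m_sub: "f \<in> m \<Longrightarrow> f \<in> carrier R"
  using M.a_Hcarr by blast

lemma not_in_m_Unit:
  assumes "f \<in> carrier R" "f \<notin> m"
  shows "f \<in> Units R"
proof (rule ccontr)
  assume nu: "f \<notin> Units R"
  have "\<one> \<notin> PIdl f"
  proof
    assume "\<one> \<in> PIdl f"
    then obtain c where "c \<in> carrier R" "\<one> = f \<otimes> c" using PIdl_iff[OF assms(1)] by blast
    then show False using nu assms(1) by (auto simp: Units_def m_comm)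
  qed
  with cgenideal_ideal[OF assms(1)] have "PIdl f \<subseteq> m"
    by (rule proper_ideal_sub_maximal[rotated]) (rule local)
  then show False using assms(2) cgenideal_self[OF assms(1)] by blast
qed

lemma m_not_Unit: "f \<in> m \<Longrightarrow> f \<notin> Units R"
  by (metis M.I_l_closed M.I_notcarr M.one_imp_carrier Units_inv_closed Units_l_inv)

lemma x_in_m: "x \<in> m" and y_in_m: "y \<in> m"
  using genideal_self[of "{x, y}"] by (auto simp: m_eq)

lemma in_m_E:
  assumes "f \<in> m"
  obtains a b where "a \<in> carrier R" "b \<in> carrier R" "f = x \<otimes> a \<oplus> y \<otimes> b"
proof -
  let ?J = "PIdl x <+>\<^bsub>R\<^esub> PIdl y"
  have id: "ideal ?J R" by (intro add_ideals cgenideal_ideal) auto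
  have "x \<in> ?J"
    unfolding set_add_def' using cgenideal_self[OF x_in] additive_subgroup.zero_closed[OF ideal.axioms(1)[OF cgenideal_ideal[OF y_in]]]
    by (metis (mono_tags, lifting) UN_I insertI1 r_zero x_in)
  moreover have "y \<in> ?J"
    unfolding set_add_def' using cgenideal_self[OF y_in] additive_subgroup.zero_closed[OF ideal.axioms(1)[OF cgenideal_ideal[OF x_in]]]
    by (metis (mono_tags, lifting) UN_I insertI1 l_zero y_in)
  ultimately have "{x, y} \<subseteq> ?J" by blast
  then have "m \<subseteq> ?J" unfolding m_eq by (rule genideal_minimal[OF id])
  then obtain u v where uv: "u \<in> PIdl x" "v \<in> PIdl y" "f = u \<oplus> v"
    using assms unfolding set_add_def' by blast
  obtain a where a: "a \<in> carrier R" "u = x \<otimes> a" using uv(1) PIdl_iff[OF x_in] by blast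
  obtain b where b: "b \<in> carrier R" "v = y \<otimes> b" using uv(2) PIdl_iff[OF y_in] by blast
  show ?thesis using that[OF a(1) b(1)] uv(3) a(2) b(2) by blast
qed

text \<open>The ideals \<open>N + h\<^sub>i R\<close> increase, and where they become stationary \<open>(1 - yc) h\<^sub>i \<in> N\<close>.\<close>

lemma nakayama_sequence:
  assumes N: "ideal N R" and t: "t \<in> m" and h: "\<And>i. h i \<in> carrier R"
    and step: "\<And>i. h i \<ominus> t \<otimes> h (Suc i) \<in> N"
  shows "h i \<in> N"
proof -
  interpret N: ideal N R by (rule N)
  have tc: "t \<in> carrier R" using t m_sub by blast
  define D where "D i = N <+>\<^bsub>R\<^esub> PIdl (h i)" for i
  have D_iff: "f \<in> D i \<longleftrightarrow> (\<exists>n\<in>N. \<exists>c\<in>carrier R. f = n \<oplus> h i \<otimes> c)" for f i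
  proof -
    have "f \<in> D i \<longleftrightarrow> (\<exists>n\<in>N. \<exists>v\<in>PIdl (h i). f = n \<oplus> v)"
      unfolding D_def set_add_def' by auto
    also have "\<dots> \<longleftrightarrow> (\<exists>n\<in>N. \<exists>c\<in>carrier R. f = n \<oplus> h i \<otimes> c)"
      by (simp add: Bex_def PIdl_iff[OF h]) blast
    finally show ?thesis .
  qed
  have D_id: "ideal (D i) R" for i
    unfolding D_def by (intro add_ideals N cgenideal_ideal h)
  have D_mono: "D i \<subseteq> D (Suc i)" for i
  proof
    fix f assume "f \<in> D i"
    then obtain n c where nc: "n \<in> N" "c \<in> carrier R" "f = n \<oplus> h i \<otimes> c" using D_iff by blast
    define n' where "n' = n \<oplus> (h i \<ominus> t \<otimes> h (Suc i)) \<otimes> c"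
    have "n' \<in> N" unfolding n'_def using nc step by (intro N.a_closed N.I_r_closed)
    moreover have "n \<in> carrier R" using nc(1) N.a_Hcarr by blast
    then have "f = n' \<oplus> h (Suc i) \<otimes> (t \<otimes> c)"
      unfolding n'_def nc(3) using h[of i] h[of "Suc i"] nc(2) tc by algebra
    ultimately show "f \<in> D (Suc i)" using D_iff nc(2) tc by blast
  qed
  have mono: "D i \<subseteq> D j" if "i \<le> j" for i j
    using lift_Suc_mono_le[of D, OF D_mono that] .
  have "\<exists>k. \<forall>i. D i \<subseteq> D k" by (rule ascending_ideals_stationary[of D, OF D_id D_mono])
  then obtain k where k: "\<And>i. D i \<subseteq> D k" by auto
  have up: "h (Suc i) \<in> N" if "i \<ge> k" for i
  proof -
  have "h (Suc i) \<in> D (Suc i)"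
  proof -
    have "h (Suc i) = \<zero> \<oplus> h (Suc i) \<otimes> \<one>" using h[of "Suc i"] by simp
    then show ?thesis using D_iff N.zero_closed by blast
  qed
  then have "h (Suc i) \<in> D i" using k[of "Suc i"] mono[OF that] by blast
  then obtain n c where nc: "n \<in> N" "c \<in> carrier R" "h (Suc i) = n \<oplus> h i \<otimes> c"
    using D_iff by blast
  \<comment> \<open>Modulo N the relations h(i+1) = h(i) c and h(i) = t h(i+1) combine to u h(i+1) =
    0, and t \<in> m makes u a unit.\<close>
  define u where "u = \<one> \<ominus> t \<otimes> c"
  have uc: "u \<in> carrier R" unfolding u_def using tc nc by simp
  have "u \<notin> m"
  proof
    assume "u \<in> m"
    moreover have "t \<otimes> c \<in> m" using t nc M.I_r_closed by blast
    ultimately have "u \<oplus> t \<otimes> c \<in> m" by (rule M.a_closed)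
    moreover have "u \<oplus> t \<otimes> c = \<one>" unfolding u_def using tc nc by algebra
    ultimately show False using m_not_Unit by auto
  qed
  then have U: "u \<in> Units R" using uc not_in_m_Unit by blast
  have "h (Suc i) \<otimes> u = n \<oplus> (h i \<ominus> t \<otimes> h (Suc i)) \<otimes> c"
  proof -
    have n: "n \<in> carrier R" using nc(1) N.a_Hcarr by blast
    have "h (Suc i) \<otimes> u = h (Suc i) \<ominus> h (Suc i) \<otimes> (t \<otimes> c)"
      unfolding u_def using h[of "Suc i"] tc nc(2) by algebra
    also have "\<dots> = (n \<oplus> h i \<otimes> c) \<ominus> h (Suc i) \<otimes> (t \<otimes> c)" using nc(3) by simp
    also have "\<dots> = n \<oplus> (h i \<ominus> t \<otimes> h (Suc i)) \<otimes> c"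
      using h[of "Suc i"] h[of i] tc nc(2) n by algebra
    finally show ?thesis .
  qed
  also have "\<dots> \<in> N" using nc step by (intro N.a_closed N.I_r_closed)
  finally have "h (Suc i) \<otimes> u \<otimes> inv u \<in> N" by (rule N.I_r_closed[OF _ Units_inv_closed[OF U]])
  then show ?thesis using U h[of "Suc i"] by (simp add: m_assoc Units_closed)
  qed
  have down: "h i \<in> N" if "h (Suc i) \<in> N" for i
  proof -
    have "(h i \<ominus> t \<otimes> h (Suc i)) \<oplus> t \<otimes> h (Suc i) \<in> N"
      using step that tc by (intro N.a_closed N.I_l_closed)
    moreover have "(h i \<ominus> t \<otimes> h (Suc i)) \<oplus> t \<otimes> h (Suc i) = h i"
      using h[of i] h[of "Suc i"] tc by algebra
    ultimately show ?thesis by simp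
  qed
  have "h i \<in> N" if "i \<le> Suc k"
    by (rule inc_induct[OF that]) (use up[of k] down in auto)
  moreover have "h i \<in> N" if "\<not> i \<le> Suc k"
    using up[of "i - 1"] that by (cases i) auto
  ultimately show ?thesis by blast
qed

section \<open>The ring R modulo x and its primes\<close>

lemma swap: "local_parameters R m y x"
proof unfold_locales
  show "m = Idl {y, x}" using m_eq by (simp add: insert_commute)
qed (fact max | rule local | fact x_in | fact y_in | fact intermediate_prime | assumption)+

text \<open>At the last exponent j for which z lies in the ideal of y^j and x, the coefficient of
  y^j is a unit: a coefficient in m would supply one more factor y modulo x.\<close>

lemma not_in_m_pow:
  fixes n :: nat
  assumes "z \<in> carrier R" "z \<notin> PIdl x" "\<not> (\<exists>c\<in>carrier R. \<exists>h\<in>carrier R. z = y [^] n \<otimes> c \<oplus> x \<otimes> h)"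
  shows "\<exists>u\<in>Units R. \<exists>h\<in>carrier R. \<exists>j<n. z = u \<otimes> y [^] j \<oplus> x \<otimes> h"
  using assms(3)
proof (induction n)
  case 0
  have "z = y [^] (0::nat) \<otimes> z \<oplus> x \<otimes> \<zero>" using assms(1) by simp
  then show ?case using 0 assms(1) by blast
next
  case (Suc n)
  show ?case
  proof (cases "\<exists>c\<in>carrier R. \<exists>h\<in>carrier R. z = y [^] n \<otimes> c \<oplus> x \<otimes> h")
    case False
    then show ?thesis using Suc.IH less_SucI by meson
  next
    case True
    then obtain c h where ch: "c \<in> carrier R" "h \<in> carrier R" "z = y [^] n \<otimes> c \<oplus> x \<otimes> h" by blast
    have "c \<notin> m"
    proof
      assume "c \<in> m"
      then obtain a b where ab: "a \<in> carrier R" "b \<in> carrier R" "c = x \<otimes> a \<oplus> y \<otimes> b" by (rule in_m_E)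
      have yn: "y [^] n \<in> carrier R" by simp
      have "z = y [^] Suc n \<otimes> b \<oplus> x \<otimes> (h \<oplus> y [^] n \<otimes> a)"
        unfolding ch(3) ab(3) nat_pow_Suc using yn ch ab x_in y_in by algebra
      then show False using Suc.prems ab ch by blast
    qed
    then have "c \<in> Units R" using ch not_in_m_Unit by blast
    moreover have "z = c \<otimes> y [^] n \<oplus> x \<otimes> h" using ch by (simp add: m_comm)
    ultimately show ?thesis using ch by blast
  qed
qed

lemma PIdl_x_ideal: "ideal (PIdl x) R" by (rule cgenideal_ideal) simp

text \<open>Otherwise z would lie in the ideal of y^n and x for every n. The coefficients then
  satisfy c(n) = y c(n+1) up to elements killed by y^n modulo x, and
  \<open>nakayama_sequence\<close> forces z into xR.\<close>

lemma unit_power_rep: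
  assumes z: "z \<in> carrier R" "z \<notin> PIdl x"
  obtains u h n where "u \<in> Units R" "h \<in> carrier R" "z = u \<otimes> y [^] (n::nat) \<oplus> x \<otimes> h"
proof (rule ccontr)
  note rep = that
  assume "\<not> thesis"
  then have "\<forall>n. \<exists>c\<in>carrier R. \<exists>h\<in>carrier R. z = y [^] (n::nat) \<otimes> c \<oplus> x \<otimes> h"
    using not_in_m_pow[OF z] rep by blast
  then obtain c where c: "\<And>n. c n \<in> carrier R" "\<And>n::nat. \<exists>h\<in>carrier R. z = y [^] n \<otimes> c n \<oplus> x \<otimes> h" by metis
  interpret I: ideal "PIdl x" R by (rule PIdl_x_ideal)
  \<comment> \<open>At this stage y could still be nilpotent modulo x, so y^n cannot be cancelled;
    \<open>N n\<close> collects what it kills in R/xR.\<close>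
  define N where "N n = {f \<in> carrier R. y [^] (n::nat) \<otimes> f \<in> PIdl x}" for n
  have N_id: "ideal (N n) R" for n
  proof (rule idealI)
    show "ring R" ..
    show "subgroup (N n) (add_monoid R)"
    proof (rule add.subgroupI)
      show "N n \<subseteq> carrier R" unfolding N_def by auto
      show "N n \<noteq> {}" using I.zero_closed unfolding N_def by (auto intro!: exI[of _ \<zero>])
      show "\<ominus> a \<in> N n" if "a \<in> N n" for a
        using that I.a_inv_closed unfolding N_def by (auto simp: r_minus)
      show "a \<oplus> b \<in> N n" if "a \<in> N n" "b \<in> N n" for a b
        using that I.a_closed unfolding N_def by (auto simp: r_distr)
    qed
    show "f \<otimes> a \<in> N n" if "a \<in> N n" "f \<in> carrier R" for a f
      using that I.I_l_closed[of "y [^] n \<otimes> a" f] unfolding N_def by (auto simp: m_lcomm)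
    show "a \<otimes> f \<in> N n" if "a \<in> N n" "f \<in> carrier R" for a f
      using that I.I_r_closed[of "y [^] n \<otimes> a" f] unfolding N_def by (auto simp: m_assoc)
  qed
  have N_mono: "N n \<subseteq> N (Suc n)" for n
    proof
      fix f assume f: "f \<in> N n"
      have "y [^] n \<otimes> f \<otimes> y \<in> PIdl x" using f I.I_r_closed unfolding N_def by auto
      moreover have "y [^] n \<otimes> f \<otimes> y = y [^] Suc n \<otimes> f" using f unfolding N_def by (simp add: m_ac)
      ultimately show "f \<in> N (Suc n)" using f unfolding N_def by auto
    qed
  have "\<exists>k. \<forall>i. N i \<subseteq> N k" by (rule ascending_ideals_stationary[of N, OF N_id N_mono])
  then obtain s where s: "\<And>i. N i \<subseteq> N s" by auto
  have "c i \<in> N s" for i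
  proof (rule nakayama_sequence[OF N_id y_in_m c(1)])
    fix i
    obtain h where h: "h \<in> carrier R" "z = y [^] i \<otimes> c i \<oplus> x \<otimes> h" using c(2) by blast
    obtain h' where h': "h' \<in> carrier R" "z = y [^] Suc i \<otimes> c (Suc i) \<oplus> x \<otimes> h'" using c(2) by blast
    have p: "y [^] i \<in> carrier R" by simp
    have "y [^] i \<otimes> (c i \<ominus> y \<otimes> c (Suc i)) = (y [^] i \<otimes> c i \<oplus> x \<otimes> h) \<ominus> (y [^] Suc i \<otimes> c (Suc i) \<oplus> x \<otimes> h') \<oplus> x \<otimes> (h' \<ominus> h)"
      unfolding nat_pow_Suc using p c(1)[of i] c(1)[of "Suc i"] h(1) h'(1) x_in y_in by algebra
    also have "\<dots> = x \<otimes> (h' \<ominus> h)" using h h' z(1) by (metis (no_types, lifting) a_minus_def l_zero m_closed minus_closed r_neg x_in)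
    finally have "y [^] i \<otimes> (c i \<ominus> y \<otimes> c (Suc i)) \<in> PIdl x" using PIdl_iff h h' by auto
    then have "c i \<ominus> y \<otimes> c (Suc i) \<in> N i" unfolding N_def using c(1) by auto
    then show "c i \<ominus> y \<otimes> c (Suc i) \<in> N s" using s by blast
  qed
  then have "y [^] s \<otimes> c s \<in> PIdl x" unfolding N_def by auto
  moreover obtain h where "h \<in> carrier R" "z = y [^] s \<otimes> c s \<oplus> x \<otimes> h" using c(2) by blast
  ultimately have "z \<in> PIdl x" using I.a_closed PIdl_iff by auto
  then show False using z by blast
qed

text \<open>Krull's principal ideal theorem for \<open>xR\<close>. Given a prime \<open>q\<close> strictly between \<open>0\<close> and \<open>m\<close>
  and \<open>0 \<noteq> f \<in> q\<close>, the ideals \<open>Q\<^sub>n = {h | sh \<in> f\<^sup>nR for some s \<notin> q}\<close> replace the symbolic powers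
  of the usual argument.\<close>

lemma pow_notin_PIdl: "y [^] (s::nat) \<notin> PIdl x"
proof
  assume ys: "y [^] s \<in> PIdl x"
  obtain q where q: "primeideal q R" "q \<noteq> {\<zero>}" "q \<subset> m" using intermediate_prime by blast
  interpret q: primeideal q R by (rule q(1))
  interpret I: ideal "PIdl x" R by (rule PIdl_x_ideal)
  \<comment> \<open>If q contained x, then y^s \<in> xR would put y into q as well, and q would be
    all of m.\<close>
  have y_q: "y \<in> q" if "x \<in> q"
  proof -
    have "PIdl x \<subseteq> q" using that by (rule cgenideal_minimal[OF q.is_ideal])
    then have "y [^] s \<in> q" using ys by blast
    then show ?thesis
    proof (induction s)
      case 0 then show ?case using q.I_notcarr q.one_imp_carrier by auto
    next
      case (Suc s) then show ?case using q.I_prime[of "y [^] s" y] by auto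
    qed
  qed
  have xq: "x \<notin> q"
  proof
    assume "x \<in> q"
    then have "m \<subseteq> q" unfolding m_eq using y_q by (intro genideal_minimal[OF q.is_ideal]) auto
    then show False using q(3) by blast
  qed
  obtain f where f: "f \<in> q" "f \<noteq> \<zero>" using q(2) q.zero_closed by blast
  have fc: "f \<in> carrier R" using f q.a_Hcarr by blast
  define Q where "Q n = {h \<in> carrier R. \<exists>s\<in>carrier R - q. s \<otimes> h \<in> PIdl (f [^] (n::nat))}" for n
  have fn: "f [^] n \<in> carrier R" for n :: nat using fc by simp
  have Q_id: "ideal (Q n) R" for n
  proof -
    interpret F: ideal "PIdl (f [^] n)" R by (rule cgenideal_ideal[OF fn])
      have sub: "subgroup (Q n) (add_monoid R)"
      proof (rule add.subgroupI)
        show "Q n \<subseteq> carrier R" unfolding Q_def by auto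
        have "\<zero> \<in> Q n" unfolding Q_def using xq F.zero_closed by (auto intro!: bexI[of _ x])
        then show "Q n \<noteq> {}" by auto
        show "\<ominus> a \<in> Q n" if "a \<in> Q n" for a
          using that F.a_inv_closed unfolding Q_def by (auto simp: r_minus)
        show "a \<oplus> b \<in> Q n" if ab: "a \<in> Q n" "b \<in> Q n" for a b
        proof -
          obtain s t where st: "s \<in> carrier R" "s \<notin> q" "t \<in> carrier R" "t \<notin> q"
            "s \<otimes> a \<in> PIdl (f [^] n)" "t \<otimes> b \<in> PIdl (f [^] n)" using ab unfolding Q_def by blast
          have c: "a \<in> carrier R" "b \<in> carrier R" using ab unfolding Q_def by auto
          have "s \<otimes> t \<notin> q" using st q.I_prime by blast
          moreover have "s \<otimes> t \<otimes> (a \<oplus> b) = t \<otimes> (s \<otimes> a) \<oplus> s \<otimes> (t \<otimes> b)"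
            using st c by algebra
          moreover have "t \<otimes> (s \<otimes> a) \<oplus> s \<otimes> (t \<otimes> b) \<in> PIdl (f [^] n)"
            by (rule F.a_closed[OF F.I_l_closed[OF st(5,3)] F.I_l_closed[OF st(6,1)]])
          ultimately show ?thesis unfolding Q_def using st c by (auto intro!: bexI[of _ "s \<otimes> t"])
        qed
      qed
      have l: "h \<otimes> a \<in> Q n" if ah: "a \<in> Q n" "h \<in> carrier R" for a h
      proof -
        obtain s where s: "s \<in> carrier R" "s \<notin> q" "s \<otimes> a \<in> PIdl (f [^] n)" "a \<in> carrier R"
          using ah(1) unfolding Q_def by blast
        have "s \<otimes> (h \<otimes> a) = h \<otimes> (s \<otimes> a)" using s(1,4) that(2) by (simp add: m_lcomm)
        then have "s \<otimes> (h \<otimes> a) \<in> PIdl (f [^] n)" using F.I_l_closed[OF s(3) that(2)] by simp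
        then show ?thesis unfolding Q_def mem_Collect_eq using s(1,2,4) that(2) by (intro conjI bexI[of _ s]) auto
      qed
      have r: "a \<otimes> h \<in> Q n" if "a \<in> Q n" "h \<in> carrier R" for a h
      proof -
        have "a \<in> carrier R" using that unfolding Q_def by auto
        then show ?thesis using l[OF that] that by (simp add: m_comm)
      qed
    show ?thesis by (rule idealI[OF ring_axioms sub l r])
  qed
  have Q_x: "h \<in> Q n" if hx: "h \<in> carrier R" "x \<otimes> h \<in> Q n" for h n
  proof -
    obtain s where s: "s \<in> carrier R" "s \<notin> q" "s \<otimes> (x \<otimes> h) \<in> PIdl (f [^] n)"
      using hx unfolding Q_def by blast
    have "s \<otimes> x \<notin> q" using s xq q.I_prime by blast
    moreover have "s \<otimes> x \<otimes> h \<in> PIdl (f [^] n)" using s that by (simp add: m_assoc)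
    ultimately show ?thesis unfolding Q_def using s that by (auto intro!: bexI[of _ "s \<otimes> x"])
  qed
  have Q_Suc: "Q (Suc n) \<subseteq> Q n" for n
  proof
    fix h assume "h \<in> Q (Suc n)"
    then obtain s c where s: "s \<in> carrier R" "s \<notin> q" "c \<in> carrier R" "s \<otimes> h = f [^] Suc n \<otimes> c" "h \<in> carrier R"
      unfolding Q_def using PIdl_iff[OF fn] by blast
    have "s \<otimes> h = f [^] n \<otimes> (f \<otimes> c)" using s fc by (simp add: m_assoc)
    then show "h \<in> Q n" unfolding Q_def using s fc PIdl_iff[OF fn] by auto
  qed
  \<comment> \<open>Orders in y modulo x of elements of \<open>Q n\<close>, with the unit normalized
    to 1. The assumption y^s \<in> xR makes s such an exponent for every n, because 0 belongs to
    \<open>Q n\<close>.\<close>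
  define E where "E n = {j::nat. \<exists>h\<in>carrier R. y [^] j \<oplus> x \<otimes> h \<in> Q n}" for n
  have s_E: "s \<in> E n" for n
  proof -
    obtain c where c: "c \<in> carrier R" "y [^] s = x \<otimes> c" using ys PIdl_iff by blast
    have "y [^] s \<oplus> x \<otimes> (\<ominus> c) = \<zero>" using c by (simp add: r_minus r_neg)
    then show ?thesis unfolding E_def
      using additive_subgroup.zero_closed[OF ideal.axioms(1)[OF Q_id]] c(1) by (auto intro!: bexI[of _ "\<ominus> c"])
  qed
  define e where "e n = (LEAST j. j \<in> E n)" for n
  have e_E: "e n \<in> E n" for n unfolding e_def using s_E by (rule LeastI)
  have e_le: "e n \<le> j" if "j \<in> E n" for n j unfolding e_def using that by (rule Least_le)
  \<comment> \<open>The least exponents are bounded by s, so one of them is the largest; there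
    passing from \<open>Q n\<close> to \<open>Q (Suc n)\<close> does not raise the order.\<close>
  obtain n where n: "\<And>k. e k \<le> e n"
  proof -
    have "finite (range e)" by (rule finite_subset[of _ "{..s}"]) (use e_le[OF s_E] in auto)
    then have "Max (range e) \<in> range e" "\<And>k. e k \<le> Max (range e)" by (auto intro: Max_in)
    then show ?thesis using that by (metis imageE)
  qed
  interpret Qn: ideal "Q n" R by (rule Q_id)
  interpret Qs: ideal "Q (Suc n)" R by (rule Q_id)
  \<comment> \<open>An element of \<open>Q (Suc n)\<close> with least exponent divides away the
    y-part of h, and what remains is a multiple of x; the cofactor is again in \<open>Q n\<close>
    since x \<notin> q.\<close>
  have step: "\<exists>h'\<in>Q n. h \<ominus> x \<otimes> h' \<in> Q (Suc n)" if h: "h \<in> Q n" for h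
  proof -
    have hc: "h \<in> carrier R" using h unfolding Q_def by auto
    have "\<exists>h'\<in>carrier R. h \<ominus> x \<otimes> h' \<in> Q (Suc n)"
    proof (cases "h \<in> PIdl x")
      case True
      then obtain h' where "h' \<in> carrier R" "h = x \<otimes> h'" using PIdl_iff by blast
      then show ?thesis using Qs.zero_closed by (intro bexI[of _ h']) (simp_all add: a_minus_def r_neg)
    next
      case False
      then obtain u g j where u: "u \<in> Units R" "g \<in> carrier R" "h = u \<otimes> y [^] (j::nat) \<oplus> x \<otimes> g"
        using unit_power_rep[OF hc] by blast
      have uc: "u \<in> carrier R" "inv u \<in> carrier R" "inv u \<otimes> u = \<one>" using u by auto
      have p: "y [^] k \<in> carrier R" for k :: nat by simp
      have "inv u \<otimes> h = (inv u \<otimes> u) \<otimes> y [^] j \<oplus> x \<otimes> (inv u \<otimes> g)"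
        unfolding u(3) using uc(1,2) u(2) p[of j] x_in by algebra
      then have "inv u \<otimes> h = y [^] j \<oplus> x \<otimes> (inv u \<otimes> g)" using uc by simp
      moreover have "inv u \<otimes> h \<in> Q n" using h uc by (intro Qn.I_l_closed)
      ultimately have "j \<in> E n" unfolding E_def using uc u(2) by (auto intro!: bexI[of _ "inv u \<otimes> g"])
      then have le: "e (Suc n) \<le> j" using e_le n order_trans by blast
      define k where "k = e (Suc n)"
      obtain w where w: "w \<in> carrier R" "y [^] k \<oplus> x \<otimes> w \<in> Q (Suc n)"
        using e_E[of "Suc n"] unfolding E_def k_def by blast
      have "h = (y [^] k \<oplus> x \<otimes> w) \<otimes> (u \<otimes> y [^] (j - k)) \<oplus> x \<otimes> (g \<ominus> w \<otimes> (u \<otimes> y [^] (j - k)))"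
      proof -
        have "y [^] j = y [^] k \<otimes> y [^] (j - k)" using le unfolding k_def by (simp add: nat_pow_mult)
        then have "h = u \<otimes> (y [^] k \<otimes> y [^] (j - k)) \<oplus> x \<otimes> g" using u by simp
        then show ?thesis using uc u(2) p[of k] p[of "j - k"] w(1) x_in by algebra
      qed
      moreover have "(y [^] k \<oplus> x \<otimes> w) \<otimes> (u \<otimes> y [^] (j - k)) \<in> Q (Suc n)"
        using w uc by (intro Qs.I_r_closed) auto
      moreover define h' where "h' = g \<ominus> w \<otimes> (u \<otimes> y [^] (j - k))"
      moreover have h'c: "h' \<in> carrier R" unfolding h'_def using u w uc by simp
      moreover define t where "t = (y [^] k \<oplus> x \<otimes> w) \<otimes> (u \<otimes> y [^] (j - k))"
      ultimately have ht: "h = t \<oplus> x \<otimes> h'" "t \<in> Q (Suc n)" by auto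
      have "t \<in> carrier R" using ht unfolding Q_def by blast
      then have "h \<ominus> x \<otimes> h' = t" unfolding ht(1) using h'c x_in by algebra
      then have "h \<ominus> x \<otimes> h' \<in> Q (Suc n)" using ht(2) by simp
      then show ?thesis using h'c by blast
    qed
    then obtain h' where h': "h' \<in> carrier R" "h \<ominus> x \<otimes> h' \<in> Q (Suc n)" by blast
    have "h \<oplus> \<ominus> (h \<ominus> x \<otimes> h') \<in> Q n" using h h' Q_Suc by (intro Qn.a_closed Qn.a_inv_closed) auto
    moreover have "h \<oplus> \<ominus> (h \<ominus> x \<otimes> h') = x \<otimes> h'" using hc h' x_in by algebra
    ultimately have "x \<otimes> h' \<in> Q n" by simp
    then show ?thesis using Q_x[OF h'(1)] h'(2) by blast
  qed
  then obtain F where F: "\<And>h. h \<in> Q n \<Longrightarrow> F h \<in> Q n \<and> h \<ominus> x \<otimes> F h \<in> Q (Suc n)"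
    using bchoice[of "Q n" "\<lambda>h h'. h' \<in> Q n \<and> h \<ominus> x \<otimes> h' \<in> Q (Suc n)"] by blast
  define h where "h i = (F ^^ i) (f [^] n)" for i :: nat
  have "f [^] n \<in> Q n" unfolding Q_def using cgenideal_self[OF fn] fn xq
    ideal.I_l_closed[OF cgenideal_ideal[OF fn]] by (auto intro!: bexI[of _ x])
  then have hQ: "h i \<in> Q n" for i unfolding h_def by (induction i) (use F in auto)
  \<comment> \<open>Nakayama turns the step into f^n \<in> \<open>Q (Suc n)\<close>; cancelling f^n
    then puts an element outside q into fR, which lies inside q.\<close>
  have "h 0 \<in> Q (Suc n)"
  proof (rule nakayama_sequence[OF Q_id x_in_m])
    show "h i \<in> carrier R" for i using hQ[of i] unfolding Q_def by blast
    show "h i \<ominus> x \<otimes> h (Suc i) \<in> Q (Suc n)" for i using F[OF hQ[of i]] unfolding h_def by simp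
  qed
  then have "f [^] n \<in> Q (Suc n)" unfolding h_def by simp
  then obtain s c where s: "s \<in> carrier R" "s \<notin> q" "c \<in> carrier R" "s \<otimes> f [^] n = f [^] Suc n \<otimes> c"
    unfolding Q_def using PIdl_iff[OF fn] by blast
  have "f [^] n \<otimes> s = f [^] n \<otimes> (f \<otimes> c)" using s fc by (simp add: m_comm m_assoc)
  moreover have "f [^] n \<noteq> \<zero>" using f fc by (induction n) (auto simp: integral_iff)
  ultimately have "s = f \<otimes> c" using s fc m_lcancel by auto
  then show False using s f q.I_r_closed by blast
qed

text \<open>With the roles of x and y exchanged, the first power of x avoids yR, while zero does
  not.\<close>

lemma x_nonzero: "x \<noteq> \<zero>"
proof -
  interpret S: local_parameters R m y x by (rule swap)
  have "\<zero> \<in> PIdl y" using additive_subgroup.zero_closed[OF ideal.axioms(1)[OF S.PIdl_x_ideal]] .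
  then show ?thesis using S.pow_notin_PIdl[of 1] by auto
qed

lemma y_notin: "y \<notin> PIdl x"
  using pow_notin_PIdl[of 1] by simp

text \<open>Modulo x both factors are units times powers of y. So is the product, and no power of y
  vanishes modulo x.\<close>

lemma PIdl_x_prime:
  assumes "f \<in> carrier R" "g \<in> carrier R" "f \<otimes> g \<in> PIdl x"
  shows "f \<in> PIdl x \<or> g \<in> PIdl x"
proof (rule ccontr)
  assume n: "\<not> ?thesis"
  obtain u h n where u: "u \<in> Units R" "h \<in> carrier R" "f = u \<otimes> y [^] (n::nat) \<oplus> x \<otimes> h"
    using unit_power_rep[OF assms(1)] n by blast
  obtain u' h' n' where u': "u' \<in> Units R" "h' \<in> carrier R" "g = u' \<otimes> y [^] (n'::nat) \<oplus> x \<otimes> h'"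
    using unit_power_rep[OF assms(2)] n by blast
  interpret I: ideal "PIdl x" R by (rule PIdl_x_ideal)
  define v where "v = inv (u \<otimes> u')"
  have v: "v \<in> carrier R" "v \<otimes> (u \<otimes> u') = \<one>" unfolding v_def using u u' by auto
  have uc: "u \<in> carrier R" "u' \<in> carrier R" using u u' by auto
  have p: "y [^] n \<in> carrier R" "y [^] n' \<in> carrier R" by auto
  have "v \<otimes> (f \<otimes> g) = v \<otimes> (u \<otimes> u') \<otimes> (y [^] n \<otimes> y [^] n') \<oplus> x \<otimes> (v \<otimes> (h \<otimes> g \<oplus> u \<otimes> y [^] n \<otimes> h'))"
    unfolding u(3) u'(3) using v(1) uc p u(2) u'(2) x_in by algebra
  also have "\<dots> = y [^] (n + n') \<oplus> x \<otimes> (v \<otimes> (h \<otimes> g \<oplus> u \<otimes> y [^] n \<otimes> h'))"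
    using v p by (simp add: nat_pow_mult)
  finally have "y [^] (n + n') \<oplus> x \<otimes> (v \<otimes> (h \<otimes> g \<oplus> u \<otimes> y [^] n \<otimes> h')) \<in> PIdl x"
    using I.I_l_closed assms(3) v(1) by metis
  moreover have "x \<otimes> (v \<otimes> (h \<otimes> g \<oplus> u \<otimes> y [^] n \<otimes> h')) \<in> PIdl x"
    unfolding PIdl_iff[OF x_in] using v uc p u(2) u'(2) assms(2)
    by (intro bexI[of _ "v \<otimes> (h \<otimes> g \<oplus> u \<otimes> y [^] n \<otimes> h')"]) simp_all
  ultimately have "y [^] (n + n') \<in> PIdl x"
    by (rule PIdl_minus_cancel[OF x_in, rotated 2]) (use v(1) uc p u(2) u'(2) assms(2) in simp_all)
  then show False using pow_notin_PIdl by blast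
qed

text \<open>If f could be divided by g forever, the quotients z(k) = g z(k+1) would satisfy the
  hypothesis of \<open>nakayama_sequence\<close> for the zero ideal, so f would be 0.\<close>

lemma factor_out:
  assumes f: "f \<in> carrier R" "f \<noteq> \<zero>" and g: "g \<in> m" "g \<noteq> \<zero>"
  obtains k f' where "f' \<in> carrier R" "f = g [^] (k::nat) \<otimes> f'" "f' \<notin> PIdl g"
proof (rule ccontr)
  note rep = that
  assume "\<not> thesis"
  have gc: "g \<in> carrier R" using g m_sub by blast
  have gk: "g [^] k \<in> carrier R" "g [^] k \<noteq> \<zero>" for k :: nat
    using g gc by (induction k) (auto simp: integral_iff)
  have ex: "\<exists>c\<in>carrier R. f = g [^] (k::nat) \<otimes> c" for k
  proof (induction k)
    case 0 then show ?case using f by (auto intro!: bexI[of _ f])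
  next
    case (Suc k)
    then obtain c where c: "c \<in> carrier R" "f = g [^] k \<otimes> c" by blast
    then have "c \<in> PIdl g" using rep \<open>\<not> thesis\<close> by blast
    then obtain c' where c': "c' \<in> carrier R" "c = g \<otimes> c'" using PIdl_iff gc by blast
    have "f = g [^] Suc k \<otimes> c'" using c c' gc by (simp add: m_assoc)
    then show ?case using c' by blast
  qed
  then obtain z where z: "\<And>k. z k \<in> carrier R" "\<And>k. f = g [^] (k::nat) \<otimes> z k" by metis
  have zs: "z k = g \<otimes> z (Suc k)" for k
  proof -
    have "g [^] k \<otimes> z k = g [^] k \<otimes> (g \<otimes> z (Suc k))"
      using z(2)[of k] z(2)[of "Suc k"] z(1) gc by (simp add: m_assoc)
    then show ?thesis using gk z(1) gc m_lcancel by auto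
  qed
  have "z 0 \<in> {\<zero>}"
  proof (rule nakayama_sequence[OF zeroideal g(1) z(1)])
    show "z i \<ominus> g \<otimes> z (Suc i) \<in> {\<zero>}" for i
      using zs[of i] z(1) gc by (simp add: a_minus_def r_neg)
  qed
  then show False using z(2)[of 0] z(1) f by simp
qed

text \<open>Choose g \<in> p of least order in y modulo x. Subtracting a multiple of g from any f
  \<in> p leaves x f' with f' \<in> p, because x \<notin> p; iterating this, Nakayama gives p
  \<subseteq> gR.\<close>

lemma prime_principal:
  assumes p: "primeideal p R" "p \<noteq> {\<zero>}" "x \<notin> p"
  obtains g where "g \<in> p" "g \<noteq> \<zero>" "p = PIdl g"
proof -
  interpret p: primeideal p R by (rule p(1))
  have pc: "f \<in> p \<Longrightarrow> f \<in> carrier R" for f using p.a_Hcarr by blast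
  have px: "f \<in> p" if "f \<in> carrier R" "x \<otimes> f \<in> p" for f
    using p.I_prime[OF x_in that] p(3) by blast
  define E where "E = {n::nat. \<exists>u\<in>Units R. \<exists>h\<in>carrier R. u \<otimes> y [^] n \<oplus> x \<otimes> h \<in> p}"
  have "\<exists>n. n \<in> E"
  proof -
    obtain f where f: "f \<in> p" "f \<noteq> \<zero>" using p(2) p.zero_closed by blast
    obtain k f' where k: "f' \<in> carrier R" "f = x [^] (k::nat) \<otimes> f'" "f' \<notin> PIdl x"
      using factor_out[OF pc[OF f(1)] f(2) x_in_m x_nonzero] by blast
    \<comment> \<open>Factors x cancel inside the prime p, so p contains an element outside xR and E
      is not empty.\<close>
    have "x [^] k \<otimes> f' \<in> p \<Longrightarrow> f' \<in> p"
    proof (induction k)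
      case 0 then show ?case using k(1) by simp
    next
      case (Suc k)
      have "x \<otimes> (x [^] k \<otimes> f') \<in> p" using Suc.prems k(1) by (simp add: m_ac)
      then have "x [^] k \<otimes> f' \<in> p" by (rule px[rotated]) (use k(1) in simp)
      then show ?case by (rule Suc.IH)
    qed
    then have "f' \<in> p" using f k by simp
    moreover obtain u h n where "u \<in> Units R" "h \<in> carrier R" "f' = u \<otimes> y [^] (n::nat) \<oplus> x \<otimes> h"
      using unit_power_rep[OF k(1,3)] by blast
    ultimately show ?thesis unfolding E_def by blast
  qed
  define n where "n = (LEAST n. n \<in> E)"
  have "n \<in> E" unfolding n_def using \<open>\<exists>n. n \<in> E\<close> by (metis LeastI)
  then obtain u h where u: "u \<in> Units R" "h \<in> carrier R" "u \<otimes> y [^] n \<oplus> x \<otimes> h \<in> p" unfolding E_def by blast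
  define g where "g = u \<otimes> y [^] n \<oplus> x \<otimes> h"
  have gp: "g \<in> p" using u g_def by simp
  have gc: "g \<in> carrier R" using gp pc by blast
  interpret G: ideal "PIdl g" R by (rule cgenideal_ideal[OF gc])
  interpret I: ideal "PIdl x" R by (rule PIdl_x_ideal)
  have uc: "u \<in> carrier R" "inv u \<in> carrier R" "inv u \<otimes> u = \<one>" using u by auto
  have gx: "g \<notin> PIdl x"
  proof
    assume "g \<in> PIdl x"
    then have "u \<otimes> y [^] n \<in> PIdl x"
      unfolding g_def using u uc PIdl_minus_cancel[OF x_in, of "u \<otimes> y [^] n" "x \<otimes> h"] PIdl_iff[OF x_in] by auto
    then have "inv u \<otimes> (u \<otimes> y [^] n) \<in> PIdl x" using uc I.I_l_closed by blast
    moreover have "inv u \<otimes> (u \<otimes> y [^] n) = y [^] n" using uc by (simp add: m_assoc[symmetric])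
    ultimately show False using pow_notin_PIdl by auto
  qed
  have step: "\<exists>f'\<in>p. f \<ominus> x \<otimes> f' \<in> PIdl g" if f: "f \<in> p" for f
  proof (cases "f \<in> PIdl x")
    case True
    then obtain f' where f': "f' \<in> carrier R" "f = x \<otimes> f'" using PIdl_iff by blast
    then have "f' \<in> p" using px f by blast
    then show ?thesis using f' G.zero_closed by (intro bexI[of _ f']) (simp_all add: a_minus_def r_neg)
  next
    case False
    then obtain v k j where v: "v \<in> Units R" "k \<in> carrier R" "f = v \<otimes> y [^] (j::nat) \<oplus> x \<otimes> k"
      using unit_power_rep[OF pc[OF f]] by blast
    then have "j \<in> E" unfolding E_def using f by auto
    then have le: "n \<le> j" unfolding n_def by (rule Least_le)
    have vc: "v \<in> carrier R" using v by auto
    define c where "c = v \<otimes> inv u \<otimes> y [^] (j - n)"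
    have cc: "c \<in> carrier R" unfolding c_def using vc uc by simp
    have p': "y [^] n \<in> carrier R" "y [^] (j - n) \<in> carrier R" "y [^] j = y [^] n \<otimes> y [^] (j - n)"
      using le by (auto simp: nat_pow_mult)
    have "c \<otimes> u = v \<otimes> y [^] (j - n) \<otimes> (inv u \<otimes> u)"
      unfolding c_def using vc uc(1,2) p' by algebra
    then have cu: "c \<otimes> u = v \<otimes> y [^] (j - n)" using vc uc(3) p' by simp
    have "f \<ominus> g \<otimes> c = v \<otimes> y [^] (j - n) \<otimes> y [^] n \<oplus> x \<otimes> k \<ominus> (c \<otimes> u \<otimes> y [^] n \<oplus> x \<otimes> (h \<otimes> c))"
      unfolding v(3) p'(3) g_def using vc v(2) p'(1,2) uc(1) u(2) cc x_in by algebra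
    also have "\<dots> = x \<otimes> (k \<ominus> h \<otimes> c)"
      unfolding cu using vc v(2) p'(1,2) u(2) cc x_in by algebra
    finally have eq: "f \<ominus> g \<otimes> c = x \<otimes> (k \<ominus> h \<otimes> c)" .
    have "f \<oplus> \<ominus> (g \<otimes> c) \<in> p" using f gp cc by (intro p.a_closed p.a_inv_closed p.I_r_closed)
    then have "x \<otimes> (k \<ominus> h \<otimes> c) \<in> p" using eq by (simp add: a_minus_def)
    then have kp: "k \<ominus> h \<otimes> c \<in> p" by (rule px[rotated]) (use v(2) u(2) cc in simp)
    have "f \<ominus> x \<otimes> (k \<ominus> h \<otimes> c) = g \<otimes> c"
      unfolding eq[symmetric] using pc[OF f] gc cc by algebra
    then show ?thesis using kp PIdl_iff[OF gc] cc by (intro bexI[of _ "k \<ominus> h \<otimes> c"]) auto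
  qed
  then obtain F where F: "\<And>f. f \<in> p \<Longrightarrow> F f \<in> p \<and> f \<ominus> x \<otimes> F f \<in> PIdl g"
    using bchoice[of p "\<lambda>f f'. f' \<in> p \<and> f \<ominus> x \<otimes> f' \<in> PIdl g"] by blast
  have "p \<subseteq> PIdl g"
  proof
    fix f assume f: "f \<in> p"
    define z where "z i = (F ^^ i) f" for i :: nat
    have zp: "z i \<in> p" for i unfolding z_def by (induction i) (use F f in auto)
    have "z 0 \<in> PIdl g"
    proof (rule nakayama_sequence[OF G.is_ideal x_in_m])
      show "z i \<in> carrier R" for i using zp pc by blast
      show "z i \<ominus> x \<otimes> z (Suc i) \<in> PIdl g" for i using F[OF zp[of i]] unfolding z_def by simp
    qed
    then show "f \<in> PIdl g" by (simp add: z_def)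
  qed
  moreover have "PIdl g \<subseteq> p" using gp by (rule cgenideal_minimal[OF p.is_ideal])
  moreover have "g \<noteq> \<zero>" using gx I.zero_closed by blast
  ultimately show ?thesis using that gp by blast
qed

text \<open>A prime q strictly below gR does not contain g. For 0 \<noteq> f \<in> q all factors g
  can then be cancelled within q, leaving an element of q that g does not divide.\<close>

lemma principal_prime_height_one:
  assumes p: "primeideal (PIdl g) R" "g \<in> m" "g \<noteq> \<zero>"
  shows "height_one_prime R (PIdl g)"
proof -
  have gc: "g \<in> carrier R" by (rule m_sub[OF p(2)])
  interpret G: primeideal "PIdl g" R by (rule p(1))
  have below: "q = {\<zero>}" if q: "primeideal q R" "q \<subset> PIdl g" for q
  proof (rule ccontr)
    interpret q: primeideal q R by (rule q(1))
    assume "q \<noteq> {\<zero>}"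
    then obtain f where f: "f \<in> q" "f \<noteq> \<zero>" using q.zero_closed by blast
    have fc: "f \<in> carrier R" using f q.a_Hcarr by blast
    have gq: "g \<notin> q" using q(2) cgenideal_minimal[OF q.is_ideal] by blast
    obtain k f' where k: "f' \<in> carrier R" "f = g [^] (k::nat) \<otimes> f'" "f' \<notin> PIdl g"
      using factor_out[OF fc f(2) p(2,3)] by blast
    have "g [^] k \<otimes> f' \<in> q \<Longrightarrow> f' \<in> q"
    proof (induction k)
      case 0 then show ?case using k(1) by simp
    next
      case (Suc k)
      then show ?case using q.I_prime[of g "g [^] k \<otimes> f'"] k(1) gc gq by (simp add: m_ac)
    qed
    then show False using f k q(2) by auto
  qed
  define S where "S = {enat n | n. \<exists>C :: nat \<Rightarrow> 'a set.
      (\<forall>i\<le>n. primeideal (C i) R) \<and> (\<forall>i<n. C i \<subset> C (Suc i)) \<and> C n = PIdl g}"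
  have gself: "g \<in> PIdl g" by (rule cgenideal_self[OF gc])
  have "enat 1 \<in> S"
  proof -
    define C :: "nat \<Rightarrow> 'a set" where "C i = (if i = 0 then {\<zero>} else PIdl g)" for i
    have "\<forall>i\<le>1. primeideal (C i) R" using p zeroprimeideal by (auto simp: C_def)
    moreover have "{\<zero>} \<subset> PIdl g" using gself p(3) G.zero_closed by auto
    ultimately show ?thesis unfolding S_def by (intro CollectI exI[of _ 1] conjI exI[of _ C]) (auto simp: C_def)
  qed
  moreover have "z \<le> 1" if zS: "z \<in> S" for z
  proof -
    obtain n C where C: "z = enat n" "\<forall>i\<le>n. primeideal (C i) R" "\<forall>i<n. C i \<subset> C (Suc i)" "C n = PIdl g"
      using zS unfolding S_def by blast
    have "n \<le> 1"
    proof (rule ccontr)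
      assume "\<not> n \<le> 1"
      then obtain k where k: "n = Suc (Suc k)" by (metis One_nat_def le_SucI not0_implies_Suc not_less_eq_eq le_refl)
      have "primeideal (C (Suc k)) R" "C (Suc k) \<subset> C (Suc (Suc k))" using C(2,3) k by simp_all
      then have "C (Suc k) = {\<zero>}" using C(4) k by (intro below) simp_all
      moreover have "C k \<subset> C (Suc k)" using C(3) k by simp
      moreover have "\<zero> \<in> C k"
        using C(2) k by (intro additive_subgroup.zero_closed ideal.axioms(1) primeideal.axioms(1)) simp
      ultimately show False by auto
    qed
    then show ?thesis using C(1) by (simp add: one_enat_def)
  qed
  ultimately have "Sup S = 1" by (intro antisym Sup_least) (auto simp: one_enat_def Sup_upper)
  then show ?thesis unfolding height_one_prime_def ideal_height_def S_def using p by simp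
qed

end

section \<open>Multiples of values\<close>

lemma nat_multiple_0 [simp]: "nat_multiple 0 \<phi> = 0"
  by (simp add: nat_multiple_def)

lemma nat_multiple_Suc [simp]: "nat_multiple (Suc n) \<phi> = \<phi> + nat_multiple n \<phi>"
  by (simp add: nat_multiple_def add.commute)

lemma nat_multiple_add: "nat_multiple (m + n) \<phi> = nat_multiple m \<phi> + nat_multiple n \<phi>"
  by (induction m) (simp_all add: add.assoc)

lemma nat_multiple_add_right: "nat_multiple n (\<phi> + \<psi>) = nat_multiple n \<phi> + nat_multiple n \<psi>"
  by (induction n) (simp_all add: add_ac)

lemma nat_multiple_zero_right [simp]: "nat_multiple n 0 = 0"
  by (induction n) simp_all

lemma nat_multiple_mult: "nat_multiple (m * n) \<phi> = nat_multiple m (nat_multiple n \<phi>)"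
  by (induction m) (simp_all add: nat_multiple_add)

lemma nat_multiple_1 [simp]: "nat_multiple 1 \<phi> = \<phi>" "nat_multiple (Suc 0) \<phi> = \<phi>"
  by simp_all

lemma nat_multiple_uminus: "nat_multiple n (- \<phi>) = - nat_multiple n (\<phi> :: 'g::ab_group_add)"
  by (induction n) simp_all

context
  fixes \<phi> \<psi> :: "'g::linordered_ab_group_add"
begin

lemma nat_multiple_nonneg: "0 \<le> \<phi> \<Longrightarrow> 0 \<le> nat_multiple n \<phi>"
  by (induction n) simp_all

lemma nat_multiple_pos: "0 < \<phi> \<Longrightarrow> 0 < n \<Longrightarrow> 0 < nat_multiple n \<phi>"
  by (cases n) (simp_all add: nat_multiple_nonneg add_pos_nonneg)

lemma nat_multiple_mono_right: "\<phi> \<le> \<psi> \<Longrightarrow> nat_multiple n \<phi> \<le> nat_multiple n \<psi>"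
  by (induction n) (simp_all add: add_mono)

lemma nat_multiple_mono: "0 \<le> \<phi> \<Longrightarrow> m \<le> n \<Longrightarrow> nat_multiple m \<phi> \<le> nat_multiple n \<phi>"
  by (metis add_0_right add_left_mono le_Suc_ex nat_multiple_add nat_multiple_nonneg)

lemma le_nat_multiple: "0 \<le> \<phi> \<Longrightarrow> 0 < n \<Longrightarrow> \<phi> \<le> nat_multiple n \<phi>"
  using nat_multiple_mono[of 1 n] by simp

end

text \<open>Every integer is a difference of two natural numbers; through
  \<open>int_multiple_diff_nat\<close> all laws are inherited from
  \<open>nat_multiple\<close>.\<close>

definition int_multiple :: "int \<Rightarrow> 'g::ab_group_add \<Rightarrow> 'g" where
  "int_multiple e \<phi> = (if 0 \<le> e then nat_multiple (nat e) \<phi> else - nat_multiple (nat (- e)) \<phi>)"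

lemma int_multiple_of_nat [simp]: "int_multiple (int n) \<phi> = nat_multiple n \<phi>"
  by (simp add: int_multiple_def)

lemma int_multiple_diff_nat: "int_multiple (int m - int n) \<phi> = nat_multiple m \<phi> - nat_multiple n \<phi>"
proof (cases "n \<le> m")
  case True
  then show ?thesis
    using nat_multiple_add[of "m - n" n \<phi>] by (simp add: int_multiple_def nat_diff_distrib)
next
  case False
  then show ?thesis
    using nat_multiple_add[of "n - m" m \<phi>] by (simp add: int_multiple_def nat_diff_distrib)
qed

lemma int_cases_diff: obtains m n where "e = int m - int n"
  by (metis int_diff_cases)

lemma int_multiple_add: "int_multiple (d + e) \<phi> = int_multiple d \<phi> + int_multiple e \<phi>"
proof -
  obtain m n where d: "d = int m - int n" by (rule int_cases_diff)
  obtain k l where e: "e = int k - int l" by (rule int_cases_diff)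
  have "d + e = int (m + k) - int (n + l)" unfolding d e by simp
  then show ?thesis unfolding d e by (simp only: int_multiple_diff_nat nat_multiple_add) simp
qed

lemma int_multiple_minus: "int_multiple (- e) \<phi> = - int_multiple e \<phi>"
proof -
  obtain m n where e: "e = int m - int n" by (rule int_cases_diff)
  have "- e = int n - int m" unfolding e by simp
  then show ?thesis unfolding e by (simp only: int_multiple_diff_nat) simp
qed

lemma int_multiple_diff: "int_multiple (d - e) \<phi> = int_multiple d \<phi> - int_multiple e \<phi>"
  using int_multiple_add[of d "- e" \<phi>] by (simp add: int_multiple_minus)

lemma int_multiple_mult_nat: "int_multiple (e * int n) \<phi> = int_multiple e (nat_multiple n \<phi>)"
proof -
  obtain k l where e: "e = int k - int l" by (rule int_cases_diff)
  have "e * int n = int (k * n) - int (l * n)" unfolding e by (simp add: algebra_simps)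
  then show ?thesis unfolding e by (simp only: int_multiple_diff_nat nat_multiple_mult)
qed

section \<open>Subgroups generated by values and their indices\<close>

lemma group_closure_diff: "s \<in> group_closure S \<Longrightarrow> t \<in> group_closure S \<Longrightarrow> s - t \<in> group_closure S"
  by (rule group_closure.diff)

lemma group_closure_nat_multiple: "s \<in> group_closure S \<Longrightarrow> nat_multiple n s \<in> group_closure S"
  by (induction n) (auto intro: group_closure_add)

lemma group_closure_int_multiple: "s \<in> group_closure S \<Longrightarrow> int_multiple e s \<in> group_closure S"
  by (simp add: int_multiple_def group_closure_nat_multiple)

lemma group_closure_mono: "S \<subseteq> T \<Longrightarrow> group_closure S \<subseteq> group_closure T"
proof
  fix s assume "S \<subseteq> T" "s \<in> group_closure S"
  from this(2,1) show "s \<in> group_closure T"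
    by induction (auto intro: group_closure.intros)
qed

lemma group_closure_insert:
  "group_closure (insert \<beta> S) = {h + int_multiple e \<beta> | h e. h \<in> group_closure S}" (is "?L = ?R")
proof
  have b: "\<beta> \<in> group_closure (insert \<beta> S)" by (auto intro: group_closure.base)
  have "group_closure S \<subseteq> group_closure (insert \<beta> S)" by (rule group_closure_mono) auto
  then show "?R \<subseteq> ?L" using group_closure_int_multiple[OF b] by (auto intro!: group_closure_add)
  show "?L \<subseteq> ?R"
  proof
    fix s assume "s \<in> ?L"
    then show "s \<in> ?R"
    proof induction
      case (base s)
      then consider "s = \<beta>" | "s \<in> insert 0 S" by blast
      then show ?case
      proof cases
        case 1
        then have "s = 0 + int_multiple (int 1) \<beta>" unfolding int_multiple_of_nat by simp
        then show ?thesis using zero_in_group_closure by blast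
      next
        case 2
        then have "s = s + int_multiple (int 0) \<beta>" "s \<in> group_closure S"
          unfolding int_multiple_of_nat by (auto intro: group_closure.base)
        then show ?thesis by blast
      qed
    next
      case (diff s t)
      then obtain h e h' e' where *: "s = h + int_multiple e \<beta>" "h \<in> group_closure S"
        "t = h' + int_multiple e' \<beta>" "h' \<in> group_closure S" by blast
      have "s - t = (h - h') + int_multiple (e - e') \<beta>" using * by (simp add: int_multiple_diff)
      then show ?case using * group_closure.diff by blast
    qed
  qed
qed

lemma coset_eq_iff:
  "(+) a ` group_closure S = (+) b ` group_closure S \<longleftrightarrow> a - b \<in> group_closure S"
proof
  assume "(+) a ` group_closure S = (+) b ` group_closure S"
  moreover have "a \<in> (+) a ` group_closure S" by (auto intro: image_eqI[of _ _ 0])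
  ultimately obtain h where "h \<in> group_closure S" "a = b + h" by auto
  then show "a - b \<in> group_closure S" by simp
next
  have *: "(+) a ` group_closure S \<subseteq> (+) b ` group_closure S" if "a - b \<in> group_closure S" for a b
  proof
    fix z assume "z \<in> (+) a ` group_closure S"
    then obtain h where h: "h \<in> group_closure S" "z = a + h" by blast
    have "z = b + ((a - b) + h)" using h by simp
    then show "z \<in> (+) b ` group_closure S" using group_closure_add[OF that h(1)] by blast
  qed
  assume "a - b \<in> group_closure S"
  moreover from this have "b - a \<in> group_closure S"
    by (metis group_closure_minus_iff minus_diff_eq)
  ultimately show "(+) a ` group_closure S = (+) b ` group_closure S" using * by blast
qed

lemma cosets_insert:
  "(\<lambda>g. (+) g ` group_closure S) ` group_closure (insert \<beta> S) =
     range (\<lambda>e. (+) (int_multiple e \<beta>) ` group_closure S)" (is "?L = ?R")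
proof -
  have "(+) (h + int_multiple e \<beta>) ` group_closure S = (+) (int_multiple e \<beta>) ` group_closure S"
    if "h \<in> group_closure S" for h e using that by (simp add: coset_eq_iff)
  then have "?L \<subseteq> ?R" unfolding group_closure_insert by blast
  moreover have "int_multiple e \<beta> \<in> group_closure (insert \<beta> S)" for e
    by (intro group_closure_int_multiple group_closure.base) auto
  then have "?R \<subseteq> ?L" by blast
  ultimately show ?thesis by (rule antisym)
qed

text \<open>If a nonzero multiple e \<beta> lies in the subgroup, the cosets are represented by k
  \<beta> with 0 \<le> k < |e|, so there are only finitely many.\<close>

lemma subgroup_index_infinite:
  assumes "subgroup_index (group_closure (insert \<beta> S)) (group_closure S) = \<infinity>"
    and "int_multiple e \<beta> \<in> group_closure S"
  shows "e = 0"
proof (rule ccontr)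
  assume "e \<noteq> 0"
  define N where "N = nat \<bar>e\<bar>"
  have N: "N > 0" "int N = \<bar>e\<bar>" using \<open>e \<noteq> 0\<close> by (auto simp: N_def)
  have NH: "nat_multiple N \<beta> \<in> group_closure S"
    using assms(2) int_multiple_minus[of e \<beta>] N(2) by (metis abs_if group_closure_minus_iff int_multiple_of_nat)
  have "range (\<lambda>e. (+) (int_multiple e \<beta>) ` group_closure S) \<subseteq>
      (\<lambda>e. (+) (int_multiple e \<beta>) ` group_closure S) ` {0..<int N}"
  proof
    fix c assume "c \<in> range (\<lambda>e. (+) (int_multiple e \<beta>) ` group_closure S)"
    then obtain k where k: "c = (+) (int_multiple k \<beta>) ` group_closure S" by blast
    have "k - k mod int N = k div int N * int N" by (simp add: minus_mod_eq_div_mult)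
    then have "int_multiple k \<beta> - int_multiple (k mod int N) \<beta> \<in> group_closure S"
      unfolding int_multiple_diff[symmetric] by (simp add: int_multiple_mult_nat group_closure_int_multiple NH)
    then have "c = (+) (int_multiple (k mod int N) \<beta>) ` group_closure S"
      unfolding k by (simp add: coset_eq_iff)
    then show "c \<in> (\<lambda>e. (+) (int_multiple e \<beta>) ` group_closure S) ` {0..<int N}" using N by auto
  qed
  then have "finite ((\<lambda>g. (+) g ` group_closure S) ` group_closure (insert \<beta> S))"
    unfolding cosets_insert by (rule finite_subset) auto
  then show False using assms(1) by (simp add: subgroup_index_def)
qed

text \<open>Among finitely many cosets two multiples of \<beta> coincide, so some positive multiple
  lies in the subgroup. The least one, M \<beta>, has exactly M cosets, which identifies M with the
  index.\<close>

lemma subgroup_index_finite: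
  assumes "subgroup_index (group_closure (insert \<beta> S)) (group_closure S) = enat N"
  shows "0 < N" "int_multiple e \<beta> \<in> group_closure S \<longleftrightarrow> int N dvd e"
proof -
  define co where "co k = (+) (int_multiple k \<beta>) ` group_closure S" for k
  have fin: "finite (range co)" and card: "card (range co) = N"
    using assms unfolding subgroup_index_def cosets_insert co_def by (auto simp: Let_def split: if_splits)
  show N: "0 < N" using fin card by (metis card_gt_0_iff empty_not_UNIV image_is_empty)
  have co_eq: "co k = co l \<longleftrightarrow> int_multiple (k - l) \<beta> \<in> group_closure S" for k l
    unfolding co_def by (simp add: coset_eq_iff int_multiple_diff)
  have "\<not> inj co" using fin finite_imageD infinite_UNIV_int by blast
  then obtain k l where "co k = co l" "k \<noteq> l" unfolding inj_def by blast
  then have "int_multiple \<bar>k - l\<bar> \<beta> \<in> group_closure S" "\<bar>k - l\<bar> > 0"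
    using co_eq by (auto simp: abs_if) (metis co_eq minus_diff_eq)
  then have ex: "\<exists>n>0. nat_multiple n \<beta> \<in> group_closure S"
    by (intro exI[of _ "nat \<bar>k - l\<bar>"]) (auto simp: int_multiple_def)
  define M where "M = (LEAST n. n > 0 \<and> nat_multiple n \<beta> \<in> group_closure S)"
  have M: "M > 0" "nat_multiple M \<beta> \<in> group_closure S"
    using LeastI_ex[OF ex] unfolding M_def by auto
  have M_le: "M \<le> n" if "n > 0" "nat_multiple n \<beta> \<in> group_closure S" for n
    unfolding M_def using that by (intro Least_le) auto
  have dvd: "int_multiple e \<beta> \<in> group_closure S \<longleftrightarrow> int M dvd e" for e
  proof
    assume "int M dvd e"
    then show "int_multiple e \<beta> \<in> group_closure S"
      by (metis M(2) dvd_div_mult_self group_closure_int_multiple int_multiple_mult_nat)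
  next
    assume e: "int_multiple e \<beta> \<in> group_closure S"
    have "e mod int M = e - e div int M * int M" by (simp add: minus_div_mult_eq_mod)
    then have "int_multiple (e mod int M) \<beta> \<in> group_closure S"
      using e by (simp add: int_multiple_diff int_multiple_mult_nat group_closure_int_multiple M group_closure_diff)
    then have "nat_multiple (nat (e mod int M)) \<beta> \<in> group_closure S"
      using M(1) by (simp add: int_multiple_def)
    moreover have "nat (e mod int M) < M" using M(1) by (simp add: nat_less_iff)
    ultimately have "nat (e mod int M) = 0" using M_le by (metis not_gr_zero not_le)
    moreover have "e mod int M \<ge> 0" using M(1) by simp
    ultimately show "int M dvd e" by (simp add: mod_eq_0_iff_dvd)
  qed
  \<comment> \<open>Counting the cosets a second time, by residues modulo M, gives M = N.\<close>
  have "range co = co ` {0..<int M}"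
  proof -
    have "co k = co (k mod int M)" for k
      unfolding co_eq dvd by (simp add: minus_mod_eq_div_mult)
    moreover have "k mod int M \<in> {0..<int M}" for k using M(1) by simp
    ultimately show ?thesis by blast
  qed
  moreover have "inj_on co {0..<int M}"
  proof (rule inj_onI)
    fix k l assume kl: "k \<in> {0..<int M}" "l \<in> {0..<int M}" "co k = co l"
    from kl(3) have "int M dvd k - l" unfolding co_eq dvd .
    then have "k mod int M = l mod int M" by (simp only: mod_eq_dvd_iff)
    moreover have "k mod int M = k" "l mod int M = l" using kl by simp_all
    ultimately show "k = l" by simp
  qed
  ultimately have "M = N" using card by (simp add: card_image)
  then show "int_multiple e \<beta> \<in> group_closure S \<longleftrightarrow> int N dvd e" using dvd by simp
qed

section \<open>Chains of primes in dimension two and in height one\<close>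

lemma krull_dim_2_chain:
  assumes "krull_dim R = 2"
  obtains C0 C1 C2 where "primeideal C0 R" "primeideal C1 R" "primeideal C2 R" "C0 \<subset> C1" "C1 \<subset> C2"
proof -
  have "\<exists>n\<ge>2. \<exists>C :: nat \<Rightarrow> 'a set. (\<forall>i\<le>n. primeideal (C i) R) \<and> (\<forall>i<n. C i \<subset> C (Suc i))"
  proof (rule ccontr)
    assume *: "\<not> ?thesis"
    have "krull_dim R \<le> 1" unfolding krull_dim_def
    proof (rule Sup_least, clarify)
      fix n :: nat and C :: "nat \<Rightarrow> 'a set"
      assume "\<forall>i\<le>n. primeideal (C i) R" "\<forall>i<n. C i \<subset> C (Suc i)"
      then have "\<not> n \<ge> 2" using * by blast
      then show "enat n \<le> 1" by (simp add: one_enat_def)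
    qed
    then show False using assms by simp
  qed
  then obtain n C where "n \<ge> 2" "\<forall>i\<le>n. primeideal (C i) R" "\<forall>i<n. C i \<subset> C (Suc i)" by blast
  then show thesis by (intro that[of "C 0" "C 1" "C 2"]) (auto simp: numeral_2_eq_2)
qed

lemma krull_dim_2_no_chain:
  assumes "krull_dim R = 2" "primeideal C0 R" "primeideal C1 R" "primeideal C2 R" "primeideal C3 R"
    and "C0 \<subset> C1" "C1 \<subset> C2" "C2 \<subset> C3"
  shows False
proof -
  define C :: "nat \<Rightarrow> 'a set" where "C i = [C0, C1, C2, C3] ! i" for i
  have le3: "i \<le> 3 \<longleftrightarrow> i = 0 \<or> i = 1 \<or> i = 2 \<or> i = 3" and l3: "i < 3 \<longleftrightarrow> i = 0 \<or> i = 1 \<or> i = 2" for i :: nat by auto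
  have "(\<forall>i\<le>3. primeideal (C i) R) \<and> (\<forall>i<3. C i \<subset> C (Suc i))"
    unfolding le3 l3 C_def using assms by (auto simp: numeral_2_eq_2 numeral_3_eq_3)
  then have "enat 3 \<le> krull_dim R" unfolding krull_dim_def by (intro Sup_upper) blast
  then show False using assms(1) by (simp add: numeral_eq_enat)
qed

lemma height_one_chain:
  assumes "height_one_prime R Q"
  obtains C0 where "primeideal C0 R" "C0 \<subset> Q"
proof -
  have "\<exists>n\<ge>1. \<exists>C :: nat \<Rightarrow> 'a set. (\<forall>i\<le>n. primeideal (C i) R) \<and> (\<forall>i<n. C i \<subset> C (Suc i)) \<and> C n = Q"
  proof (rule ccontr)
    assume *: "\<not> ?thesis"
    have "ideal_height R Q \<le> 0" unfolding ideal_height_def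
    proof (rule Sup_least, clarify)
      fix n :: nat and C :: "nat \<Rightarrow> 'a set"
      assume "\<forall>i\<le>n. primeideal (C i) R" "\<forall>i<n. C i \<subset> C (Suc i)" "Q = C n"
      then have "\<not> n \<ge> 1" using * by blast
      then show "enat n \<le> 0" by (simp add: zero_enat_def)
    qed
    then show False using assms by (simp add: height_one_prime_def)
  qed
  then obtain n C where n: "n \<ge> 1" "\<forall>i\<le>n. primeideal (C i) R" "\<forall>i<n. C i \<subset> C (Suc i)" "C n = Q" by blast
  then have "C (n - 1) \<subset> Q" by (metis One_nat_def Suc_diff_1 diff_less less_eq_Suc_le zero_less_Suc)
  then show thesis using n by (intro that[of "C (n - 1)"]) auto
qed

lemma height_one_no_chain:
  assumes "height_one_prime R Q" "primeideal C0 R" "primeideal C1 R" "C0 \<subset> C1" "C1 \<subset> Q"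
  shows False
proof -
  define C :: "nat \<Rightarrow> 'a set" where "C i = [C0, C1, Q] ! i" for i
  have le3: "i \<le> 2 \<longleftrightarrow> i = 0 \<or> i = 1 \<or> i = 2" and l3: "i < 2 \<longleftrightarrow> i = 0 \<or> i = 1" for i :: nat by auto
  have "(\<forall>i\<le>2. primeideal (C i) R) \<and> (\<forall>i<2. C i \<subset> C (Suc i)) \<and> C 2 = Q"
    unfolding le3 l3 C_def using assms by (auto simp: numeral_2_eq_2 height_one_prime_def)
  then have "enat 2 \<le> ideal_height R Q" unfolding ideal_height_def by (intro Sup_upper) blast
  then show False using assms(1) by (simp add: numeral_eq_enat one_enat_def height_one_prime_def)
qed

section \<open>Valued fields\<close>

locale valued_field = field K for K :: "('a, 'b) ring_scheme" (structure) +
  fixes \<nu> :: "'a \<Rightarrow> 'g::linordered_ab_group_add"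
  assumes val: "valuation K \<nu>"
begin

text \<open>Membership in these sets replaces inequalities between values: 0 belongs to them
  whatever \<nu> assigns to it, so sums that happen to vanish need no separate treatment.\<close>

definition ge :: "'g \<Rightarrow> 'a set" where
  "ge \<phi> = {f \<in> carrier K. f = \<zero> \<or> \<phi> \<le> \<nu> f}"

definition gt :: "'g \<Rightarrow> 'a set" where
  "gt \<phi> = {f \<in> carrier K. f = \<zero> \<or> \<phi> < \<nu> f}"

lemma v_mult [simp]:
  "f \<in> carrier K \<Longrightarrow> f \<noteq> \<zero> \<Longrightarrow> g \<in> carrier K \<Longrightarrow> g \<noteq> \<zero> \<Longrightarrow> \<nu> (f \<otimes> g) = \<nu> f + \<nu> g"
  using val unfolding valuation_def by auto

lemma v_add:
  "f \<in> carrier K \<Longrightarrow> f \<noteq> \<zero> \<Longrightarrow> g \<in> carrier K \<Longrightarrow> g \<noteq> \<zero> \<Longrightarrow> f \<oplus> g \<noteq> \<zero> \<Longrightarrow> min (\<nu> f) (\<nu> g) \<le> \<nu> (f \<oplus> g)"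
  using val unfolding valuation_def by auto

lemma v_one [simp]: "\<nu> \<one> = 0"
  using v_mult[of \<one> \<one>] by simp

lemma v_inv [simp]:
  assumes "f \<in> carrier K" "f \<noteq> \<zero>"
  shows "\<nu> (inv f) = - \<nu> f"
proof -
  have "f \<in> Units K" using assms field_Units by blast
  then have "inv f \<in> carrier K" "inv f \<noteq> \<zero>" "f \<otimes> inv f = \<one>"
    using Units_inv_Units field_Units by auto
  then have "\<nu> f + \<nu> (inv f) = 0" using v_mult[OF assms, of "inv f"] by simp
  then show ?thesis by (simp add: eq_neg_iff_add_eq_0 add.commute)
qed

lemma inv_closed' [simp]: "f \<in> carrier K \<Longrightarrow> f \<noteq> \<zero> \<Longrightarrow> inv f \<in> carrier K"
  and inv_nonzero [simp]: "f \<in> carrier K \<Longrightarrow> f \<noteq> \<zero> \<Longrightarrow> inv f \<noteq> \<zero>"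
  and r_inv' [simp]: "f \<in> carrier K \<Longrightarrow> f \<noteq> \<zero> \<Longrightarrow> f \<otimes> inv f = \<one>"
  and l_inv' [simp]: "f \<in> carrier K \<Longrightarrow> f \<noteq> \<zero> \<Longrightarrow> inv f \<otimes> f = \<one>"
  using Units_inv_Units field_Units by auto

lemma v_minus [simp]:
  assumes "f \<in> carrier K"
  shows "\<nu> (\<ominus> f) = \<nu> f"
proof (cases "f = \<zero>")
  case False
  have m1: "\<ominus> \<one> \<noteq> \<zero>" by (metis add.inv_eq_1_iff one_closed one_not_zero)
  have "\<nu> (\<ominus> \<one>) + \<nu> (\<ominus> \<one>) = \<nu> (\<ominus> \<one> \<otimes> \<ominus> \<one>)" using m1 by simp
  also have "\<ominus> \<one> \<otimes> \<ominus> \<one> = \<one>" by (simp add: l_minus)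
  finally have "\<nu> (\<ominus> \<one>) = 0" by simp
  moreover have "\<ominus> f = \<ominus> \<one> \<otimes> f" using assms by (simp add: l_minus)
  ultimately show ?thesis using v_mult[of "\<ominus> \<one>" f] assms False m1 by simp
qed simp

lemma pow_nonzero [simp]: "f \<in> carrier K \<Longrightarrow> f \<noteq> \<zero> \<Longrightarrow> f [^] (n::nat) \<noteq> \<zero>"
  by (induction n) (auto simp: integral_iff)

lemma v_pow [simp]: "f \<in> carrier K \<Longrightarrow> f \<noteq> \<zero> \<Longrightarrow> \<nu> (f [^] (n::nat)) = nat_multiple n (\<nu> f)"
  by (induction n) (auto simp: integral_iff add.commute)

lemma geI: "f \<in> carrier K \<Longrightarrow> \<phi> \<le> \<nu> f \<Longrightarrow> f \<in> ge \<phi>"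
  and gtI: "f \<in> carrier K \<Longrightarrow> \<phi> < \<nu> f \<Longrightarrow> f \<in> gt \<phi>"
  and ge_carrier: "f \<in> ge \<phi> \<Longrightarrow> f \<in> carrier K"
  and gt_carrier: "f \<in> gt \<phi> \<Longrightarrow> f \<in> carrier K"
  and gt_ge: "f \<in> gt \<phi> \<Longrightarrow> f \<in> ge \<phi>"
  and zero_ge [simp]: "\<zero> \<in> ge \<phi>" and zero_gt [simp]: "\<zero> \<in> gt \<phi>"
  by (auto simp: ge_def gt_def)

lemma ge_gt_mono: "f \<in> ge \<phi> \<Longrightarrow> \<psi> < \<phi> \<Longrightarrow> f \<in> gt \<psi>"
  by (auto simp: ge_def gt_def)

lemma ge_add:
  assumes "f \<in> ge \<phi>" "g \<in> ge \<phi>"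
  shows "f \<oplus> g \<in> ge \<phi>"
proof -
  have c: "f \<in> carrier K" "g \<in> carrier K" using assms ge_carrier by auto
  consider "f = \<zero>" | "g = \<zero>" | "f \<oplus> g = \<zero>" | "f \<noteq> \<zero>" "g \<noteq> \<zero>" "f \<oplus> g \<noteq> \<zero>" by blast
  then show ?thesis
  proof cases
    case 4
    then have "\<phi> \<le> min (\<nu> f) (\<nu> g)" using assms by (auto simp: ge_def)
    also note v_add[OF c(1) 4(1) c(2) 4(2,3)]
    finally show ?thesis using c by (intro geI) simp_all
  qed (use assms c in auto)
qed

lemma gt_add:
  assumes "f \<in> gt \<phi>" "g \<in> gt \<phi>"
  shows "f \<oplus> g \<in> gt \<phi>"
proof -
  have c: "f \<in> carrier K" "g \<in> carrier K" using assms gt_carrier by auto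
  consider "f = \<zero>" | "g = \<zero>" | "f \<oplus> g = \<zero>" | "f \<noteq> \<zero>" "g \<noteq> \<zero>" "f \<oplus> g \<noteq> \<zero>" by blast
  then show ?thesis
  proof cases
    case 4
    then have "\<phi> < min (\<nu> f) (\<nu> g)" using assms by (auto simp: gt_def)
    also note v_add[OF c(1) 4(1) c(2) 4(2,3)]
    finally show ?thesis using c by (intro gtI) simp_all
  qed (use assms c in auto)
qed

lemma ge_minus: "f \<in> ge \<phi> \<Longrightarrow> \<ominus> f \<in> ge \<phi>"
  and gt_minus: "f \<in> gt \<phi> \<Longrightarrow> \<ominus> f \<in> gt \<phi>"
  by (auto simp: ge_def gt_def)

lemma ge_diff: "f \<in> ge \<phi> \<Longrightarrow> g \<in> ge \<phi> \<Longrightarrow> f \<ominus> g \<in> ge \<phi>"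
  and gt_diff: "f \<in> gt \<phi> \<Longrightarrow> g \<in> gt \<phi> \<Longrightarrow> f \<ominus> g \<in> gt \<phi>"
  by (auto simp: a_minus_def intro: ge_add gt_add ge_minus gt_minus)

lemma ge_mult: "f \<in> ge \<phi> \<Longrightarrow> g \<in> ge \<psi> \<Longrightarrow> f \<otimes> g \<in> ge (\<phi> + \<psi>)"
  by (cases "f = \<zero>"; cases "g = \<zero>") (auto simp: ge_def intro: add_mono)

lemma gt_mult: "f \<in> gt \<phi> \<Longrightarrow> g \<in> ge \<psi> \<Longrightarrow> f \<otimes> g \<in> gt (\<phi> + \<psi>)"
  by (cases "f = \<zero>"; cases "g = \<zero>") (auto simp: ge_def gt_def intro: add_less_le_mono)

lemma gt_mult': "f \<in> ge \<phi> \<Longrightarrow> g \<in> gt \<psi> \<Longrightarrow> f \<otimes> g \<in> gt (\<phi> + \<psi>)"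
  by (cases "f = \<zero>"; cases "g = \<zero>") (auto simp: ge_def gt_def intro: add_le_less_mono)

lemma exact_iff: "f \<in> carrier K \<Longrightarrow> f \<in> ge \<phi> \<and> f \<notin> gt \<phi> \<longleftrightarrow> f \<noteq> \<zero> \<and> \<nu> f = \<phi>"
  by (auto simp: ge_def gt_def)

lemma exact_add:
  assumes "f \<in> carrier K" "f \<noteq> \<zero>" "g \<in> gt (\<nu> f)"
  shows "f \<oplus> g \<noteq> \<zero>" "\<nu> (f \<oplus> g) = \<nu> f"
proof -
  have c: "g \<in> carrier K" using assms gt_carrier by auto
  have "f \<oplus> g \<in> ge (\<nu> f)" by (rule ge_add[OF geI gt_ge]) (use assms in auto)
  moreover have "f \<oplus> g \<notin> gt (\<nu> f)"
  proof
    assume "f \<oplus> g \<in> gt (\<nu> f)"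
    then have "(f \<oplus> g) \<ominus> g \<in> gt (\<nu> f)" using assms gt_diff by blast
    moreover have "(f \<oplus> g) \<ominus> g = f" using assms c by algebra
    ultimately show False using assms by (auto simp: gt_def)
  qed
  ultimately show "f \<oplus> g \<noteq> \<zero>" "\<nu> (f \<oplus> g) = \<nu> f" using exact_iff[of "f \<oplus> g" "\<nu> f"] assms c by auto
qed

section \<open>The valuation ring and its residue field\<close>

abbreviation "V \<equiv> valuation_ring K \<nu>"
abbreviation "mV \<equiv> valuation_ideal K \<nu>"
abbreviation "L \<equiv> residue_field K \<nu>"
abbreviation "res \<equiv> residue_class K \<nu>"

lemma V_simps [simp]:
  "carrier V = ge 0" "monoid.mult V = monoid.mult K" "ring.add V = ring.add K" "ring.zero V = \<zero>" "monoid.one V = \<one>"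
  by (auto simp: valuation_ring_def ge_def)

lemma mV_eq: "mV = gt 0"
  by (auto simp: valuation_ideal_def gt_def)

lemma ge0_one [simp]: "\<one> \<in> ge 0" by (simp add: geI)

lemma ge0_mult: "f \<in> ge 0 \<Longrightarrow> g \<in> ge 0 \<Longrightarrow> f \<otimes> g \<in> ge 0"
  using ge_mult[of f 0 g 0] by simp

lemma V_cring: "cring V"
proof -
  have *: "\<forall>f\<in>ge 0. \<exists>g\<in>ge 0. g \<oplus> f = \<zero>"
  proof
    fix f assume "f \<in> ge 0"
    then show "\<exists>g\<in>ge 0. g \<oplus> f = \<zero>" using ge_minus ge_carrier by (auto intro!: bexI[of _ "\<ominus> f"] l_neg)
  qed
  show ?thesis
    by (intro cringI abelian_groupI comm_monoidI)
      (use * in \<open>auto simp: ge_carrier ge0_mult ge_add m_ac a_ac l_distr r_distr\<close>)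
qed

lemma V_domain: "domain V"
proof -
  interpret V: cring V by (rule V_cring)
  show ?thesis by unfold_locales (auto simp: integral_iff ge_carrier)
qed

lemma V_inv: "f \<in> ge 0 \<Longrightarrow> \<ominus>\<^bsub>V\<^esub> f = \<ominus> f"
proof -
  assume f: "f \<in> ge 0"
  interpret V: cring V by (rule V_cring)
  have "\<ominus> f \<oplus> f = \<zero>" using f ge_carrier by (simp add: l_neg)
  then have "\<ominus>\<^bsub>V\<^esub> f = \<ominus> f"
    using V.minus_equality[of "\<ominus> f" f] f ge_minus by simp
  then show ?thesis .
qed

lemma V_ideal:
  assumes "J \<subseteq> ge 0" "\<zero> \<in> J" "\<And>f g. f \<in> J \<Longrightarrow> g \<in> J \<Longrightarrow> f \<oplus> g \<in> J"
    "\<And>f g. f \<in> J \<Longrightarrow> g \<in> ge 0 \<Longrightarrow> g \<otimes> f \<in> J"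
  shows "ideal J V"
proof -
  interpret V: cring V by (rule V_cring)
  have m1: "\<ominus> \<one> \<in> ge 0" by (intro ge_minus) simp
  have "\<ominus>\<^bsub>V\<^esub> f \<in> J" if "f \<in> J" for f
  proof -
    have "\<ominus> \<one> \<otimes> f \<in> J" using assms(4) that m1 by blast
    moreover have "\<ominus> \<one> \<otimes> f = \<ominus> f" using that assms(1) ge_carrier by (auto simp: l_minus)
    ultimately show ?thesis using V_inv that assms(1) by auto
  qed
  then have "subgroup J (add_monoid V)"
    by (intro V.add.subgroupI) (use assms in \<open>auto simp: a_inv_def\<close>)
  then show ?thesis
  proof (intro idealI)
    show "ring V" ..
    show "x \<otimes>\<^bsub>V\<^esub> a \<in> J" if "a \<in> J" "x \<in> carrier V" for a x using that assms(4) by auto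
    show "a \<otimes>\<^bsub>V\<^esub> x \<in> J" if "a \<in> J" "x \<in> carrier V" for a x
      using that assms(4)[of a x] assms(1) ge_carrier by (auto simp: m_comm subset_iff)
  qed
qed

lemma ideal_mV: "ideal mV V"
  unfolding mV_eq using gt_mult'[of _ 0 _ 0] by (intro V_ideal) (auto intro: gt_ge gt_add)

text \<open>An element of value zero has its inverse in the valuation ring, so an ideal containing
  it contains \<one>.\<close>

lemma V_proper_ideal:
  assumes J: "ideal J V" "\<one> \<notin> J"
  shows "J \<subseteq> mV"
proof
  interpret J: ideal J V by (rule J(1))
  fix f assume f: "f \<in> J"
  have fV: "f \<in> ge 0" using J.a_Hcarr[OF f] by simp
  show "f \<in> mV"
  proof (rule ccontr)
    assume "f \<notin> mV"
    then have v: "f \<noteq> \<zero>" "\<nu> f = 0" using fV exact_iff[of f 0] ge_carrier by (auto simp: mV_eq)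
    then have "inv f \<in> ge 0" using fV ge_carrier by (intro geI) auto
    then have "f \<otimes> inv f \<in> J" using J.I_r_closed[OF f, of "inv f"] by simp
    then show False using J v fV ge_carrier by simp
  qed
qed

lemma maximal_mV: "maximalideal mV V"
proof -
  interpret V: cring V by (rule V_cring)
  show ?thesis
  proof (rule maximalidealI[OF ideal_mV])
    have "\<one> \<notin> mV" by (simp add: mV_eq gt_def)
    then show "carrier V \<noteq> mV" using ge0_one V_simps(1) by metis
    fix J assume J: "ideal J V" "mV \<subseteq> J" "J \<subseteq> carrier V"
    show "J = mV \<or> J = carrier V"
    proof (cases "\<one> \<in> J")
      case True
      then show ?thesis using ideal.one_imp_carrier[OF J(1)] by simp
    next
      case False
      then show ?thesis using V_proper_ideal[OF J(1)] J by blast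
    qed
  qed
qed

lemma L_field: "field L"
  unfolding residue_field_def by (rule maximalideal.quotient_is_field[OF maximal_mV V_cring])

sublocale L: field L by (rule L_field)

lemma res_hom: "res \<in> ring_hom V L"
proof -
  have "(\<lambda>f. res f) = (+>\<^bsub>V\<^esub>) mV" by (simp add: fun_eq_iff residue_class_def)
  then show ?thesis using ideal.rcos_ring_hom[OF ideal_mV] by (simp add: residue_field_def)
qed

lemma res_closed [simp]: "f \<in> ge 0 \<Longrightarrow> res f \<in> carrier L"
  and res_mult: "f \<in> ge 0 \<Longrightarrow> g \<in> ge 0 \<Longrightarrow> res (f \<otimes> g) = res f \<otimes>\<^bsub>L\<^esub> res g"
  and res_add: "f \<in> ge 0 \<Longrightarrow> g \<in> ge 0 \<Longrightarrow> res (f \<oplus> g) = res f \<oplus>\<^bsub>L\<^esub> res g"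
  and res_one [simp]: "res \<one> = \<one>\<^bsub>L\<^esub>"
  using res_hom unfolding ring_hom_def by auto

lemma res_zero_iff: "f \<in> ge 0 \<Longrightarrow> res f = \<zero>\<^bsub>L\<^esub> \<longleftrightarrow> f \<in> gt 0"
proof -
  assume f: "f \<in> ge 0"
  interpret m: ideal mV V by (rule ideal_mV)
  have "\<zero>\<^bsub>L\<^esub> = mV" by (simp add: residue_field_def FactRing_def)
  moreover have "mV +>\<^bsub>V\<^esub> f = mV \<longleftrightarrow> f \<in> mV"
    using m.a_rcos_const m.a_rcos_self f by auto
  ultimately show ?thesis by (simp add: residue_class_def mV_eq)
qed

lemma res_zero [simp]: "res \<zero> = \<zero>\<^bsub>L\<^esub>"
  using res_zero_iff[of \<zero>] by simp

lemma carrier_L: "carrier L = res ` ge 0"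
  by (auto simp: residue_field_def FactRing_def A_RCOSETS_def' residue_class_def)

lemma res_nonzero: "f \<in> carrier K \<Longrightarrow> f \<noteq> \<zero> \<Longrightarrow> \<nu> f = 0 \<Longrightarrow> res f \<noteq> \<zero>\<^bsub>L\<^esub>"
  using res_zero_iff[of f] by (auto simp: ge_def gt_def)

lemma res_inv:
  assumes "f \<in> carrier K" "f \<noteq> \<zero>" "\<nu> f = 0"
  shows "res (inv f) = inv\<^bsub>L\<^esub> res f"
proof -
  have *: "f \<in> ge 0" "inv f \<in> ge 0" using assms by (auto intro!: geI)
  have "res f \<otimes>\<^bsub>L\<^esub> res (inv f) = \<one>\<^bsub>L\<^esub>" using res_mult[OF *] assms by simp
  then show ?thesis using L.comm_inv_char[of "res f" "res (inv f)"] * by simp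
qed

lemma res_pow: "f \<in> ge 0 \<Longrightarrow> f [^] (n::nat) \<in> ge 0 \<and> res (f [^] n) = res f [^]\<^bsub>L\<^esub> n"
  by (induction n) (auto simp: res_mult ge0_mult ge_carrier)

lemma res_eqI: "f \<in> ge 0 \<Longrightarrow> g \<in> ge 0 \<Longrightarrow> f \<ominus> g \<in> gt 0 \<Longrightarrow> res f = res g"
proof -
  assume *: "f \<in> ge 0" "g \<in> ge 0" "f \<ominus> g \<in> gt 0"
  have "f = (f \<ominus> g) \<oplus> g" using *(1,2)[THEN ge_carrier] by algebra
  then have "res f = res (f \<ominus> g) \<oplus>\<^bsub>L\<^esub> res g" using res_add[of "f \<ominus> g" g] * ge_diff by metis
  then show ?thesis using res_zero_iff[of "f \<ominus> g"] * gt_ge by simp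
qed

end

section \<open>Rank two valuations\<close>

context valued_field
begin

text \<open>The quotient g/f lies in the valuation ring: its ideals are final segments with respect
  to the value.\<close>

lemma V_ideal_upward:
  assumes J: "ideal J V" and f: "f \<in> J" "f \<noteq> \<zero>" and g: "g \<in> carrier K" "g = \<zero> \<or> \<nu> f \<le> \<nu> g"
  shows "g \<in> J"
proof -
  interpret J: ideal J V by (rule J)
  have fc: "f \<in> carrier K" using J.a_Hcarr[OF f(1)] ge_carrier by simp
  have "g \<otimes> inv f \<in> ge 0"
    using g fc f(2) by (cases "g = \<zero>") (auto intro!: geI)
  then have "(g \<otimes> inv f) \<otimes> f \<in> J" using J.I_l_closed[OF f(1), of "g \<otimes> inv f"] by simp
  then show ?thesis using g fc f(2) by (simp add: m_assoc)
qed

text \<open>The elements infinitely large compared with \<xi>. For \<xi> = \<nu>(x) > 0 this is the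
  largest prime of the valuation ring that does not contain x.\<close>

definition beyond :: "'g \<Rightarrow> 'a set" where
  "beyond \<xi> = {h \<in> ge 0. \<forall>N. h \<in> gt (nat_multiple N \<xi>)}"

lemma beyond_iff:
  assumes "h \<in> carrier K" "h \<noteq> \<zero>" "0 \<le> \<xi>"
  shows "h \<in> beyond \<xi> \<longleftrightarrow> (\<forall>N. nat_multiple N \<xi> < \<nu> h)"
proof
  assume *: "\<forall>N. nat_multiple N \<xi> < \<nu> h"
  then have "0 < \<nu> h" using nat_multiple_0 by metis
  then show "h \<in> beyond \<xi>" using assms * by (auto simp: beyond_def intro!: geI gtI)
qed (use assms in \<open>auto simp: beyond_def gt_def\<close>)

text \<open>Primality holds because values bounded by M \<xi> and by N \<xi> have a sum bounded by
  (M + N) \<xi>.\<close>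

lemma prime_beyond:
  assumes "0 \<le> \<xi>"
  shows "primeideal (beyond \<xi>) V"
proof (rule primeidealI)
  show "ideal (beyond \<xi>) V"
  proof (rule V_ideal)
    show "g \<otimes> f \<in> beyond \<xi>" if "f \<in> beyond \<xi>" "g \<in> ge 0" for f g
      using that gt_mult'[of g 0 f] ge0_mult by (auto simp: beyond_def)
  qed (auto simp: beyond_def ge_add gt_add)
  show "cring V" by (rule V_cring)
  have "\<one> \<notin> beyond \<xi>" using beyond_iff[of \<one> \<xi>] assms by (auto intro!: exI[of _ 0])
  then show "carrier V \<noteq> beyond \<xi>" using ge0_one V_simps(1) by metis
  fix a b assume ab: "a \<in> carrier V" "b \<in> carrier V" "a \<otimes>\<^bsub>V\<^esub> b \<in> beyond \<xi>"
  show "a \<in> beyond \<xi> \<or> b \<in> beyond \<xi>"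
  proof (rule ccontr)
    assume n: "\<not> ?thesis"
    have c: "a \<in> carrier K" "b \<in> carrier K" using ab ge_carrier by auto
    have z: "a \<noteq> \<zero>" "b \<noteq> \<zero>" using n by (auto simp: beyond_def)
    then obtain M N where "\<not> nat_multiple M \<xi> < \<nu> a" "\<not> nat_multiple N \<xi> < \<nu> b"
      using n c assms beyond_iff by blast
    then have "\<nu> (a \<otimes> b) \<le> nat_multiple (M + N) \<xi>" using c z by (simp add: nat_multiple_add add_mono)
    moreover have "nat_multiple (M + N) \<xi> < \<nu> (a \<otimes> b)"
      using ab c z assms beyond_iff[of "a \<otimes> b"] by (simp add: integral_iff)
    ultimately show False by simp
  qed
qed

lemma V_zero_prime: "primeideal {\<zero>} V"
  using domain.zeroprimeideal[OF V_domain] by simp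

lemma mV_prime: "primeideal mV V"
  by (rule cring.maximalideal_prime[OF V_cring maximal_mV])

lemma V_prime_sub: "primeideal J V \<Longrightarrow> J \<subseteq> mV"
proof (rule V_proper_ideal)
  assume J: "primeideal J V"
  interpret J: primeideal J V by (rule J)
  show "ideal J V" by (rule J.is_ideal)
  show "\<one> \<notin> J" using J.one_imp_carrier J.I_notcarr by auto
qed

lemma V_prime_zero: "primeideal J V \<Longrightarrow> \<zero> \<in> J"
  using additive_subgroup.zero_closed[of J V] by (simp add: primeideal_def ideal_def)

lemma V_prime_pow:
  assumes "primeideal J V" "f \<in> ge 0" "f [^] (n::nat) \<in> J"
  shows "f \<in> J"
  using assms(3)
proof (induction n)
  case 0
  then show ?case using V_prime_sub[OF assms(1)] by (auto simp: mV_eq gt_def)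
next
  case (Suc n)
  then show ?case using primeideal.I_prime[OF assms(1), of "f [^] n" f] assms(2) res_pow by auto
qed

end

locale rank_two_valuation = valued_field +
  fixes I :: "'a set"
  assumes rank: "valuation_rank K \<nu> = 2" and I: "height_one_prime (valuation_ring K \<nu>) I"
begin

lemma dimV: "krull_dim V = 2"
  using rank by (simp add: valuation_rank_def)

lemma I_prime: "primeideal I V"
  using I by (simp add: height_one_prime_def)

lemma I_nonzero: "{\<zero>} \<subset> I"
proof -
  obtain C0 where C0: "primeideal C0 V" "C0 \<subset> I" using height_one_chain[OF I] .
  then show ?thesis using V_prime_zero by blast
qed

text \<open>A chain of three primes has its top inside mV; if I were mV, the lower two would
  contradict height one.\<close>

lemma I_proper: "I \<subset> mV"
proof -
  have "I \<noteq> mV"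
  proof
    assume eq: "I = mV"
    obtain C0 C1 C2 where C: "primeideal C0 V" "primeideal C1 V" "primeideal C2 V" "C0 \<subset> C1" "C1 \<subset> C2"
      using krull_dim_2_chain[OF dimV] .
    have "C1 \<subset> I" using C V_prime_sub[OF C(3)] eq by blast
    then show False using height_one_no_chain[OF I C(1,2,4)] by blast
  qed
  then show ?thesis using V_prime_sub[OF I_prime] by blast
qed

text \<open>An element of I of value at most N \<nu>(x) would put x^N, hence x, into I; this gives
  one inclusion. Were it strict, 0, I, \<open>beyond (\<nu> x)\<close> and mV would form a chain too
  long for rank two.\<close>

lemma I_contains_beyond:
  assumes "x \<in> carrier K" "x \<noteq> \<zero>" "x \<notin> I" "0 < \<nu> x"
  shows "I = beyond (\<nu> x)"
proof -
  let ?J = "beyond (\<nu> x)"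
  have xg: "x \<in> ge 0" using assms by (intro geI) auto
  have J: "primeideal ?J V" using assms by (intro prime_beyond) auto
  have sub: "I \<subseteq> ?J"
  proof
    fix h assume h: "h \<in> I"
    have hg: "h \<in> ge 0" using h I_prime by (auto simp: primeideal_def ideal_def dest: additive_subgroup.a_Hcarr)
    show "h \<in> ?J"
    proof (cases "h = \<zero>")
      case True
      then show ?thesis using J V_prime_zero by blast
    next
      case False
      have "nat_multiple N (\<nu> x) < \<nu> h" for N
      proof (rule ccontr)
        assume "\<not> ?thesis"
        then have "x [^] N \<in> I"
          using assms by (intro V_ideal_upward[OF primeideal.axioms(1)[OF I_prime] h False]) auto
        then show False using V_prime_pow[OF I_prime xg] assms by blast
      qed
      then show ?thesis using False hg ge_carrier assms beyond_iff by (simp add: order_less_imp_le)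
    qed
  qed
  have xJ: "x \<notin> ?J" using assms beyond_iff[of x "\<nu> x"] by (auto intro!: exI[of _ 1])
  have "x \<in> mV" using assms by (simp add: mV_eq gtI)
  then have "?J \<subset> mV" using V_prime_sub[OF J] xJ by blast
  then have "\<not> I \<subset> ?J"
    using krull_dim_2_no_chain[OF dimV V_zero_prime I_prime J mV_prime I_nonzero] by blast
  then show ?thesis using sub by blast
qed

text \<open>For x \<in> I the prime \<open>beyond (\<nu> x)\<close> lies in I but misses x; as I has
  height one, it is zero, so no value exceeds all multiples of \<nu>(x).\<close>

lemma archimedean_in_I:
  assumes x: "x \<in> I" "x \<noteq> \<zero>" and h: "h \<in> carrier K" "h \<noteq> \<zero>"
  obtains N where "\<nu> h \<le> nat_multiple N (\<nu> x)"
proof -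
  let ?J = "beyond (\<nu> x)"
  have xg: "x \<in> ge 0" using x(1) I_prime by (auto simp: primeideal_def ideal_def dest: additive_subgroup.a_Hcarr)
  have xc: "x \<in> carrier K" using xg ge_carrier by blast
  have v: "0 < \<nu> x" using x I_proper by (auto simp: mV_eq gt_def)
  have J: "primeideal ?J V" using v by (intro prime_beyond) auto
  have xJ: "x \<notin> ?J" using x v xc beyond_iff[of x "\<nu> x"] by (auto intro!: exI[of _ 1])
  have "?J \<subseteq> I"
  proof
    fix h assume h: "h \<in> ?J"
    have hc: "h \<in> carrier K" using h ge_carrier by (auto simp: beyond_def)
    have "h = \<zero> \<or> \<nu> x \<le> \<nu> h" using beyond_iff[OF hc] h v nat_multiple_1(1) by (metis order_less_imp_le)
    then show "h \<in> I" by (rule V_ideal_upward[OF primeideal.axioms(1)[OF I_prime] x hc])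
  qed
  then have "?J \<subset> I" using xJ x by blast
  then have "\<not> {\<zero>} \<subset> ?J" using height_one_no_chain[OF I V_zero_prime J] by blast
  then have "h \<notin> ?J" using h V_prime_zero[OF J] by auto
  then show ?thesis using beyond_iff[OF h, of "\<nu> x"] v that by (auto simp: not_less)
qed

end

section \<open>Degrees of simple extensions\<close>

context field
begin

lemma finsum_lessThan_Suc:
  "f \<in> {..<Suc n} \<rightarrow> carrier R \<Longrightarrow> (\<Oplus>q\<in>{..<Suc n}. f q) = f n \<oplus> (\<Oplus>q\<in>{..<n}. f q)"
  unfolding lessThan_Suc by (rule finsum_insert) auto

lemma eval_map_rev_upt:
  assumes "c \<in> {..<Q} \<rightarrow> carrier R" "a \<in> carrier R"
  shows "eval (map c (rev [0..<Q])) a = (\<Oplus>q\<in>{..<Q}. c q \<otimes> a [^] q)"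
  using assms(1)
proof (induction Q)
  case (Suc Q)
  have "(\<Oplus>q\<in>{..<Suc Q}. c q \<otimes> a [^] q) = c Q \<otimes> a [^] Q \<oplus> (\<Oplus>q\<in>{..<Q}. c q \<otimes> a [^] q)"
    using Suc.prems assms(2) by (intro finsum_lessThan_Suc) auto
  moreover have "c \<in> {..<Q} \<rightarrow> carrier R" using Suc.prems by auto
  ultimately show ?case using Suc.IH by simp
qed simp

lemma coeff_map_rev_upt: "q < Q \<Longrightarrow> coeff (map c (rev [0..<Q])) q = c q"
  by (subst coeff_nth) (auto simp: rev_nth)

text \<open>The bound on Q is conditional because arbitrarily many powers of a transcendental
  element are independent. A nontrivial relation would be a polynomial of degree below Q vanishing
  at a, contrary to the minimality of \<open>Irr F a\<close>.\<close>

lemma power_independence: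
  assumes F: "subfield F R" and a: "a \<in> carrier R"
    and Q: "algebraic F a \<Longrightarrow> Q \<le> degree (Irr F a)"
    and c: "\<And>q. q < Q \<Longrightarrow> c q \<in> F" and sum: "(\<Oplus>q\<in>{..<Q}. c q \<otimes> a [^] q) = \<zero>" and q: "q < Q"
  shows "c q = \<zero>"
proof -
  have FR: "F \<subseteq> carrier R" by (rule subfieldE(3)[OF F])
  \<comment> \<open>Polynomials are coefficient lists with the leading coefficient first, hence the
    reversal; \<open>normalize\<close> strips leading zeros.\<close>
  define l where "l = map c (rev [0..<Q])"
  define p where "p = normalize l"
  have l: "set l \<subseteq> F" using c by (auto simp: l_def)
  have p: "p \<in> carrier (F [X])"
    using normalize_gives_polynomial[OF l] unfolding p_def univ_poly_def by simp
  have "eval p a = eval l a" unfolding p_def using l FR a by (intro eval_normalize) auto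
  then have ev: "eval p a = \<zero>"
    unfolding l_def using sum c FR a by (subst (asm) eval_map_rev_upt) auto
  have "p = []"
  proof (rule ccontr)
    assume "p \<noteq> []"
    then have alg: "algebraic F a" using eval_transcendental[of F a p] p ev unfolding over_def by blast
    have "degree (Irr F a) \<le> degree p"
      using \<open>p \<noteq> []\<close> p ev alg F a
      by (intro pdivides_imp_degree_le[OF subfieldE(1)[OF F] IrrE(1)] Irr_minimal) (auto simp: over_def)
    moreover have "length p \<le> Q" using normalize_length_le[of l] unfolding p_def l_def by simp
    moreover have "length p > 0" using \<open>p \<noteq> []\<close> by simp
    ultimately show False using Q[OF alg] by linarith
  qed
  then have "coeff l q = \<zero>" using normalize_coeff[of l] unfolding p_def by simp
  then show ?thesis using coeff_map_rev_upt[OF q] unfolding l_def by simp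
qed

lemma generate_field_algebraic:
  assumes F: "subfield F R" and a: "a \<in> carrier R" and alg: "algebraic F a"
  shows "generate_field R (F \<union> {a}) = simple_extension F a"
proof
  have FR: "F \<subseteq> carrier R" by (rule subfieldE(3)[OF F])
  have sub: "subfield (simple_extension F a) R"
    using simple_extension_is_subfield[OF F a] alg by (simp add: over_def)
  show "generate_field R (F \<union> {a}) \<subseteq> simple_extension F a"
    using FR a sub simple_extension_incl[OF FR a] simple_extension_mem[OF subfieldE(1)[OF F] a]
    by (intro generate_field_min_subfield1) auto
  have "subring (generate_field R (F \<union> {a})) R"
    using FR a by (intro subfieldE(1) generate_field_is_subfield) auto
  then show "simple_extension F a \<subseteq> generate_field R (F \<union> {a})"
    by (rule simple_extension_subring_incl) (auto intro: generate_field.incl)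
qed

context
  fixes F a E
  assumes F: "subfield F R" and a: "a \<in> carrier R" and E: "E = generate_field R (F \<union> {a})"
begin

lemma E_subring: "subring E R" and a_in_E: "a \<in> E"
proof -
  have FR: "F \<subseteq> carrier R" by (rule subfieldE(3)[OF F])
  then show "subring E R" unfolding E using a by (intro subfieldE(1) generate_field_is_subfield) auto
  show "a \<in> E" unfolding E by (auto intro: generate_field.incl)
qed

lemma extension_degree_algebraic:
  assumes "algebraic F a"
  shows "extension_degree R E F = enat (degree (Irr F a))"
proof -
  have d: "dimension (degree (Irr F a)) F E"
    using dimension_simple_extension[OF F a] generate_field_algebraic[OF F a assms] assms
    unfolding E by (simp add: over_def)
  show ?thesis
    using finite_dimensionI[OF d] dimI[OF F d] by (simp add: extension_degree_def over_def)
qed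

lemma extension_degree_transcendental:
  assumes "transcendental F a"
  shows "extension_degree R E F = \<infinity>"
  using finite_dimension_imp_algebraic[OF F E_subring _ a_in_E] assms
  by (auto simp: extension_degree_def over_def)

lemma degree_independence:
  assumes "enat Q \<le> extension_degree R E F"
    and "\<And>q. q < Q \<Longrightarrow> c q \<in> F" "(\<Oplus>q\<in>{..<Q}. c q \<otimes> a [^] q) = \<zero>" "q < Q"
  shows "c q = \<zero>"
  using assms extension_degree_algebraic by (intro power_independence[OF F a _ assms(2-4)]) auto

text \<open>Finite degree excludes the transcendental case. The relation is stated with the leading
  coefficient 1 split off, since this is the shape in which the algorithm lifts the minimal
  polynomial.\<close>

lemma finite_degree:
  assumes "extension_degree R E F = enat D"
  shows "0 < D" "\<And>t. coeff (Irr F a) t \<in> F"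
    "a [^] D \<oplus> (\<Oplus>t\<in>{..<D}. coeff (Irr F a) t \<otimes> a [^] t) = \<zero>"
proof -
  have FR: "F \<subseteq> carrier R" by (rule subfieldE(3)[OF F])
  have alg: "algebraic F a" using assms extension_degree_transcendental by auto
  then have alg': "(algebraic over F) a" by (simp add: over_def)
  have D: "D = degree (Irr F a)" using assms extension_degree_algebraic[OF alg] by simp
  let ?p = "Irr F a"
  have p: "polynomial F ?p" using IrrE(1)[OF F a alg'] by (simp add: univ_poly_carrier)
  have lc: "lead_coeff ?p = \<one>" and ev: "eval ?p a = \<zero>" using IrrE(3,4)[OF F a alg'] by auto
  have ne: "?p \<noteq> []"
    using IrrE(2)[OF F a alg'] by (auto simp: ring_irreducible_def univ_poly_zero)
  show "0 < D"
    using pirreducible_degree[OF F IrrE(1)[OF F a alg'] IrrE(2)[OF F a alg']] by (simp add: D)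
  have setp: "set ?p \<subseteq> F" using p polynomial_incl by blast
  have F0: "\<zero> \<in> F" by (rule subringE(2)[OF subfieldE(1)[OF F]])
  show c: "coeff ?p t \<in> F" for t
  proof -
    have "coeff ?p t \<in> set ?p \<union> {\<zero>}" unfolding coeff_img(3)[symmetric] by (rule rangeI)
    then show ?thesis
    proof
      assume "coeff ?p t \<in> {\<zero>}"
      then have "coeff ?p t = \<zero>" by (rule singletonD)
      then show ?thesis using F0 by (rule ssubst)
    qed (rule subsetD[OF setp])
  qed
  have len: "length ?p = Suc D" using ne by (cases ?p) (auto simp: D)
  have "?p = map (coeff ?p) (rev [0..<Suc D])" using coeff_list[of ?p] unfolding len by simp
  then have "eval ?p a = (\<Oplus>t\<in>{..<Suc D}. coeff ?p t \<otimes> a [^] t)"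
    using eval_map_rev_upt[of "coeff ?p" "Suc D" a] c FR a by auto
  also have "\<dots> = coeff ?p D \<otimes> a [^] D \<oplus> (\<Oplus>t\<in>{..<D}. coeff ?p t \<otimes> a [^] t)"
    using c FR a by (intro finsum_lessThan_Suc) auto
  also have "coeff ?p D = \<one>" using lead_coeff_simp[OF ne] lc D by simp
  finally show "a [^] D \<oplus> (\<Oplus>t\<in>{..<D}. coeff ?p t \<otimes> a [^] t) = \<zero>" using ev a by simp
qed

lemma degree_one_iff: "extension_degree R E F = 1 \<longleftrightarrow> a \<in> F"
proof
  assume d: "extension_degree R E F = 1"
  then have d1: "extension_degree R E F = enat 1" by (simp add: one_enat_def)
  let ?c = "coeff (Irr F a) 0"
  have FR: "F \<subseteq> carrier R" by (rule subfieldE(3)[OF F])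
  have c: "?c \<in> F" using finite_degree(2)[OF d1] .
  have "a [^] (1::nat) \<oplus> ?c \<otimes> a [^] (0::nat) = \<zero>"
    using finite_degree(3)[OF d1] finsum_lessThan_Suc[of "\<lambda>t. coeff (Irr F a) t \<otimes> a [^] t" 0] c FR a
    by auto
  then have "a \<oplus> ?c = \<zero>" using a c FR by auto
  then have "a = \<ominus> ?c" using a c FR by (metis minus_equality subsetD)
  then show "a \<in> F" using subringE(5)[OF subfieldE(1)[OF F] c] by metis
next
  assume aF: "a \<in> F"
  have FR: "F \<subseteq> carrier R" by (rule subfieldE(3)[OF F])
  have "E = F"
    unfolding E using generate_field_min_subfield1[OF _ F, of "F \<union> {a}"] aF FR a
    by (auto intro: generate_field.incl)
  then show "extension_degree R E F = 1"
    using finite_dimensionI[OF dimension_one[OF F]] dimI[OF F dimension_one[OF F]]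
    by (simp add: extension_degree_def over_def one_enat_def)
qed

end

end

section \<open>The generating sequence\<close>

context valued_field
begin

lemma ge_finsum: "(\<And>i. i \<in> S \<Longrightarrow> f i \<in> ge \<phi>) \<Longrightarrow> (\<Oplus>i\<in>S. f i) \<in> ge \<phi>"
proof (induction S rule: infinite_finite_induct)
  case (insert i S)
  then have "f \<in> S \<rightarrow> carrier K" "f i \<in> carrier K" using ge_carrier by auto
  then show ?case using insert by (simp add: ge_add)
qed (simp_all add: finsum_infinite)

lemma res_finsum:
  "finite S \<Longrightarrow> (\<And>i. i \<in> S \<Longrightarrow> f i \<in> ge 0) \<Longrightarrow> res (\<Oplus>i\<in>S. f i) = (\<Oplus>\<^bsub>L\<^esub>i\<in>S. res (f i))"
proof (induction S rule: finite_induct)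
  case (insert i S)
  have "f \<in> S \<rightarrow> carrier K" "f i \<in> carrier K" using insert.prems ge_carrier by auto
  moreover have "(\<lambda>i. res (f i)) \<in> S \<rightarrow> carrier L" "res (f i) \<in> carrier L" using insert.prems by auto
  moreover have "(\<Oplus>i\<in>S. f i) \<in> ge 0" using insert.prems by (intro ge_finsum) auto
  ultimately show ?case using insert by (simp add: res_add)
qed simp

lemma inv_mult:
  assumes "f \<in> carrier K" "f \<noteq> \<zero>" "g \<in> carrier K" "g \<noteq> \<zero>"
  shows "inv (f \<otimes> g) = inv f \<otimes> inv g"
proof -
  have c: "inv f \<in> carrier K" "inv g \<in> carrier K" using assms by auto
  have "(f \<otimes> g) \<otimes> (inv f \<otimes> inv g) = (f \<otimes> inv f) \<otimes> (g \<otimes> inv g)"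
    using assms(1,3) c by algebra
  also have "\<dots> = \<one>" using assms by simp
  finally show ?thesis using assms c by (intro comm_inv_char) auto
qed

lemma inv_pow:
  assumes "f \<in> carrier K" "f \<noteq> \<zero>"
  shows "inv (f [^] (n::nat)) = inv f [^] n"
  using assms by (induction n) (auto simp: inv_mult)

end

text \<open>The data of the algorithm for a dominating valuation with \<nu>(x) = \<nu>(m); the rank
  and the prime I join in \<open>rank_two_sequence\<close>.\<close>

locale generating_sequence = valued_field K \<nu>
  for K :: "('a, 'b) ring_scheme" (structure) and \<nu> :: "'a \<Rightarrow> 'g::linordered_ab_group_add" +
  fixes R m CS :: "'a set" and x y :: 'a and P :: "nat \<Rightarrow> 'a" and \<Omega> :: enat
    and nbar d n :: "nat \<Rightarrow> enat" and \<alpha> :: "nat \<Rightarrow> 'a set"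
  assumes quotient: "quotient_field K R"
    and regular: "regular_local_ring (K\<lparr>carrier := R\<rparr>) m"
    and dim_two: "krull_dim (K\<lparr>carrier := R\<rparr>) = 2"
    and CS_sub: "CS \<subseteq> R"
    and x_R: "x \<in> R" and y_R: "y \<in> R" and m_gen: "m = Idl\<^bsub>K\<lparr>carrier := R\<rparr>\<^esub> {x, y}"
    and dom: "dominates K \<nu> R m"
    and value_x: "\<nu> x = ideal_value K \<nu> m"
    and run: "algorithm_run K \<nu> R CS x y P \<Omega> nbar d n \<alpha>"
begin

section \<open>The ring R inside its quotient field\<close>

abbreviation "A \<equiv> K\<lparr>carrier := R\<rparr>"

lemma R_subring: "subring R K"
  using quotient by (simp add: quotient_field_def)

lemma R_sub: "f \<in> R \<Longrightarrow> f \<in> carrier K"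
  using subringE(1)[OF R_subring] by blast

lemma R_zero [simp]: "\<zero> \<in> R" and R_one [simp]: "\<one> \<in> R"
  and R_add: "f \<in> R \<Longrightarrow> g \<in> R \<Longrightarrow> f \<oplus> g \<in> R"
  and R_mult: "f \<in> R \<Longrightarrow> g \<in> R \<Longrightarrow> f \<otimes> g \<in> R"
  and R_minus: "f \<in> R \<Longrightarrow> \<ominus> f \<in> R"
  using subringE(2,3,5,6,7)[OF R_subring] by auto

lemma R_diff: "f \<in> R \<Longrightarrow> g \<in> R \<Longrightarrow> f \<ominus> g \<in> R"
  by (simp add: a_minus_def R_add R_minus)

lemma R_pow: "f \<in> R \<Longrightarrow> f [^] (e::nat) \<in> R"
  by (induction e) (auto simp: R_mult)

lemma R_finsum: "(\<And>i. i \<in> S \<Longrightarrow> f i \<in> R) \<Longrightarrow> (\<Oplus>i\<in>S. f i) \<in> R"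
proof (induction S rule: infinite_finite_induct)
  case (insert i S)
  then have "f \<in> S \<rightarrow> carrier K" "f i \<in> carrier K" using R_sub by auto
  then show ?case using insert by (simp add: R_add)
qed (simp_all add: finsum_infinite)

lemma A_domain: "domain A"
  by (rule subring_is_domain[OF R_subring])

text \<open>The middle prime of a chain C0 \<subset> C1 \<subset> C2 is nonzero and lies strictly
  below m; this supplies \<open>intermediate_prime\<close>.\<close>

lemma A_local: "local_parameters A m x y"
proof -
  have loc: "noetherian_ring A" "maximalideal m A" "\<And>m'. maximalideal m' A \<Longrightarrow> m' = m"
    using regular by (auto simp: regular_local_ring_def local_ring_def)
  interpret A: domain A by (rule A_domain)
  obtain C0 C1 C2 where C: "primeideal C0 A" "primeideal C1 A" "primeideal C2 A" "C0 \<subset> C1" "C1 \<subset> C2"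
    using krull_dim_2_chain[OF dim_two] .
  interpret N: noetherian_ring A by (rule loc(1))
  interpret ND: noetherian_domain A ..
  have "C2 \<subseteq> m"
  proof (rule N.proper_ideal_sub_maximal)
    show "m' = m" if "maximalideal m' A" for m' using that by (rule loc(3))
    show "ideal C2 A" by (rule primeideal.axioms(1)[OF C(3)])
    then show "\<one>\<^bsub>A\<^esub> \<notin> C2" using primeideal.I_notcarr[OF C(3)] ideal.one_imp_carrier by blast
  qed
  then have "C1 \<subset> m" using C(5) by blast
  moreover have "\<zero>\<^bsub>A\<^esub> \<in> C0"
    using C(1) by (intro additive_subgroup.zero_closed ideal.axioms(1) primeideal.axioms(1))
  then have "C1 \<noteq> {\<zero>\<^bsub>A\<^esub>}" using C(4) by auto
  ultimately have q: "\<exists>q. primeideal q A \<and> q \<noteq> {\<zero>\<^bsub>A\<^esub>} \<and> q \<subset> m" using C(2) by blast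
  show ?thesis
  proof (rule local_parameters.intro[OF ND.noetherian_domain_axioms local_parameters_axioms.intro])
    show "m' = m" if "maximalideal m' A" for m' using that by (rule loc(3))
  qed (use loc(2) x_R y_R m_gen q in simp_all)
qed

sublocale A: local_parameters A m x y by (rule A_local)

lemma A_pow [simp]: "f [^]\<^bsub>A\<^esub> (e::nat) = f [^] e"
  by (rule nat_pow_consistent[symmetric])

definition XR :: "'a set" where "XR = {x \<otimes> h | h. h \<in> R}"

lemma XR_eq: "PIdl\<^bsub>A\<^esub> x = XR"
  using A.PIdl_iff[of x] x_R by (auto simp: XR_def)

lemma R_ge: "f \<in> R \<Longrightarrow> f \<in> ge 0"
  using dom by (auto simp: dominates_def)

lemma m_iff: "f \<in> R \<Longrightarrow> f \<in> m \<longleftrightarrow> f \<in> gt 0"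
  using dom by (auto simp: dominates_def mV_eq)

lemma m_R: "f \<in> m \<Longrightarrow> f \<in> R" using A.m_sub by simp

lemma XR_R: "f \<in> XR \<Longrightarrow> f \<in> R"
  using x_R by (auto simp: XR_def R_mult)

lemma XR_add: "f \<in> XR \<Longrightarrow> g \<in> XR \<Longrightarrow> f \<oplus> g \<in> XR"
  using additive_subgroup.a_closed[OF ideal.axioms(1)[OF A.PIdl_x_ideal]] by (simp add: XR_eq)

lemma XR_zero [simp]: "\<zero> \<in> XR"
  using additive_subgroup.zero_closed[OF ideal.axioms(1)[OF A.PIdl_x_ideal]] by (simp add: XR_eq)

lemma XR_mult: "f \<in> XR \<Longrightarrow> g \<in> R \<Longrightarrow> f \<otimes> g \<in> XR" "f \<in> XR \<Longrightarrow> g \<in> R \<Longrightarrow> g \<otimes> f \<in> XR"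
  using ideal.I_r_closed[OF A.PIdl_x_ideal] ideal.I_l_closed[OF A.PIdl_x_ideal] by (simp_all add: XR_eq)

lemma XR_cancel: "f \<in> R \<Longrightarrow> g \<in> XR \<Longrightarrow> f \<oplus> g \<in> XR \<Longrightarrow> f \<in> XR"
  using A.PIdl_minus_cancel[of x f g] x_R XR_R by (simp add: XR_eq)

lemma XR_prime: "f \<in> R \<Longrightarrow> g \<in> R \<Longrightarrow> f \<otimes> g \<in> XR \<Longrightarrow> f \<in> XR \<or> g \<in> XR"
  using A.PIdl_x_prime[of f g] by (simp add: XR_eq)

lemma one_notin_XR: "\<one> \<notin> XR"
  using A.pow_notin_PIdl[of 0] by (simp add: XR_eq)

lemma XR_pow: "f \<in> R \<Longrightarrow> f [^] (e::nat) \<in> XR \<Longrightarrow> f \<in> XR"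
proof (induction e)
  case (Suc e)
  then show ?case using XR_prime[of "f [^] e" f] R_pow by auto
qed (simp add: one_notin_XR)

lemma y_notin_XR: "y \<notin> XR"
  using A.y_notin by (simp add: XR_eq)

lemma x_nz: "x \<noteq> \<zero>"
  using A.x_nonzero by simp

lemma y_nz: "y \<noteq> \<zero>"
  using y_notin_XR by auto

lemma unit_inv:
  assumes "u \<in> R" "u \<noteq> \<zero>" "\<nu> u = 0"
  shows "inv u \<in> R"
proof -
  have "u \<notin> m" using m_iff assms by (auto simp: gt_def)
  then have "u \<in> Units A" using A.not_in_m_Unit assms by simp
  then obtain v where "v \<in> R" "v \<otimes> u = \<one>" unfolding Units_def by auto
  then have "inv u = v" using assms R_sub comm_inv_char[of u v] m_comm by metis
  then show ?thesis using \<open>v \<in> R\<close> by simp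
qed

lemma m_E:
  assumes "f \<in> m"
  obtains a b where "a \<in> R" "b \<in> R" "f = x \<otimes> a \<oplus> y \<otimes> b"
  using A.in_m_E[OF assms] by auto

lemma v_x_pos: "0 < \<nu> x"
  using m_iff[OF x_R] A.x_in_m x_nz by (auto simp: gt_def)

text \<open>\<open>ideal_value\<close> is a LEAST and says nothing before a minimum is exhibited.
  Since m is generated by x and y, the smaller of \<nu>(x) and \<nu>(y) is attained on m and bounds
  it from below.\<close>

lemma v_x_min:
  assumes "f \<in> m"
  shows "f \<in> ge (\<nu> x)"
proof -
  define \<mu> where "\<mu> = min (\<nu> x) (\<nu> y)"
  have mu: "g \<in> ge \<mu>" if g: "g \<in> m" for g
  proof -
    obtain a b where ab: "a \<in> R" "b \<in> R" "g = x \<otimes> a \<oplus> y \<otimes> b" using m_E[OF g] .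
    have "x \<in> ge \<mu>" "y \<in> ge \<mu>" using x_R y_R R_sub by (auto simp: \<mu>_def intro!: geI)
    then have "x \<otimes> a \<in> ge \<mu>" "y \<otimes> b \<in> ge \<mu>"
      using ge_mult[of x \<mu> a 0] ge_mult[of y \<mu> b 0] ab R_ge by auto
    then show ?thesis using ab ge_add by simp
  qed
  have "\<mu> \<in> \<nu> ` (m - {\<zero>})"
    using A.x_in_m A.y_in_m x_nz y_nz by (auto simp: \<mu>_def min_def)
  then have "ideal_value K \<nu> m = \<mu>"
    unfolding ideal_value_def by (rule Least_equality) (use mu in \<open>auto simp: ge_def\<close>)
  then show ?thesis using mu[OF assms] value_x by simp
qed

lemma v_y_ge: "\<nu> x \<le> \<nu> y"
  using v_x_min[OF A.y_in_m] y_nz by (simp add: ge_def)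

section \<open>Reading off the steps of the algorithm\<close>

lemma monomial_0 [simp]: "monomial K P 0 w = \<one>"
  by (simp add: monomial_def)

abbreviation "\<beta> i \<equiv> \<nu> (P i)"

lemma P_0 [simp]: "P 0 = x" and P_1 [simp]: "P (Suc 0) = y" and Omega_ge: "1 \<le> \<Omega>"
  using run by (auto simp: algorithm_run_def)

lemma nbar_def: "1 \<le> i \<Longrightarrow> enat i \<le> \<Omega> \<Longrightarrow>
    nbar i = subgroup_index (group_closure (insert (\<beta> i) (\<nu> ` P ` {..<i}))) (group_closure (\<nu> ` P ` {..<i}))"
proof -
  assume "1 \<le> i" "enat i \<le> \<Omega>"
  moreover have "{..i} = insert i {..<i}" by auto
  then have "\<nu> ` P ` {..i} = insert (\<beta> i) (\<nu> ` P ` {..<i})" by simp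
  ultimately show ?thesis using run unfolding algorithm_run_def by auto
qed

abbreviation "G i \<equiv> group_closure (\<nu> ` P ` {..<i})"

text \<open>As in \<open>G i\<close>, only indices below i enter. With this shift
  \<open>nbar i\<close> is the index of \<open>G i\<close> in \<open>G (Suc i)\<close>, and
  \<open>d i\<close> the degree of \<open>Kf (Suc i)\<close> over \<open>Kf i\<close> as long as
  \<open>nbar i\<close> is finite.\<close>

definition Kf :: "nat \<Rightarrow> 'a set set" where
  "Kf i = residue_adjoin K \<nu> R \<alpha> {1..<i}"

lemma nbar_fin: "1 \<le> i \<Longrightarrow> enat i \<le> \<Omega> \<Longrightarrow> nbar i = enat N \<Longrightarrow> 0 < N"
  "1 \<le> i \<Longrightarrow> enat i \<le> \<Omega> \<Longrightarrow> nbar i = enat N \<Longrightarrow> int_multiple e (\<beta> i) \<in> G i \<longleftrightarrow> int N dvd e"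
  using nbar_def subgroup_index_finite by metis+

lemma nbar_inf: "1 \<le> i \<Longrightarrow> enat i \<le> \<Omega> \<Longrightarrow> nbar i = \<infinity> \<Longrightarrow> int_multiple e (\<beta> i) \<in> G i \<Longrightarrow> e = 0"
  using nbar_def subgroup_index_infinite by metis

lemma step_inf:
  assumes "1 \<le> i" "enat i \<le> \<Omega>" "nbar i = \<infinity>"
  shows "\<Omega> = enat i" "\<alpha> i = \<one>\<^bsub>L\<^esub>" "d i = 1" "n i = \<infinity>"
  using run assms unfolding algorithm_run_def by auto

lemma step_fin:
  assumes "1 \<le> i" "enat i \<le> \<Omega>" "nbar i = enat N"
  obtains w U where "U = monomial K P i w" "\<And>j. 1 \<le> j \<Longrightarrow> j < i \<Longrightarrow> enat (w j) < n j"
    "\<nu> U = nat_multiple N (\<beta> i)" "\<alpha> i = res (P i [^] N \<otimes> inv U)"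
    "d i = \<infinity> \<Longrightarrow> \<Omega> = enat i" "d i = \<infinity> \<Longrightarrow> n i = \<infinity>"
    "\<And>D. d i = enat D \<Longrightarrow> enat i < \<Omega>" "\<And>D. d i = enat D \<Longrightarrow> n i = enat (N * D)"
    "\<And>D. d i = enat D \<Longrightarrow> next_element K \<nu> R CS P nbar d n \<alpha> i U"
proof -
  have "if nbar i = \<infinity> then \<Omega> = enat i \<and> \<alpha> i = \<one>\<^bsub>L\<^esub> \<and> d i = 1 \<and> n i = \<infinity>
    else (\<exists>U. admissible_monomial K \<nu> P nbar n i U \<and>
            \<alpha> i = res (P i [^] the_enat (nbar i) \<otimes> inv U) \<and>
            d i = extension_degree L (residue_adjoin K \<nu> R \<alpha> {1..i}) (residue_adjoin K \<nu> R \<alpha> {1..<i}) \<and>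
            (if d i = \<infinity> then \<Omega> = enat i \<and> n i = \<infinity>
             else enat i < \<Omega> \<and> n i = nbar i * d i \<and>
                  next_element K \<nu> R CS P nbar d n \<alpha> i U))"
    using run assms(1,2) unfolding algorithm_run_def by blast
  then have "\<exists>U. admissible_monomial K \<nu> P nbar n i U \<and>
            \<alpha> i = res (P i [^] N \<otimes> inv U) \<and>
            (if d i = \<infinity> then \<Omega> = enat i \<and> n i = \<infinity>
             else enat i < \<Omega> \<and> n i = nbar i * d i \<and>
                  next_element K \<nu> R CS P nbar d n \<alpha> i U)"
    unfolding assms(3) by (simp only: enat.distinct if_False the_enat.simps) blast
  then obtain U where U: "admissible_monomial K \<nu> P nbar n i U"
            "\<alpha> i = residue_class K \<nu> (P i [^] N \<otimes> inv U)"
            "if d i = \<infinity> then \<Omega> = enat i \<and> n i = \<infinity>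
             else enat i < \<Omega> \<and> n i = nbar i * d i \<and>
                  next_element K \<nu> R CS P nbar d n \<alpha> i U" by blast
  obtain w where w: "U = monomial K P i w" "\<forall>j\<in>{1..<i}. enat (w j) < n j"
    "\<nu> U = nat_multiple N (\<beta> i)" using U(1) assms(3) unfolding admissible_monomial_def by auto
  show thesis
    by (rule that[OF w(1) _ w(3) U(2)]) (use w(2) U(3) assms(3) in auto)
qed

lemma d_def: "1 \<le> i \<Longrightarrow> enat i \<le> \<Omega> \<Longrightarrow> nbar i = enat N \<Longrightarrow>
    d i = extension_degree L (Kf (Suc i)) (Kf i)"
proof -
  assume "1 \<le> i" "enat i \<le> \<Omega>" "nbar i = enat N"
  then have "d i = extension_degree L (residue_adjoin K \<nu> R \<alpha> {1..i}) (Kf i)"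
    using run unfolding algorithm_run_def Kf_def by auto
  moreover have "{1..i} = {1..<Suc i}" by auto
  ultimately show ?thesis by (simp add: Kf_def)
qed

end

lemma (in field) generate_field_insert:
  assumes "H \<subseteq> carrier R" "a \<in> carrier R"
  shows "generate_field R (insert a H) = generate_field R (generate_field R H \<union> {a})"
proof
  have H: "generate_field R H \<subseteq> carrier R" by (rule generate_field_incl[OF assms(1)])
  show "generate_field R (insert a H) \<subseteq> generate_field R (generate_field R H \<union> {a})"
    using H assms by (intro mono_generate_field) (auto intro: generate_field.incl)
  have "generate_field R H \<subseteq> generate_field R (insert a H)"
    using assms by (intro mono_generate_field) auto
  then show "generate_field R (generate_field R H \<union> {a}) \<subseteq> generate_field R (insert a H)"
    using assms H by (intro generate_field_min_subfield1 generate_field_is_subfield)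
      (auto intro: generate_field.incl)
qed

lemma digit_sum_less:
  fixes b :: "nat \<Rightarrow> 'g::linordered_ab_group_add" and N w :: "nat \<Rightarrow> nat"
  assumes "0 < b 1" "1 \<le> i"
    and "\<And>k. 1 \<le> k \<Longrightarrow> k < i \<Longrightarrow> nat_multiple (N k) (b k) < b (Suc k)"
    and "\<And>k. 1 \<le> k \<Longrightarrow> k < i \<Longrightarrow> w k < N k"
  shows "(\<Sum>k\<in>{1..<i}. nat_multiple (w k) (b k)) < b i \<and> 0 < b i"
  using assms(2-4)
proof (induction i rule: dec_induct)
  case base
  then show ?case using assms(1) by simp
next
  case (step i)
  have IH: "(\<Sum>k\<in>{1..<i}. nat_multiple (w k) (b k)) < b i" "0 < b i" using step by auto
  have "(\<Sum>k\<in>{1..<Suc i}. nat_multiple (w k) (b k)) = (\<Sum>k\<in>{1..<i}. nat_multiple (w k) (b k)) + nat_multiple (w i) (b i)"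
    using step.hyps by simp
  also have "\<dots> < b i + nat_multiple (w i) (b i)" using IH(1) by simp
  also have "\<dots> = nat_multiple (Suc (w i)) (b i)" by simp
  also have "\<dots> \<le> nat_multiple (N i) (b i)"
    using IH(2) step.prems(2)[of i] step.hyps by (intro nat_multiple_mono) (auto simp: Suc_le_eq)
  also have "\<dots> < b (Suc i)" using step.prems(1)[of i] step.hyps by simp
  finally have 1: "(\<Sum>k\<in>{1..<Suc i}. nat_multiple (w k) (b k)) < b (Suc i)" .
  have "0 \<le> nat_multiple (N i) (b i)" using IH(2) by (intro nat_multiple_nonneg) simp
  then have "0 < b (Suc i)" using step.prems(1)[of i] step.hyps by (meson le_less_trans lessI)
  then show ?case using 1 by simp
qed

section \<open>Invariants of the sequence\<close>

context generating_sequence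
begin

lemma XR_finsum: "(\<And>i. i \<in> S \<Longrightarrow> f i \<in> XR) \<Longrightarrow> (\<Oplus>i\<in>S. f i) \<in> XR"
proof (induction S rule: infinite_finite_induct)
  case (insert i S)
  then have "f \<in> S \<rightarrow> carrier K" "f i \<in> carrier K" using XR_R R_sub by auto
  then show ?case using insert by (simp add: XR_add)
qed (simp_all add: finsum_infinite)

lemma monomial_Suc:
  "(\<And>k. k \<le> i \<Longrightarrow> P k \<in> R) \<Longrightarrow> monomial K P (Suc i) w = monomial K P i w \<otimes> P i [^] w i"
  unfolding monomial_def lessThan_Suc using R_sub
  by (subst finprod_insert) (auto simp: m_comm)

lemma monomial_props:
  assumes "\<And>k. k < i \<Longrightarrow> P k \<in> R \<and> P k \<noteq> \<zero>"
  shows "monomial K P i w \<in> R \<and> monomial K P i w \<noteq> \<zero> \<and>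
    \<nu> (monomial K P i w) = (\<Sum>k<i. nat_multiple (w k) (\<beta> k))"
  using assms
proof (induction i)
  case (Suc i)
  have IH: "monomial K P i w \<in> R" "monomial K P i w \<noteq> \<zero>"
    "\<nu> (monomial K P i w) = (\<Sum>k<i. nat_multiple (w k) (\<beta> k))" using Suc by auto
  have Pi: "P i \<in> R" "P i \<noteq> \<zero>" using Suc.prems by auto
  have M: "monomial K P (Suc i) w = monomial K P i w \<otimes> P i [^] w i"
    using Suc.prems by (intro monomial_Suc) auto
  show ?case unfolding M using IH Pi by (simp add: R_mult R_pow R_sub integral_iff)
qed simp

lemma monomial_XR:
  assumes "\<And>k. k < i \<Longrightarrow> P k \<in> R \<and> P k \<noteq> \<zero>" "1 \<le> i" "0 < w 0"
  shows "monomial K P i w \<in> XR"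
  using assms(2,1)
proof (induction i rule: dec_induct)
  case base
  have "monomial K P 1 w = x [^] w 0"
    using monomial_Suc[of 0 w] x_R R_sub[OF x_R] by simp
  also have "\<dots> = x \<otimes> x [^] (w 0 - 1)"
    using assms(3) R_sub[OF x_R] by (cases "w 0") (auto simp: m_comm)
  finally show ?case using R_pow[OF x_R] by (auto simp: XR_def)
next
  case (step i)
  have M: "monomial K P (Suc i) w = monomial K P i w \<otimes> P i [^] w i"
    using step.prems by (intro monomial_Suc) auto
  show ?case unfolding M using step by (intro XR_mult R_pow) auto
qed

text \<open>Together with \<open>ascending_upto\<close> this is the induction hypothesis under which
  the next element of the sequence can be analysed.\<close>

definition nonzero_upto :: "nat \<Rightarrow> bool" where
  "nonzero_upto i \<longleftrightarrow> (\<forall>k\<le>i. P k \<in> R \<and> P k \<noteq> \<zero>)"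

definition ascending_upto :: "nat \<Rightarrow> bool" where
  "ascending_upto i \<longleftrightarrow> (\<forall>k. 1 \<le> k \<and> k < i \<longrightarrow>
      nat_multiple (the_enat (n k)) (\<beta> k) < \<beta> (Suc k) \<and> P (Suc k) \<ominus> P k [^] the_enat (n k) \<in> XR)"

lemma lt_OmegaE:
  assumes "1 \<le> i" "enat i < \<Omega>"
  obtains N D where "nbar i = enat N" "d i = enat D" "n i = enat (N * D)"
proof -
  have le: "enat i \<le> \<Omega>" using assms(2) by simp
  have "nbar i \<noteq> \<infinity>" using step_inf(1)[OF assms(1) le] assms(2) by auto
  then obtain N where N: "nbar i = enat N" by auto
  obtain U w where *: "d i = \<infinity> \<Longrightarrow> \<Omega> = enat i" "\<And>D. d i = enat D \<Longrightarrow> n i = enat (N * D)"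
    by (rule step_fin[OF assms(1) le N]) blast
  have "d i \<noteq> \<infinity>" using *(1) assms(2) by auto
  then obtain D where "d i = enat D" by auto
  then show ?thesis using that N *(2) by blast
qed

lemma alpha_closed':
  assumes "nonzero_upto i" "1 \<le> i" "enat i \<le> \<Omega>"
  shows "\<alpha> i \<in> carrier L"
proof (cases "nbar i")
  case infinity
  then show ?thesis using step_inf(2)[OF assms(2,3)] by simp
next
  case (enat N)
  obtain w U where U: "U = monomial K P i w" "\<nu> U = nat_multiple N (\<beta> i)" "\<alpha> i = res (P i [^] N \<otimes> inv U)"
    by (rule step_fin[OF assms(2,3) enat]) blast
  have "U \<in> R" "U \<noteq> \<zero>" using monomial_props[of i w] assms(1) U by (auto simp: nonzero_upto_def)
  moreover have "P i \<in> R" "P i \<noteq> \<zero>" using assms(1) by (auto simp: nonzero_upto_def)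
  ultimately have "P i [^] N \<otimes> inv U \<in> ge 0" using U(2) R_sub by (intro geI) auto
  then show ?thesis using U(3) by simp
qed

lemma residue_adjoin_subfield:
  assumes "\<And>k. k \<in> J \<Longrightarrow> \<alpha> k \<in> carrier L"
  shows "res ` R \<union> \<alpha> ` J \<subseteq> carrier L" "subfield (residue_adjoin K \<nu> R \<alpha> J) L"
proof -
  show *: "res ` R \<union> \<alpha> ` J \<subseteq> carrier L" using assms R_ge by auto
  show "subfield (residue_adjoin K \<nu> R \<alpha> J) L"
    unfolding residue_adjoin_def by (rule L.generate_field_is_subfield[OF *])
qed

lemma Kf_Suc:
  assumes "\<And>k. 1 \<le> k \<Longrightarrow> k \<le> i \<Longrightarrow> \<alpha> k \<in> carrier L" "1 \<le> i"
  shows "Kf (Suc i) = generate_field L (Kf i \<union> {\<alpha> i})"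
proof -
  have "{1..<Suc i} = insert i {1..<i}" using assms(2) by auto
  then have "res ` R \<union> \<alpha> ` {1..<Suc i} = insert (\<alpha> i) (res ` R \<union> \<alpha> ` {1..<i})" by auto
  then show ?thesis unfolding Kf_def residue_adjoin_def
    using assms residue_adjoin_subfield(1)[of "{1..<i}"] by (simp add: L.generate_field_insert)
qed

text \<open>All lower monomials contain x, so P(i+1) is the n_i-th power of P_i modulo x. Dividing
  by U^D turns P(i+1) into the lifted minimal polynomial at an element with residue \<alpha>_i; this
  residue is a root, so the value of P(i+1) jumps above n_i \<nu>(P_i).\<close>

lemma next_step:
  assumes nz: "nonzero_upto i" and asc: "ascending_upto i" and i: "1 \<le> i" "enat i < \<Omega>"
    and PX: "P i \<notin> XR"
  shows "P (Suc i) \<in> R \<and> P (Suc i) \<notin> XR \<and> nat_multiple (the_enat (n i)) (\<beta> i) < \<beta> (Suc i) \<and>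
    P (Suc i) \<ominus> P i [^] the_enat (n i) \<in> XR"
proof -
  have le: "enat i \<le> \<Omega>" using i(2) by simp
  obtain N D where ND: "nbar i = enat N" "d i = enat D" "n i = enat (N * D)" using lt_OmegaE[OF i] .
  obtain w U where U: "U = monomial K P i w" "\<nu> U = nat_multiple N (\<beta> i)"
    "\<alpha> i = res (P i [^] N \<otimes> inv U)" "next_element K \<nu> R CS P nbar d n \<alpha> i U"
    by (rule step_fin[OF i(1) le ND(1)]) (use ND(2) in blast)
  let ?f = "ring.Irr L (Kf i) (\<alpha> i)"
  obtain lam :: "nat \<Rightarrow> nat" and a j where
    aj': "\<forall>t<D. \<forall>s\<in>{1..lam t}. a s t \<in> CS \<and> (\<forall>k\<in>{1..<i}. enat (j s t k) < n k) \<and>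
          \<nu> (monomial K P i (j s t) \<otimes> P i [^] (t * N)) = nat_multiple (N * D) (\<beta> i)" and
    co': "\<forall>t<D. ring.coeff L ?f t =
          res ((\<Oplus>s\<in>{1..lam t}. a s t \<otimes> monomial K P i (j s t)) \<otimes> inv (U [^] (D - t)))" and
    PS: "P (Suc i) = P i [^] (N * D) \<oplus>
         (\<Oplus>t\<in>{..<D}. (\<Oplus>s\<in>{1..lam t}. a s t \<otimes> monomial K P i (j s t)) \<otimes> P i [^] (t * N))"
    using U(4) unfolding next_element_def Let_def ND the_enat.simps Kf_def by blast
  have aj: "a s t \<in> CS \<and> (\<forall>k\<in>{1..<i}. enat (j s t k) < n k) \<and>
          \<nu> (monomial K P i (j s t) \<otimes> P i [^] (t * N)) = nat_multiple (N * D) (\<beta> i)"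
    if "t < D" "s \<in> {1..lam t}" for t s using aj' that by blast
  have co: "ring.coeff L ?f t =
          res ((\<Oplus>s\<in>{1..lam t}. a s t \<otimes> monomial K P i (j s t)) \<otimes> inv (U [^] (D - t)))"
    if "t < D" for t using co' that by blast
  define S where "S t = (\<Oplus>s\<in>{1..lam t}. a s t \<otimes> monomial K P i (j s t))" for t
  have PR: "P i \<in> R" "P i \<noteq> \<zero>" "P i \<in> carrier K" using nz R_sub by (auto simp: nonzero_upto_def)
  have UR: "U \<in> R" "U \<noteq> \<zero>" "U \<in> carrier K"
    using monomial_props[of i w] nz U(1) R_sub by (auto simp: nonzero_upto_def)
  have nzi: "P k \<in> R \<and> P k \<noteq> \<zero>" if "k < i" for k using nz that by (auto simp: nonzero_upto_def)
  have M: "monomial K P i (j s t) \<in> XR" "\<nu> (monomial K P i (j s t)) = nat_multiple (D - t) (\<nu> U)"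
    if st: "t < D" "s \<in> {1..lam t}" for s t
  proof -
    let ?M = "monomial K P i (j s t)"
    have MR: "?M \<in> R" "?M \<noteq> \<zero>" "\<nu> ?M = (\<Sum>k<i. nat_multiple (j s t k) (\<beta> k))"
      using monomial_props[of i "j s t"] nzi by auto
    have "\<nu> ?M + nat_multiple (t * N) (\<beta> i) = nat_multiple (N * D) (\<beta> i)"
      using aj[OF st] MR PR R_sub by simp
    also have "N * D = (D - t) * N + t * N" using st(1) by (simp add: algebra_simps)
    finally show v: "\<nu> ?M = nat_multiple (D - t) (\<nu> U)"
      by (simp add: nat_multiple_add nat_multiple_mult U(2))
    show "?M \<in> XR"
    proof (rule monomial_XR[OF nzi i(1)], assumption, rule ccontr)
      \<comment> \<open>Without a factor x the value is a digit sum and stays below \<nu>(P_i), but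
        it has to be the (D - t) N-fold of \<nu>(P_i), and both D - t and N are positive.\<close>
      assume "\<not> 0 < j s t 0"
      then have "\<nu> ?M = (\<Sum>k\<in>{1..<i}. nat_multiple (j s t k) (\<beta> k))"
        unfolding MR(3) lessThan_atLeast0 using i(1) by (simp add: sum.atLeast_Suc_lessThan)
      also have "\<dots> < \<beta> i"
      proof -
        have "0 < \<beta> 1" using v_x_pos v_y_ge by simp
        moreover have "j s t k < the_enat (n k)" if k: "1 \<le> k" "k < i" for k
        proof -
          have "enat k < \<Omega>" using k i(2) by (meson enat_ord_simps(2) less_trans)
          then obtain N' where "n k = enat N'" using lt_OmegaE[OF k(1)] by metis
          moreover have "enat (j s t k) < n k" using aj[OF st] k by auto
          ultimately show ?thesis by simp
        qed
        ultimately show ?thesis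
          using digit_sum_less[of \<beta> i "\<lambda>k. the_enat (n k)" "j s t"] i(1) asc by (auto simp: ascending_upto_def)
      qed
      also have "\<beta> i \<le> nat_multiple ((D - t) * N) (\<beta> i)"
        using R_ge[OF PR(1)] PR(2) st(1) nbar_fin(1)[OF i(1) le ND(1)] by (intro le_nat_multiple) (auto simp: ge_def)
      finally show False using v U(2) by (simp add: nat_multiple_mult)
    qed
  qed
  have aR: "a s t \<in> R" if "t < D" "s \<in> {1..lam t}" for s t using aj[OF that] CS_sub by auto
  have SX: "S t \<in> XR" if "t < D" for t
    unfolding S_def using M(1) aR that by (intro XR_finsum XR_mult) auto
  have Sge: "S t \<in> ge (\<nu> (U [^] (D - t)))" if t: "t < D" for t
    unfolding S_def
  proof (rule ge_finsum)
    fix s assume s: "s \<in> {1..lam t}"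
    have "monomial K P i (j s t) \<in> ge (\<nu> (U [^] (D - t)))"
      using M[OF t s] XR_R R_sub UR by (intro geI) auto
    then show "a s t \<otimes> monomial K P i (j s t) \<in> ge (\<nu> (U [^] (D - t)))"
      using ge_mult[of "a s t" 0] R_ge[OF aR[OF t s]] by simp
  qed
  define T where "T = (\<Oplus>t\<in>{..<D}. S t \<otimes> P i [^] (t * N))"
  have TX: "T \<in> XR" unfolding T_def using SX PR by (intro XR_finsum XR_mult R_pow) auto
  have PS': "P (Suc i) = P i [^] (N * D) \<oplus> T" unfolding PS T_def S_def ..
  have pw: "P i [^] (N * D) \<in> R" using PR R_pow by blast
  have 1: "P (Suc i) \<in> R" unfolding PS' using pw TX XR_R R_add by blast
  have 2: "P (Suc i) \<notin> XR"
  proof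
    assume "P (Suc i) \<in> XR"
    then have "P i [^] (N * D) \<in> XR" using XR_cancel[OF pw TX] unfolding PS' by blast
    then show False using PX XR_pow[OF PR(1)] by blast
  qed
  have "P (Suc i) \<ominus> P i [^] (N * D) = T"
    unfolding PS' using R_sub[OF pw] R_sub[OF XR_R[OF TX]] by algebra
  then have 3: "P (Suc i) \<ominus> P i [^] the_enat (n i) \<in> XR" using TX ND by simp
  \<comment> \<open>e has residue \<alpha>_i, and the elements \<open>c t\<close> below have the
    coefficients of its minimal polynomial as residues; so \<open>P (Suc i)\<close> divided by U^D
    is that polynomial lifted to the valuation ring.\<close>
  define e where "e = P i [^] N \<otimes> inv U"
  have e: "e \<in> ge 0" unfolding e_def using PR UR U(2) by (intro geI) auto
  have ec: "e \<in> carrier K" using e ge_carrier by blast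
  define c where "c t = S t \<otimes> inv (U [^] (D - t))" for t
  have c0: "c t \<in> ge 0" if t: "t < D" for t
  proof -
    have "inv (U [^] (D - t)) \<in> ge (- \<nu> (U [^] (D - t)))" using UR by (intro geI) auto
    then show ?thesis unfolding c_def using ge_mult[OF Sge[OF t]] by fastforce
  qed
  have e_pow: "e [^] t = P i [^] (t * N) \<otimes> inv (U [^] t)" for t :: nat
    unfolding e_def using PR UR by (simp add: nat_pow_distrib nat_pow_pow inv_pow mult.commute)
  define Z where "Z = inv (U [^] D)"
  have Zc: "Z \<in> carrier K" unfolding Z_def using UR by simp
  have summand: "(S t \<otimes> P i [^] (t * N)) \<otimes> Z = c t \<otimes> e [^] t" if t: "t < D" for t
  proof -
    have "U [^] D = U [^] (D - t) \<otimes> U [^] t" using t UR by (simp add: nat_pow_mult)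
    then have "Z = inv (U [^] (D - t)) \<otimes> inv (U [^] t)" unfolding Z_def using UR by (simp add: inv_mult)
    moreover have "S t \<in> carrier K" using SX[OF t] XR_R R_sub by blast
    moreover have "inv (U [^] (D - t)) \<in> carrier K" "inv (U [^] t) \<in> carrier K" "P i [^] (t * N) \<in> carrier K"
      using UR PR by auto
    ultimately show ?thesis unfolding c_def e_pow by (simp add: m_ac)
  qed
  have lead: "P i [^] (N * D) \<otimes> Z = e [^] D" unfolding e_pow Z_def by (simp add: mult.commute)
  have ct: "c t \<otimes> e [^] t \<in> ge 0" if "t < D" for t using c0[OF that] res_pow[OF e] ge0_mult by blast
  have "T \<otimes> Z = (\<Oplus>t\<in>{..<D}. (S t \<otimes> P i [^] (t * N)) \<otimes> Z)"
    unfolding T_def using SX XR_R R_sub PR Zc by (intro finsum_ldistr) auto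
  also have "\<dots> = (\<Oplus>t\<in>{..<D}. c t \<otimes> e [^] t)"
    by (rule add.finprod_cong') (use summand ge_carrier[OF ct] in auto)
  finally have TZ: "T \<otimes> Z = (\<Oplus>t\<in>{..<D}. c t \<otimes> e [^] t)" .
  have PZ: "P (Suc i) \<otimes> Z = e [^] D \<oplus> (\<Oplus>t\<in>{..<D}. c t \<otimes> e [^] t)"
    unfolding PS' TZ[symmetric] lead[symmetric] using R_sub[OF pw] R_sub[OF XR_R[OF TX]] Zc by algebra
  have ak: "\<alpha> k \<in> carrier L" if "1 \<le> k" "k \<le> i" for k
  proof (rule alpha_closed')
    show "nonzero_upto k" using nz that by (auto simp: nonzero_upto_def)
    show "enat k \<le> \<Omega>" using that le by (meson enat_ord_simps(1) order_trans)
  qed (rule that)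
  have sub: "subfield (Kf i) L" unfolding Kf_def by (rule residue_adjoin_subfield(2)) (use ak in auto)
  have deg: "extension_degree L (Kf (Suc i)) (Kf i) = enat D" using d_def[OF i(1) le ND(1)] ND(2) by simp
  note fd = L.finite_degree[OF sub ak[OF i(1) order_refl] Kf_Suc[OF ak i(1)] deg]
  have sum0: "(\<Oplus>t\<in>{..<D}. c t \<otimes> e [^] t) \<in> ge 0" using ct by (intro ge_finsum) auto
  have sr: "res (\<Oplus>t\<in>{..<D}. c t \<otimes> e [^] t) = (\<Oplus>\<^bsub>L\<^esub>t\<in>{..<D}. res (c t \<otimes> e [^] t))"
    by (rule res_finsum) (use ct in auto)
  have "res (P (Suc i) \<otimes> Z) = res e [^]\<^bsub>L\<^esub> D \<oplus>\<^bsub>L\<^esub> (\<Oplus>\<^bsub>L\<^esub>t\<in>{..<D}. res (c t \<otimes> e [^] t))"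
    unfolding PZ sr[symmetric] using res_pow[OF e] sum0 by (simp add: res_add)
  also have "(\<Oplus>\<^bsub>L\<^esub>t\<in>{..<D}. res (c t \<otimes> e [^] t)) = (\<Oplus>\<^bsub>L\<^esub>t\<in>{..<D}. ring.coeff L ?f t \<otimes>\<^bsub>L\<^esub> \<alpha> i [^]\<^bsub>L\<^esub> t)"
  proof (rule L.add.finprod_cong')
    show "(\<lambda>t. ring.coeff L ?f t \<otimes>\<^bsub>L\<^esub> \<alpha> i [^]\<^bsub>L\<^esub> t) \<in> {..<D} \<rightarrow> carrier L"
      using fd(2) subfieldE(3)[OF sub] ak[OF i(1)] by auto
    show "res (c t \<otimes> e [^] t) = ring.coeff L ?f t \<otimes>\<^bsub>L\<^esub> \<alpha> i [^]\<^bsub>L\<^esub> t" if "t \<in> {..<D}" for t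
      using that co[of t] c0[of t] res_pow[OF e, of t] U(3) by (simp add: res_mult c_def S_def e_def)
  qed simp
  also have "res e = \<alpha> i" using U(3) by (simp add: e_def)
  finally have "res (P (Suc i) \<otimes> Z) = \<zero>\<^bsub>L\<^esub>" using fd(3) by simp
  moreover have "P (Suc i) \<otimes> Z \<in> ge 0" unfolding PZ using res_pow[OF e] sum0 by (intro ge_add) auto
  ultimately have "P (Suc i) \<otimes> Z \<in> gt 0" using res_zero_iff by blast
  moreover have "P (Suc i) \<noteq> \<zero>" using 2 by auto
  ultimately have "0 < \<beta> (Suc i) - \<nu> (U [^] D)"
    using 1 R_sub UR unfolding Z_def gt_def by (auto simp: integral_iff)
  then have "nat_multiple (the_enat (n i)) (\<beta> i) < \<beta> (Suc i)"
    using UR ND by (simp add: U(2) nat_multiple_mult[symmetric] mult.commute)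
  then show ?thesis using 1 2 3 by blast
qed

lemma sequence_props:
  "1 \<le> i \<Longrightarrow> enat i \<le> \<Omega> \<Longrightarrow> nonzero_upto i \<and> ascending_upto i \<and> P i \<notin> XR"
proof (induction i rule: dec_induct)
  case base
  have "nonzero_upto 1" unfolding nonzero_upto_def
    using x_R y_R x_nz y_nz by (auto simp: le_Suc_eq)
  then show ?case using y_notin_XR by (auto simp: ascending_upto_def)
next
  case (step i)
  have lt: "enat i < \<Omega>" using step.prems by (metis Suc_ile_eq)
  then have IH: "nonzero_upto i" "ascending_upto i" "P i \<notin> XR" using step by auto
  note ns = next_step[OF IH(1,2) step.hyps(1) lt IH(3)]
  moreover have "P (Suc i) \<noteq> \<zero>" using ns by auto
  ultimately show ?case using IH unfolding nonzero_upto_def ascending_upto_def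
    by (auto simp: le_Suc_eq less_Suc_eq)
qed

text \<open>The elements \<open>P 0\<close>, ..., \<open>P (i-1)\<close> exist. This admits i =
  \<Omega> + 1, which is needed for normal forms that involve the last element itself.\<close>

definition ok :: "nat \<Rightarrow> bool" where
  "ok i \<longleftrightarrow> (\<forall>k<i. enat k \<le> \<Omega>)"

lemma ok_le: "ok i \<Longrightarrow> j \<le> i \<Longrightarrow> ok j"
  by (auto simp: ok_def)

lemma ok_Suc: "ok (Suc i) \<longleftrightarrow> enat i \<le> \<Omega>"
proof
  assume "enat i \<le> \<Omega>"
  then show "ok (Suc i)" unfolding ok_def by (meson enat_ord_simps(1) less_Suc_eq_le order_trans)
qed (auto simp: ok_def)

lemma P_R: "enat i \<le> \<Omega> \<Longrightarrow> P i \<in> R" and P_nz: "enat i \<le> \<Omega> \<Longrightarrow> P i \<noteq> \<zero>"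
proof -
  assume i: "enat i \<le> \<Omega>"
  \<comment> \<open>The invariant starts at index 1; the maximum also covers
    \<open>P 0\<close>.\<close>
  have "nonzero_upto (max 1 i)"
    by (rule conjunct1[OF sequence_props]) (use i Omega_ge in \<open>auto simp: max_def one_enat_def\<close>)
  then show "P i \<in> R" "P i \<noteq> \<zero>" by (auto simp: nonzero_upto_def)
qed

lemma P_carrier: "enat i \<le> \<Omega> \<Longrightarrow> P i \<in> carrier K"
  using P_R R_sub by blast

lemma alpha_closed: "1 \<le> i \<Longrightarrow> enat i \<le> \<Omega> \<Longrightarrow> \<alpha> i \<in> carrier L"
  using alpha_closed' sequence_props by blast

lemma P_Suc:
  assumes "1 \<le> i" "enat i < \<Omega>"
  shows "nat_multiple (the_enat (n i)) (\<beta> i) < \<beta> (Suc i)" "P (Suc i) \<ominus> P i [^] the_enat (n i) \<in> XR"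
proof -
  have "ascending_upto (Suc i)" using sequence_props[of "Suc i"] assms by (simp add: Suc_ile_eq)
  then show "nat_multiple (the_enat (n i)) (\<beta> i) < \<beta> (Suc i)" "P (Suc i) \<ominus> P i [^] the_enat (n i) \<in> XR"
    using assms(1) by (auto simp: ascending_upto_def)
qed

lemma Kf_subfield: "ok i \<Longrightarrow> subfield (Kf i) L"
  unfolding Kf_def by (rule residue_adjoin_subfield(2)) (auto simp: ok_def intro: alpha_closed)

lemma Kf_in_carrier: "ok i \<Longrightarrow> a \<in> Kf i \<Longrightarrow> a \<in> carrier L"
  using subfieldE(3)[OF Kf_subfield] by blast

lemma res_R_Kf: "u \<in> R \<Longrightarrow> res u \<in> Kf i"
  unfolding Kf_def residue_adjoin_def by (rule generate_field.incl) simp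

lemma alpha_Kf: "1 \<le> i \<Longrightarrow> i < j \<Longrightarrow> \<alpha> i \<in> Kf j"
  unfolding Kf_def residue_adjoin_def by (rule generate_field.incl) simp

lemma Kf_mono: "ok j \<Longrightarrow> i \<le> j \<Longrightarrow> Kf i \<subseteq> Kf j"
  unfolding Kf_def residue_adjoin_def
  by (rule L.mono_generate_field) (auto simp: ok_def R_ge intro: alpha_closed)

lemma Kf_mult: "a \<in> Kf i \<Longrightarrow> b \<in> Kf i \<Longrightarrow> a \<otimes>\<^bsub>L\<^esub> b \<in> Kf i"
  and Kf_add: "a \<in> Kf i \<Longrightarrow> b \<in> Kf i \<Longrightarrow> a \<oplus>\<^bsub>L\<^esub> b \<in> Kf i"
  and Kf_inv: "a \<in> Kf i \<Longrightarrow> a \<noteq> \<zero>\<^bsub>L\<^esub> \<Longrightarrow> inv\<^bsub>L\<^esub> a \<in> Kf i"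
  and Kf_one: "\<one>\<^bsub>L\<^esub> \<in> Kf i"
  unfolding Kf_def residue_adjoin_def by (auto intro: generate_field.intros)

lemma Kf_zero: "\<zero>\<^bsub>L\<^esub> \<in> Kf i"
  unfolding Kf_def residue_adjoin_def by (rule L.zero_in_generate)

lemma Kf_pow: "a \<in> Kf i \<Longrightarrow> a [^]\<^bsub>L\<^esub> (e::nat) \<in> Kf i"
  by (induction e) (auto intro: Kf_one Kf_mult)

lemma Kf_finsum: "ok i \<Longrightarrow> (\<And>q. q \<in> S \<Longrightarrow> c q \<in> Kf i) \<Longrightarrow> (\<Oplus>\<^bsub>L\<^esub>q\<in>S. c q) \<in> Kf i"
proof (induction S rule: infinite_finite_induct)
  case (insert q S)
  then have "c \<in> S \<rightarrow> carrier L" "c q \<in> carrier L" using Kf_in_carrier by auto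
  then show ?case using insert by (simp add: Kf_add)
qed (simp_all add: L.finsum_infinite Kf_zero)

lemma Kf_Suc': "1 \<le> i \<Longrightarrow> enat i \<le> \<Omega> \<Longrightarrow> Kf (Suc i) = generate_field L (Kf i \<union> {\<alpha> i})"
proof (rule Kf_Suc)
  assume *: "1 \<le> i" "enat i \<le> \<Omega>"
  show "\<alpha> k \<in> carrier L" if "1 \<le> k" "k \<le> i" for k
    using that(2) order_trans[of "enat k" "enat i" \<Omega>] *(2) by (intro alpha_closed[OF that(1)]) simp
qed

lemma d_pos:
  assumes "1 \<le> i" "enat i \<le> \<Omega>" shows "1 \<le> d i"
proof (cases "nbar i")
  case infinity
  then show ?thesis using step_inf(3)[OF assms] by simp
next
  case (enat N)
  have oki: "ok i" using assms by (meson ok_Suc ok_le le_SucI order_refl)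
  show ?thesis
  proof (cases "d i")
    case (enat D)
    then have "0 < D"
      using L.finite_degree(1)[OF Kf_subfield[OF oki] alpha_closed[OF assms] Kf_Suc'[OF assms]]
        d_def[OF assms \<open>nbar i = enat N\<close>] by simp
    then show ?thesis using enat by (simp add: one_enat_def)
  qed simp
qed

lemma n_pos:
  assumes "1 \<le> i" "enat i \<le> \<Omega>" shows "1 \<le> n i"
proof (cases "enat i < \<Omega>")
  case True
  obtain N D where ND: "nbar i = enat N" "d i = enat D" "n i = enat (N * D)" using lt_OmegaE[OF assms(1) True] .
  have "0 < N" by (rule nbar_fin(1)[OF assms ND(1)])
  moreover have "0 < D" using d_pos[OF assms] ND(2) by (simp add: one_enat_def)
  ultimately show ?thesis using ND(3) by (simp add: one_enat_def)
next
  case False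
  have "n i = \<infinity>"
  proof (cases "nbar i")
    case infinity then show ?thesis using step_inf(4)[OF assms] by simp
  next
    case (enat N)
    obtain U w where "d i = \<infinity> \<Longrightarrow> n i = \<infinity>" "\<And>D. d i = enat D \<Longrightarrow> enat i < \<Omega>"
      by (rule step_fin[OF assms enat]) blast
    then show ?thesis using False by (cases "d i") auto
  qed
  then show ?thesis by simp
qed

text \<open>Either way of stopping sets n to infinity, and with nbar and d both finite the run would
  continue.\<close>

lemma n_Omega:
  assumes "\<Omega> = enat i" shows "n i = \<infinity>"
proof -
  have i: "1 \<le> i" "enat i \<le> \<Omega>" using Omega_ge assms by (auto simp: one_enat_def)
  show ?thesis
  proof (cases "nbar i")
    case infinity then show ?thesis using step_inf(4)[OF i] by simp
  next
    case (enat N)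
    obtain U w where "d i = \<infinity> \<Longrightarrow> n i = \<infinity>" "\<And>D. d i = enat D \<Longrightarrow> enat i < \<Omega>"
      by (rule step_fin[OF i enat]) blast
    then show ?thesis using assms by (cases "d i") auto
  qed
qed

text \<open>Strict growth starts at index 1: the values of x and y may coincide. It follows from n_i
  \<nu>(P_i) < \<nu>(P_(i+1)) with n_i \<ge> 1.\<close>

lemma beta_mono: "1 \<le> i \<Longrightarrow> i < j \<Longrightarrow> enat j \<le> \<Omega> \<Longrightarrow> \<beta> i < \<beta> j"
  and beta_ge: "enat i \<le> \<Omega> \<Longrightarrow> \<nu> x \<le> \<beta> i"
proof -
  have *: "\<nu> x \<le> \<beta> i \<and> (\<forall>k. 1 \<le> k \<and> k < i \<longrightarrow> \<beta> k < \<beta> i)" if "1 \<le> i" "enat i \<le> \<Omega>" for i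
    using that
  proof (induction i rule: dec_induct)
    case base then show ?case using v_y_ge by simp
  next
    case (step i)
    have lt: "enat i < \<Omega>" using step.prems by (simp add: Suc_ile_eq)
    then have IH: "\<nu> x \<le> \<beta> i" "\<forall>k. 1 \<le> k \<and> k < i \<longrightarrow> \<beta> k < \<beta> i" using step by auto
    obtain N D where ND: "n i = enat (N * D)" using lt_OmegaE[OF step.hyps(1) lt] by metis
    have "0 < N * D" using n_pos[OF step.hyps(1) less_imp_le[OF lt]] ND by (simp add: one_enat_def Suc_le_eq)
    then have "\<beta> i \<le> nat_multiple (N * D) (\<beta> i)"
      using IH(1) v_x_pos by (intro le_nat_multiple) auto
    also have "\<dots> < \<beta> (Suc i)" using P_Suc(1)[OF step.hyps(1) lt] ND by simp
    finally have "\<beta> i < \<beta> (Suc i)" .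
    then show ?case using IH by (auto simp: less_Suc_eq)
  qed
  show "\<nu> x \<le> \<beta> i" if "enat i \<le> \<Omega>" for i using *[of i] that by (cases i) auto
  show "\<beta> i < \<beta> j" if "1 \<le> i" "i < j" "enat j \<le> \<Omega>" for i j using *[of j] that by simp
qed

lemma beta_pos: "enat i \<le> \<Omega> \<Longrightarrow> 0 < \<beta> i"
  using beta_ge v_x_pos by (meson less_le_trans)

text \<open>Laurent monomials in \<open>P 0\<close>, ..., \<open>P (i-1)\<close>, a multiplicative
  group whose values fill \<open>G i\<close>. An exponent is kept as a difference of two natural
  numbers so that ordinary powers suffice.\<close>

primrec Mon :: "nat \<Rightarrow> 'a set" where
  "Mon 0 = {\<one>}"
| "Mon (Suc i) = {M \<otimes> P i [^] a \<otimes> inv (P i [^] b) | M a b. M \<in> Mon i \<and> a \<in> (UNIV :: nat set) \<and> b \<in> (UNIV :: nat set)}"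

declare Mon.simps(2) [simp del]

lemma Mon_SucI: "M \<in> Mon i \<Longrightarrow> M \<otimes> P i [^] (a::nat) \<otimes> inv (P i [^] (b::nat)) \<in> Mon (Suc i)"
  by (auto simp: Mon.simps(2))

lemma Mon_SucE:
  assumes "M \<in> Mon (Suc i)"
  obtains M' a b where "M' \<in> Mon i" "M = M' \<otimes> P i [^] (a::nat) \<otimes> inv (P i [^] (b::nat))"
  using assms by (auto simp: Mon.simps(2))

lemma Mon_nz: "ok i \<Longrightarrow> M \<in> Mon i \<Longrightarrow> M \<in> carrier K \<and> M \<noteq> \<zero>"
proof (induction i arbitrary: M)
  case (Suc i)
  have Pi: "P i \<in> carrier K" "P i \<noteq> \<zero>" using Suc.prems P_carrier P_nz ok_Suc by auto
  obtain M' a b where M': "M' \<in> Mon i" "M = M' \<otimes> P i [^] (a::nat) \<otimes> inv (P i [^] (b::nat))"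
    using Mon_SucE[OF Suc.prems(2)] .
  have "M' \<in> carrier K" "M' \<noteq> \<zero>" using Suc.IH[OF ok_le[OF Suc.prems(1)] M'(1)] by auto
  then show ?case using M'(2) Pi by (simp add: integral_iff)
qed simp

lemma Mon_one: "\<one> \<in> Mon i"
proof (induction i)
  case (Suc i)
  then show ?case using Mon_SucI[OF Suc, of 0 0] by simp
qed simp

lemma Mon_Suc_sub: "ok (Suc i) \<Longrightarrow> M \<in> Mon i \<Longrightarrow> M \<in> Mon (Suc i)"
  using Mon_SucI[of M i 0 0] Mon_nz[of i M] ok_le[of "Suc i" i] by simp

lemma Mon_mono: "ok j \<Longrightarrow> i \<le> j \<Longrightarrow> M \<in> Mon i \<Longrightarrow> M \<in> Mon j"
proof (induction j)
  case (Suc j)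
  show ?case
  proof (cases "i = Suc j")
    case False
    then show ?thesis using Suc Mon_Suc_sub ok_le[of "Suc j" j] by auto
  qed (use Suc in simp)
qed simp

lemma P_Mon: "ok i \<Longrightarrow> k < i \<Longrightarrow> P k \<in> Mon i"
proof -
  assume *: "ok i" "k < i"
  have "P k \<in> Mon (Suc k)"
    using Mon_SucI[OF Mon_one, of k 1 0] P_carrier[of k] * by (simp add: ok_def)
  then show ?thesis using Mon_mono[of i "Suc k"] * by auto
qed

lemma Mon_mult: "ok i \<Longrightarrow> M \<in> Mon i \<Longrightarrow> M' \<in> Mon i \<Longrightarrow> M \<otimes> M' \<in> Mon i"
proof (induction i arbitrary: M M')
  case (Suc i)
  have Pi: "P i \<in> carrier K" "P i \<noteq> \<zero>" using Suc.prems P_carrier P_nz ok_Suc by auto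
  have oki: "ok i" using ok_le[OF Suc.prems(1)] by simp
  obtain N a b where N: "N \<in> Mon i" "M = N \<otimes> P i [^] (a::nat) \<otimes> inv (P i [^] (b::nat))"
    using Mon_SucE[OF Suc.prems(2)] .
  obtain N' a' b' where N': "N' \<in> Mon i" "M' = N' \<otimes> P i [^] (a'::nat) \<otimes> inv (P i [^] (b'::nat))"
    using Mon_SucE[OF Suc.prems(3)] .
  have c: "N \<in> carrier K" "N' \<in> carrier K" using N N' Mon_nz oki by auto
  have c': "P i [^] a \<in> carrier K" "P i [^] a' \<in> carrier K" "inv (P i [^] b) \<in> carrier K" "inv (P i [^] b') \<in> carrier K"
    using Pi by auto
  have i: "inv (P i [^] (b + b')) = inv (P i [^] b) \<otimes> inv (P i [^] b')"
    using Pi by (simp add: nat_pow_mult[symmetric] inv_mult)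
  have "M \<otimes> M' = (N \<otimes> N') \<otimes> (P i [^] a \<otimes> P i [^] a') \<otimes> (inv (P i [^] b) \<otimes> inv (P i [^] b'))"
    unfolding N(2) N'(2) using c c' by algebra
  also have "\<dots> = (N \<otimes> N') \<otimes> P i [^] (a + a') \<otimes> inv (P i [^] (b + b'))"
    using Pi by (simp add: nat_pow_mult i)
  finally show ?case using Mon_SucI[OF Suc.IH[OF oki N(1) N'(1)]] by simp
qed simp

lemma Mon_inv: "ok i \<Longrightarrow> M \<in> Mon i \<Longrightarrow> inv M \<in> Mon i"
proof (induction i arbitrary: M)
  case (Suc i)
  have Pi: "P i \<in> carrier K" "P i \<noteq> \<zero>" using Suc.prems P_carrier P_nz ok_Suc by auto
  have oki: "ok i" using ok_le[OF Suc.prems(1)] by simp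
  obtain N a b where N: "N \<in> Mon i" "M = N \<otimes> P i [^] (a::nat) \<otimes> inv (P i [^] (b::nat))"
    using Mon_SucE[OF Suc.prems(2)] .
  have c: "N \<in> carrier K" "N \<noteq> \<zero>" using N Mon_nz oki by auto
  have ii: "inv (inv (P i [^] b)) = P i [^] b"
    using Pi by (intro comm_inv_char) auto
  have "inv M = inv N \<otimes> inv (P i [^] a) \<otimes> inv (inv (P i [^] b))"
    unfolding N(2) using c Pi by (simp add: inv_mult integral_iff)
  also have "\<dots> = inv N \<otimes> P i [^] b \<otimes> inv (P i [^] a)"
    unfolding ii using c Pi by (simp add: m_ac)
  finally show ?case using Mon_SucI[OF Suc.IH[OF oki N(1)]] by simp
qed simp

lemma Mon_pow: "ok i \<Longrightarrow> M \<in> Mon i \<Longrightarrow> M [^] (e::nat) \<in> Mon i"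
  by (induction e) (auto intro: Mon_one Mon_mult)

lemma monomial_Mon: "ok i \<Longrightarrow> monomial K P i w \<in> Mon i"
proof (induction i)
  case (Suc i)
  have "ok i" using ok_le[OF Suc.prems] by simp
  then have "monomial K P i w \<in> Mon (Suc i)" using Suc Mon_Suc_sub by blast
  moreover have "monomial K P (Suc i) w = monomial K P i w \<otimes> P i [^] w i"
    using Suc.prems by (intro monomial_Suc P_R) (auto simp: ok_def)
  ultimately show ?case using Suc.prems by (auto intro!: Mon_mult Mon_pow P_Mon)
qed simp

lemma G_Suc: "G (Suc i) = {h + int_multiple e (\<beta> i) | h e. h \<in> G i}"
proof -
  have "\<nu> ` P ` {..<Suc i} = insert (\<beta> i) (\<nu> ` P ` {..<i})" by (auto simp: lessThan_Suc)
  then show ?thesis by (simp only: group_closure_insert)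
qed

lemma Mon_v: "ok i \<Longrightarrow> M \<in> Mon i \<Longrightarrow> \<nu> M \<in> G i"
proof (induction i arbitrary: M)
  case (Suc i)
  have Pi: "P i \<in> carrier K" "P i \<noteq> \<zero>" using Suc.prems P_carrier P_nz ok_Suc by auto
  have oki: "ok i" using ok_le[OF Suc.prems(1)] by simp
  obtain N a b where N: "N \<in> Mon i" "M = N \<otimes> P i [^] (a::nat) \<otimes> inv (P i [^] (b::nat))"
    using Mon_SucE[OF Suc.prems(2)] .
  have c: "N \<in> carrier K" "N \<noteq> \<zero>" using N Mon_nz oki by auto
  have "\<nu> M = \<nu> N + int_multiple (int a - int b) (\<beta> i)"
    unfolding N(2) using c Pi by (simp add: integral_iff int_multiple_diff_nat)
  then show ?case unfolding G_Suc using Suc.IH[OF oki N(1)] by blast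
qed simp

lemma Mon_ex: "ok i \<Longrightarrow> \<gamma> \<in> G i \<Longrightarrow> \<exists>M\<in>Mon i. \<nu> M = \<gamma>"
proof (induction i arbitrary: \<gamma>)
  case (Suc i)
  have Pi: "P i \<in> carrier K" "P i \<noteq> \<zero>" using Suc.prems P_carrier P_nz ok_Suc by auto
  have oki: "ok i" using ok_le[OF Suc.prems(1)] by simp
  obtain h e where h: "h \<in> G i" "\<gamma> = h + int_multiple e (\<beta> i)" using Suc.prems(2) unfolding G_Suc by blast
  obtain N where N: "N \<in> Mon i" "\<nu> N = h" using Suc.IH[OF oki h(1)] by blast
  obtain a b where e: "e = int a - int b" by (rule int_cases_diff)
  have c: "N \<in> carrier K" "N \<noteq> \<zero>" using N Mon_nz oki by auto
  have "\<nu> (N \<otimes> P i [^] a \<otimes> inv (P i [^] b)) = \<gamma>"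
    unfolding h(2) e using c Pi N(2) by (simp add: integral_iff int_multiple_diff_nat)
  then show ?case using Mon_SucI[OF N(1)] by blast
qed simp

lemma beta_G: "k < i \<Longrightarrow> \<beta> k \<in> G i"
  by (rule group_closure.base) auto

text \<open>If P_i has net exponent e in a monomial of value zero, then e \<nu>(P_i) lies in
  \<open>G i\<close>, so nbar_i divides e. Trading each power with exponent nbar_i for U_i costs a
  factor with residue \<alpha>_i and removes P_i from the monomial.\<close>

lemma res_Mon: "ok i \<Longrightarrow> M \<in> Mon i \<Longrightarrow> \<nu> M = 0 \<Longrightarrow> res M \<in> Kf i"
proof (induction i arbitrary: M)
  case 0
  then show ?case by (simp add: Kf_one)
next
  case (Suc i)
  have Om: "enat i \<le> \<Omega>" using Suc.prems(1) ok_Suc by simp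
  have Pi: "P i \<in> carrier K" "P i \<noteq> \<zero>" using Om P_carrier P_nz by auto
  have oki: "ok i" using ok_le[OF Suc.prems(1)] by simp
  \<comment> \<open>Nonnegative net exponent of \<open>P i\<close>; a negative one is treated at the
    end by passing to the inverse monomial.\<close>
  have pos: "res M \<in> Kf (Suc i)"
    if M: "M = N \<otimes> P i [^] a \<otimes> inv (P i [^] b)" "N \<in> Mon i" "\<nu> M = 0" "b \<le> a" for M N and a b :: nat
  proof -
    have c: "N \<in> carrier K" "N \<noteq> \<zero>" using M Mon_nz oki by auto
    define e where "e = a - b"
    have a: "a = e + b" using M(4) by (simp add: e_def)
    have Me: "M = N \<otimes> P i [^] e"
      unfolding M(1) a using c Pi by (simp add: nat_pow_mult[symmetric] m_assoc)
    have v: "\<nu> N + nat_multiple e (\<beta> i) = 0" using M(3) c Pi by (simp add: Me)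
    show ?thesis
    proof (cases "e = 0")
      case True
      then have "M = N" using Me c by simp
      then have "res M \<in> Kf i" using Suc.IH[OF oki M(2)] M(3) by simp
      then show ?thesis using Kf_mono[OF Suc.prems(1), of i] by auto
    next
      case False
      have iG: "int_multiple (int e) (\<beta> i) \<in> G i"
      proof -
        have "nat_multiple e (\<beta> i) = - \<nu> N" using v by (simp add: eq_neg_iff_add_eq_0 add.commute)
        then show ?thesis using Mon_v[OF oki M(2)] by simp
      qed
      \<comment> \<open>For i = 0 the group \<open>G i\<close> is trivial, while e \<nu>(x) is
        positive.\<close>
      have i1: "1 \<le> i"
      proof (rule ccontr)
        assume "\<not> 1 \<le> i"
        then have "nat_multiple e (\<beta> i) = 0" using iG by (simp add: not_le)
        moreover have "0 < nat_multiple e (\<beta> i)" using False beta_pos[OF Om] by (intro nat_multiple_pos) auto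
        ultimately show False by simp
      qed
      then have "nbar i \<noteq> \<infinity>" using nbar_inf[OF i1 Om _ iG] False by auto
      then obtain N' where N': "nbar i = enat N'" by auto
      obtain w U where U: "U = monomial K P i w" "\<nu> U = nat_multiple N' (\<beta> i)" "\<alpha> i = res (P i [^] N' \<otimes> inv U)"
        by (rule step_fin[OF i1 Om N']) blast
      have UM: "U \<in> Mon i" using U(1) monomial_Mon[OF oki] by simp
      have Uc: "U \<in> carrier K" "U \<noteq> \<zero>" using Mon_nz[OF oki UM] by auto
      have "int N' dvd int e" using nbar_fin(2)[OF i1 Om N'] iG by blast
      then have "N' dvd e" by simp
      then obtain q where q: "e = N' * q" by (elim dvdE)
      \<comment> \<open>N1 is the part of M below index i: M = N1 p^q, where p has residue
        \<alpha>_i and N1 again has value zero.\<close>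
      define N1 where "N1 = N \<otimes> U [^] q"
      define p where "p = P i [^] N' \<otimes> inv U"
      have "p \<in> ge 0" unfolding p_def using Pi Uc U(2) by (intro geI) auto
      have N1M: "N1 \<in> Mon i" unfolding N1_def using oki M(2) UM by (intro Mon_mult Mon_pow)
      have v1: "\<nu> N1 = 0"
        unfolding N1_def using v c Uc by (simp add: U(2) nat_multiple_mult[symmetric] q mult.commute)
      have "p [^] q = P i [^] e \<otimes> inv (U [^] q)"
        unfolding p_def q using Pi Uc by (simp add: nat_pow_distrib nat_pow_pow inv_pow)
      moreover have "N \<otimes> U [^] q \<otimes> (P i [^] e \<otimes> inv (U [^] q)) = N \<otimes> P i [^] e \<otimes> (U [^] q \<otimes> inv (U [^] q))"
        using c Pi Uc by (simp add: m_ac)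
      ultimately have "M = N1 \<otimes> p [^] q"
        unfolding Me N1_def using c Pi Uc by simp
      moreover have "N1 \<in> ge 0" using Mon_nz[OF oki N1M] v1 by (intro geI) auto
      ultimately have "res M = res N1 \<otimes>\<^bsub>L\<^esub> \<alpha> i [^]\<^bsub>L\<^esub> q"
        using res_pow[OF \<open>p \<in> ge 0\<close>] U(3) by (simp add: res_mult p_def)
      moreover have "res N1 \<in> Kf (Suc i)"
        using Suc.IH[OF oki N1M v1] Kf_mono[OF Suc.prems(1), of i] by auto
      ultimately show ?thesis using alpha_Kf[OF i1, of "Suc i"] by (simp add: Kf_mult Kf_pow)
    qed
  qed
  obtain N a b where N: "N \<in> Mon i" "M = N \<otimes> P i [^] (a::nat) \<otimes> inv (P i [^] (b::nat))"
    using Mon_SucE[OF Suc.prems(2)] .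
  have c: "N \<in> carrier K" "N \<noteq> \<zero>" using N Mon_nz oki by auto
  have Mc: "M \<in> carrier K" "M \<noteq> \<zero>" using Mon_nz Suc.prems by auto
  show ?case
  proof (cases "b \<le> a")
    case True
    then show ?thesis using pos N Suc.prems(3) by blast
  next
    case False
    have ii: "inv (inv (P i [^] b)) = P i [^] b" using Pi by (intro comm_inv_char) auto
    have "inv M = inv N \<otimes> inv (P i [^] a) \<otimes> inv (inv (P i [^] b))"
      unfolding N(2) using c Pi by (simp add: inv_mult integral_iff)
    also have "\<dots> = inv N \<otimes> P i [^] b \<otimes> inv (P i [^] a)"
      unfolding ii using c Pi by (simp add: m_ac)
    finally have eq: "inv M = inv N \<otimes> P i [^] b \<otimes> inv (P i [^] a)" .
    have "\<nu> (inv M) = 0" using Suc.prems(3) Mc by simp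
    then have "res (inv M) \<in> Kf (Suc i)"
      using False by (intro pos[OF eq Mon_inv[OF oki N(1)]]) auto
    moreover have ri: "res (inv M) = inv\<^bsub>L\<^esub> res M" using res_inv Mc Suc.prems(3) by simp
    ultimately have 1: "inv\<^bsub>L\<^esub> res M \<in> Kf (Suc i)" by simp
    have "M \<in> ge 0" using Mc Suc.prems(3) by (simp add: geI)
    then have U: "res M \<in> Units L" using res_nonzero[OF Mc Suc.prems(3)] L.field_Units by simp
    have "inv\<^bsub>L\<^esub> res M \<noteq> \<zero>\<^bsub>L\<^esub>" using L.Units_inv_Units[OF U] L.field_Units by blast
    then have "inv\<^bsub>L\<^esub> (inv\<^bsub>L\<^esub> res M) \<in> Kf (Suc i)" by (rule Kf_inv[OF 1])
    then show ?thesis using L.Units_inv_inv[OF U] by simp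
  qed
qed

end

section \<open>Normal forms\<close>

context generating_sequence
begin

text \<open>The normal forms in \<open>P\<^sub>0, \<dots>, P\<^bsub>i-1\<^esub>\<close>: exponents of \<open>P\<^sub>k\<close> are below \<open>n\<^sub>k\<close> for \<open>k \<ge> 1\<close>.
  The innermost coefficients are \<open>0\<close> or a unit of \<open>R\<close> times a power of \<open>x\<close>, which stands for
  an arbitrary polynomial in \<open>x\<close> over a coefficient set.\<close>

fun NF :: "nat \<Rightarrow> 'a set" where
  "NF 0 = {\<zero>}"
| "NF (Suc 0) = {\<zero>} \<union> {u \<otimes> x [^] (a::nat) | u a. u \<in> R \<and> u \<noteq> \<zero> \<and> \<nu> u = 0}"
| "NF (Suc (Suc i)) = {\<Oplus>b\<in>{..<B}. s b \<otimes> P (Suc i) [^] b | s B. (\<forall>b<B. s b \<in> NF (Suc i)) \<and> enat B \<le> n (Suc i)}"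

text \<open>The initial form of f is that of a Laurent monomial times a coefficient in
  \<open>Kf i\<close>. Preserving this property from one level of normal forms to the next is what
  excludes cancellation.\<close>

definition rational :: "nat \<Rightarrow> 'a \<Rightarrow> bool" where
  "rational i f \<longleftrightarrow> (\<exists>M\<in>Mon i. \<nu> M = \<nu> f \<and> res (f \<otimes> inv M) \<in> Kf i)"

text \<open>Two Laurent monomials of the same value differ by one of value zero, whose residue lies
  in \<open>Kf i\<close> by \<open>res_Mon\<close>; so the choice of M is immaterial.\<close>

lemma rational_all:
  assumes i: "ok i" and f: "f \<in> carrier K" "f \<noteq> \<zero>" "rational i f" and M: "M \<in> Mon i" "\<nu> M = \<nu> f"
  shows "res (f \<otimes> inv M) \<in> Kf i"
proof -
  obtain M' where M': "M' \<in> Mon i" "\<nu> M' = \<nu> f" "res (f \<otimes> inv M') \<in> Kf i"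
    using f(3) unfolding rational_def by blast
  have c: "M \<in> carrier K" "M \<noteq> \<zero>" "M' \<in> carrier K" "M' \<noteq> \<zero>" using Mon_nz[OF i] M M' by auto
  have q: "M' \<otimes> inv M \<in> Mon i" "\<nu> (M' \<otimes> inv M) = 0"
    using Mon_mult[OF i M'(1) Mon_inv[OF i M(1)]] c M M' by auto
  have "f \<otimes> inv M = (f \<otimes> inv M') \<otimes> (M' \<otimes> inv M)"
  proof -
    have "(f \<otimes> inv M') \<otimes> (M' \<otimes> inv M) = f \<otimes> inv M \<otimes> (M' \<otimes> inv M')"
      using f(1) c(1,3) inv_closed'[OF c(1,2)] inv_closed'[OF c(3,4)] by algebra
    also have "\<dots> = f \<otimes> inv M" using f c by simp
    finally show ?thesis ..
  qed
  moreover have "f \<otimes> inv M' \<in> ge 0" using f c M' by (intro geI) auto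
  moreover have "M' \<otimes> inv M \<in> ge 0" using c q by (intro geI) auto
  ultimately have "res (f \<otimes> inv M) = res (f \<otimes> inv M') \<otimes>\<^bsub>L\<^esub> res (M' \<otimes> inv M)" by (simp add: res_mult)
  then show ?thesis using M'(3) res_Mon[OF i q] Kf_mult by simp
qed

lemma rational_G: "ok i \<Longrightarrow> rational i f \<Longrightarrow> \<nu> f \<in> G i"
  unfolding rational_def using Mon_v by metis

text \<open>At \<Omega> the algorithm sets n to infinity by decree. The product formula still holds
  there because nbar and d are positive.\<close>

lemma n_eq:
  assumes i: "1 \<le> i" "enat i \<le> \<Omega>" shows "n i = nbar i * d i"
proof (cases "nbar i")
  case infinity
  then show ?thesis using step_inf(3,4)[OF i infinity] by simp
next
  case (enat N)
  have "0 < N" by (rule nbar_fin(1)[OF i enat])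
  show ?thesis
  proof (cases "enat i < \<Omega>")
    case True
    then show ?thesis using lt_OmegaE[OF i(1)] by (metis times_enat_simps(1))
  next
    case False
    obtain U w where "\<And>D. d i = enat D \<Longrightarrow> enat i < \<Omega>" by (rule step_fin[OF i enat]) blast
    then have "d i = \<infinity>" using False by (cases "d i") auto
    moreover have "n i = \<infinity>" using n_Omega i(2) False by (simp add: order.order_iff_strict)
    ultimately show ?thesis using enat \<open>0 < N\<close> by (simp add: zero_enat_def)
  qed
qed

text \<open>The quotient is the ceiling of k / N, that is, the number of multiples of N, starting
  with 0, that are below k.\<close>

lemma less_ceiling_div:
  assumes "0 < N" shows "q < (k + N - 1) div N \<longleftrightarrow> q * N < (k::nat)"
proof -
  have "q < (k + N - 1) div N \<longleftrightarrow> Suc q * N \<le> k + N - 1"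
    unfolding less_eq_Suc_le using assms by (simp only: less_eq_div_iff_mult_less_eq)
  also have "\<dots> \<longleftrightarrow> q * N < k" using assms by auto
  finally show ?thesis .
qed

text \<open>Among the terms \<open>s\<^sub>b P\<^sub>i\<^sup>b\<close> of minimal value the exponents \<open>b\<close> agree modulo \<open>nbar\<^sub>i\<close>, so that up to
  a monomial factor the initial term is a polynomial in \<open>\<alpha>\<^sub>i\<close> of degree less than \<open>d\<^sub>i\<close> over
  \<open>k(\<alpha>\<^sub>1, \<dots>, \<alpha>\<^bsub>i-1\<^esub>)\<close>; it cannot vanish.\<close>

lemma leading_terms:
  assumes i: "1 \<le> i" "enat i \<le> \<Omega>"
    and s: "\<And>b. b < B \<Longrightarrow> s b \<in> carrier K \<and> (s b \<noteq> \<zero> \<longrightarrow> rational i (s b))"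
    and B: "enat B \<le> n i" and nz: "\<exists>b<B. s b \<noteq> \<zero>"
    and f: "f = (\<Oplus>b\<in>{..<B}. s b \<otimes> P i [^] b)"
  shows "f \<noteq> \<zero>" "rational (Suc i) f"
    "\<exists>b<B. s b \<noteq> \<zero> \<and> \<nu> f = \<nu> (s b) + nat_multiple b (\<beta> i)"
    "\<And>b. b < B \<Longrightarrow> s b \<noteq> \<zero> \<Longrightarrow> \<nu> f \<le> \<nu> (s b) + nat_multiple b (\<beta> i)"
proof -
  have oki: "ok i" and okS: "ok (Suc i)" using i(2) ok_Suc ok_le le_SucI by blast+
  have Pi: "P i \<in> carrier K" "P i \<noteq> \<zero>" using P_carrier P_nz i by auto
  define v where "v b = \<nu> (s b) + nat_multiple b (\<beta> i)" for b
  define T where "T = {b. b < B \<and> s b \<noteq> \<zero>}"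
  have T: "finite T" "T \<noteq> {}" using nz by (auto simp: T_def)
  define \<kappa> where "\<kappa> = Min (v ` T)"
  have lam_le: "\<kappa> \<le> v b" if "b \<in> T" for b using T that by (simp add: \<kappa>_def)
  define T0 where "T0 = {b \<in> T. v b = \<kappa>}"
  have "\<kappa> \<in> v ` T" unfolding \<kappa>_def using T by (intro Min_in) auto
  then have T0: "finite T0" "T0 \<noteq> {}" using T by (auto simp: T0_def)
  \<comment> \<open>The least exponent serves as origin: the others in T0 become b0 + N q with q
    natural, and the polynomial in \<alpha>_i acquires a nonzero constant term.\<close>
  define b0 where "b0 = Min T0"
  have b0: "b0 \<in> T0" "\<And>b. b \<in> T0 \<Longrightarrow> b0 \<le> b" using T0 by (auto simp: b0_def)
  have b0': "b0 < B" "s b0 \<noteq> \<zero>" "v b0 = \<kappa>" "s b0 \<in> carrier K" using b0(1) s by (auto simp: T0_def T_def)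
  have "\<nu> (s b0) \<in> G i" using rational_G[OF oki] s b0' by blast
  then obtain H where H: "H \<in> Mon i" "\<nu> H = \<nu> (s b0)" using Mon_ex[OF oki] by blast
  have Hc: "H \<in> carrier K" "H \<noteq> \<zero>" using Mon_nz[OF oki H(1)] by auto
  \<comment> \<open>A monomial of the minimal value. Dividing by it moves f into the valuation ring,
    where only the terms of T0 have nonzero residue.\<close>
  define W where "W = H \<otimes> P i [^] b0"
  have WM: "W \<in> Mon (Suc i)" unfolding W_def
    by (intro Mon_mult[OF okS] Mon_pow[OF okS] P_Mon[OF okS] Mon_Suc_sub[OF okS] H(1)) simp
  have W: "W \<in> carrier K" "W \<noteq> \<zero>" "\<nu> W = \<kappa>"
    using Hc Pi H(2) b0'(3) unfolding W_def v_def by (auto simp: integral_iff)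
  define \<tau> where "\<tau> b = s b \<otimes> P i [^] b \<otimes> inv W" for b
  have tc: "\<tau> b \<in> carrier K" if "b < B" for b unfolding \<tau>_def using s[OF that] Pi W by simp
  have tv: "\<tau> b \<noteq> \<zero>" "\<nu> (\<tau> b) = v b - \<kappa>" if "b \<in> T" for b
    using that s Pi W unfolding \<tau>_def T_def v_def by (auto simp: integral_iff)
  have t_ge: "\<tau> b \<in> ge 0" if "b < B" for b
  proof (cases "b \<in> T")
    case True
    then show ?thesis using tv lam_le tc that by (intro geI) auto
  next
    case False
    then have "s b = \<zero>" using that by (simp add: T_def)
    then show ?thesis using Pi W by (simp add: \<tau>_def)
  qed
  have t_zero: "res (\<tau> b) = \<zero>\<^bsub>L\<^esub>" if b: "b < B" "b \<notin> T0" for b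
  proof (cases "b \<in> T")
    case True
    then have "\<kappa> < v b" using lam_le[of b] b by (auto simp: T0_def order.order_iff_strict)
    then have "\<tau> b \<in> gt 0" using tv[OF True] tc[OF b(1)] by (intro gtI) auto
    then show ?thesis using res_zero_iff[OF t_ge[OF b(1)]] by blast
  next
    case False
    then have "s b = \<zero>" using b by (simp add: T_def)
    then show ?thesis using Pi W by (simp add: \<tau>_def)
  qed
  have diff: "int_multiple (int b - int b0) (\<beta> i) \<in> G i" if "b \<in> T0" for b
  proof -
    have "v b = v b0" using that b0' by (simp add: T0_def)
    then have "nat_multiple b (\<beta> i) - nat_multiple b0 (\<beta> i) = \<nu> (s b0) - \<nu> (s b)"
      by (simp add: v_def algebra_simps)
    moreover have "\<nu> (s b) \<in> G i" using that s rational_G[OF oki] by (auto simp: T0_def T_def)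
    ultimately show ?thesis
      using \<open>\<nu> (s b0) \<in> G i\<close> by (simp add: int_multiple_diff_nat group_closure_diff)
  qed
  have fW: "f \<otimes> inv W = (\<Oplus>b\<in>{..<B}. \<tau> b)"
    unfolding f \<tau>_def using s Pi W by (intro finsum_ldistr) auto
  have fW_ge: "f \<otimes> inv W \<in> ge 0" unfolding fW using t_ge by (intro ge_finsum) auto
  have rfW: "res (f \<otimes> inv W) = (\<Oplus>\<^bsub>L\<^esub>b\<in>{..<B}. res (\<tau> b))"
    unfolding fW using t_ge by (intro res_finsum) auto
  have r0: "res (s b0 \<otimes> inv H) \<in> Kf i"
    using rational_all[OF oki b0'(4,2) _ H] s[OF b0'(1)] b0'(2) by blast
  have r0z: "res (s b0 \<otimes> inv H) \<noteq> \<zero>\<^bsub>L\<^esub>"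
    using b0' H(2) Hc by (intro res_nonzero) (auto simp: integral_iff)
  have main: "res (f \<otimes> inv W) \<noteq> \<zero>\<^bsub>L\<^esub> \<and> res (f \<otimes> inv W) \<in> Kf (Suc i)"
  proof (cases "nbar i")
    case infinity
    \<comment> \<open>With infinite index no nonzero multiple of \<nu>(P_i) lies in
      \<open>G i\<close>, so a single term has minimal value.\<close>
    have T0b: "T0 = {b0}"
    proof -
      have "b = b0" if "b \<in> T0" for b
        using nbar_inf[OF i infinity diff[OF that]] by simp
      then show ?thesis using b0(1) by blast
    qed
    have "(\<Oplus>\<^bsub>L\<^esub>b\<in>{..<B}. res (\<tau> b)) = (\<Oplus>\<^bsub>L\<^esub>b\<in>{b0}. res (\<tau> b))"
    proof (intro L.add.finprod_mono_neutral_cong_right)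
      show "res (\<tau> b) = \<zero>\<^bsub>L\<^esub>" if "b \<in> {..<B} - {b0}" for b
        by (rule t_zero) (use that T0b in blast)+
      show "(\<lambda>b. res (\<tau> b)) \<in> {..<B} \<rightarrow> carrier L" using t_ge by (auto intro: res_closed)
    qed (use b0'(1) in simp_all)
    also have "\<dots> = res (\<tau> b0)" using t_ge[OF b0'(1)] by simp
    also have "\<tau> b0 = s b0 \<otimes> inv H"
    proof -
      have "\<tau> b0 = s b0 \<otimes> inv H \<otimes> (P i [^] b0 \<otimes> inv (P i [^] b0))"
        unfolding \<tau>_def W_def using b0'(4) Hc Pi by (simp add: inv_mult m_ac)
      then show ?thesis using b0'(4) Hc Pi by simp
    qed
    finally show ?thesis unfolding rfW using r0 r0z Kf_mono[OF okS, of i] by auto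
  next
    case (enat N)
    have N: "0 < N" by (rule nbar_fin(1)[OF i enat])
    obtain w U where U: "U = monomial K P i w" "\<nu> U = nat_multiple N (\<beta> i)" "\<alpha> i = res (P i [^] N \<otimes> inv U)"
      by (rule step_fin[OF i enat]) blast
    have UM: "U \<in> Mon i" using U(1) monomial_Mon[OF oki] by simp
    have Uc: "U \<in> carrier K" "U \<noteq> \<zero>" using Mon_nz[OF oki UM] by auto
    define p where "p = P i [^] N \<otimes> inv U"
    have p_ge: "p \<in> ge 0" unfolding p_def using Pi Uc U(2) by (intro geI) auto
    \<comment> \<open>The number of exponents b0 + N q below B, which bounds the degree of the
      polynomial in \<alpha>_i.\<close>
    define Q where "Q = (B - b0 + N - 1) div N"
    have Q: "q < Q \<longleftrightarrow> b0 + N * q < B" for q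
      unfolding Q_def less_ceiling_div[OF N] using b0'(1) by (auto simp: mult.commute)
    \<comment> \<open>B is at most n_i = N D, so exponents that agree modulo N occur at most D
      times.\<close>
    have Qd: "enat Q \<le> d i"
    proof (cases "d i")
      case (enat D)
      have "Q \<le> D"
      proof (rule ccontr)
        assume "\<not> Q \<le> D"
        then have "b0 + N * D < B" using Q[of D] by (metis not_le)
        then show False using B n_eq[OF i] \<open>nbar i = enat N\<close> enat by simp
      qed
      then show ?thesis using enat by simp
    qed simp
    \<comment> \<open>Trading the power of P_i with exponent N q for U^q keeps the value, so
      \<open>M q\<close> has the value of the coefficient at b0 + N q and involves earlier elements
      only.\<close>
    define M where "M q = H \<otimes> inv (U [^] q)" for q :: nat
    have MM: "M q \<in> Mon i" for q unfolding M_def using oki H(1) UM by (intro Mon_mult Mon_inv Mon_pow)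
    have Mc: "M q \<in> carrier K" "M q \<noteq> \<zero>" for q using Mon_nz[OF oki MM] by auto
    define c where "c q = (if b0 + N * q \<in> T0 then res (s (b0 + N * q) \<otimes> inv (M q)) else \<zero>\<^bsub>L\<^esub>)" for q
    have Mv: "\<nu> (M q) = \<nu> (s (b0 + N * q))" if "b0 + N * q \<in> T0" for q
    proof -
      have "v (b0 + N * q) = v b0" using that b0' by (simp add: T0_def)
      then show ?thesis unfolding M_def v_def using Hc Uc H(2)
        by (simp add: U(2) nat_multiple_add nat_multiple_mult[symmetric] mult.commute algebra_simps)
    qed
    have cK: "c q \<in> Kf i" for q
    proof (cases "b0 + N * q \<in> T0")
      case True
      then have "res (s (b0 + N * q) \<otimes> inv (M q)) \<in> Kf i"
        using s[of "b0 + N * q"] rational_all[OF oki _ _ _ MM Mv[OF True]] by (auto simp: T0_def T_def)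
      then show ?thesis using True by (simp add: c_def)
    qed (simp add: c_def Kf_zero)
    have tau: "res (\<tau> (b0 + N * q)) = c q \<otimes>\<^bsub>L\<^esub> \<alpha> i [^]\<^bsub>L\<^esub> q" if q: "q < Q" for q
    proof (cases "b0 + N * q \<in> T0")
      case True
      let ?b = "b0 + N * q"
      have sc: "s ?b \<in> carrier K" "s ?b \<noteq> \<zero>" using True s by (auto simp: T0_def T_def)
      have iM: "inv (M q) = inv H \<otimes> U [^] q"
      proof -
        have "inv (inv (U [^] q)) = U [^] q" using Uc by (intro comm_inv_char) auto
        then show ?thesis unfolding M_def using Hc Uc by (simp add: inv_mult)
      qed
      have pq: "p [^] q = P i [^] (N * q) \<otimes> inv (U [^] q)"
        unfolding p_def using Pi Uc by (simp add: nat_pow_distrib nat_pow_pow inv_pow)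
      have e: "P i [^] ?b = P i [^] b0 \<otimes> P i [^] (N * q)" "inv W = inv H \<otimes> inv (P i [^] b0)"
        unfolding W_def using Hc Pi by (simp_all add: inv_mult nat_pow_mult)
      have cc: "inv H \<in> carrier K" "P i [^] b0 \<in> carrier K" "inv (P i [^] b0) \<in> carrier K"
        "P i [^] (N * q) \<in> carrier K" "U [^] q \<in> carrier K" "inv (U [^] q) \<in> carrier K"
        using Hc Pi Uc by auto
      have "\<tau> ?b = s ?b \<otimes> inv H \<otimes> P i [^] (N * q) \<otimes> (P i [^] b0 \<otimes> inv (P i [^] b0))"
        unfolding \<tau>_def e using sc(1) cc by algebra
      also have "\<dots> = s ?b \<otimes> inv H \<otimes> P i [^] (N * q) \<otimes> (U [^] q \<otimes> inv (U [^] q))"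
        using sc Hc Pi Uc by simp
      also have "\<dots> = (s ?b \<otimes> inv (M q)) \<otimes> p [^] q"
        unfolding iM pq using sc(1) cc by algebra
      finally have "\<tau> ?b = (s ?b \<otimes> inv (M q)) \<otimes> p [^] q" .
      moreover have "s ?b \<otimes> inv (M q) \<in> ge 0" using sc Mc Mv[OF True] by (intro geI) auto
      ultimately show ?thesis using True res_pow[OF p_ge] U(3) by (simp add: res_mult c_def p_def)
    next
      case False
      then have "res (\<tau> (b0 + N * q)) = \<zero>\<^bsub>L\<^esub>" using t_zero q Q by blast
      then show ?thesis using False alpha_closed[OF i] by (simp add: c_def)
    qed
    have inj: "inj_on (\<lambda>q. b0 + N * q) {..<Q}" using N by (auto simp: inj_on_def)
    have out: "res (\<tau> b) = \<zero>\<^bsub>L\<^esub>" if b: "b < B" "b \<notin> (\<lambda>q. b0 + N * q) ` {..<Q}" for b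
    proof (rule t_zero[OF b(1)])
      show "b \<notin> T0"
      proof
        assume bT: "b \<in> T0"
        then have "int N dvd int b - int b0" using nbar_fin(2)[OF i enat] diff by blast
        then have "N dvd b - b0" using b0(2)[OF bT] by (simp flip: of_nat_diff)
        then obtain q where "b - b0 = N * q" by (elim dvdE)
        then have "b = b0 + N * q" using b0(2)[OF bT] by simp
        then show False using b Q by auto
      qed
    qed
    have sub: "(\<lambda>q. b0 + N * q) ` {..<Q} \<subseteq> {..<B}" using Q by auto
    have "(\<Oplus>\<^bsub>L\<^esub>b\<in>{..<B}. res (\<tau> b)) = (\<Oplus>\<^bsub>L\<^esub>b\<in>(\<lambda>q. b0 + N * q) ` {..<Q}. res (\<tau> b))"
    proof (intro L.add.finprod_mono_neutral_cong_right)
      show "res (\<tau> b) = \<zero>\<^bsub>L\<^esub>" if "b \<in> {..<B} - (\<lambda>q. b0 + N * q) ` {..<Q}" for b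
        using that by (intro out) auto
      show "(\<lambda>b. res (\<tau> b)) \<in> {..<B} \<rightarrow> carrier L" using t_ge by (auto intro: res_closed)
    qed (use sub in simp_all)
    also have "\<dots> = (\<Oplus>\<^bsub>L\<^esub>q\<in>{..<Q}. res (\<tau> (b0 + N * q)))"
    proof (rule L.add.finprod_reindex[OF _ inj])
      show "(\<lambda>b. res (\<tau> b)) \<in> (\<lambda>q. b0 + N * q) ` {..<Q} \<rightarrow> carrier L"
        using sub t_ge by (auto intro: res_closed)
    qed
    also have "\<dots> = (\<Oplus>\<^bsub>L\<^esub>q\<in>{..<Q}. c q \<otimes>\<^bsub>L\<^esub> \<alpha> i [^]\<^bsub>L\<^esub> q)"
      by (rule L.add.finprod_cong') (use tau Kf_in_carrier[OF oki cK] alpha_closed[OF i] in auto)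
    finally have sum: "res (f \<otimes> inv W) = (\<Oplus>\<^bsub>L\<^esub>q\<in>{..<Q}. c q \<otimes>\<^bsub>L\<^esub> \<alpha> i [^]\<^bsub>L\<^esub> q)" unfolding rfW .
    have "res (f \<otimes> inv W) \<noteq> \<zero>\<^bsub>L\<^esub>"
    proof
      assume "res (f \<otimes> inv W) = \<zero>\<^bsub>L\<^esub>"
      then have s0: "(\<Oplus>\<^bsub>L\<^esub>q\<in>{..<Q}. c q \<otimes>\<^bsub>L\<^esub> \<alpha> i [^]\<^bsub>L\<^esub> q) = \<zero>\<^bsub>L\<^esub>" using sum by simp
      have "enat Q \<le> extension_degree L (Kf (Suc i)) (Kf i)" using Qd d_def[OF i enat] by simp
      \<comment> \<open>The constant term is the residue of \<open>s b0\<close> divided by H, which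
        has value zero and hence nonzero residue.\<close>
      then have "c 0 = \<zero>\<^bsub>L\<^esub>"
        by (rule L.degree_independence[OF Kf_subfield[OF oki] alpha_closed[OF i] Kf_Suc'[OF i] _ cK s0])
          (use Q[of 0] b0' in simp)
      moreover have "c 0 = res (s b0 \<otimes> inv H)" using b0(1) Hc by (simp add: c_def M_def)
      ultimately show False using r0z by simp
    qed
    moreover have "res (f \<otimes> inv W) \<in> Kf (Suc i)"
      unfolding sum using cK Kf_mono[OF okS, of i] alpha_Kf[OF i(1), of "Suc i"]
      by (intro Kf_finsum[OF okS] Kf_mult Kf_pow) auto
    ultimately show ?thesis by blast
  qed
  have fc: "f \<in> carrier K" unfolding f using s Pi by (intro finsum_closed) auto
  have "f \<otimes> inv W \<notin> gt 0" using main res_zero_iff[OF fW_ge] by blast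
  then have fWv: "f \<otimes> inv W \<noteq> \<zero>" "\<nu> (f \<otimes> inv W) = 0"
    using fW_ge exact_iff[of "f \<otimes> inv W" 0] fc W by auto
  then show f0: "f \<noteq> \<zero>" using W by auto
  have vf: "\<nu> f = \<kappa>" using fWv(2) fc f0 W by simp
  show "rational (Suc i) f" unfolding rational_def using WM W(3) vf main by auto
  show "\<exists>b<B. s b \<noteq> \<zero> \<and> \<nu> f = \<nu> (s b) + nat_multiple b (\<beta> i)"
    using b0' vf unfolding v_def by auto
  show "\<nu> f \<le> \<nu> (s b) + nat_multiple b (\<beta> i)" if "b < B" "s b \<noteq> \<zero>" for b
    using lam_le[of b] that vf unfolding v_def by (simp add: T_def)
qed

lemma NF_SucE:
  assumes "f \<in> NF (Suc i)" "1 \<le> i"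
  obtains s B where "f = (\<Oplus>b\<in>{..<B}. s b \<otimes> P i [^] b)" "\<And>b. b < B \<Longrightarrow> s b \<in> NF i" "enat B \<le> n i"
  using assms by (cases i) auto

lemma NF_SucI:
  assumes "1 \<le> i" "\<And>b. b < B \<Longrightarrow> s b \<in> NF i" "enat B \<le> n i"
  shows "(\<Oplus>b\<in>{..<B}. s b \<otimes> P i [^] b) \<in> NF (Suc i)"
  using assms by (cases i) auto

lemma NF_R: "ok i \<Longrightarrow> s \<in> NF i \<Longrightarrow> s \<in> R"
proof (induction i arbitrary: s rule: NF.induct)
  case (3 i)
  have oki: "ok (Suc i)" by (rule ok_le[OF 3(2)]) simp
  have PR: "P (Suc i) \<in> R" using 3(2) unfolding ok_Suc by (rule P_R)
  obtain t B where t: "s = (\<Oplus>b\<in>{..<B}. t b \<otimes> P (Suc i) [^] b)" "\<And>b. b < B \<Longrightarrow> t b \<in> NF (Suc i)"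
    "enat B \<le> n (Suc i)" by (rule NF_SucE[OF 3(3)]) auto
  show ?case unfolding t(1) using 3(1)[OF lessI oki t(2)] PR by (intro R_finsum R_mult R_pow) auto
qed (use x_R R_mult R_pow in auto)

text \<open>The innermost coefficient divided by its power of x is a unit of R, with residue in the
  ground field; each further level is \<open>leading_terms\<close>.\<close>

lemma NF_rational: "ok i \<Longrightarrow> s \<in> NF i \<Longrightarrow> s \<noteq> \<zero> \<Longrightarrow> rational i s"
proof (induction i arbitrary: s rule: NF.induct)
  case 2
  obtain u a where u: "s = u \<otimes> x [^] (a::nat)" "u \<in> R" "u \<noteq> \<zero>" "\<nu> u = 0" using 2 by auto
  have M: "x [^] a \<in> Mon (Suc 0)" using Mon_pow[OF 2(1) P_Mon[OF 2(1), of 0]] by simp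
  have xc: "x \<in> carrier K" "u \<in> carrier K" using x_R u R_sub by auto
  have "s \<otimes> inv (x [^] a) = u" unfolding u(1) using xc x_nz by (simp add: m_assoc)
  then have "res (s \<otimes> inv (x [^] a)) \<in> Kf (Suc 0)" using res_R_Kf[OF u(2)] by simp
  moreover have "\<nu> (x [^] a) = \<nu> s" unfolding u(1) using xc x_nz u by simp
  ultimately show ?case unfolding rational_def using M by blast
next
  case (3 i)
  have oki: "ok (Suc i)" by (rule ok_le[OF 3(2)]) simp
  have le: "enat (Suc i) \<le> \<Omega>" using 3(2) unfolding ok_Suc .
  obtain t B where t: "s = (\<Oplus>b\<in>{..<B}. t b \<otimes> P (Suc i) [^] b)" "\<And>b. b < B \<Longrightarrow> t b \<in> NF (Suc i)"
    "enat B \<le> n (Suc i)"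
    by (rule NF_SucE[OF 3(3)]) auto
  have "\<exists>b<B. t b \<noteq> \<zero>"
  proof (rule ccontr)
    assume "\<not> ?thesis"
    then have "s = (\<Oplus>b\<in>{..<B}. \<zero>)"
      unfolding t(1) using P_carrier[OF le] by (intro add.finprod_cong') auto
    then show False using 3(4) by simp
  qed
  then show ?case
    using leading_terms(2)[OF _ le _ t(3) _ t(1)] 3(1)[OF lessI oki t(2)] NF_R[OF oki t(2)] R_sub by auto
qed simp

lemma NF_sum_props:
  assumes i: "1 \<le> i" "enat i \<le> \<Omega>" and s: "\<And>b. b < B \<Longrightarrow> s b \<in> NF i" and B: "enat B \<le> n i"
    and f: "f = (\<Oplus>b\<in>{..<B}. s b \<otimes> P i [^] b)" and nz: "f \<noteq> \<zero>"
  shows "\<exists>b<B. s b \<noteq> \<zero> \<and> \<nu> f = \<nu> (s b) + nat_multiple b (\<beta> i)"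
proof -
  have oki: "ok i" using i ok_Suc ok_le le_SucI by blast
  have "\<exists>b<B. s b \<noteq> \<zero>"
  proof (rule ccontr)
    assume "\<not> ?thesis"
    then have "f = (\<Oplus>b\<in>{..<B}. \<zero>)"
      unfolding f using P_carrier[OF i(2)] by (intro add.finprod_cong') auto
    then show False using nz by simp
  qed
  then show ?thesis
    using leading_terms(3)[OF i _ B _ f] NF_rational[OF oki s] NF_R[OF oki s] R_sub by auto
qed

lemma NF_sum_le:
  assumes i: "1 \<le> i" "enat i \<le> \<Omega>" and s: "\<And>b. b < B \<Longrightarrow> s b \<in> NF i" and B: "enat B \<le> n i"
    and f: "f = (\<Oplus>b\<in>{..<B}. s b \<otimes> P i [^] b)" and b: "b < B" "s b \<noteq> \<zero>"
  shows "f \<noteq> \<zero>" "\<nu> f \<le> \<nu> (s b) + nat_multiple b (\<beta> i)"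
proof -
  have oki: "ok i" using i ok_Suc ok_le le_SucI by blast
  have s': "\<And>b. b < B \<Longrightarrow> s b \<in> carrier K \<and> (s b \<noteq> \<zero> \<longrightarrow> rational i (s b))"
    using NF_rational[OF oki s] NF_R[OF oki s] R_sub by auto
  have ex: "\<exists>b<B. s b \<noteq> \<zero>" using b by blast
  show "f \<noteq> \<zero>" using leading_terms(1)[OF i s' B ex f] .
  show "\<nu> f \<le> \<nu> (s b) + nat_multiple b (\<beta> i)" using leading_terms(4)[OF i s' B ex f b] .
qed

text \<open>Normal forms whose innermost coefficients carry no power of x. They are the digits of an
  expansion in powers of x.\<close>

fun NFx :: "nat \<Rightarrow> 'a set" where
  "NFx 0 = {\<zero>}"
| "NFx (Suc 0) = {u \<in> R. u = \<zero> \<or> \<nu> u = 0}"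
| "NFx (Suc (Suc i)) = {\<Oplus>b\<in>{..<B}. s b \<otimes> P (Suc i) [^] b | s B. (\<forall>b<B. s b \<in> NFx (Suc i)) \<and> enat B \<le> n (Suc i)}"

lemma NFx_SucE:
  assumes "f \<in> NFx (Suc i)" "1 \<le> i"
  obtains s B where "f = (\<Oplus>b\<in>{..<B}. s b \<otimes> P i [^] b)" "\<And>b. b < B \<Longrightarrow> s b \<in> NFx i" "enat B \<le> n i"
  using assms by (cases i) auto

lemma NFx_SucI:
  assumes "1 \<le> i" "\<And>b. b < B \<Longrightarrow> s b \<in> NFx i" "enat B \<le> n i"
  shows "(\<Oplus>b\<in>{..<B}. s b \<otimes> P i [^] b) \<in> NFx (Suc i)"
  using assms by (cases i) auto

lemma zero_NF: "\<zero> \<in> NF i" and zero_NFx: "\<zero> \<in> NFx i"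
proof -
  show "\<zero> \<in> NF i" by (cases i rule: NF.cases) (auto intro!: exI[of _ 0] simp: enat_0)
  show "\<zero> \<in> NFx i" by (cases i rule: NF.cases) (auto intro!: exI[of _ 0] simp: enat_0)
qed

lemma NFx_R: "ok i \<Longrightarrow> s \<in> NFx i \<Longrightarrow> s \<in> R"
proof (induction i arbitrary: s rule: NFx.induct)
  case (3 i)
  have oki: "ok (Suc i)" by (rule ok_le[OF 3(2)]) simp
  have PR: "P (Suc i) \<in> R" using 3(2) unfolding ok_Suc by (rule P_R)
  obtain t B where t: "s = (\<Oplus>b\<in>{..<B}. t b \<otimes> P (Suc i) [^] b)" "\<And>b. b < B \<Longrightarrow> t b \<in> NFx (Suc i)"
    "enat B \<le> n (Suc i)" by (rule NFx_SucE[OF 3(3)]) auto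
  show ?case unfolding t(1) using 3(1)[OF lessI oki t(2)] PR by (intro R_finsum R_mult R_pow) auto
qed auto

section \<open>Expansions of elements of R into normal forms\<close>

lemma power_sum_pad:
  fixes B B' :: nat
  assumes "P i \<in> carrier K" "\<And>b. b < B \<Longrightarrow> s b \<in> carrier K" "B \<le> B'"
  shows "(\<Oplus>b\<in>{..<B}. s b \<otimes> P i [^] b) = (\<Oplus>b\<in>{..<B'}. (if b < B then s b else \<zero>) \<otimes> P i [^] b)"
proof -
  have "(\<Oplus>b\<in>{..<B'}. (if b < B then s b else \<zero>) \<otimes> P i [^] b) = (\<Oplus>b\<in>{..<B}. s b \<otimes> P i [^] b)"
    by (rule add.finprod_mono_neutral_cong_right) (use assms in auto)
  then show ?thesis ..
qed

text \<open>Sums of normal forms are not normal forms in general. This one is, because at the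
  innermost level a unit plus a multiple of x is a unit, and without the unit only the exponent of x
  goes up by one.\<close>

lemma NFx_add_NF: "1 \<le> i \<Longrightarrow> ok i \<Longrightarrow> t \<in> NFx i \<Longrightarrow> s \<in> NF i \<Longrightarrow> t \<oplus> x \<otimes> s \<in> NF i"
proof (induction i arbitrary: s t rule: dec_induct)
  case base
  have t: "t \<in> R" "t = \<zero> \<or> \<nu> t = 0" using base by auto
  have tc: "t \<in> carrier K" using t R_sub by blast
  have xc: "x \<in> carrier K" using x_R R_sub by blast
  have sR: "s \<in> R" using NF_R[OF base(1)] base(3) by simp
  have sc: "s \<in> carrier K" using sR R_sub by blast
  show ?case
  proof (cases "t = \<zero>")
    case True
    show ?thesis
    proof (cases "s = \<zero>")
      case False
      then obtain u a where u: "s = u \<otimes> x [^] (a::nat)" "u \<in> R" "u \<noteq> \<zero>" "\<nu> u = 0" using base by auto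
      have "t \<oplus> x \<otimes> s = u \<otimes> x [^] Suc a"
        unfolding True u(1) using xc u R_sub by (simp add: m_ac)
      then show ?thesis unfolding One_nat_def NF.simps using u(2-4) by blast
    qed (use True xc in simp)
  next
    case False
    have "x \<otimes> s \<in> gt (\<nu> t)"
      using gt_mult[OF gtI[OF xc v_x_pos] R_ge[OF sR]] t False by simp
    then have "t \<oplus> x \<otimes> s \<noteq> \<zero>" "\<nu> (t \<oplus> x \<otimes> s) = \<nu> t" using exact_add[OF tc False] by auto
    moreover have "t \<oplus> x \<otimes> s \<in> R" using t sR x_R by (simp add: R_add R_mult)
    ultimately have "\<exists>u. u \<in> R \<and> u \<noteq> \<zero> \<and> \<nu> u = 0 \<and> t \<oplus> x \<otimes> s = u \<otimes> x [^] (0::nat)"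
      using t False tc sc xc by (intro exI[of _ "t \<oplus> x \<otimes> s"]) auto
    then show ?thesis unfolding One_nat_def NF.simps by blast
  qed
next
  case (step i)
  have oki: "ok i" by (rule ok_le[OF step.prems(1)]) simp
  have PR: "P i \<in> R" using step.prems(1) unfolding ok_Suc by (rule P_R)
  have Pc: "P i \<in> carrier K" and xc: "x \<in> carrier K" using PR x_R R_sub by auto
  obtain t' B where t: "t = (\<Oplus>b\<in>{..<B}. t' b \<otimes> P i [^] b)" "\<And>b. b < B \<Longrightarrow> t' b \<in> NFx i" "enat B \<le> n i"
    using NFx_SucE[OF step.prems(2) step.hyps(1)] by blast
  obtain s' C where s: "s = (\<Oplus>b\<in>{..<C}. s' b \<otimes> P i [^] b)" "\<And>b. b < C \<Longrightarrow> s' b \<in> NF i" "enat C \<le> n i"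
    using NF_SucE[OF step.prems(3) step.hyps(1)] by blast
  define E where "E = max B C"
  define t2 where "t2 b = (if b < B then t' b else \<zero>)" for b
  define s2 where "s2 b = (if b < C then s' b else \<zero>)" for b
  have t2: "t2 b \<in> NFx i" and s2: "s2 b \<in> NF i" for b
    using t s zero_NF zero_NFx by (auto simp: t2_def s2_def)
  have t2c: "t2 b \<in> carrier K" and s2c: "s2 b \<in> carrier K" for b
    using NFx_R[OF oki t2] NF_R[OF oki s2] R_sub by auto
  have t3: "t = (\<Oplus>b\<in>{..<E}. t2 b \<otimes> P i [^] b)"
    unfolding t(1) t2_def E_def using Pc t(2) NFx_R[OF oki] R_sub by (intro power_sum_pad) auto
  have s3: "s = (\<Oplus>b\<in>{..<E}. s2 b \<otimes> P i [^] b)"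
    unfolding s(1) s2_def E_def using Pc s(2) NF_R[OF oki] R_sub by (intro power_sum_pad) auto
  have "x \<otimes> s = (\<Oplus>b\<in>{..<E}. x \<otimes> (s2 b \<otimes> P i [^] b))"
    unfolding s3 using Pc xc s2c by (intro finsum_rdistr) auto
  then have "t \<oplus> x \<otimes> s = (\<Oplus>b\<in>{..<E}. t2 b \<otimes> P i [^] b \<oplus> x \<otimes> (s2 b \<otimes> P i [^] b))"
    unfolding t3 using Pc xc s2c t2c by (simp add: finsum_addf)
  also have "\<dots> = (\<Oplus>b\<in>{..<E}. (t2 b \<oplus> x \<otimes> s2 b) \<otimes> P i [^] b)"
    using Pc xc s2c t2c by (intro add.finprod_cong') (auto simp: l_distr m_assoc)
  finally have eq: "t \<oplus> x \<otimes> s = (\<Oplus>b\<in>{..<E}. (t2 b \<oplus> x \<otimes> s2 b) \<otimes> P i [^] b)" .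
  have "enat E \<le> n i" using t(3) s(3) by (simp add: E_def max_def)
  then show ?case unfolding eq using step.IH[OF oki t2 s2] by (intro NF_SucI[OF step.hyps(1)])
qed

text \<open>An expansion in base p: the quotient of each division is divided again, and the
  multiples of z that arise are merely collected.\<close>

lemma iterated_division:
  fixes B :: nat
  assumes z: "z \<in> R" and p: "p \<in> R" and S: "S \<subseteq> R"
    and div: "\<And>f. f \<in> R \<Longrightarrow> \<exists>s\<in>S. \<exists>g\<in>R. \<exists>h\<in>R. f = s \<oplus> z \<otimes> g \<oplus> p \<otimes> h"
    and f: "f \<in> R"
  shows "\<exists>s. (\<forall>b<B. s b \<in> S) \<and> (\<exists>g\<in>R. \<exists>h\<in>R. f = (\<Oplus>b\<in>{..<B}. s b \<otimes> p [^] b) \<oplus> z \<otimes> g \<oplus> p [^] B \<otimes> h)"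
proof (induction B)
  case 0
  have "f = (\<Oplus>b\<in>{..<0::nat}. (\<lambda>_. \<zero>) b \<otimes> p [^] b) \<oplus> z \<otimes> \<zero> \<oplus> p [^] (0::nat) \<otimes> f"
    using f z R_sub by simp
  then show ?case using f R_zero by (intro exI[of _ "\<lambda>_. \<zero>"] conjI bexI[of _ \<zero>] bexI[of _ f]) auto
next
  case (Suc B)
  obtain s g h where s: "\<forall>b<B. s b \<in> S" "g \<in> R" "h \<in> R"
    "f = (\<Oplus>b\<in>{..<B}. s b \<otimes> p [^] b) \<oplus> z \<otimes> g \<oplus> p [^] B \<otimes> h" using Suc.IH by blast
  obtain s' g' h' where s': "s' \<in> S" "g' \<in> R" "h' \<in> R" "h = s' \<oplus> z \<otimes> g' \<oplus> p \<otimes> h'" using div[OF s(3)] by blast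
  define t where "t = s(B := s')"
  have tS: "\<forall>b<Suc B. t b \<in> S" using s s' by (auto simp: t_def less_Suc_eq)
  have sc: "s b \<in> carrier K" if "b < B" for b using s(1) S R_sub that by blast
  have pc: "p [^] b \<in> carrier K" "p \<in> carrier K" "z \<in> carrier K" for b :: nat using p z R_sub by auto
  have s'c: "s' \<in> carrier K" "g' \<in> carrier K" "h' \<in> carrier K" "g \<in> carrier K" using s' s S R_sub by auto
  have "(\<Oplus>b\<in>{..<B}. t b \<otimes> p [^] b) = (\<Oplus>b\<in>{..<B}. s b \<otimes> p [^] b)"
    using sc pc by (intro add.finprod_cong') (auto simp: t_def)
  moreover have "(\<Oplus>b\<in>{..<Suc B}. t b \<otimes> p [^] b) = t B \<otimes> p [^] B \<oplus> (\<Oplus>b\<in>{..<B}. t b \<otimes> p [^] b)"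
    using sc s'c pc by (intro finsum_lessThan_Suc) (auto simp: t_def)
  ultimately have sum: "(\<Oplus>b\<in>{..<Suc B}. t b \<otimes> p [^] b) = s' \<otimes> p [^] B \<oplus> (\<Oplus>b\<in>{..<B}. s b \<otimes> p [^] b)"
    by (simp add: t_def)
  define w where "w = (\<Oplus>b\<in>{..<B}. s b \<otimes> p [^] b)"
  have wc: "w \<in> carrier K" unfolding w_def using sc pc by (intro finsum_closed) auto
  have "f = w \<oplus> z \<otimes> g \<oplus> p [^] B \<otimes> (s' \<oplus> z \<otimes> g' \<oplus> p \<otimes> h')" using s(4) s'(4) by (simp add: w_def)
  also have "\<dots> = (s' \<otimes> p [^] B \<oplus> w) \<oplus> z \<otimes> (g \<oplus> p [^] B \<otimes> g') \<oplus> (p [^] B \<otimes> p) \<otimes> h'"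
    using wc s'c pc by algebra
  finally have "f = (\<Oplus>b\<in>{..<Suc B}. t b \<otimes> p [^] b) \<oplus> z \<otimes> (g \<oplus> p [^] B \<otimes> g') \<oplus> p [^] Suc B \<otimes> h'"
    unfolding sum w_def by simp
  moreover have "g \<oplus> p [^] B \<otimes> g' \<in> R" using s s' p by (simp add: R_add R_mult R_pow)
  ultimately show ?case using tS s'(3) by blast
qed

text \<open>For i = 1 an element of R is a unit or lies in m. For the step, n_i divisions by P_i
  leave a multiple of the n_i-th power of P_i, which agrees with P_(i+1) modulo x.\<close>

lemma expand_mod_x:
  "1 \<le> i \<Longrightarrow> enat i \<le> \<Omega> \<Longrightarrow> f \<in> R \<Longrightarrow> \<exists>t\<in>NFx i. \<exists>g\<in>R. \<exists>h\<in>R. f = t \<oplus> x \<otimes> g \<oplus> P i \<otimes> h"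
proof (induction i arbitrary: f rule: dec_induct)
  case base
  have c: "x \<in> carrier K" "y \<in> carrier K" "f \<in> carrier K" using x_R y_R base R_sub by auto
  show ?case
  proof (cases "f \<in> m")
    case True
    then obtain a b where ab: "a \<in> R" "b \<in> R" "f = x \<otimes> a \<oplus> y \<otimes> b" by (rule m_E)
    then have "f = \<zero> \<oplus> x \<otimes> a \<oplus> P 1 \<otimes> b" using c R_sub by simp
    then show ?thesis using ab zero_NFx by blast
  next
    case False
    then have "f \<notin> gt 0" using m_iff base by blast
    then have "\<nu> f = 0" using exact_iff[of f 0] R_ge[OF base(2)] c by auto
    then have "f \<in> NFx 1" using base by simp
    moreover have "f = f \<oplus> x \<otimes> \<zero> \<oplus> P 1 \<otimes> \<zero>" using c by simp
    ultimately show ?thesis using R_zero by blast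
  qed
next
  case (step i)
  have lt: "enat i < \<Omega>" using step.prems by (simp add: Suc_ile_eq)
  have PR: "P i \<in> R" "P (Suc i) \<in> R" using P_R lt step.prems by auto
  have oki: "ok i" using ok_Suc[of i] lt ok_le[of "Suc i" i] by simp
  obtain N D where ND: "n i = enat (N * D)" using lt_OmegaE[OF step.hyps(1) lt] by metis
  let ?B = "N * D"
  obtain s g h where s: "\<forall>b<?B. s b \<in> NFx i" "g \<in> R" "h \<in> R"
    "f = (\<Oplus>b\<in>{..<?B}. s b \<otimes> P i [^] b) \<oplus> x \<otimes> g \<oplus> P i [^] ?B \<otimes> h"
    using iterated_division[OF x_R PR(1) _ _ step.prems(2), where S = "NFx i" and B = ?B] step.IH lt NFx_R[OF oki]
    by (auto simp: subset_iff)
  define t where "t = (\<Oplus>b\<in>{..<?B}. s b \<otimes> P i [^] b)"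
  have tN: "t \<in> NFx (Suc i)" unfolding t_def using s(1) ND by (intro NFx_SucI[OF step.hyps(1)]) auto
  then have tc: "t \<in> carrier K" using NFx_R[of "Suc i"] ok_Suc lt R_sub by auto
  obtain r where r: "r \<in> R" "P (Suc i) \<ominus> P i [^] ?B = x \<otimes> r"
    using P_Suc(2)[OF step.hyps(1) lt] ND by (auto simp: XR_def)
  have c: "x \<in> carrier K" "g \<in> carrier K" "h \<in> carrier K" "r \<in> carrier K" "P i [^] ?B \<in> carrier K" "P (Suc i) \<in> carrier K"
    using x_R s r PR R_sub by auto
  have "f = t \<oplus> x \<otimes> g \<oplus> P i [^] ?B \<otimes> h" using s(4) by (simp add: t_def)
  also have "\<dots> = t \<oplus> x \<otimes> g \<oplus> P (Suc i) \<otimes> h \<ominus> (P (Suc i) \<ominus> P i [^] ?B) \<otimes> h"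
    using c tc by algebra
  also have "\<dots> = t \<oplus> x \<otimes> (g \<ominus> r \<otimes> h) \<oplus> P (Suc i) \<otimes> h"
    unfolding r(2) using c tc by algebra
  finally show ?case using tN s(3) R_diff[OF s(2) R_mult[OF r(1) s(3)]] by blast
qed

text \<open>The cofactor of x is expanded again, and \<open>NFx_add_NF\<close> joins the digit t in
  front of the part already expanded.\<close>

lemma expand_x:
  assumes i: "1 \<le> i" "enat i \<le> \<Omega>" and f: "f \<in> R"
  shows "\<exists>s\<in>NF i. \<exists>g\<in>R. \<exists>h\<in>R. f = s \<oplus> x [^] (e::nat) \<otimes> g \<oplus> P i \<otimes> h"
  using f
proof (induction e arbitrary: f)
  case 0
  have "f = \<zero> \<oplus> x [^] (0::nat) \<otimes> f \<oplus> P i \<otimes> \<zero>" using 0 P_carrier[OF i(2)] R_sub by simp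
  then show ?case using 0 zero_NF R_zero by blast
next
  case (Suc e)
  have oki: "ok i" using ok_Suc[of i] i ok_le[of "Suc i" i] by simp
  obtain t g h where t: "t \<in> NFx i" "g \<in> R" "h \<in> R" "f = t \<oplus> x \<otimes> g \<oplus> P i \<otimes> h"
    using expand_mod_x[OF i Suc.prems] by blast
  obtain s g' h' where s: "s \<in> NF i" "g' \<in> R" "h' \<in> R" "g = s \<oplus> x [^] e \<otimes> g' \<oplus> P i \<otimes> h'"
    using Suc.IH[OF t(2)] by blast
  have c: "t \<in> carrier K" "s \<in> carrier K" "h \<in> carrier K" "h' \<in> carrier K" "g' \<in> carrier K" "x \<in> carrier K"
    "x [^] e \<in> carrier K" "P i \<in> carrier K"
    using t s NF_R[OF oki] NFx_R[OF oki] x_R R_sub P_carrier[OF i(2)] by auto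
  have "f = t \<oplus> x \<otimes> (s \<oplus> x [^] e \<otimes> g' \<oplus> P i \<otimes> h') \<oplus> P i \<otimes> h" using t(4) s(4) by simp
  also have "\<dots> = (t \<oplus> x \<otimes> s) \<oplus> (x [^] e \<otimes> x) \<otimes> g' \<oplus> P i \<otimes> (h \<oplus> x \<otimes> h')" using c by algebra
  finally have "f = (t \<oplus> x \<otimes> s) \<oplus> x [^] Suc e \<otimes> g' \<oplus> P i \<otimes> (h \<oplus> x \<otimes> h')" by simp
  moreover have "h \<oplus> x \<otimes> h' \<in> R" using t s x_R by (simp add: R_add R_mult)
  ultimately show ?case using NFx_add_NF[OF i(1) oki t(1) s(1)] s(2) by blast
qed

lemma expand:
  assumes i: "1 \<le> i" "enat i \<le> \<Omega>" and f: "f \<in> R"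
  obtains s g h where "\<And>b. b < B \<Longrightarrow> s b \<in> NF i" "g \<in> R" "h \<in> R"
    "f = (\<Oplus>b\<in>{..<B}. s b \<otimes> P i [^] b) \<oplus> x [^] (e::nat) \<otimes> g \<oplus> P i [^] (B::nat) \<otimes> h"
proof -
  have oki: "ok i" using ok_Suc[of i] i ok_le[of "Suc i" i] by simp
  have "NF i \<subseteq> R" using NF_R[OF oki] by blast
  then show thesis
    using iterated_division[OF R_pow[OF x_R] P_R[OF i(2)] _ expand_x[OF i] f, where B = B] that by blast
qed

definition finv :: "'g \<Rightarrow> bool" where
  "finv \<gamma> \<longleftrightarrow> (\<exists>M. \<gamma> < nat_multiple M (\<nu> x))"

lemma remainder_ge:
  assumes i: "1 \<le> i" "enat i \<le> \<Omega>" and gh: "g \<in> R" "h \<in> R"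
    and e: "\<phi> \<le> nat_multiple e (\<nu> x)" and B: "\<phi> \<le> nat_multiple B (\<beta> i)"
  shows "x [^] e \<otimes> g \<oplus> P i [^] B \<otimes> h \<in> ge \<phi>"
proof -
  have "x [^] e \<in> ge \<phi>" "P i [^] B \<in> ge \<phi>"
    using x_R R_sub x_nz P_carrier[OF i(2)] P_nz[OF i(2)] e B by (auto intro!: geI)
  then have "x [^] e \<otimes> g \<in> ge (\<phi> + 0)" "P i [^] B \<otimes> h \<in> ge (\<phi> + 0)"
    using R_ge gh ge_mult by blast+
  then show ?thesis using ge_add by simp
qed

lemma sub_gt_exact:
  assumes "f \<in> carrier K" "f \<noteq> \<zero>" "s \<in> carrier K" "r \<in> gt (\<nu> f)" "f = s \<oplus> r"
  shows "s \<noteq> \<zero>" "\<nu> s = \<nu> f" "f \<ominus> s \<in> gt (\<nu> f)"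
proof -
  have rc: "r \<in> carrier K" using assms gt_carrier by blast
  have s: "s = f \<oplus> \<ominus> r" unfolding assms(5) using assms(3) rc by algebra
  have "\<ominus> r \<in> gt (\<nu> f)" using assms gt_minus by blast
  then show "s \<noteq> \<zero>" "\<nu> s = \<nu> f" using exact_add[OF assms(1,2)] s by metis+
  have "f \<ominus> s = r" unfolding assms(5) using assms(3) rc by algebra
  then show "f \<ominus> s \<in> gt (\<nu> f)" using assms by simp
qed

text \<open>A step with n_i > 1 at least doubles the value. If from r on all n_i are 1, then
  \<nu>(P_i) = \<nu>(U_i) is a combination of the values below r; were these values bounded, only
  finitely many could occur, against strict growth.\<close>

lemma beta_unbounded:
  assumes "\<Omega> = \<infinity>"
  shows "\<exists>r\<ge>1. nat_multiple k (\<nu> x) \<le> \<beta> r"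
proof (induction k)
  case 0
  show ?case using beta_pos[of 1] assms by (intro exI[of _ 1]) (auto simp: order_less_imp_le)
next
  case (Suc k)
  have Om: "enat i \<le> \<Omega>" "enat i < \<Omega>" for i using assms by auto
  obtain r where r: "r \<ge> 1" "nat_multiple k (\<nu> x) \<le> \<beta> r" using Suc.IH by blast
  show ?case
  proof (cases "\<exists>i\<ge>r. n i \<noteq> 1")
    case True
    then obtain i where i: "i \<ge> r" "n i \<noteq> 1" by blast
    have i1: "1 \<le> i" using i r by simp
    obtain e where e: "n i = enat e" using lt_OmegaE[OF i1 Om(2)] by metis
    have "2 \<le> e" using n_pos[OF i1 Om(1)] i(2) e by (simp add: one_enat_def)
    have "\<beta> r \<le> \<beta> i" using beta_mono[OF r(1), of i] i Om by (cases "r = i") (auto simp: order_less_imp_le)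
    have "nat_multiple (Suc k) (\<nu> x) \<le> \<beta> i + \<beta> i"
      using r(2) \<open>\<beta> r \<le> \<beta> i\<close> beta_ge[OF Om(1), of i] by (auto intro: add_mono order_trans)
    also have "\<beta> i + \<beta> i = nat_multiple 2 (\<beta> i)" by (simp add: numeral_2_eq_2)
    also have "\<dots> \<le> nat_multiple e (\<beta> i)"
      using \<open>2 \<le> e\<close> beta_pos[OF Om(1), of i] by (intro nat_multiple_mono) auto
    also have "\<dots> < \<beta> (Suc i)" using P_Suc(1)[OF i1 Om(2)] e by simp
    finally show ?thesis by (intro exI[of _ "Suc i"]) (auto simp: order_less_imp_le)
  next
    case False
    then have n1: "n i = 1" if "i \<ge> r" for i using that by blast
    show ?thesis
    proof (rule ccontr)
      assume neg: "\<not> ?thesis"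
      then have small: "\<beta> i < nat_multiple (Suc k) (\<nu> x)" if "i \<ge> 1" for i using that by auto
      \<comment> \<open>Exponents at places from r on vanish because n = 1 there; the others are at
        most k, since k + 1 copies of any value already reach the assumed bound.\<close>
      have "\<beta> ` {r..} \<subseteq> (\<lambda>w. \<Sum>j<r. nat_multiple (w j) (\<beta> j)) ` ({..<r} \<rightarrow>\<^sub>E {..k})"
      proof
        fix b assume "b \<in> \<beta> ` {r..}"
        then obtain i where i: "b = \<beta> i" "i \<ge> r" by blast
        have i1: "1 \<le> i" using i r by simp
        obtain N D where ND: "nbar i = enat N" "n i = enat (N * D)" using lt_OmegaE[OF i1 Om(2)] by metis
        have N: "N = 1" using n1[OF i(2)] ND by (simp add: one_enat_def)
        obtain w U where U: "U = monomial K P i w" "\<And>j. 1 \<le> j \<Longrightarrow> j < i \<Longrightarrow> enat (w j) < n j"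
          "\<nu> U = nat_multiple N (\<beta> i)" by (rule step_fin[OF i1 Om(1) ND(1)]) blast
        have w0: "w j = 0" if "r \<le> j" "j < i" for j
          using U(2)[of j] n1[OF that(1)] that r by (simp add: one_enat_def)
        have "\<nu> U = (\<Sum>j<i. nat_multiple (w j) (\<beta> j))"
          unfolding U(1) using monomial_props[of i w] P_R[OF Om(1)] P_nz[OF Om(1)] by blast
        also have "\<dots> = (\<Sum>j<r. nat_multiple (w j) (\<beta> j))"
          using w0 i(2) by (intro sum.mono_neutral_right) auto
        finally have b: "b = (\<Sum>j<r. nat_multiple (w j) (\<beta> j))" using U(3) N i(1) by simp
        have nn: "0 \<le> nat_multiple (w j) (\<beta> j)" for j
          by (rule nat_multiple_nonneg[OF order_less_imp_le[OF beta_pos[OF Om(1)]]])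
        have "w j \<le> k" if j: "j < r" for j
        proof (rule ccontr)
          assume "\<not> w j \<le> k"
          then have "nat_multiple (Suc k) (\<nu> x) \<le> nat_multiple (w j) (\<nu> x)"
            using v_x_pos by (intro nat_multiple_mono) auto
          also have "\<dots> \<le> nat_multiple (w j) (\<beta> j)" by (rule nat_multiple_mono_right[OF beta_ge[OF Om(1)]])
          also have "\<dots> \<le> (\<Sum>j<r. nat_multiple (w j) (\<beta> j))"
            using j nn by (subst sum.remove[of _ j]) (auto intro: add_increasing2 sum_nonneg)
          also have "\<dots> = \<beta> i" using b i by simp
          finally show False using small[OF i1] by simp
        qed
        then have "restrict w {..<r} \<in> {..<r} \<rightarrow>\<^sub>E {..k}" by auto
        moreover have "b = (\<Sum>j<r. nat_multiple (restrict w {..<r} j) (\<beta> j))" unfolding b by simp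
        ultimately show "b \<in> (\<lambda>w. \<Sum>j<r. nat_multiple (w j) (\<beta> j)) ` ({..<r} \<rightarrow>\<^sub>E {..k})" by blast
      qed
      moreover have "finite ({..<r} \<rightarrow>\<^sub>E {..k})" by (intro finite_PiE) auto
      ultimately have "finite (\<beta> ` {r..})" by (meson finite_imageI finite_subset)
      moreover have "inj_on \<beta> {r..}"
      proof (rule linorder_inj_onI')
        fix i j assume "i \<in> {r..}" "j \<in> {r..}" "i < j"
        then show "\<beta> i \<noteq> \<beta> j" using beta_mono[of i j] Om(1) r(1) by fastforce
      qed
      ultimately have "finite {r..}" by (rule finite_imageD)
      then show False by (simp add: infinite_Ici)
    qed
  qed
qed

text \<open>Let \<nu>(f) < M \<nu>(x). An infinite run has some P_r of value at least M \<nu>(x),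
  and f is expanded modulo x^M and P_r. A finite run has n infinite at \<Omega>, so powers of the
  last element up to exponent M are available. Either way the error has larger value than f.\<close>

lemma representation:
  assumes f: "f \<in> R" "f \<noteq> \<zero>" "finv (\<nu> f)"
  obtains i s where "1 \<le> i" "ok i" "s \<in> NF i" "s \<noteq> \<zero>" "\<nu> s = \<nu> f" "f \<ominus> s \<in> gt (\<nu> f)"
proof -
  obtain M where M: "\<nu> f < nat_multiple M (\<nu> x)" using f(3) by (auto simp: finv_def)
  have fc: "f \<in> carrier K" using f R_sub by blast
  show thesis
  proof (cases \<Omega>)
    case infinity
    then obtain r where r: "r \<ge> 1" "nat_multiple M (\<nu> x) \<le> \<beta> r" using beta_unbounded by blast
    have Om: "enat r \<le> \<Omega>" using infinity by simp
    have okr: "ok r" unfolding ok_def using infinity by simp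
    obtain s g h where s: "s \<in> NF r" "g \<in> R" "h \<in> R" "f = s \<oplus> x [^] M \<otimes> g \<oplus> P r \<otimes> h"
      using expand_x[OF r(1) Om f(1)] by blast
    have sc: "s \<in> carrier K" using NF_R[OF okr s(1)] R_sub by blast
    have Pc: "P r \<in> carrier K" by (rule P_carrier[OF Om])
    have "x [^] M \<otimes> g \<oplus> P r [^] (1::nat) \<otimes> h \<in> ge (nat_multiple M (\<nu> x))"
      using r s by (intro remainder_ge[OF r(1) Om]) auto
    then have rem: "x [^] M \<otimes> g \<oplus> P r \<otimes> h \<in> gt (\<nu> f)" using ge_gt_mono M Pc by auto
    have "f = s \<oplus> (x [^] M \<otimes> g \<oplus> P r \<otimes> h)"
      using s(4) sc Pc s(2,3) x_R R_sub by (simp add: a_assoc)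
    then show ?thesis using that[OF r(1) okr s(1)] sub_gt_exact[OF fc f(2) sc rem] by blast
  next
    case (enat r)
    have r: "1 \<le> r" "enat r \<le> \<Omega>" using enat Omega_ge by (auto simp: one_enat_def)
    have okr: "ok (Suc r)" using r ok_Suc by simp
    obtain s g h where s: "\<And>b. b < M \<Longrightarrow> s b \<in> NF r" "g \<in> R" "h \<in> R"
      "f = (\<Oplus>b\<in>{..<M}. s b \<otimes> P r [^] b) \<oplus> x [^] M \<otimes> g \<oplus> P r [^] M \<otimes> h"
      using expand[OF r f(1), of M M] by blast
    define t where "t = (\<Oplus>b\<in>{..<M}. s b \<otimes> P r [^] b)"
    have tN: "t \<in> NF (Suc r)" unfolding t_def using s(1) n_Omega[OF enat] by (intro NF_SucI[OF r(1)]) auto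
    have tc: "t \<in> carrier K" using NF_R[OF okr tN] R_sub by blast
    have Pc: "P r \<in> carrier K" by (rule P_carrier[OF r(2)])
    have "x [^] M \<otimes> g \<oplus> P r [^] M \<otimes> h \<in> ge (nat_multiple M (\<nu> x))"
      using s nat_multiple_mono_right[OF beta_ge[OF r(2)]] by (intro remainder_ge[OF r]) auto
    then have rem: "x [^] M \<otimes> g \<oplus> P r [^] M \<otimes> h \<in> gt (\<nu> f)" using ge_gt_mono M by blast
    have "f = t \<oplus> (x [^] M \<otimes> g \<oplus> P r [^] M \<otimes> h)"
      using s(4) tc Pc s(2,3) x_R R_sub by (simp add: a_assoc t_def)
    then show ?thesis using that[OF _ okr tN] sub_gt_exact[OF fc f(2) tc rem] by auto
  qed
qed

end

section \<open>Commensurability of values\<close>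

lemma nat_multiple_int_multiple:
  "nat_multiple N (int_multiple e \<xi>) = int_multiple (int N * e) (\<xi> :: 'g::ab_group_add)"
proof -
  obtain k l where e: "e = int k - int l" by (rule int_cases_diff)
  have "nat_multiple N (nat_multiple k \<xi> - nat_multiple l \<xi>) = nat_multiple (N * k) \<xi> - nat_multiple (N * l) \<xi>"
    using nat_multiple_add_right[of N "nat_multiple k \<xi>" "- nat_multiple l \<xi>"]
    by (simp add: nat_multiple_mult nat_multiple_uminus)
  moreover have "int N * e = int (N * k) - int (N * l)" unfolding e by (simp add: algebra_simps)
  ultimately show ?thesis unfolding e by (simp only: int_multiple_diff_nat)
qed

text \<open>Rational dependence on \<xi>, written without division. If all indices nbar were finite,
  every value of a P_i would depend on \<nu>(x) in this sense.\<close>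

definition commensurable :: "'g::ab_group_add \<Rightarrow> 'g \<Rightarrow> bool" where
  "commensurable \<xi> \<gamma> \<longleftrightarrow> (\<exists>N>0. \<exists>e. nat_multiple N \<gamma> = int_multiple e \<xi>)"

lemma commensurable_diff:
  assumes "commensurable \<xi> \<gamma>" "commensurable \<xi> \<delta>"
  shows "commensurable \<xi> (\<gamma> - \<delta>)"
proof -
  obtain N e where 1: "0 < N" "nat_multiple N \<gamma> = int_multiple e \<xi>" using assms(1) by (auto simp: commensurable_def)
  obtain N' e' where 2: "0 < N'" "nat_multiple N' \<delta> = int_multiple e' \<xi>" using assms(2) by (auto simp: commensurable_def)
  have "nat_multiple (N * N') (\<gamma> - \<delta>) = nat_multiple (N' * N) \<gamma> - nat_multiple (N * N') \<delta>"
    using nat_multiple_add_right[of "N * N'" \<gamma> "- \<delta>"] by (simp add: nat_multiple_uminus mult.commute)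
  also have "\<dots> = int_multiple (int N' * e - int N * e') \<xi>"
    by (simp add: nat_multiple_mult 1 2 nat_multiple_int_multiple int_multiple_diff)
  finally show ?thesis unfolding commensurable_def using 1 2 by (metis nat_0_less_mult_iff)
qed

lemma commensurable_group_closure:
  assumes "\<And>s. s \<in> S \<Longrightarrow> commensurable \<xi> s" "\<gamma> \<in> group_closure S"
  shows "commensurable \<xi> \<gamma>"
  using assms(2)
proof induction
  case (base s)
  have "nat_multiple 1 0 = int_multiple (int 0) \<xi>" unfolding int_multiple_of_nat by simp
  then have "commensurable \<xi> 0" unfolding commensurable_def by blast
  then show ?case using base assms(1) by auto
qed (rule commensurable_diff)

lemma commensurable_nat_multiple:
  assumes "0 < N" "commensurable \<xi> (nat_multiple N \<gamma>)" shows "commensurable \<xi> \<gamma>"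
proof -
  obtain M e where "0 < M" "nat_multiple M (nat_multiple N \<gamma>) = int_multiple e \<xi>"
    using assms(2) by (auto simp: commensurable_def)
  then have "nat_multiple (M * N) \<gamma> = int_multiple e \<xi>" "0 < M * N" using assms(1) by (auto simp: nat_multiple_mult)
  then show ?thesis unfolding commensurable_def by blast
qed

section \<open>Comparison modulo x: orders in y against values\<close>

context generating_sequence
begin

text \<open>The ideal generated by x and z. With z a power of y it measures the order in y modulo
  x.\<close>

definition XZ :: "'a \<Rightarrow> 'a set" where
  "XZ z = {x \<otimes> a \<oplus> z \<otimes> b | a b. a \<in> R \<and> b \<in> R}"

lemma XZ_I: "a \<in> R \<Longrightarrow> b \<in> R \<Longrightarrow> x \<otimes> a \<oplus> z \<otimes> b \<in> XZ z"
  by (auto simp: XZ_def)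

lemma XZ_E:
  assumes "f \<in> XZ z"
  obtains a b where "a \<in> R" "b \<in> R" "f = x \<otimes> a \<oplus> z \<otimes> b"
  using assms by (auto simp: XZ_def)

lemma XR_XZ: "z \<in> R \<Longrightarrow> f \<in> XR \<Longrightarrow> f \<in> XZ z"
proof -
  assume z: "z \<in> R" and "f \<in> XR"
  then obtain a where a: "a \<in> R" "f = x \<otimes> a" by (auto simp: XR_def)
  have "f = x \<otimes> a \<oplus> z \<otimes> \<zero>" using a z x_R R_sub by simp
  then show ?thesis using XZ_I[of a \<zero> z] a by simp
qed

lemma z_XZ: "z \<in> R \<Longrightarrow> z \<in> XZ z"
  using XZ_I[of \<zero> \<one> z] x_R R_sub by simp

lemma XZ_add: "z \<in> R \<Longrightarrow> f \<in> XZ z \<Longrightarrow> g \<in> XZ z \<Longrightarrow> f \<oplus> g \<in> XZ z"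
proof -
  assume z: "z \<in> R" and f: "f \<in> XZ z" and g: "g \<in> XZ z"
  obtain a b where a: "a \<in> R" "b \<in> R" "f = x \<otimes> a \<oplus> z \<otimes> b" using f by (rule XZ_E)
  obtain c d where c: "c \<in> R" "d \<in> R" "g = x \<otimes> c \<oplus> z \<otimes> d" using g by (rule XZ_E)
  have "f \<oplus> g = x \<otimes> (a \<oplus> c) \<oplus> z \<otimes> (b \<oplus> d)"
    unfolding a(3) c(3) using a(1,2) c(1,2) z x_R R_sub by algebra
  then show ?thesis using XZ_I[of "a \<oplus> c" "b \<oplus> d" z] a c by (simp add: R_add)
qed

lemma XZ_mult: "z \<in> R \<Longrightarrow> f \<in> XZ z \<Longrightarrow> r \<in> R \<Longrightarrow> r \<otimes> f \<in> XZ z"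
proof -
  assume z: "z \<in> R" and f: "f \<in> XZ z" and r: "r \<in> R"
  obtain a b where a: "a \<in> R" "b \<in> R" "f = x \<otimes> a \<oplus> z \<otimes> b" using f by (rule XZ_E)
  have "r \<otimes> f = x \<otimes> (r \<otimes> a) \<oplus> z \<otimes> (r \<otimes> b)"
    unfolding a(3) using a(1,2) r z x_R R_sub by algebra
  then show ?thesis using XZ_I[of "r \<otimes> a" "r \<otimes> b" z] a r by (simp add: R_mult)
qed

lemma XZ_R: "z \<in> R \<Longrightarrow> f \<in> XZ z \<Longrightarrow> f \<in> R"
  by (auto simp: XZ_def x_R R_add R_mult)

lemma XZ_trans: "z \<in> XZ z' \<Longrightarrow> z' \<in> R \<Longrightarrow> f \<in> XZ z \<Longrightarrow> f \<in> XZ z'"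
proof -
  assume z: "z \<in> XZ z'" and z': "z' \<in> R" and f: "f \<in> XZ z"
  obtain a b where a: "a \<in> R" "b \<in> R" "f = x \<otimes> a \<oplus> z \<otimes> b" using f by (rule XZ_E)
  have "z \<in> R" using XZ_R[OF z' z] .
  have "x \<otimes> a \<in> XZ z'" using XR_XZ[OF z'] a by (auto simp: XR_def)
  moreover have "z \<otimes> b \<in> XZ z'"
    using XZ_mult[OF z' z a(2)] \<open>z \<in> R\<close> a(2) R_sub by (simp add: m_comm)
  ultimately show ?thesis unfolding a(3) by (rule XZ_add[OF z'])
qed

lemma XZ_prod: "z \<in> R \<Longrightarrow> z' \<in> R \<Longrightarrow> f \<in> XZ z \<Longrightarrow> g \<in> XZ z' \<Longrightarrow> f \<otimes> g \<in> XZ (z \<otimes> z')"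
proof -
  assume z: "z \<in> R" "z' \<in> R" and f: "f \<in> XZ z" and g: "g \<in> XZ z'"
  obtain a b where a: "a \<in> R" "b \<in> R" "f = x \<otimes> a \<oplus> z \<otimes> b" using f by (rule XZ_E)
  obtain c d where c: "c \<in> R" "d \<in> R" "g = x \<otimes> c \<oplus> z' \<otimes> d" using g by (rule XZ_E)
  have "f \<otimes> g = x \<otimes> (a \<otimes> g \<oplus> z \<otimes> b \<otimes> c) \<oplus> (z \<otimes> z') \<otimes> (b \<otimes> d)"
    unfolding a(3) c(3) using a(1,2) c(1,2) z x_R R_sub by algebra
  then show ?thesis
    using XZ_I[of "a \<otimes> g \<oplus> z \<otimes> b \<otimes> c" "b \<otimes> d" "z \<otimes> z'"] a c z XZ_R[OF z(2) g]
    by (simp add: R_mult R_add)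
qed

lemma XZ_pow: "z \<in> R \<Longrightarrow> f \<in> XZ z \<Longrightarrow> f [^] (e::nat) \<in> XZ (z [^] e)"
proof (induction e)
  case 0
  then show ?case using z_XZ[of \<one>] by simp
next
  case (Suc e)
  then show ?case using XZ_prod[of "z [^] e" z "f [^] e" f] R_pow by simp
qed

text \<open>Modulo x, g is a unit times some y^e, and the next power of y does not divide this
  because xR is prime and contains no power of y.\<close>

lemma notin_XZ_y_power:
  assumes g: "g \<in> R" "g \<notin> XR"
  obtains e where "g \<notin> XZ (y [^] (e::nat))"
proof -
  have "g \<notin> PIdl\<^bsub>A\<^esub> x" using g XR_eq by simp
  then obtain u h e where uU: "u \<in> Units A" and "h \<in> carrier A" "g = u \<otimes>\<^bsub>A\<^esub> y [^]\<^bsub>A\<^esub> (e::nat) \<oplus>\<^bsub>A\<^esub> x \<otimes>\<^bsub>A\<^esub> h"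
    using A.unit_power_rep[of g] g(1) by auto
  then have u: "u \<in> R" "h \<in> R" "g = u \<otimes> y [^] e \<oplus> x \<otimes> h" using A.Units_closed by auto
  have um: "u \<notin> m" using A.m_not_Unit uU by blast
  have "g \<notin> XZ (y [^] Suc e)"
  proof
    assume "g \<in> XZ (y [^] Suc e)"
    then obtain a b where ab: "a \<in> R" "b \<in> R" "g = x \<otimes> a \<oplus> y [^] Suc e \<otimes> b" by (rule XZ_E)
    have c: "x \<in> carrier K" "y \<in> carrier K" "y [^] e \<in> carrier K" "u \<in> carrier K" "h \<in> carrier K" "a \<in> carrier K" "b \<in> carrier K"
      using x_R y_R u ab R_sub by auto
    have "y [^] e \<otimes> (u \<ominus> y \<otimes> b) = (u \<otimes> y [^] e \<oplus> x \<otimes> h) \<ominus> x \<otimes> h \<ominus> (y [^] e \<otimes> y) \<otimes> b"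
      using c by algebra
    also have "\<dots> = (x \<otimes> a \<oplus> (y [^] e \<otimes> y) \<otimes> b) \<ominus> x \<otimes> h \<ominus> (y [^] e \<otimes> y) \<otimes> b" using u(3) ab(3) by simp
    also have "\<dots> = x \<otimes> (a \<ominus> h)" using c by algebra
    finally have "y [^] e \<otimes> (u \<ominus> y \<otimes> b) \<in> XR" using u ab R_diff by (auto simp: XR_def)
    moreover have uyR: "u \<ominus> y \<otimes> b \<in> R" using u ab y_R by (simp add: R_diff R_mult)
    ultimately have "y [^] e \<in> XR \<or> u \<ominus> y \<otimes> b \<in> XR" using XR_prime R_pow[OF y_R] by blast
    moreover have "y [^] e \<notin> XR" using XR_pow[OF y_R] y_notin_XR by blast
    moreover have "u \<ominus> y \<otimes> b \<notin> XR"
    proof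
      assume "u \<ominus> y \<otimes> b \<in> XR"
      then have "u \<ominus> y \<otimes> b \<in> gt 0"
        using gt_mult[OF gtI[OF R_sub[OF x_R] v_x_pos] R_ge] by (auto simp: XR_def)
      moreover have "y \<otimes> b \<in> gt 0"
        using gt_mult[OF _ R_ge[OF ab(2)], of y 0] m_iff[OF y_R] A.y_in_m by simp
      ultimately have "(u \<ominus> y \<otimes> b) \<oplus> y \<otimes> b \<in> gt 0" by (rule gt_add)
      moreover have "(u \<ominus> y \<otimes> b) \<oplus> y \<otimes> b = u" using c by algebra
      ultimately show False using um m_iff[OF u(1)] by simp
    qed
    ultimately show False by blast
  qed
  then show thesis by (rule that)
qed

text \<open>Modulo x each element of the sequence is a power, with positive exponent, of its
  predecessor.\<close>

lemma P_XZ: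
  assumes i: "1 \<le> i"
  shows "i \<le> j \<Longrightarrow> enat j \<le> \<Omega> \<Longrightarrow> P j \<in> XZ (P i)"
proof (induction j rule: dec_induct)
  case base
  have "enat i \<le> \<Omega>" using base by simp
  then show ?case by (intro z_XZ P_R)
next
  case (step j)
  have lt: "enat j < \<Omega>" using step.prems by (simp add: Suc_ile_eq)
  have j1: "1 \<le> j" using step.hyps i by simp
  have "enat i \<le> enat j" using step.hyps by simp
  then have "enat i \<le> \<Omega>" using lt by (meson less_imp_le order_trans)
  then have PiR: "P i \<in> R" by (rule P_R)
  have PjR: "P j \<in> R" "P (Suc j) \<in> R" using lt step.prems P_R by auto
  have Pj: "P j \<in> XZ (P i)" using step lt by simp
  obtain e where e: "n j = enat e" using lt_OmegaE[OF j1 lt] by metis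
  have "1 \<le> e" using n_pos[OF j1] lt e by (simp add: one_enat_def)
  then obtain e' where e': "e = Suc e'" by (cases e) auto
  have "P j [^] e \<in> XZ (P i)" unfolding e' nat_pow_Suc by (rule XZ_mult[OF PiR Pj R_pow[OF PjR(1)]])
  moreover have "P (Suc j) \<ominus> P j [^] e \<in> XZ (P i)" using P_Suc(2)[OF j1 lt] e XR_XZ[OF PiR] by simp
  ultimately have "P j [^] e \<oplus> (P (Suc j) \<ominus> P j [^] e) \<in> XZ (P i)" by (rule XZ_add[OF PiR])
  moreover have "P j [^] e \<oplus> (P (Suc j) \<ominus> P j [^] e) = P (Suc j)"
    using R_sub[OF R_pow[OF PjR(1), of e]] R_sub[OF PjR(2)] by algebra
  ultimately show ?case by simp
qed

text \<open>Each index with n_i \<ge> 2 raises the order in y by at least one: P_i lies in the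
  ideals of x, y^e and of x, y, so its square lies in the ideal of x, y^(e+1).\<close>

lemma P_XZ_y_power:
  assumes "\<Omega> = \<infinity>" "infinite {i. 1 \<le> i \<and> 1 < n i}"
  shows "\<exists>r\<ge>1. P r \<in> XZ (y [^] (e::nat))"
proof (induction e)
  case 0
  have "P 1 \<in> XZ (y [^] (0::nat))"
    using z_XZ[of \<one>] XZ_mult[of \<one> \<one> y] y_R R_sub by simp
  then show ?case by blast
next
  case (Suc e)
  have Om: "enat i \<le> \<Omega>" "enat i < \<Omega>" for i using assms by auto
  obtain r where r: "r \<ge> 1" "P r \<in> XZ (y [^] e)" using Suc.IH by blast
  obtain i where i: "i \<ge> r" "1 < n i"
    using assms(2) by (metis (mono_tags, lifting) infinite_nat_iff_unbounded_le mem_Collect_eq)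
  have i1: "1 \<le> i" using i r by simp
  obtain k where k: "n i = enat k" using lt_OmegaE[OF i1 Om(2)] by metis
  have k2: "2 \<le> k" using i(2) k by (simp add: one_enat_def)
  have PR: "P j \<in> R" for j using P_R Om by blast
  have "P i \<in> XZ (y [^] e)" using XZ_trans[OF r(2) R_pow[OF y_R]] P_XZ[OF r(1) i(1) Om(1)] by blast
  moreover have "P i \<in> XZ y" using P_XZ[OF _ i1 Om(1)] by simp
  ultimately have "P i \<otimes> P i \<in> XZ (y [^] e \<otimes> y)" by (intro XZ_prod R_pow y_R)
  then have PP: "P i \<otimes> P i \<in> XZ (y [^] Suc e)" by simp
  have zR: "y [^] Suc e \<in> R" by (rule R_pow[OF y_R])
  have "P i [^] k = P i [^] (k - 2) \<otimes> (P i \<otimes> P i)"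
  proof -
    have "P i \<otimes> P i = P i [^] (2::nat)" using R_sub[OF PR] by (simp add: numeral_2_eq_2)
    moreover have "P i [^] (k - 2) \<otimes> P i [^] (2::nat) = P i [^] (k - 2 + 2)"
      using R_sub[OF PR] by (rule nat_pow_mult)
    ultimately show ?thesis using k2 by (metis le_add_diff_inverse2)
  qed
  then have "P i [^] k \<in> XZ (y [^] Suc e)" using XZ_mult[OF zR PP R_pow[OF PR]] by simp
  moreover have "P (Suc i) \<ominus> P i [^] k \<in> XZ (y [^] Suc e)"
    using P_Suc(2)[OF i1 Om(2)] k XR_XZ[OF zR] by simp
  ultimately have "P i [^] k \<oplus> (P (Suc i) \<ominus> P i [^] k) \<in> XZ (y [^] Suc e)" by (rule XZ_add[OF zR])
  moreover have "P i [^] k \<oplus> (P (Suc i) \<ominus> P i [^] k) = P (Suc i)"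
    using R_sub[OF R_pow[OF PR, of i k]] R_sub[OF PR, of "Suc i"] by algebra
  ultimately have "P (Suc i) \<in> XZ (y [^] Suc e)" by simp
  then show ?case by (intro exI[of _ "Suc i"]) simp
qed

lemma NF_sum_notin_XR:
  fixes B :: nat
  assumes i: "1 \<le> i" "enat i \<le> \<Omega>" and s: "\<And>b. b < B \<Longrightarrow> s b \<in> NF i"
    and f: "(\<Oplus>b\<in>{..<B}. s b \<otimes> P i [^] b) \<notin> XR"
  obtains b where "b < B" "s b \<notin> XR"
proof (rule ccontr)
  assume "\<not> thesis"
  then have "s b \<in> XR" if "b < B" for b using that \<open>\<not> thesis\<close> \<open>\<And>b. b < B \<Longrightarrow> s b \<notin> XR \<Longrightarrow> thesis\<close> by blast
  then have "(\<Oplus>b\<in>{..<B}. s b \<otimes> P i [^] b) \<in> XR"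
    using P_R[OF i(2)] by (intro XR_finsum XR_mult R_pow) auto
  then show False using f by blast
qed

lemma NF_one_notin_XR:
  assumes s: "s \<in> NF 1" "s \<notin> XR"
  shows "s \<noteq> \<zero>" "\<nu> s = 0"
proof -
  show s0: "s \<noteq> \<zero>" using s(2) XR_zero by blast
  obtain u a where u: "s = u \<otimes> x [^] (a::nat)" "u \<in> R" "u \<noteq> \<zero>" "\<nu> u = 0"
    using s(1) s0 unfolding One_nat_def NF.simps by blast
  have "a = 0"
  proof (rule ccontr)
    assume "a \<noteq> 0"
    then obtain a' where "a = Suc a'" by (cases a) auto
    then have "s = x \<otimes> (u \<otimes> x [^] a')" using u x_R R_sub by (simp add: m_ac)
    moreover have "u \<otimes> x [^] a' \<in> R" using u x_R by (simp add: R_mult R_pow)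
    ultimately show False using s(2) unfolding XR_def by blast
  qed
  then show "\<nu> s = 0" using u R_sub by simp
qed

text \<open>A normal form outside xR has a coefficient outside xR. Since nothing cancels, its value
  is at most that of the corresponding term, which stays below \<nu>(P_i) by the bounds on the
  exponents.\<close>

lemma NF_lt_beta: "1 \<le> i \<Longrightarrow> enat i \<le> \<Omega> \<Longrightarrow> s \<in> NF i \<Longrightarrow> s \<notin> XR \<Longrightarrow> s \<noteq> \<zero> \<and> \<nu> s < \<beta> i"
proof (induction i arbitrary: s rule: dec_induct)
  case base
  then show ?case using NF_one_notin_XR[OF base(2,3)] beta_pos[OF base(1)] by simp
next
  case (step i)
  have lt: "enat i < \<Omega>" using step.prems by (simp add: Suc_ile_eq)
  then have le: "enat i \<le> \<Omega>" by simp
  obtain t B where t: "s = (\<Oplus>b\<in>{..<B}. t b \<otimes> P i [^] b)" "\<And>b. b < B \<Longrightarrow> t b \<in> NF i" "enat B \<le> n i"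
    using NF_SucE[OF step.prems(2) step.hyps(1)] by blast
  obtain b where b: "b < B" "t b \<notin> XR"
    by (rule NF_sum_notin_XR[OF step.hyps(1) le t(2) step.prems(3)[unfolded t(1)]])
  have tb: "t b \<noteq> \<zero>" "\<nu> (t b) < \<beta> i" using step.IH[OF le t(2)[OF b(1)] b(2)] by auto
  obtain e where e: "n i = enat e" using lt_OmegaE[OF step.hyps(1) lt] by metis
  have "\<nu> s \<le> \<nu> (t b) + nat_multiple b (\<beta> i)" by (rule NF_sum_le(2)[OF step.hyps(1) le t(2,3,1) b(1) tb(1)])
  also have "\<dots> < nat_multiple (Suc b) (\<beta> i)" using tb by simp
  also have "\<dots> \<le> nat_multiple e (\<beta> i)"
    using b(1) t(3) e beta_pos[OF le] by (intro nat_multiple_mono) auto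
  also have "\<dots> < \<beta> (Suc i)" using P_Suc(1)[OF step.hyps(1) lt] e by simp
  finally show ?case using step.prems(3) by auto
qed

lemma finv_add: "finv \<gamma> \<Longrightarrow> finv \<delta> \<Longrightarrow> finv (\<gamma> + \<delta>)"
  unfolding finv_def using nat_multiple_add[of _ _ "\<nu> x"] by (metis add_strict_mono)

lemma finv_le: "finv \<gamma> \<Longrightarrow> \<delta> \<le> \<gamma> \<Longrightarrow> finv \<delta>"
  unfolding finv_def by (meson le_less_trans)

lemma finv_nat_multiple: "finv \<gamma> \<Longrightarrow> finv (nat_multiple e \<gamma>)"
proof (induction e)
  case 0
  have "0 < nat_multiple 1 (\<nu> x)" using v_x_pos by simp
  then show ?case unfolding finv_def nat_multiple_0 by blast
qed (simp add: finv_add)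

lemma finv_x: "finv (\<nu> x)"
  unfolding finv_def using v_x_pos by (intro exI[of _ 2]) (simp add: numeral_2_eq_2)

lemma finv_zero: "finv 0"
  using finv_nat_multiple[OF finv_x, of 0] by simp

text \<open>Needed at the last index, where \<nu>(P_i) may exceed all multiples of \<nu>(x) and
  \<open>NF_lt_beta\<close> says too little; the bound is assembled from the earlier values.\<close>

lemma NF_finv_bound:
  "1 \<le> i \<Longrightarrow> enat i \<le> \<Omega> \<Longrightarrow> (\<And>k. k < i \<Longrightarrow> finv (\<beta> k)) \<Longrightarrow>
    \<exists>\<gamma>. finv \<gamma> \<and> (\<forall>s\<in>NF i. s \<notin> XR \<longrightarrow> s \<noteq> \<zero> \<and> \<nu> s \<le> \<gamma>)"
proof (induction i rule: dec_induct)
  case base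
  show ?case
  proof (intro exI[of _ 0] conjI ballI impI)
    fix s assume "s \<in> NF 1" "s \<notin> XR"
    then show "s \<noteq> \<zero>" "\<nu> s \<le> 0" using NF_one_notin_XR[of s] by simp_all
  qed (rule finv_zero)
next
  case (step i)
  have lt: "enat i < \<Omega>" using step.prems by (simp add: Suc_ile_eq)
  then have le: "enat i \<le> \<Omega>" by simp
  obtain \<gamma> where g: "finv \<gamma>" "\<And>s. s \<in> NF i \<Longrightarrow> s \<notin> XR \<Longrightarrow> s \<noteq> \<zero> \<and> \<nu> s \<le> \<gamma>"
    using step.IH[OF le] step.prems(2) less_Suc_eq by blast
  obtain e where e: "n i = enat e" using lt_OmegaE[OF step.hyps(1) lt] by metis
  have "s \<noteq> \<zero> \<and> \<nu> s \<le> \<gamma> + nat_multiple e (\<beta> i)" if s: "s \<in> NF (Suc i)" "s \<notin> XR" for s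
  proof -
    obtain t B where t: "s = (\<Oplus>b\<in>{..<B}. t b \<otimes> P i [^] b)" "\<And>b. b < B \<Longrightarrow> t b \<in> NF i" "enat B \<le> n i"
      using NF_SucE[OF s(1) step.hyps(1)] by blast
    obtain b where b: "b < B" "t b \<notin> XR"
      by (rule NF_sum_notin_XR[OF step.hyps(1) le t(2) s(2)[unfolded t(1)]])
    have tb: "t b \<noteq> \<zero>" "\<nu> (t b) \<le> \<gamma>" using g(2)[OF t(2)[OF b(1)] b(2)] by auto
    have "\<nu> s \<le> \<nu> (t b) + nat_multiple b (\<beta> i)" by (rule NF_sum_le(2)[OF step.hyps(1) le t(2,3,1) b(1) tb(1)])
    also have "\<dots> \<le> \<gamma> + nat_multiple e (\<beta> i)"
      using b(1) t(3) e beta_pos[OF le] tb by (intro add_mono nat_multiple_mono) auto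
    finally show ?thesis using s(2) by auto
  qed
  moreover have "finv (\<gamma> + nat_multiple e (\<beta> i))"
    using g(1) step.prems by (intro finv_add finv_nat_multiple) auto
  ultimately show ?case by blast
qed

text \<open>For j \<ge> i all terms with a positive power of P_j lie in the ideal of x and P_i. So
  the constant coefficient is outside this ideal, and descending to level i gives a bound that does
  not depend on j.\<close>

lemma NF_notin_XZ_lt:
  assumes i: "1 \<le> i"
  shows "i \<le> j \<Longrightarrow> enat j \<le> \<Omega> \<Longrightarrow> s \<in> NF j \<Longrightarrow> s \<notin> XZ (P i) \<Longrightarrow> s \<noteq> \<zero> \<and> \<nu> s < \<beta> i"
proof (induction j arbitrary: s rule: dec_induct)
  case base
  then show ?case using NF_lt_beta[OF i base(1,2)] XR_XZ P_R by blast
next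
  case (step j)
  have lt: "enat j < \<Omega>" using step.prems by (simp add: Suc_ile_eq)
  then have le: "enat j \<le> \<Omega>" by simp
  have j1: "1 \<le> j" using step.hyps i by simp
  have "enat i \<le> enat j" using step.hyps by simp
  then have PiR: "P i \<in> R" using le order_trans P_R by blast
  have PjR: "P j \<in> R" by (rule P_R[OF le])
  obtain t B where t: "s = (\<Oplus>b\<in>{..<B}. t b \<otimes> P j [^] b)" "\<And>b. b < B \<Longrightarrow> t b \<in> NF j" "enat B \<le> n j"
    using NF_SucE[OF step.prems(2) j1] by blast
  have okj: "ok j" using ok_Suc[of j] le ok_le[of "Suc j" j] by simp
  have tR: "t b \<in> R" if "b < B" for b using NF_R[OF okj t(2)[OF that]] .
  have Pj: "P j \<in> XZ (P i)" by (rule P_XZ[OF i step.hyps(1) le])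
  have zeroXZ: "\<zero> \<in> XZ (P i)" using XR_XZ[OF PiR XR_zero] .
  have sum: "(\<Oplus>b\<in>{..<B}. t b \<otimes> P j [^] b) \<in> XZ (P i)" if t0: "0 < B \<Longrightarrow> t 0 \<in> XZ (P i)"
  proof -
    have tm: "t b \<otimes> P j [^] b \<in> XZ (P i)" if "b < B" for b
    proof (cases b)
      case 0
      then show ?thesis using t0 that tR[OF that] R_sub by simp
    next
      case (Suc b')
      have "t b \<otimes> P j [^] b = (t b \<otimes> P j [^] b') \<otimes> P j"
        using Suc tR[OF that] PjR R_sub by (simp add: m_assoc)
      then show ?thesis using XZ_mult[OF PiR Pj] tR[OF that] PjR by (simp add: R_mult R_pow)
    qed
    have "(\<Oplus>b\<in>{..<C}. t b \<otimes> P j [^] b) \<in> XZ (P i)" if "C \<le> B" for C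
      using that
    proof (induction C)
      case (Suc C)
      have "(\<Oplus>b\<in>{..<Suc C}. t b \<otimes> P j [^] b) = t C \<otimes> P j [^] C \<oplus> (\<Oplus>b\<in>{..<C}. t b \<otimes> P j [^] b)"
        using Suc.prems tR PjR R_sub by (intro finsum_lessThan_Suc) auto
      then show ?case using Suc tm[of C] XZ_add[OF PiR] by simp
    qed (simp add: zeroXZ)
    then show ?thesis by simp
  qed
  have "0 < B" "t 0 \<notin> XZ (P i)" using sum step.prems(3) t(1) by blast+
  then have t0: "t 0 \<noteq> \<zero>" "\<nu> (t 0) < \<beta> i" using step.IH[OF le t(2)] by auto
  have "\<nu> s \<le> \<nu> (t 0) + nat_multiple 0 (\<beta> j)"
    by (rule NF_sum_le(2)[OF j1 le t(2,3,1) \<open>0 < B\<close> t0(1)])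
  then show ?case using t0 step.prems(3) zeroXZ by auto
qed

text \<open>Finite index puts a positive multiple of \<nu>(P_i) into the group generated by the
  earlier values.\<close>

lemma commensurable_beta:
  assumes "\<And>k. 1 \<le> k \<Longrightarrow> k \<le> i \<Longrightarrow> enat k \<le> \<Omega> \<and> nbar k \<noteq> \<infinity>"
  shows "commensurable (\<nu> x) (\<beta> i)"
  using assms
proof (induction i rule: less_induct)
  case (less i)
  show ?case
  proof (cases "i = 0")
    case True
    have "nat_multiple 1 (\<nu> x) = int_multiple (int 1) (\<nu> x)" unfolding int_multiple_of_nat ..
    then show ?thesis unfolding True P_0 commensurable_def by blast
  next
    case False
    then have i: "1 \<le> i" "enat i \<le> \<Omega>" "nbar i \<noteq> \<infinity>" using less.prems[of i] by auto
    then obtain N where N: "nbar i = enat N" by auto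
    have "0 < N" by (rule nbar_fin(1)[OF i(1,2) N])
    have "nat_multiple N (\<beta> i) \<in> G i" using nbar_fin(2)[OF i(1,2) N, of "int N"] by simp
    then have "commensurable (\<nu> x) (nat_multiple N (\<beta> i))"
      by (rule commensurable_group_closure[rotated]) (use less in auto)
    then show ?thesis using commensurable_nat_multiple[OF \<open>0 < N\<close>] by blast
  qed
qed

lemma commensurable_pos:
  assumes "commensurable (\<nu> x) \<gamma>" "0 < \<gamma>"
  obtains N e where "0 < N" "0 < e" "nat_multiple N \<gamma> = nat_multiple e (\<nu> x)"
proof -
  obtain N e where e: "0 < N" "nat_multiple N \<gamma> = int_multiple e (\<nu> x)"
    using assms(1) by (auto simp: commensurable_def)
  have pos: "0 < nat_multiple N \<gamma>" using assms e by (intro nat_multiple_pos)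
  have "0 < e"
  proof (rule ccontr)
    assume "\<not> 0 < e"
    then have "int_multiple e (\<nu> x) = - nat_multiple (nat (- e)) (\<nu> x)" by (auto simp: int_multiple_def)
    moreover have "0 \<le> nat_multiple (nat (- e)) (\<nu> x)" using v_x_pos by (intro nat_multiple_nonneg) simp
    ultimately show False using pos e by simp
  qed
  then have "nat_multiple N \<gamma> = nat_multiple (nat e) (\<nu> x)" "0 < nat e" using e by (auto simp: int_multiple_def)
  then show thesis using that e by blast
qed

text \<open>A positive value commensurable with \<nu>(x) is bounded by one of its own multiples that
  is also a multiple of \<nu>(x).\<close>

lemma finv_beta:
  assumes "enat i \<le> \<Omega>" "\<And>k. 1 \<le> k \<Longrightarrow> k \<le> i \<Longrightarrow> nbar k \<noteq> \<infinity>"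
  shows "finv (\<beta> i)"
proof -
  have "enat k \<le> \<Omega>" if "k \<le> i" for k using assms(1) that by (meson enat_ord_simps(1) order_trans)
  then have "commensurable (\<nu> x) (\<beta> i)" using assms by (intro commensurable_beta) auto
  then obtain N e where Ne: "0 < N" "nat_multiple N (\<beta> i) = nat_multiple e (\<nu> x)"
    using commensurable_pos beta_pos[OF assms(1)] by metis
  have "\<beta> i \<le> nat_multiple N (\<beta> i)" using beta_pos[OF assms(1)] Ne(1) by (intro le_nat_multiple) auto
  then show ?thesis using finv_le finv_nat_multiple[OF finv_x] Ne(2) by metis
qed

lemma finv_beta_lt: "enat i < \<Omega> \<Longrightarrow> finv (\<beta> i)"
proof (rule finv_beta)
  assume lt: "enat i < \<Omega>"
  then show "enat i \<le> \<Omega>" by simp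
  show "nbar k \<noteq> \<infinity>" if "1 \<le> k" "k \<le> i" for k
  proof -
    have "enat k < \<Omega>" using that lt by (meson enat_ord_simps(1) le_less_trans)
    then show ?thesis using lt_OmegaE[OF that(1)] by (metis enat.distinct(2))
  qed
qed

end

section \<open>The contracted prime ideal\<close>

locale rank_two_sequence =
  generating_sequence K \<nu> R m CS x y P \<Omega> nbar d n \<alpha> + rank_two_valuation K \<nu> I
  for K :: "('a, 'b) ring_scheme" (structure) and \<nu> :: "'a \<Rightarrow> 'g::linordered_ab_group_add"
    and R m CS x y P \<Omega> nbar d n \<alpha> I
begin

lemma I_ge: "f \<in> I \<Longrightarrow> f \<in> ge 0"
  using I_prime by (auto simp: primeideal_def ideal_def dest: additive_subgroup.a_Hcarr)

lemma I_upward: "f \<in> I \<Longrightarrow> f \<noteq> \<zero> \<Longrightarrow> g \<in> carrier K \<Longrightarrow> g = \<zero> \<or> \<nu> f \<le> \<nu> g \<Longrightarrow> g \<in> I"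
  by (rule V_ideal_upward[OF primeideal.axioms(1)[OF I_prime]])

lemma I_sub_m: "f \<in> I \<Longrightarrow> f \<in> R \<Longrightarrow> f \<in> m"
  using I_proper m_iff by (auto simp: mV_eq)

lemma contraction_prime: "primeideal (I \<inter> R) A"
proof -
  interpret I: primeideal I V by (rule I_prime)
  show ?thesis
  proof (rule primeidealI)
    show "ideal (I \<inter> R) A"
    proof (rule idealI)
      show "ring A" by (rule A.ring_axioms)
      show "subgroup (I \<inter> R) (add_monoid A)"
      proof (rule A.add.subgroupI)
        show "I \<inter> R \<subseteq> carrier A" by simp
        show "I \<inter> R \<noteq> {}" using V_prime_zero[OF I_prime] R_zero by blast
        show "\<ominus>\<^bsub>A\<^esub> f \<in> I \<inter> R" if f: "f \<in> I \<inter> R" for f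
        proof -
          have "\<ominus> f \<in> R" "f \<in> carrier K" using f R_minus R_sub by auto
          then have "\<ominus> f \<oplus> f = \<zero>" by (simp add: l_neg)
          then have e: "\<ominus>\<^bsub>A\<^esub> f = \<ominus> f" using A.minus_equality[of "\<ominus> f" f] f \<open>\<ominus> f \<in> R\<close> by simp
          have "\<ominus>\<^bsub>V\<^esub> f \<in> I" using I.a_inv_closed f by blast
          then have "\<ominus> f \<in> I" using V_inv I_ge f by auto
          then show ?thesis using e \<open>\<ominus> f \<in> R\<close> by simp
        qed
        show "f \<oplus>\<^bsub>A\<^esub> g \<in> I \<inter> R" if "f \<in> I \<inter> R" "g \<in> I \<inter> R" for f g
          using that additive_subgroup.a_closed[OF ideal.axioms(1)[OF I.is_ideal], of f g] R_add by simp
      qed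
      show "r \<otimes>\<^bsub>A\<^esub> f \<in> I \<inter> R" if "f \<in> I \<inter> R" "r \<in> carrier A" for f r
        using that I.I_l_closed[of f r] R_ge R_mult by simp
      show "f \<otimes>\<^bsub>A\<^esub> r \<in> I \<inter> R" if "f \<in> I \<inter> R" "r \<in> carrier A" for f r
        using that I.I_r_closed[of f r] R_ge R_mult by simp
    qed
    show "cring A" by (rule A.cring_axioms)
    have "\<one> \<notin> I" using I_proper by (auto simp: mV_eq gt_def)
    then have "\<one> \<in> carrier A" "\<one> \<notin> I \<inter> R" by simp_all
    then show "carrier A \<noteq> I \<inter> R" by metis
    show "f \<in> I \<inter> R \<or> g \<in> I \<inter> R" if fg: "f \<in> carrier A" "g \<in> carrier A" "f \<otimes>\<^bsub>A\<^esub> g \<in> I \<inter> R" for f g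
    proof -
      have fR: "f \<in> R" "g \<in> R" and fgI: "f \<otimes>\<^bsub>V\<^esub> g \<in> I" using fg by simp_all
      have "f \<in> carrier V" "g \<in> carrier V" using R_ge fR by simp_all
      from primeideal.I_prime[OF I_prime this fgI] show ?thesis using fR by blast
    qed
  qed
qed

lemma fraction:
  assumes "f \<in> carrier K" "f \<noteq> \<zero>"
  obtains a b where "a \<in> R" "a \<noteq> \<zero>" "b \<in> R" "b \<noteq> \<zero>" "f = a \<otimes> inv b" "\<nu> f = \<nu> a - \<nu> b"
proof -
  obtain a b where ab: "a \<in> R" "b \<in> R" "b \<noteq> \<zero>" "f = a \<otimes> inv b"
    using quotient assms(1) unfolding quotient_field_def by blast
  have c: "a \<in> carrier K" "b \<in> carrier K" using ab R_sub by auto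
  have "a \<noteq> \<zero>" using ab assms c by auto
  then show thesis using that ab c by simp
qed

section \<open>The case x \<in> I\<close>

context
  assumes xI: "x \<in> I"
begin

lemma I_R_eq_m: "I \<inter> R = m"
proof
  show "I \<inter> R \<subseteq> m" using I_sub_m by blast
  show "m \<subseteq> I \<inter> R"
  proof
    fix f assume f: "f \<in> m"
    have "f \<in> I"
      by (rule I_upward[OF xI x_nz]) (use v_x_min[OF f] in \<open>auto simp: ge_def\<close>)
    then show "f \<in> I \<inter> R" using m_R[OF f] by blast
  qed
qed

lemma all_finv:
  assumes "h \<in> carrier K" "h \<noteq> \<zero>" shows "finv (\<nu> h)"
proof -
  obtain N where "\<nu> h \<le> nat_multiple N (\<nu> x)" using archimedean_in_I[OF xI x_nz assms] .
  then show ?thesis using finv_le finv_nat_multiple[OF finv_x] by blast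
qed

text \<open>If all nbar were finite, the values of R, hence of K, would be commensurable with
  \<nu>(x). Then some power of every element of mV would reach \<nu>(x) and lie in I, so I would be
  mV.\<close>

lemma Omega_finite: "\<exists>i\<ge>1. \<Omega> = enat i \<and> nbar i = \<infinity>"
proof (rule ccontr)
  assume neg: "\<not> ?thesis"
  have fin: "nbar i \<noteq> \<infinity>" if i: "1 \<le> i" "enat i \<le> \<Omega>" for i
  proof
    assume inf: "nbar i = \<infinity>"
    show False using neg i(1) step_inf(1)[OF i inf] inf by metis
  qed
  have comm: "commensurable (\<nu> x) (\<nu> f)" if f: "f \<in> R" "f \<noteq> \<zero>" for f
  proof -
    obtain i s where s: "1 \<le> i" "ok i" "s \<in> NF i" "s \<noteq> \<zero>" "\<nu> s = \<nu> f"
      by (rule representation[OF f all_finv[OF R_sub[OF f(1)] f(2)]])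
    have "\<nu> f \<in> G i" using rational_G[OF s(2) NF_rational[OF s(2-4)]] s(5) by simp
    moreover have "commensurable (\<nu> x) \<gamma>" if \<gamma>: "\<gamma> \<in> \<nu> ` P ` {..<i}" for \<gamma>
    proof -
      obtain k where k: "k < i" "\<gamma> = \<beta> k" using \<gamma> by auto
      have Om: "enat l \<le> \<Omega>" if "l \<le> k" for l using s(2) k(1) that by (simp add: ok_def)
      have "commensurable (\<nu> x) (\<beta> k)" by (rule commensurable_beta) (use Om fin in blast)
      then show ?thesis using k by simp
    qed
    ultimately show ?thesis by (rule commensurable_group_closure[rotated])
  qed
  obtain e where e: "e \<in> mV" "e \<notin> I" using I_proper by blast
  have e0: "e \<noteq> \<zero>" using e(2) V_prime_zero[OF I_prime] by blast
  have ec: "e \<in> carrier K" "0 < \<nu> e" using e(1) e0 by (auto simp: mV_eq gt_def)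
  obtain a b where ab: "a \<in> R" "a \<noteq> \<zero>" "b \<in> R" "b \<noteq> \<zero>" "\<nu> e = \<nu> a - \<nu> b"
    using fraction[OF ec(1) e0] by blast
  have "commensurable (\<nu> x) (\<nu> e)" unfolding ab(5) using ab comm commensurable_diff by blast
  then obtain N k where Nk: "0 < N" "0 < k" "nat_multiple N (\<nu> e) = nat_multiple k (\<nu> x)"
    using commensurable_pos ec(2) by blast
  have "\<nu> x \<le> \<nu> (e [^] N)"
    using ec e0 Nk v_x_pos by (simp add: le_nat_multiple)
  then have eN: "e [^] N \<in> I" using I_upward[OF xI x_nz] ec by auto
  have "e \<in> ge 0" using ec by (simp add: geI)
  then have "e \<in> I" using V_prime_pow[OF I_prime _ eN] by blast
  then show False using e(2) by blast
qed

end

section \<open>The case x \<notin> I\<close>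

context
  assumes xI: "x \<notin> I"
begin

lemma I_iff: "f \<in> carrier K \<Longrightarrow> f \<noteq> \<zero> \<Longrightarrow> f \<in> I \<longleftrightarrow> \<not> finv (\<nu> f)"
proof -
  assume f: "f \<in> carrier K" "f \<noteq> \<zero>"
  have I: "I = beyond (\<nu> x)" by (rule I_contains_beyond[OF R_sub[OF x_R] x_nz xI v_x_pos])
  have "f \<in> I \<longleftrightarrow> (\<forall>N. nat_multiple N (\<nu> x) < \<nu> f)"
    unfolding I using beyond_iff[OF f] v_x_pos by simp
  also have "\<dots> \<longleftrightarrow> \<not> finv (\<nu> f)"
  proof
    assume "\<forall>N. nat_multiple N (\<nu> x) < \<nu> f"
    then show "\<not> finv (\<nu> f)" unfolding finv_def by (meson less_asym)
  next
    assume nf: "\<not> finv (\<nu> f)"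
    show "\<forall>N. nat_multiple N (\<nu> x) < \<nu> f"
    proof
      fix N
      have "nat_multiple N (\<nu> x) < nat_multiple (Suc N) (\<nu> x)" using v_x_pos by simp
      also have "\<dots> \<le> \<nu> f" using nf unfolding finv_def by (meson not_less)
      finally show "nat_multiple N (\<nu> x) < \<nu> f" .
    qed
  qed
  finally show ?thesis .
qed

text \<open>Write an element of I as a/b with a, b \<in> R; since \<nu>(b) \<ge> 0, the numerator
  has at least the same value and lies in I too.\<close>

lemma contraction_nonzero: "I \<inter> R \<noteq> {\<zero>}"
proof -
  obtain f where f: "f \<in> I" "f \<noteq> \<zero>" using I_nonzero by blast
  have fc: "f \<in> carrier K" using I_ge[OF f(1)] ge_carrier by blast
  obtain a b where ab: "a \<in> R" "a \<noteq> \<zero>" "b \<in> R" "b \<noteq> \<zero>" "\<nu> f = \<nu> a - \<nu> b"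
    using fraction[OF fc f(2)] by blast
  have "0 \<le> \<nu> b" using R_ge[OF ab(3)] ab(4) by (simp add: ge_def)
  then have "\<nu> f \<le> \<nu> a" using ab(5) by simp
  then have "a \<in> I" using I_upward[OF f] R_sub[OF ab(1)] by blast
  then show ?thesis using ab by blast
qed

lemma contraction_principal:
  obtains g where "g \<in> I" "g \<in> R" "g \<noteq> \<zero>" "I \<inter> R = PIdl\<^bsub>A\<^esub> g"
proof (rule A.prime_principal[OF contraction_prime])
  show "I \<inter> R \<noteq> {\<zero>\<^bsub>A\<^esub>}" using contraction_nonzero by simp
  show "x \<notin> I \<inter> R" using xI by blast
  fix g assume g: "g \<in> I \<inter> R" "g \<noteq> \<zero>\<^bsub>A\<^esub>" "I \<inter> R = PIdl\<^bsub>A\<^esub> g"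
  have "g \<noteq> \<zero>" using g(2) by simp
  show thesis by (rule that[OF IntD1[OF g(1)] IntD2[OF g(1)] \<open>g \<noteq> \<zero>\<close> g(3)])
qed

lemma contraction_height_one: "height_one_prime A (I \<inter> R)"
proof -
  obtain g where g: "g \<in> I" "g \<in> R" "g \<noteq> \<zero>" "I \<inter> R = PIdl\<^bsub>A\<^esub> g" by (rule contraction_principal)
  show ?thesis
    unfolding g(4)
  proof (rule A.principal_prime_height_one)
    show "primeideal (PIdl\<^bsub>A\<^esub> g) A" using contraction_prime unfolding g(4) .
    show "g \<in> m" by (rule I_sub_m[OF g(1,2)])
    show "g \<noteq> \<zero>\<^bsub>A\<^esub>" using g(3) by simp
  qed
qed

lemma PIdl_A_iff: "g \<in> R \<Longrightarrow> f \<in> PIdl\<^bsub>A\<^esub> g \<longleftrightarrow> (\<exists>c\<in>R. f = g \<otimes> c)"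
  using A.PIdl_iff[of g f] by simp

text \<open>If g = x h, then h \<in> I because x \<notin> I; so h is a multiple of g and x would be
  a unit.\<close>

lemma generator_notin_XR:
  assumes g: "g \<in> I" "g \<in> R" "g \<noteq> \<zero>" "I \<inter> R = PIdl\<^bsub>A\<^esub> g"
  shows "g \<notin> XR"
proof
  assume "g \<in> XR"
  then obtain h where h: "h \<in> R" "g = x \<otimes> h" by (auto simp: XR_def)
  have "h \<in> I" using primeideal.I_prime[OF I_prime, of x h] g h xI x_R R_ge by auto
  then obtain c where c: "c \<in> R" "h = g \<otimes> c" using g h PIdl_A_iff by blast
  have cc: "x \<in> carrier K" "c \<in> carrier K" "g \<in> carrier K" using x_R c g R_sub by auto
  have "g \<otimes> \<one> = x \<otimes> (g \<otimes> c)" using h(2) c(2) cc by simp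
  also have "\<dots> = g \<otimes> (x \<otimes> c)" using cc by (simp add: m_lcomm)
  finally have "\<one> = x \<otimes> c"
    by (rule iffD1[OF m_lcancel[OF g(3) cc(3) one_closed m_closed[OF cc(1,2)]]])
  then show False using one_notin_XR c by (auto simp: XR_def)
qed

lemma high_value:
  assumes g: "g \<in> I" "g \<in> R" and s: "s \<in> carrier K" "s \<noteq> \<zero>" and r: "r \<in> ge (nat_multiple M (\<nu> x))" "g = s \<oplus> r"
  shows "nat_multiple M (\<nu> x) \<le> \<nu> s"
proof -
  have c: "g \<in> carrier K" "r \<in> carrier K" using R_sub[OF g(2)] ge_carrier[OF r(1)] by auto
  have "g \<in> ge (nat_multiple M (\<nu> x))"
  proof (cases "g = \<zero>")
    case False
    then have "\<not> finv (\<nu> g)" using I_iff g c by blast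
    then have "nat_multiple M (\<nu> x) \<le> \<nu> g" unfolding finv_def by (meson not_less)
    then show ?thesis using c by (intro geI)
  qed simp
  then have "g \<ominus> r \<in> ge (nat_multiple M (\<nu> x))" using r(1) by (rule ge_diff)
  moreover have "g \<ominus> r = s" unfolding r(2) using c s by algebra
  ultimately show ?thesis using s by (simp add: ge_def)
qed

text \<open>Suppose \<nu>(P_r) is bounded by a multiple of \<nu>(x). Since g has finite order in y
  modulo x, its expansion in powers of P_r has a coefficient outside xR at some exponent below e.
  This bounds the value of the approximation independently of its precision.\<close>

lemma last_in_I:
  assumes Om: "\<Omega> = enat r"
  shows "P r \<in> I"
proof (rule ccontr)
  assume nI: "P r \<notin> I"
  have r: "1 \<le> r" "enat r \<le> \<Omega>" using Omega_ge Om by (auto simp: one_enat_def)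
  have Pr: "P r \<in> R" "P r \<in> carrier K" "P r \<noteq> \<zero>" using P_R P_nz P_carrier r by auto
  have fr: "finv (\<beta> r)" using nI I_iff Pr by blast
  obtain g where g: "g \<in> I" "g \<in> R" "g \<noteq> \<zero>" "I \<inter> R = PIdl\<^bsub>A\<^esub> g" by (rule contraction_principal)
  have gX: "g \<notin> XR" by (rule generator_notin_XR[OF g])
  obtain e where e: "g \<notin> XZ (y [^] (e::nat))" by (rule notin_XZ_y_power[OF g(2) gX])
  have "finv (\<beta> k)" if "k < r" for k using that Om by (intro finv_beta_lt) simp
  then obtain \<gamma> where \<gamma>: "finv \<gamma>" "\<And>s. s \<in> NF r \<Longrightarrow> s \<notin> XR \<Longrightarrow> s \<noteq> \<zero> \<and> \<nu> s \<le> \<gamma>"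
    using NF_finv_bound[OF r] by blast
  have "finv (\<gamma> + nat_multiple e (\<beta> r))" using \<gamma>(1) fr by (intro finv_add finv_nat_multiple)
  then obtain M where M: "\<gamma> + nat_multiple e (\<beta> r) < nat_multiple M (\<nu> x)" by (auto simp: finv_def)
  \<comment> \<open>B \<ge> M makes the error large. B > e keeps the cut-off power of P_r inside the
    ideal of x and the e-th power of P_r, and in particular x^B is divisible by x.\<close>
  define B where "B = max (Suc e) M"
  obtain s u v where s: "\<And>b. b < B \<Longrightarrow> s b \<in> NF r" "u \<in> R" "v \<in> R"
    "g = (\<Oplus>b\<in>{..<B}. s b \<otimes> P r [^] b) \<oplus> x [^] B \<otimes> u \<oplus> P r [^] B \<otimes> v"
    using expand[OF r g(2), of B B] by blast
  have okr: "ok r" using ok_Suc[of r] r ok_le[of "Suc r" r] by simp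
  have sR: "s b \<in> R" if "b < B" for b using NF_R[OF okr s(1)[OF that]] .
  let ?z = "P r [^] e"
  have zR: "?z \<in> R" using Pr R_pow by blast
  define t where "t = (\<Oplus>b\<in>{..<B}. s b \<otimes> P r [^] b)"
  have tc: "t \<in> carrier K" unfolding t_def using sR R_sub Pr by (intro finsum_closed) auto
  have zy: "?z \<in> XZ (y [^] e)" using XZ_pow[OF y_R, of "P r" e] P_XZ[of 1 r] r by simp
  have PB: "P r [^] b \<in> XZ ?z" if "e \<le> b" for b
    using XZ_mult[OF zR z_XZ[OF zR] R_pow[OF Pr(1), of "b - e"]] that Pr by (simp add: nat_pow_mult)
  have xB: "x [^] B \<otimes> u \<in> XZ ?z"
  proof -
    have "x [^] B = x \<otimes> x [^] (B - 1)" using R_sub[OF x_R] by (cases B) (auto simp: B_def m_comm)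
    then have "x [^] B \<otimes> u = x \<otimes> (x [^] (B - 1) \<otimes> u)" using x_R s(2) R_sub by (simp add: m_assoc)
    then have "x [^] B \<otimes> u \<in> XR" using s(2) x_R unfolding XR_def by (auto intro: R_mult R_pow)
    then show ?thesis by (rule XR_XZ[OF zR])
  qed
  have PvB: "P r [^] B \<otimes> v \<in> XZ ?z"
    using XZ_mult[OF zR PB[of B] s(3)] s(3) Pr R_sub by (simp add: B_def m_comm)
  obtain b where b: "b < e" "b < B" "s b \<notin> XR"
  proof (rule ccontr)
    assume "\<not> thesis"
    then have low: "s b \<in> XR" if "b < e" "b < B" for b using that \<open>\<And>b. b < e \<Longrightarrow> b < B \<Longrightarrow> s b \<notin> XR \<Longrightarrow> thesis\<close> by blast
    have tm: "s b \<otimes> P r [^] b \<in> XZ ?z" if "b < B" for b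
    proof (cases "b < e")
      case True
      then show ?thesis using low that Pr by (intro XR_XZ[OF zR] XR_mult R_pow) auto
    next
      case False
      then show ?thesis using XZ_mult[OF zR PB[of b] sR[OF that]] by simp
    qed
    have "(\<Oplus>b\<in>{..<C}. s b \<otimes> P r [^] b) \<in> XZ ?z" if "C \<le> B" for C
      using that
    proof (induction C)
      case (Suc C)
      have "(\<Oplus>b\<in>{..<Suc C}. s b \<otimes> P r [^] b) = s C \<otimes> P r [^] C \<oplus> (\<Oplus>b\<in>{..<C}. s b \<otimes> P r [^] b)"
        using Suc.prems sR Pr R_sub by (intro finsum_lessThan_Suc) auto
      then show ?case using Suc tm[of C] XZ_add[OF zR] by simp
    qed (simp add: XR_XZ[OF zR XR_zero])
    then have "t \<in> XZ ?z" by (simp add: t_def)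
    then have "g \<in> XZ ?z" unfolding s(4) using xB PvB XZ_add[OF zR] by (simp add: t_def)
    then show False using e XZ_trans[OF zy R_pow[OF y_R]] by blast
  qed
  have sb: "s b \<noteq> \<zero>" "\<nu> (s b) \<le> \<gamma>" using \<gamma>(2)[OF s(1)[OF b(2)] b(3)] by auto
  have nB: "enat B \<le> n r" using n_Omega[OF Om] by simp
  have t: "t \<noteq> \<zero>" "\<nu> t \<le> \<nu> (s b) + nat_multiple b (\<beta> r)"
    using NF_sum_le[OF r s(1) nB t_def b(2) sb(1)] by auto
  have "\<nu> t \<le> \<gamma> + nat_multiple e (\<beta> r)"
    using t(2) sb(2) nat_multiple_mono[of "\<beta> r" b e] beta_pos[OF r(2)] b(1)
    by (meson add_mono order_trans order_less_imp_le)
  then have lt: "\<nu> t < nat_multiple M (\<nu> x)" using M by simp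
  have mB: "nat_multiple M (\<nu> x) \<le> nat_multiple B (\<nu> x)"
    using v_x_pos by (intro nat_multiple_mono) (auto simp: B_def)
  have rem: "x [^] B \<otimes> u \<oplus> P r [^] B \<otimes> v \<in> ge (nat_multiple M (\<nu> x))"
    using mB nat_multiple_mono_right[OF beta_ge[OF r(2)], of B]
    by (intro remainder_ge[OF r s(2,3)]) (auto intro: order_trans)
  have "g = t \<oplus> (x [^] B \<otimes> u \<oplus> P r [^] B \<otimes> v)"
    using s(4) tc Pr s(2,3) x_R R_sub by (simp add: a_assoc t_def)
  then have "nat_multiple M (\<nu> x) \<le> \<nu> t" by (rule high_value[OF g(1,2) tc t(1) rem])
  then show False using lt by simp
qed

text \<open>Write P_r = g c. If c were in m, g would not lie in the ideal of x and P_r: otherwise g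
  times the unit 1 - c b would lie in xR. The normal form approximating g would then be outside xR
  and of bounded value, while the error is large because \<nu>(P_r) exceeds all multiples of
  \<nu>(x).\<close>

lemma last_generates:
  assumes Om: "\<Omega> = enat r"
  shows "I \<inter> R = PIdl\<^bsub>A\<^esub> (P r)"
proof -
  have r: "1 \<le> r" "enat r \<le> \<Omega>" using Omega_ge Om by (auto simp: one_enat_def)
  have Pr: "P r \<in> R" "P r \<in> carrier K" "P r \<noteq> \<zero>" using P_R P_nz P_carrier r by auto
  have PI: "P r \<in> I" by (rule last_in_I[OF Om])
  obtain g where g: "g \<in> I" "g \<in> R" "g \<noteq> \<zero>" "I \<inter> R = PIdl\<^bsub>A\<^esub> g" by (rule contraction_principal)
  have gX: "g \<notin> XR" by (rule generator_notin_XR[OF g])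
  obtain c where c: "c \<in> R" "P r = g \<otimes> c" using g PI Pr PIdl_A_iff by blast
  have gc: "g \<in> carrier K" "c \<in> carrier K" "x \<in> carrier K" using g c x_R R_sub by auto
  have "c \<notin> m"
  proof
    assume cm: "c \<in> m"
    have gXZ: "g \<notin> XZ (P r)"
    proof
      assume "g \<in> XZ (P r)"
      then obtain a b where ab: "a \<in> R" "b \<in> R" "g = x \<otimes> a \<oplus> P r \<otimes> b" by (rule XZ_E)
      have abc: "a \<in> carrier K" "b \<in> carrier K" using ab R_sub by auto
      have "g \<otimes> (\<one> \<ominus> c \<otimes> b) = g \<ominus> g \<otimes> c \<otimes> b" using gc abc by algebra
      also have "\<dots> = (x \<otimes> a \<oplus> P r \<otimes> b) \<ominus> P r \<otimes> b" using ab(3) c(2) by simp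
      also have "\<dots> = x \<otimes> a" using gc abc Pr by algebra
      finally have "g \<otimes> (\<one> \<ominus> c \<otimes> b) \<in> XR" using ab by (auto simp: XR_def)
      moreover have uR: "\<one> \<ominus> c \<otimes> b \<in> R" using c ab by (simp add: R_diff R_mult)
      ultimately have "\<one> \<ominus> c \<otimes> b \<in> XR" using XR_prime[OF g(2)] gX by blast
      then have "\<one> \<ominus> c \<otimes> b \<in> gt 0"
        using gt_mult[OF gtI[OF R_sub[OF x_R] v_x_pos] R_ge] by (auto simp: XR_def)
      moreover have "c \<otimes> b \<in> gt 0" using gt_mult[OF _ R_ge[OF ab(2)], of c 0] m_iff[OF c(1)] cm by simp
      ultimately have "(\<one> \<ominus> c \<otimes> b) \<oplus> c \<otimes> b \<in> gt 0" by (rule gt_add)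
      moreover have "(\<one> \<ominus> c \<otimes> b) \<oplus> c \<otimes> b = \<one>" using gc abc by algebra
      ultimately show False by (simp add: gt_def)
    qed
    have "finv (\<beta> k)" if "k < r" for k using that Om by (intro finv_beta_lt) simp
    then obtain \<gamma> where \<gamma>: "finv \<gamma>" "\<And>s. s \<in> NF r \<Longrightarrow> s \<notin> XR \<Longrightarrow> s \<noteq> \<zero> \<and> \<nu> s \<le> \<gamma>"
      using NF_finv_bound[OF r] by blast
    obtain M where M: "\<gamma> < nat_multiple M (\<nu> x)" using \<gamma>(1) by (auto simp: finv_def)
    \<comment> \<open>The exponent \<open>Suc M\<close> splits off a factor x, so the error term
      from x visibly lies in xR.\<close>
    obtain s u v where s: "s \<in> NF r" "u \<in> R" "v \<in> R" "g = s \<oplus> x [^] Suc M \<otimes> u \<oplus> P r \<otimes> v"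
      using expand_x[OF r g(2), of "Suc M"] by blast
    have okr: "ok r" using ok_Suc[of r] r ok_le[of "Suc r" r] by simp
    have sc: "s \<in> carrier K" using NF_R[OF okr s(1)] R_sub by blast
    have xu: "x [^] Suc M \<otimes> u = x \<otimes> (x [^] M \<otimes> u)" using gc s(2) R_sub by (simp add: m_ac)
    have "s \<notin> XR"
    proof
      assume "s \<in> XR"
      moreover have "x [^] Suc M \<otimes> u \<in> XR" unfolding xu XR_def using s(2) x_R by (auto intro: R_mult R_pow)
      ultimately have "s \<oplus> x [^] Suc M \<otimes> u \<in> XR" by (rule XR_add)
      then obtain w where w: "w \<in> R" "s \<oplus> x [^] Suc M \<otimes> u = x \<otimes> w" by (auto simp: XR_def)
      then have "g = x \<otimes> w \<oplus> P r \<otimes> v" using s(4) by simp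
      then show False using gXZ XZ_I[OF w(1) s(3)] by simp
    qed
    then have sv: "s \<noteq> \<zero>" "\<nu> s < nat_multiple M (\<nu> x)" using \<gamma>(2)[OF s(1)] M by auto
    have "\<not> finv (\<beta> r)" using I_iff PI Pr by blast
    then have "nat_multiple M (\<nu> x) \<le> \<beta> r" unfolding finv_def by (meson not_less)
    then have "x [^] Suc M \<otimes> u \<oplus> P r [^] (1::nat) \<otimes> v \<in> ge (nat_multiple M (\<nu> x))"
      using v_x_pos by (intro remainder_ge[OF r s(2,3)]) (auto simp: order_less_imp_le)
    then have rem: "x [^] Suc M \<otimes> u \<oplus> P r \<otimes> v \<in> ge (nat_multiple M (\<nu> x))" using Pr by simp
    have "x [^] Suc M \<otimes> u \<in> carrier K" "P r \<otimes> v \<in> carrier K" using gc Pr s(2,3) R_sub by auto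
    then have "g = s \<oplus> (x [^] Suc M \<otimes> u \<oplus> P r \<otimes> v)" using s(4) sc by (simp only: a_assoc)
    then have "nat_multiple M (\<nu> x) \<le> \<nu> s" by (rule high_value[OF g(1,2) sc sv(1) rem])
    then show False using sv(2) by simp
  qed
  then have cv: "c \<noteq> \<zero>" "\<nu> c = 0" using m_iff[OF c(1)] R_ge[OF c(1)] exact_iff[OF gc(2), of 0] by auto
  have icR: "inv c \<in> R" by (rule unit_inv[OF c(1) cv])
  have gP: "g = P r \<otimes> inv c" unfolding c(2) using gc cv by (simp add: m_assoc)
  show ?thesis
    unfolding g(4)
  proof (rule Set.set_eqI)
    fix f
    show "f \<in> PIdl\<^bsub>A\<^esub> g \<longleftrightarrow> f \<in> PIdl\<^bsub>A\<^esub> (P r)"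
      unfolding PIdl_A_iff[OF g(2)] PIdl_A_iff[OF Pr(1)]
    proof
      assume "\<exists>a\<in>R. f = g \<otimes> a"
      then obtain a where a: "a \<in> R" "f = g \<otimes> a" by blast
      have "f = P r \<otimes> (inv c \<otimes> a)" unfolding a(2) gP using Pr icR a R_sub by (simp add: m_assoc)
      then show "\<exists>a\<in>R. f = P r \<otimes> a" using R_mult[OF icR a(1)] by blast
    next
      assume "\<exists>a\<in>R. f = P r \<otimes> a"
      then obtain a where a: "a \<in> R" "f = P r \<otimes> a" by blast
      have "f = g \<otimes> (c \<otimes> a)" unfolding a(2) c(2) using gc a R_sub by (simp add: m_assoc)
      then show "\<exists>a\<in>R. f = g \<otimes> a" using R_mult[OF c(1) a(1)] by blast
    qed
  qed
qed

text \<open>Infinitely many n_i > 1 would make the order in y modulo x of some P_r0 exceed that of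
  g. Normal forms approximating g at later levels would then lie outside the ideal of x and P_r0,
  with values below \<nu>(P_r0), however precise they are.\<close>

lemma finite_generators:
  assumes Om: "\<Omega> = \<infinity>"
  shows "finite {i. 1 \<le> i \<and> 1 < n i}"
proof (rule ccontr)
  assume inf: "infinite {i. 1 \<le> i \<and> 1 < n i}"
  have Om': "enat i \<le> \<Omega>" "enat i < \<Omega>" for i using Om by auto
  obtain g where g: "g \<in> I" "g \<in> R" "g \<noteq> \<zero>" "I \<inter> R = PIdl\<^bsub>A\<^esub> g" by (rule contraction_principal)
  have gX: "g \<notin> XR" by (rule generator_notin_XR[OF g])
  obtain e where e: "g \<notin> XZ (y [^] (e::nat))" by (rule notin_XZ_y_power[OF g(2) gX])
  obtain r0 where r0: "r0 \<ge> 1" "P r0 \<in> XZ (y [^] e)" using P_XZ_y_power[OF Om inf] by blast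
  have P0: "P r0 \<in> R" by (rule P_R[OF Om'(1)])
  have gXZ: "g \<notin> XZ (P r0)" using e XZ_trans[OF r0(2) R_pow[OF y_R]] by blast
  have "finv (\<beta> r0)" by (rule finv_beta_lt[OF Om'(2)])
  then obtain M where M: "\<beta> r0 < nat_multiple M (\<nu> x)" by (auto simp: finv_def)
  obtain r where r: "r \<ge> 1" "nat_multiple M (\<nu> x) \<le> \<beta> r" using beta_unbounded[OF Om] by blast
  have rr0: "r0 \<le> r"
  proof (rule ccontr)
    assume "\<not> r0 \<le> r"
    then have "\<beta> r < \<beta> r0" using beta_mono[OF r(1) _ Om'(1)] by simp
    then show False using M r(2) by simp
  qed
  obtain s u v where s: "s \<in> NF r" "u \<in> R" "v \<in> R" "g = s \<oplus> x [^] Suc M \<otimes> u \<oplus> P r \<otimes> v"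
    using expand_x[OF r(1) Om'(1) g(2), of "Suc M"] by blast
  have okr: "ok r" unfolding ok_def using Om' by blast
  have sc: "s \<in> carrier K" using NF_R[OF okr s(1)] R_sub by blast
  have c: "x \<in> carrier K" "u \<in> carrier K" "v \<in> carrier K" "P r \<in> carrier K"
    using x_R s R_sub P_carrier[OF Om'(1)] by auto
  have xu: "x [^] Suc M \<otimes> u = x \<otimes> (x [^] M \<otimes> u)" using c by (simp add: m_ac)
  have "s \<notin> XZ (P r0)"
  proof
    assume sX: "s \<in> XZ (P r0)"
    have "x [^] Suc M \<otimes> u \<in> XR" unfolding xu XR_def using s(2) x_R by (auto intro: R_mult R_pow)
    then have 1: "x [^] Suc M \<otimes> u \<in> XZ (P r0)" by (rule XR_XZ[OF P0])
    have 2: "P r \<otimes> v \<in> XZ (P r0)"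
      using XZ_mult[OF P0 P_XZ[OF r0(1) rr0 Om'(1)] s(3)] c by (simp add: m_comm)
    have "g \<in> XZ (P r0)" unfolding s(4) by (intro XZ_add[OF P0] sX 1 2)
    then show False using gXZ by blast
  qed
  then have sv: "s \<noteq> \<zero>" "\<nu> s < \<beta> r0" using NF_notin_XZ_lt[OF r0(1) rr0 Om'(1) s(1)] by auto
  have "x [^] Suc M \<otimes> u \<oplus> P r [^] (1::nat) \<otimes> v \<in> ge (nat_multiple M (\<nu> x))"
    using v_x_pos r(2) by (intro remainder_ge[OF r(1) Om'(1) s(2,3)]) (auto simp: order_less_imp_le)
  then have rem: "x [^] Suc M \<otimes> u \<oplus> P r \<otimes> v \<in> ge (nat_multiple M (\<nu> x))" using c by simp
  have "x [^] Suc M \<otimes> u \<in> carrier K" "P r \<otimes> v \<in> carrier K" using c by auto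
  then have "g = s \<oplus> (x [^] Suc M \<otimes> u \<oplus> P r \<otimes> v)" using s(4) sc by (simp only: a_assoc)
  then have "nat_multiple M (\<nu> x) \<le> \<nu> s" by (rule high_value[OF g(1,2) sc sv(1) rem])
  then show False using sv(2) M by simp
qed

text \<open>After all factors g are taken out, the rest is outside gR = I \<inter> R, hence of value
  bounded by a multiple of \<nu>(x).\<close>

lemma decompose:
  assumes g: "g \<in> R" "g \<noteq> \<zero>" "I \<inter> R = PIdl\<^bsub>A\<^esub> g" and f: "f \<in> R" "f \<noteq> \<zero>"
  obtains k f' where "f' \<in> R" "f' \<noteq> \<zero>" "finv (\<nu> f')" "f = g [^] (k::nat) \<otimes> f'"
proof -
  have "g \<in> PIdl\<^bsub>A\<^esub> g" using A.cgenideal_self[of g] g(1) by simp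
  then have gm: "g \<in> m" using g(3) I_sub_m by blast
  have "\<exists>(k::nat) f'. f' \<in> R \<and> f = g [^] k \<otimes> f' \<and> f' \<notin> PIdl\<^bsub>A\<^esub> g"
    by (rule A.factor_out[of f g]) (use f g gm in auto)
  then obtain k f' where k: "f' \<in> R" "f = g [^] (k::nat) \<otimes> f'" "f' \<notin> PIdl\<^bsub>A\<^esub> g" by blast
  have "f' \<noteq> \<zero>" using k f g R_sub by auto
  moreover have "f' \<notin> I" using k g(3) by blast
  ultimately show thesis using that k I_iff R_sub by blast
qed

text \<open>Numerator and denominator contain the same power of g, because one surplus factor g
  outweighs every bounded value; it cancels. Residues can therefore be computed from elements that
  normal forms approximate.\<close>

lemma unit_fraction:
  assumes "f \<in> carrier K" "f \<noteq> \<zero>" "\<nu> f = 0"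
  obtains a b where "a \<in> R" "a \<noteq> \<zero>" "finv (\<nu> a)" "b \<in> R" "b \<noteq> \<zero>" "finv (\<nu> b)" "f = a \<otimes> inv b"
proof -
  obtain g where g: "g \<in> I" "g \<in> R" "g \<noteq> \<zero>" "I \<inter> R = PIdl\<^bsub>A\<^esub> g" by (rule contraction_principal)
  have gnf: "\<not> finv (\<nu> g)" using I_iff g R_sub by blast
  have gpos: "0 \<le> \<nu> g" using R_ge[OF g(2)] g(3) by (simp add: ge_def)
  obtain a b where ab: "a \<in> R" "a \<noteq> \<zero>" "b \<in> R" "b \<noteq> \<zero>" "f = a \<otimes> inv b" "\<nu> f = \<nu> a - \<nu> b"
    using fraction[OF assms(1,2)] by blast
  obtain k a' where a': "a' \<in> R" "a' \<noteq> \<zero>" "finv (\<nu> a')" "a = g [^] (k::nat) \<otimes> a'"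
    using decompose[OF g(2-4) ab(1,2)] by blast
  obtain l b' where b': "b' \<in> R" "b' \<noteq> \<zero>" "finv (\<nu> b')" "b = g [^] (l::nat) \<otimes> b'"
    using decompose[OF g(2-4) ab(3,4)] by blast
  have c: "g \<in> carrier K" "a' \<in> carrier K" "b' \<in> carrier K" using g a' b' R_sub by auto
  have v: "nat_multiple k (\<nu> g) + \<nu> a' = nat_multiple l (\<nu> g) + \<nu> b'"
    using ab(6) assms(3) a' b' g(3) c by simp
  \<comment> \<open>Stated with fresh variables because it is applied with the roles of numerator
    and denominator exchanged as well.\<close>
  have less: False
    if kl: "l < k" and v: "nat_multiple k (\<nu> g) + \<nu> a' = nat_multiple l (\<nu> g) + \<nu> b'"
      and a': "a' \<in> R" "a' \<noteq> \<zero>" and b': "finv (\<nu> b')" for k l a' b'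
  proof -
    obtain j where j: "k = Suc j + l" using kl by (metis add.commute add_Suc_right less_imp_Suc_add)
    have "\<nu> g + (nat_multiple j (\<nu> g) + \<nu> a') = \<nu> b'" using v unfolding j nat_multiple_add by (simp add: algebra_simps)
    moreover have "0 \<le> nat_multiple j (\<nu> g)" using gpos by (rule nat_multiple_nonneg)
    moreover have "0 \<le> \<nu> a'" using R_ge[OF a'(1)] a'(2) by (simp add: ge_def)
    ultimately have "\<nu> g \<le> \<nu> b'" by (metis add_nonneg_nonneg le_add_same_cancel1)
    then show False using finv_le b' gnf by blast
  qed
  have "k = l" using less[OF _ v a'(1,2) b'(3)] less[OF _ v[symmetric] b'(1,2) a'(3)] by (meson linorder_neqE_nat)
  have "f = a' \<otimes> inv b'"
  proof -
    have cc: "inv (g [^] l) \<in> carrier K" "inv b' \<in> carrier K" "g [^] l \<in> carrier K" using c g b' by auto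
    have "f = (g [^] l \<otimes> a') \<otimes> (inv (g [^] l) \<otimes> inv b')"
      unfolding ab(5) a'(4) b'(4) \<open>k = l\<close> using c g(3) b'(2) by (simp add: inv_mult)
    also have "\<dots> = (g [^] l \<otimes> inv (g [^] l)) \<otimes> (a' \<otimes> inv b')" using c(2) cc by algebra
    finally show ?thesis using c g(3) b'(2) by simp
  qed
  then show thesis using that a' b' by blast
qed

end

end

section \<open>The value semigroup and the residue field\<close>

lemma nat_combinations_zero: "0 \<in> nat_combinations E"
  unfolding nat_combinations_def by (intro CollectI exI[of _ "{#}"]) simp

lemma nat_combinations_base: "e \<in> E \<Longrightarrow> e \<in> nat_combinations E"
  unfolding nat_combinations_def by (intro CollectI exI[of _ "{#e#}"]) simp

lemma nat_combinations_add: "a \<in> nat_combinations E \<Longrightarrow> b \<in> nat_combinations E \<Longrightarrow> a + b \<in> nat_combinations E"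
proof -
  assume "a \<in> nat_combinations E" "b \<in> nat_combinations E"
  then obtain M N where "a = \<Sum>\<^sub># M" "set_mset M \<subseteq> E" "b = \<Sum>\<^sub># N" "set_mset N \<subseteq> E"
    unfolding nat_combinations_def by blast
  then show ?thesis unfolding nat_combinations_def by (intro CollectI exI[of _ "M + N"]) auto
qed

lemma nat_combinations_nat_multiple: "a \<in> nat_combinations E \<Longrightarrow> nat_multiple e a \<in> nat_combinations E"
  by (induction e) (auto intro: nat_combinations_zero nat_combinations_add)

lemma nat_combinations_sum: "(\<And>i. i \<in> S \<Longrightarrow> f i \<in> nat_combinations E) \<Longrightarrow> sum f S \<in> nat_combinations E"
  by (induction S rule: infinite_finite_induct) (auto intro: nat_combinations_zero nat_combinations_add)

lemma nat_combinations_subset: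
  assumes "E \<subseteq> T" "0 \<in> T" "\<And>a b. a \<in> T \<Longrightarrow> b \<in> T \<Longrightarrow> a + b \<in> T"
  shows "nat_combinations E \<subseteq> T"
proof
  fix a assume "a \<in> nat_combinations E"
  then obtain M where M: "a = \<Sum>\<^sub># M" "set_mset M \<subseteq> E" unfolding nat_combinations_def by blast
  have "set_mset M \<subseteq> E \<Longrightarrow> \<Sum>\<^sub># M \<in> T"
    by (induction M) (use assms in auto)
  then show "a \<in> T" using M by blast
qed

lemma nat_combinations_mono: "E \<subseteq> E' \<Longrightarrow> nat_combinations E \<subseteq> nat_combinations E'"
  unfolding nat_combinations_def by blast

text \<open>For a monotone closure operator only the subsets missing a single element matter.\<close>

lemma minimally_generatesI:
  assumes "gen E = A" "\<And>E E'. E \<subseteq> E' \<Longrightarrow> gen E \<subseteq> gen E'"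
    and "\<And>e. e \<in> E \<Longrightarrow> gen (E - {e}) \<noteq> A"
  shows "minimally_generates gen E A"
  unfolding minimally_generates_def
proof (intro conjI allI impI)
  fix E' assume E': "E' \<subset> E"
  then obtain e where e: "e \<in> E" "e \<notin> E'" by blast
  have "gen E' \<subseteq> gen (E - {e})" "gen (E - {e}) \<subseteq> gen E" using E' e by (intro assms(2); blast)+
  then show "gen E' \<noteq> A" using assms(1) assms(3)[OF e(1)] by blast
qed (rule assms(1))

context generating_sequence
begin

definition J :: "nat set" where "J = {i. 1 \<le> i \<and> enat i \<le> \<Omega>}"

definition VG :: "'g set" where "VG = {\<nu> x} \<union> {\<beta> i | i. i \<in> J \<and> 1 < nbar i}"

lemma J_D: "i \<in> J \<Longrightarrow> 1 \<le> i \<and> enat i \<le> \<Omega>"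
  by (simp add: J_def)

lemma nbar_ge_1: "i \<in> J \<Longrightarrow> nbar i \<noteq> 0"
  using J_D nbar_fin(1) by (metis bot_nat_0.not_eq_extremum zero_enat_def)

lemma nbar_le_n: "i \<in> J \<Longrightarrow> nbar i \<le> n i"
proof -
  assume i: "i \<in> J"
  have "nbar i * 1 \<le> nbar i * d i" using d_pos[of i] J_D[OF i] by (intro mult_left_mono) auto
  then show ?thesis using n_eq[of i] J_D[OF i] by simp
qed

lemma nbar_le_1: "i \<in> J \<Longrightarrow> \<not> 1 < nbar i \<Longrightarrow> nbar i = enat 1"
  using nbar_ge_1[of i] by (cases "nbar i") (auto simp: one_enat_def zero_enat_def)

text \<open>If nbar_i = 1, then \<nu>(P_i) = \<nu>(U_i) is a combination of earlier values; this is
  why such indices are missing from \<open>VG\<close>.\<close>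

lemma beta_combination: "enat i \<le> \<Omega> \<Longrightarrow> \<beta> i \<in> nat_combinations VG"
proof (induction i rule: less_induct)
  case (less i)
  show ?case
  proof (cases "i = 0")
    case True
    then show ?thesis by (auto intro: nat_combinations_base simp: VG_def)
  next
    case False
    then have iJ: "i \<in> J" using less.prems by (simp add: J_def)
    have i: "1 \<le> i" "enat i \<le> \<Omega>" using J_D[OF iJ] by auto
    show ?thesis
    proof (cases "1 < nbar i")
      case True
      then show ?thesis using iJ by (auto intro!: nat_combinations_base simp: VG_def)
    next
      case False
      have N: "nbar i = enat 1" by (rule nbar_le_1[OF iJ False])
      obtain w U where U: "U = monomial K P i w" "\<nu> U = nat_multiple 1 (\<beta> i)"
        by (rule step_fin[OF i N]) blast
      have Om: "enat k \<le> \<Omega>" if "k < i" for k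
        using that i(2) by (meson enat_ord_simps(2) less_imp_le order_trans)
      have "\<beta> i = (\<Sum>k<i. nat_multiple (w k) (\<beta> k))"
        using monomial_props[of i w] P_R P_nz Om U by simp
      also have "\<dots> \<in> nat_combinations VG"
        using less.IH Om by (intro nat_combinations_sum nat_combinations_nat_multiple) auto
      finally show ?thesis .
    qed
  qed
qed

text \<open>As nothing cancels, the value of a normal form is the value of one of its terms.\<close>

lemma NF_combination: "1 \<le> i \<Longrightarrow> ok i \<Longrightarrow> s \<in> NF i \<Longrightarrow> s \<noteq> \<zero> \<Longrightarrow> \<nu> s \<in> nat_combinations VG"
proof (induction i arbitrary: s rule: dec_induct)
  case base
  obtain u a where u: "s = u \<otimes> x [^] (a::nat)" "u \<in> R" "u \<noteq> \<zero>" "\<nu> u = 0"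
    using base(2,3) unfolding One_nat_def NF.simps by blast
  have "\<nu> s = nat_multiple a (\<beta> 0)" using u x_R x_nz R_sub by simp
  then show ?case using beta_combination[of 0] nat_combinations_nat_multiple by (simp add: enat_0)
next
  case (step i)
  have le: "enat i \<le> \<Omega>" using step.prems(1) ok_Suc by blast
  have oki: "ok i" by (rule ok_le[OF step.prems(1)]) simp
  obtain t B where t: "s = (\<Oplus>b\<in>{..<B}. t b \<otimes> P i [^] b)" "\<And>b. b < B \<Longrightarrow> t b \<in> NF i" "enat B \<le> n i"
    using NF_SucE[OF step.prems(2) step.hyps(1)] by blast
  obtain b where b: "b < B" "t b \<noteq> \<zero>" "\<nu> s = \<nu> (t b) + nat_multiple b (\<beta> i)"
    using NF_sum_props[OF step.hyps(1) le t(2,3,1) step.prems(3)] by blast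
  show ?case unfolding b(3)
    using step.IH[OF oki t(2)[OF b(1)] b(2)] beta_combination[OF le]
    by (intro nat_combinations_add nat_combinations_nat_multiple)
qed

lemma finv_combination:
  assumes "f \<in> R" "f \<noteq> \<zero>" "finv (\<nu> f)" shows "\<nu> f \<in> nat_combinations VG"
proof -
  obtain i s where s: "1 \<le> i" "ok i" "s \<in> NF i" "s \<noteq> \<zero>" "\<nu> s = \<nu> f" by (rule representation[OF assms])
  then show ?thesis using NF_combination[OF s(1-4)] by simp
qed

lemma value_semigroup_add: "a \<in> value_semigroup K \<nu> R \<Longrightarrow> b \<in> value_semigroup K \<nu> R \<Longrightarrow> a + b \<in> value_semigroup K \<nu> R"
proof -
  assume "a \<in> value_semigroup K \<nu> R" "b \<in> value_semigroup K \<nu> R"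
  then obtain f g where "f \<in> R" "f \<noteq> \<zero>" "a = \<nu> f" "g \<in> R" "g \<noteq> \<zero>" "b = \<nu> g"
    unfolding value_semigroup_def by blast
  then show ?thesis unfolding value_semigroup_def
    using R_sub by (intro image_eqI[of _ _ "f \<otimes> g"]) (auto simp: R_mult integral_iff)
qed

text \<open>One statement for all cases: h is x, the last element of the sequence, or g, and H is
  empty or consists of \<nu>(g).\<close>

lemma value_semigroup_generated:
  assumes h: "H \<subseteq> {\<nu> h}" "h \<in> R" "h \<noteq> \<zero>" "\<nu> h \<in> nat_combinations (VG \<union> H)"
    and dec: "\<And>f. f \<in> R \<Longrightarrow> f \<noteq> \<zero> \<Longrightarrow> \<exists>k f'. f' \<in> R \<and> f' \<noteq> \<zero> \<and> finv (\<nu> f') \<and> f = h [^] (k::nat) \<otimes> f'"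
  shows "nat_combinations (VG \<union> H) = value_semigroup K \<nu> R"
proof
  have "\<beta> i \<in> value_semigroup K \<nu> R" if "enat i \<le> \<Omega>" for i
    using P_R[OF that] P_nz[OF that] by (auto simp: value_semigroup_def)
  then have "VG \<subseteq> value_semigroup K \<nu> R"
    using x_R x_nz by (auto simp: VG_def J_def value_semigroup_def)
  moreover have "H \<subseteq> value_semigroup K \<nu> R" using h by (auto simp: value_semigroup_def)
  moreover have "0 \<in> value_semigroup K \<nu> R"
    unfolding value_semigroup_def by (intro image_eqI[of _ _ \<one>]) auto
  ultimately show "nat_combinations (VG \<union> H) \<subseteq> value_semigroup K \<nu> R"
    by (intro nat_combinations_subset value_semigroup_add) auto
  show "value_semigroup K \<nu> R \<subseteq> nat_combinations (VG \<union> H)"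
  proof
    fix a assume "a \<in> value_semigroup K \<nu> R"
    then obtain f where f: "f \<in> R" "f \<noteq> \<zero>" "a = \<nu> f" unfolding value_semigroup_def by blast
    obtain k f' where k: "f' \<in> R" "f' \<noteq> \<zero>" "finv (\<nu> f')" "f = h [^] (k::nat) \<otimes> f'"
      using dec[OF f(1,2)] by blast
    have "a = nat_multiple k (\<nu> h) + \<nu> f'" using f(3) k h R_sub by simp
    moreover have "\<nu> f' \<in> nat_combinations (VG \<union> H)"
      using finv_combination[OF k(1-3)] nat_combinations_mono[of VG "VG \<union> H"] by blast
    ultimately show "a \<in> nat_combinations (VG \<union> H)"
      using h(4) by (auto intro: nat_combinations_add nat_combinations_nat_multiple)
  qed
qed

lemma beta_notin_G:
  assumes i: "i \<in> J" "1 < nbar i" shows "\<beta> i \<notin> G i"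
proof
  assume b: "\<beta> i \<in> G i"
  have i1: "1 \<le> i" "enat i \<le> \<Omega>" using J_D[OF i(1)] by auto
  have b1: "int_multiple (int 1) (\<beta> i) \<in> G i" unfolding int_multiple_of_nat using b by simp
  show False
  proof (cases "nbar i")
    case infinity
    then show False using nbar_inf[OF i1 infinity b1] by simp
  next
    case (enat N)
    then have "int N dvd int 1" using nbar_fin(2)[OF i1 enat] b1 by blast
    then have "N = 1" by simp
    then show False using i(2) enat by (simp add: one_enat_def)
  qed
qed

text \<open>For each generator e there is a set T, closed under addition, that contains 0 and the
  other generators but not e.\<close>

lemma values_minimal:
  assumes H: "H = {} \<or> (\<exists>\<gamma>. H = {\<gamma>} \<and> \<not> finv \<gamma> \<and> (\<forall>i\<in>J. finv (\<beta> i)))"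
    and e: "e \<in> VG \<union> H"
  shows "e \<notin> nat_combinations ((VG \<union> H) - {e})"
proof -
  have pos: "0 < \<beta> i" "\<nu> x \<le> \<beta> i" if "i \<in> J" for i
    using beta_pos[of i] beta_ge[of i] J_D[OF that] by auto
  have Hbig: "\<beta> i < \<gamma>" if "\<gamma> \<in> H" "i \<in> J" for \<gamma> i
    using H that finv_le by (metis empty_iff not_less singletonD)
  have Hx: "\<nu> x < \<gamma>" if "\<gamma> \<in> H" for \<gamma>
    using H that finv_le[OF finv_x] by (metis empty_iff linorder_le_less_linear linorder_not_le singletonD finv_x finv_le)
  from e consider "e = \<nu> x" | i where "i \<in> J" "1 < nbar i" "e = \<beta> i" | "e \<in> H" by (auto simp: VG_def)
  then show ?thesis
  proof cases
    case 1
    \<comment> \<open>\<nu>(x) is the least generator, so the remaining ones and their nonempty sums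
      exceed it.\<close>
    let ?T = "{\<gamma>. \<gamma> = 0 \<or> e < \<gamma>}"
    have "\<nu> x < \<beta> i" if "i \<in> J" "\<beta> i \<noteq> \<nu> x" for i using pos(2)[OF that(1)] that(2) by simp
    then have "(VG \<union> H) - {e} \<subseteq> ?T" using Hx 1 by (auto simp: VG_def)
    moreover have "a + b \<in> ?T" if "a \<in> ?T" "b \<in> ?T" for a b
      using that v_x_pos 1 by (auto simp: add_pos_pos less_trans intro: less_le_trans[of e a "a + b"])
    ultimately have "nat_combinations ((VG \<union> H) - {e}) \<subseteq> ?T" by (intro nat_combinations_subset) auto
    then show ?thesis using 1 v_x_pos by auto
  next
    case (2 i)
    \<comment> \<open>Up to \<nu>(P_i) only generators from earlier indices take part, and the group
      \<open>G i\<close> they generate misses \<nu>(P_i). Nonnegativity passes the upper bound from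
      a sum to its summands.\<close>
    let ?T = "{\<gamma>. 0 \<le> \<gamma> \<and> (\<gamma> \<le> e \<longrightarrow> \<gamma> \<in> G i)}"
    have i1: "1 \<le> i" "enat i \<le> \<Omega>" using J_D[OF 2(1)] by auto
    have xT: "\<nu> x \<in> ?T" using beta_G[of 0 i] i1 v_x_pos by auto
    have bT: "\<beta> j \<in> ?T" if j: "j \<in> J" "\<beta> j \<noteq> e" for j
    proof -
      have "j \<noteq> i" using j(2) 2(3) by auto
      then consider "j < i" | "i < j" by (meson linorder_neqE_nat)
      then show ?thesis
      proof cases
        case 1
        then show ?thesis using beta_G[of j i] pos(1)[OF j(1)] by auto
      next
        case c2: 2
        then have "e < \<beta> j" using beta_mono[OF i1(1) c2] J_D[OF j(1)] 2(3) by simp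
        then show ?thesis using pos(1)[OF j(1)] by auto
      qed
    qed
    have "\<gamma> \<in> ?T" if "\<gamma> \<in> H" for \<gamma> using Hbig[OF that 2(1)] 2(3) pos(1)[OF 2(1)] by auto
    then have "(VG \<union> H) - {e} \<subseteq> ?T" using xT bT by (auto simp: VG_def)
    moreover have "a + b \<in> ?T" if a: "a \<in> ?T" and b: "b \<in> ?T" for a b
    proof -
      have nn: "0 \<le> a" "0 \<le> b" using a b by auto
      have "a \<in> G i \<and> b \<in> G i" if "a + b \<le> e"
      proof -
        have "a \<le> a + b" "b \<le> a + b" using nn by simp_all
        then have "a \<le> e" "b \<le> e" using that by (blast intro: order_trans)+
        then show ?thesis using a b by blast
      qed
      then show ?thesis using nn by (auto intro: group_closure_add)
    qed
    ultimately have "nat_combinations ((VG \<union> H) - {e}) \<subseteq> ?T" by (intro nat_combinations_subset) auto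
    then show ?thesis using beta_notin_G[OF 2(1,2)] 2(3) by auto
  next
    case 3
    then have H': "H = {e}" "\<not> finv e" "\<And>i. i \<in> J \<Longrightarrow> finv (\<beta> i)" using H by auto
    have "nat_combinations ((VG \<union> H) - {e}) \<subseteq> {\<gamma>. finv \<gamma>}"
      using H' finv_x finv_zero finv_add by (intro nat_combinations_subset) (auto simp: VG_def)
    then show ?thesis using H'(2) by blast
  qed
qed

lemma values_minimally_generate:
  assumes H: "H = {} \<or> (\<exists>\<gamma>. H = {\<gamma>} \<and> \<not> finv \<gamma> \<and> (\<forall>i\<in>J. finv (\<beta> i)))"
    and gen: "nat_combinations (VG \<union> H) = value_semigroup K \<nu> R"
  shows "minimally_generates nat_combinations (VG \<union> H) (value_semigroup K \<nu> R)"
proof (rule minimally_generatesI[of nat_combinations, OF gen nat_combinations_mono])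
  fix e assume e: "e \<in> VG \<union> H"
  then have "e \<in> value_semigroup K \<nu> R" using gen nat_combinations_base by blast
  then show "nat_combinations ((VG \<union> H) - {e}) \<noteq> value_semigroup K \<nu> R"
    using values_minimal[OF H e] by blast
qed

section \<open>The residue field\<close>

abbreviation "KK \<equiv> residue_adjoin K \<nu> R \<alpha> {i \<in> J. 1 < d i}"

lemma KK_subfield: "subfield KK L" and KK_closed: "res ` R \<union> \<alpha> ` {i \<in> J. 1 < d i} \<subseteq> carrier L"
  using residue_adjoin_subfield[of "{i \<in> J. 1 < d i}"] alpha_closed J_D by blast+

text \<open>An index with d_k = 1 contributes nothing: \<alpha>_k already lies in the previous
  field, or equals 1 when nbar_k is infinite.\<close>

lemma Kf_KK: "ok i \<Longrightarrow> Kf i \<subseteq> KK"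
proof (induction i rule: less_induct)
  case (less i)
  have aK: "\<alpha> k \<in> KK" if k: "1 \<le> k" "k < i" for k
  proof -
    have le: "enat k \<le> \<Omega>" using less.prems k(2) by (simp add: ok_def)
    have kJ: "k \<in> J" using k le by (simp add: J_def)
    show ?thesis
    proof (cases "1 < d k")
      case True
      then show ?thesis unfolding residue_adjoin_def using kJ by (intro generate_field.incl) auto
    next
      case False
      show ?thesis
      proof (cases "nbar k")
        case infinity
        then show ?thesis using step_inf(2)[OF k(1) le]
          unfolding residue_adjoin_def by (auto intro: generate_field.one)
      next
        case (enat N)
        have okk: "ok k" using less.prems k by (intro ok_le[OF less.prems]) simp
        have "d k = 1" using False d_pos[OF k(1) le] by simp
        then have "\<alpha> k \<in> Kf k"
          using L.degree_one_iff[OF Kf_subfield[OF okk] alpha_closed[OF k(1) le] Kf_Suc'[OF k(1) le]]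
            d_def[OF k(1) le enat] by simp
        then show ?thesis using less.IH[OF k(2) okk] by blast
      qed
    qed
  qed
  have "res ` R \<subseteq> KK" unfolding residue_adjoin_def by (auto intro: generate_field.incl)
  then have "res ` R \<union> \<alpha> ` {1..<i} \<subseteq> KK" using aK by auto
  moreover have "res ` R \<union> \<alpha> ` {1..<i} \<subseteq> carrier L"
    by (rule residue_adjoin_subfield(1)) (use less.prems alpha_closed in \<open>auto simp: ok_def\<close>)
  ultimately show ?case
    unfolding Kf_def residue_adjoin_def[of K \<nu> R \<alpha> "{1..<i}"]
    by (intro L.generate_field_min_subfield1 KK_subfield)
qed

text \<open>f and the normal form representing it differ by higher value, so dividing both by the
  same monomial gives the same residue.\<close>

lemma finv_rational:
  assumes "f \<in> R" "f \<noteq> \<zero>" "finv (\<nu> f)"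
  obtains i M where "ok i" "M \<in> Mon i" "\<nu> M = \<nu> f" "res (f \<otimes> inv M) \<in> Kf i"
proof -
  obtain i s where s: "1 \<le> i" "ok i" "s \<in> NF i" "s \<noteq> \<zero>" "\<nu> s = \<nu> f" "f \<ominus> s \<in> gt (\<nu> f)"
    by (rule representation[OF assms])
  obtain M where M: "M \<in> Mon i" "\<nu> M = \<nu> s" "res (s \<otimes> inv M) \<in> Kf i"
    using NF_rational[OF s(2-4)] unfolding rational_def by blast
  have Mc: "M \<in> carrier K" "M \<noteq> \<zero>" using Mon_nz[OF s(2) M(1)] by auto
  have c: "f \<in> carrier K" "s \<in> carrier K" using assms R_sub NF_R[OF s(2,3)] by auto
  have iM: "inv M \<in> ge (- \<nu> f)" using Mc M(2) s(5) by (intro geI) auto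
  have "f \<otimes> inv M \<ominus> s \<otimes> inv M = (f \<ominus> s) \<otimes> inv M"
    using c inv_closed'[OF Mc] by algebra
  moreover have "(f \<ominus> s) \<otimes> inv M \<in> gt 0" using gt_mult[OF s(6) iM] by simp
  ultimately have "res (f \<otimes> inv M) = res (s \<otimes> inv M)"
    using c Mc M(2) s(4,5) assms(2) by (intro res_eqI geI) auto
  then show thesis using that[OF s(2) M(1)] M s(5) by simp
qed

text \<open>Numerator and denominator are each a Laurent monomial times an element with residue in
  some \<open>Kf i\<close>. For a fraction of value zero the two monomials have a quotient of value
  zero, whose residue is in the field as well.\<close>

lemma residue_field_eq:
  assumes uf: "\<And>f. f \<in> carrier K \<Longrightarrow> f \<noteq> \<zero> \<Longrightarrow> \<nu> f = 0 \<Longrightarrow>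
      \<exists>a b. a \<in> R \<and> a \<noteq> \<zero> \<and> finv (\<nu> a) \<and> b \<in> R \<and> b \<noteq> \<zero> \<and> finv (\<nu> b) \<and> f = a \<otimes> inv b"
  shows "carrier L = KK"
proof
  show "KK \<subseteq> carrier L" by (rule subfieldE(3)[OF KK_subfield])
  show "carrier L \<subseteq> KK"
  proof
    fix u assume "u \<in> carrier L"
    then obtain f where f: "f \<in> ge 0" "u = res f" using carrier_L by auto
    show "u \<in> KK"
    proof (cases "f \<in> gt 0")
      case True
      then have "u = \<zero>\<^bsub>L\<^esub>" using res_zero_iff[OF f(1)] f(2) by simp
      then show ?thesis using subringE(2)[OF subfieldE(1)[OF KK_subfield]] by simp
    next
      case False
      have fc: "f \<in> carrier K" using f(1) by (rule ge_carrier)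
      then have f0: "f \<noteq> \<zero>" "\<nu> f = 0" using exact_iff[OF fc, of 0] f(1) False by auto
      obtain a b where ab: "a \<in> R" "a \<noteq> \<zero>" "finv (\<nu> a)" "b \<in> R" "b \<noteq> \<zero>" "finv (\<nu> b)" "f = a \<otimes> inv b"
        using uf[OF fc f0] by blast
      obtain i M where M: "ok i" "M \<in> Mon i" "\<nu> M = \<nu> a" "res (a \<otimes> inv M) \<in> Kf i"
        by (rule finv_rational[OF ab(1-3)])
      obtain j M' where M': "ok j" "M' \<in> Mon j" "\<nu> M' = \<nu> b" "res (b \<otimes> inv M') \<in> Kf j"
        by (rule finv_rational[OF ab(4-6)])
      \<comment> \<open>A common level at which both monomials and both residues are
        available.\<close>
      define l where "l = max i j"
      have okl: "ok l" using M(1) M'(1) by (simp add: l_def max_def)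
      have c: "a \<in> carrier K" "b \<in> carrier K" "M \<in> carrier K" "M \<noteq> \<zero>" "M' \<in> carrier K" "M' \<noteq> \<zero>"
        using ab R_sub Mon_nz M M' by auto
      have vab: "\<nu> a = \<nu> b" using f0(2) ab c by simp
      define p where "p = a \<otimes> inv M"
      define q where "q = b \<otimes> inv M'"
      define r where "r = M \<otimes> inv M'"
      have rM: "r \<in> Mon l"
        unfolding r_def
        using Mon_mono[OF okl _ M(2)] Mon_mono[OF okl _ M'(2)] okl
        by (intro Mon_mult Mon_inv) (auto simp: l_def)
      have v0: "\<nu> p = 0" "\<nu> q = 0" "\<nu> r = 0" using c ab M M' vab by (auto simp: p_def q_def r_def)
      have pc: "p \<in> carrier K" "q \<in> carrier K" "q \<noteq> \<zero>" "r \<in> carrier K"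
        using c ab by (auto simp: p_def q_def r_def integral_iff)
      have ge0: "p \<in> ge 0" "inv q \<in> ge 0" "r \<in> ge 0" using pc v0 by (auto intro!: geI)
      have "f = p \<otimes> r \<otimes> inv q"
      proof -
        have iq: "inv q = inv b \<otimes> M'"
        proof -
          have "inv (inv M') = M'" using c by (intro comm_inv_char) auto
          then show ?thesis unfolding q_def using c ab by (simp add: inv_mult)
        qed
        have ic: "inv M \<in> carrier K" "inv M' \<in> carrier K" "inv b \<in> carrier K" using c ab by auto
        have "p \<otimes> r \<otimes> inv q = a \<otimes> inv b \<otimes> (M \<otimes> inv M) \<otimes> (M' \<otimes> inv M')"
          unfolding iq p_def r_def using c(1-3,5) ic by algebra
        then show ?thesis using ab(7) c ic by simp
      qed
      then have "u = res p \<otimes>\<^bsub>L\<^esub> res r \<otimes>\<^bsub>L\<^esub> inv\<^bsub>L\<^esub> res q"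
        using f(2) ge0 res_inv[OF pc(2,3) v0(2)] by (simp add: res_mult ge0_mult)
      moreover have "res p \<in> Kf l" using M(4) Kf_mono[OF okl, of i] by (auto simp: p_def l_def)
      moreover have "res q \<in> Kf l" using M'(4) Kf_mono[OF okl, of j] by (auto simp: q_def l_def)
      moreover have "res q \<noteq> \<zero>\<^bsub>L\<^esub>" by (rule res_nonzero[OF pc(2,3) v0(2)])
      moreover have "res r \<in> Kf l" by (rule res_Mon[OF okl rM v0(3)])
      ultimately have "u \<in> Kf l" by (auto intro: Kf_mult Kf_inv)
      then show ?thesis using Kf_KK[OF okl] by blast
    qed
  qed
qed

end

section \<open>The associated graded ring\<close>

context generating_sequence
begin

abbreviation "Fe \<phi> \<equiv> val_ge K \<nu> R \<phi>"
abbreviation "Fg \<phi> \<equiv> val_gt K \<nu> R \<phi>"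
abbreviation "gr \<equiv> gr_ring K \<nu> R"
abbreviation "piece \<phi> \<equiv> gr_piece K \<nu> R \<phi>"
abbreviation "\<Gamma> \<equiv> value_group K \<nu>"
abbreviation "cl \<phi> w \<equiv> val_gt K \<nu> R \<phi> +> w"
abbreviation "homog \<phi> w \<equiv> gr_embed K \<nu> R \<phi> (cl \<phi> w)"

lemma Fe_iff: "w \<in> Fe \<phi> \<longleftrightarrow> w \<in> R \<and> w \<in> ge \<phi>"
  using R_sub by (auto simp: val_ge_def ge_def)

lemma Fg_iff: "w \<in> Fg \<phi> \<longleftrightarrow> w \<in> R \<and> w \<in> gt \<phi>"
  using R_sub by (auto simp: val_gt_def gt_def)

lemma Fe_R: "w \<in> Fe \<phi> \<Longrightarrow> w \<in> R" and Fe_carrier: "w \<in> Fe \<phi> \<Longrightarrow> w \<in> carrier K"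
  and Fg_Fe: "w \<in> Fg \<phi> \<Longrightarrow> w \<in> Fe \<phi>" and Fe_zero [simp]: "\<zero> \<in> Fe \<phi>" and Fg_zero [simp]: "\<zero> \<in> Fg \<phi>"
  using R_sub gt_ge by (auto simp: Fe_iff Fg_iff)

lemma Fe_add: "w \<in> Fe \<phi> \<Longrightarrow> v \<in> Fe \<phi> \<Longrightarrow> w \<oplus> v \<in> Fe \<phi>"
  and Fg_add: "w \<in> Fg \<phi> \<Longrightarrow> v \<in> Fg \<phi> \<Longrightarrow> w \<oplus> v \<in> Fg \<phi>"
  and Fe_minus: "w \<in> Fe \<phi> \<Longrightarrow> \<ominus> w \<in> Fe \<phi>" and Fg_minus: "w \<in> Fg \<phi> \<Longrightarrow> \<ominus> w \<in> Fg \<phi>"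
  and Fe_mult: "w \<in> Fe \<phi> \<Longrightarrow> v \<in> Fe \<psi> \<Longrightarrow> w \<otimes> v \<in> Fe (\<phi> + \<psi>)"
  and Fg_mult: "w \<in> Fg \<phi> \<Longrightarrow> v \<in> Fe \<psi> \<Longrightarrow> w \<otimes> v \<in> Fg (\<phi> + \<psi>)"
  and Fg_mult': "w \<in> Fe \<phi> \<Longrightarrow> v \<in> Fg \<psi> \<Longrightarrow> w \<otimes> v \<in> Fg (\<phi> + \<psi>)"
  by (auto simp: Fe_iff Fg_iff R_add R_minus R_mult ge_add gt_add ge_minus gt_minus ge_mult gt_mult gt_mult')

lemma cl_iff: "u \<in> cl \<phi> w \<longleftrightarrow> (\<exists>h\<in>Fg \<phi>. u = h \<oplus> w)"
  by (auto simp: a_r_coset_def r_coset_def)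

lemma cl_self: "w \<in> R \<Longrightarrow> w \<in> cl \<phi> w"
  unfolding cl_iff using R_sub by (intro bexI[of _ \<zero>]) auto

lemma cl_eqI:
  assumes "w \<in> R" "v \<in> R" "w \<ominus> v \<in> Fg \<phi>" shows "cl \<phi> w = cl \<phi> v"
proof -
  have *: "cl \<phi> w \<subseteq> cl \<phi> v" if "w \<in> R" "v \<in> R" "w \<ominus> v \<in> Fg \<phi>" for w v
  proof
    fix u assume "u \<in> cl \<phi> w"
    then obtain h where h: "h \<in> Fg \<phi>" "u = h \<oplus> w" unfolding cl_iff by blast
    have "u = (h \<oplus> (w \<ominus> v)) \<oplus> v"
      using h R_sub that Fe_carrier[OF Fg_Fe[OF h(1)]] by algebra
    then show "u \<in> cl \<phi> v" unfolding cl_iff using Fg_add[OF h(1) that(3)] by blast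
  qed
  have "v \<ominus> w = \<ominus> (w \<ominus> v)" using R_sub assms by algebra
  then have "v \<ominus> w \<in> Fg \<phi>" using Fg_minus[OF assms(3)] by simp
  then show ?thesis using *[OF assms] *[OF assms(2,1)] by blast
qed

lemma cl_eqD:
  assumes "w \<in> R" "v \<in> R" "w \<in> cl \<phi> v" shows "w \<ominus> v \<in> Fg \<phi>"
proof -
  obtain h where h: "h \<in> Fg \<phi>" "w = h \<oplus> v" using assms(3) unfolding cl_iff by blast
  have "w \<ominus> v = h" unfolding h(2) using assms(2) R_sub Fe_carrier[OF Fg_Fe[OF h(1)]] by algebra
  then show ?thesis using h(1) by simp
qed

lemma cl_zero: "cl \<phi> \<zero> = Fg \<phi>"
  using Fe_carrier[OF Fg_Fe] by (auto simp: cl_iff)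

lemma cl_trivial: "w \<in> Fg \<phi> \<Longrightarrow> cl \<phi> w = Fg \<phi>"
  using cl_eqI[of w \<zero> \<phi>] Fe_R[OF Fg_Fe] Fe_carrier[OF Fg_Fe] cl_zero by (simp add: a_minus_def)

lemma cl_trivial_iff: "w \<in> R \<Longrightarrow> cl \<phi> w = Fg \<phi> \<longleftrightarrow> w \<in> Fg \<phi>"
  using cl_trivial cl_self by blast

lemma piece_carrier: "carrier (piece \<phi>) = cl \<phi> ` Fe \<phi>"
  by (auto simp: gr_piece_def A_FactGroup_def FactGroup_def RCOSETS_def a_r_coset_def r_coset_def)

lemma pieceE:
  assumes "u \<in> carrier (piece \<phi>)"
  obtains w where "w \<in> Fe \<phi>" "w \<in> R" "u = cl \<phi> w"
proof -
  obtain w where "w \<in> Fe \<phi>" "u = cl \<phi> w" using assms unfolding piece_carrier by blast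
  then show thesis using that[of w] Fe_R[of w \<phi>] by simp
qed

lemma piece_one: "\<one>\<^bsub>piece \<phi>\<^esub> = Fg \<phi>"
  by (simp add: gr_piece_def A_FactGroup_def FactGroup_def)

lemma piece_one_cl: "\<one>\<^bsub>piece \<phi>\<^esub> = cl \<phi> \<zero>"
  by (simp add: piece_one cl_zero)

lemma piece_mult:
  assumes "w \<in> R" "v \<in> R" shows "cl \<phi> w \<otimes>\<^bsub>piece \<phi>\<^esub> cl \<phi> v = cl \<phi> (w \<oplus> v)"
proof -
  have c: "w \<in> carrier K" "v \<in> carrier K" using assms R_sub by auto
  have "cl \<phi> w \<otimes>\<^bsub>piece \<phi>\<^esub> cl \<phi> v = {a \<oplus> b | a b. a \<in> cl \<phi> w \<and> b \<in> cl \<phi> v}"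
    by (auto simp: gr_piece_def A_FactGroup_def FactGroup_def set_mult_def)
  also have "\<dots> = cl \<phi> (w \<oplus> v)"
  proof
    show "{a \<oplus> b | a b. a \<in> cl \<phi> w \<and> b \<in> cl \<phi> v} \<subseteq> cl \<phi> (w \<oplus> v)"
    proof
      fix u assume "u \<in> {a \<oplus> b | a b. a \<in> cl \<phi> w \<and> b \<in> cl \<phi> v}"
      then obtain h h' where h: "h \<in> Fg \<phi>" "h' \<in> Fg \<phi>" "u = (h \<oplus> w) \<oplus> (h' \<oplus> v)" unfolding cl_iff by blast
      have "u = (h \<oplus> h') \<oplus> (w \<oplus> v)" unfolding h(3)
        using c Fe_carrier[OF Fg_Fe[OF h(1)]] Fe_carrier[OF Fg_Fe[OF h(2)]] by algebra
      then show "u \<in> cl \<phi> (w \<oplus> v)" unfolding cl_iff using Fg_add[OF h(1,2)] by blast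
    qed
    show "cl \<phi> (w \<oplus> v) \<subseteq> {a \<oplus> b | a b. a \<in> cl \<phi> w \<and> b \<in> cl \<phi> v}"
    proof
      fix u assume "u \<in> cl \<phi> (w \<oplus> v)"
      then obtain h where h: "h \<in> Fg \<phi>" "u = h \<oplus> (w \<oplus> v)" unfolding cl_iff by blast
      have "u = (h \<oplus> w) \<oplus> v" unfolding h(2) using c Fe_carrier[OF Fg_Fe[OF h(1)]] by algebra
      moreover have "h \<oplus> w \<in> cl \<phi> w" using h(1) unfolding cl_iff by blast
      ultimately show "u \<in> {a \<oplus> b | a b. a \<in> cl \<phi> w \<and> b \<in> cl \<phi> v}" using cl_self[OF assms(2)] by blast
    qed
  qed
  finally show ?thesis .
qed

lemma piece_comm_group: "comm_group (piece \<phi>)"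
proof (rule comm_groupI)
  show "u \<otimes>\<^bsub>piece \<phi>\<^esub> v \<in> carrier (piece \<phi>)" if u: "u \<in> carrier (piece \<phi>)" and v: "v \<in> carrier (piece \<phi>)" for u v
  proof -
    obtain w where w: "w \<in> Fe \<phi>" "w \<in> R" "u = cl \<phi> w" by (rule pieceE[OF u])
    obtain z where z: "z \<in> Fe \<phi>" "z \<in> R" "v = cl \<phi> z" by (rule pieceE[OF v])
    show ?thesis unfolding w(3) z(3) piece_mult[OF w(2) z(2)] piece_carrier
      by (rule imageI[OF Fe_add[OF w(1) z(1)]])
  qed
  show "\<one>\<^bsub>piece \<phi>\<^esub> \<in> carrier (piece \<phi>)" unfolding piece_carrier piece_one by (intro image_eqI[of _ _ \<zero>]) (simp_all add: cl_zero)
  show "u \<otimes>\<^bsub>piece \<phi>\<^esub> v \<otimes>\<^bsub>piece \<phi>\<^esub> t = u \<otimes>\<^bsub>piece \<phi>\<^esub> (v \<otimes>\<^bsub>piece \<phi>\<^esub> t)"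
    if u: "u \<in> carrier (piece \<phi>)" and v: "v \<in> carrier (piece \<phi>)" and t: "t \<in> carrier (piece \<phi>)" for u v t
  proof -
    obtain w where w: "w \<in> Fe \<phi>" "w \<in> R" "u = cl \<phi> w" by (rule pieceE[OF u])
    obtain z where z: "z \<in> Fe \<phi>" "z \<in> R" "v = cl \<phi> z" by (rule pieceE[OF v])
    obtain s where s: "s \<in> Fe \<phi>" "s \<in> R" "t = cl \<phi> s" by (rule pieceE[OF t])
    show ?thesis unfolding w(3) z(3) s(3) piece_mult[OF w(2) z(2)] piece_mult[OF z(2) s(2)]
        piece_mult[OF R_add[OF w(2) z(2)] s(2)] piece_mult[OF w(2) R_add[OF z(2) s(2)]]
      by (simp only: a_assoc[OF R_sub[OF w(2)] R_sub[OF z(2)] R_sub[OF s(2)]])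
  qed
  show "u \<otimes>\<^bsub>piece \<phi>\<^esub> v = v \<otimes>\<^bsub>piece \<phi>\<^esub> u" if u: "u \<in> carrier (piece \<phi>)" and v: "v \<in> carrier (piece \<phi>)" for u v
  proof -
    obtain w where w: "w \<in> Fe \<phi>" "w \<in> R" "u = cl \<phi> w" by (rule pieceE[OF u])
    obtain z where z: "z \<in> Fe \<phi>" "z \<in> R" "v = cl \<phi> z" by (rule pieceE[OF v])
    show ?thesis unfolding w(3) z(3) piece_mult[OF w(2) z(2)] piece_mult[OF z(2) w(2)]
      by (rule arg_cong[OF a_comm[OF R_sub[OF w(2)] R_sub[OF z(2)]]])
  qed
  show "\<one>\<^bsub>piece \<phi>\<^esub> \<otimes>\<^bsub>piece \<phi>\<^esub> u = u" if u: "u \<in> carrier (piece \<phi>)" for u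
  proof -
    obtain w where w: "w \<in> Fe \<phi>" "w \<in> R" "u = cl \<phi> w" by (rule pieceE[OF u])
    show ?thesis unfolding w(3) piece_one_cl piece_mult[OF R_zero w(2)]
      by (simp only: l_zero[OF R_sub[OF w(2)]])
  qed
  show "\<exists>v\<in>carrier (piece \<phi>). v \<otimes>\<^bsub>piece \<phi>\<^esub> u = \<one>\<^bsub>piece \<phi>\<^esub>" if u: "u \<in> carrier (piece \<phi>)" for u
  proof -
    obtain w where w: "w \<in> Fe \<phi>" "w \<in> R" "u = cl \<phi> w" by (rule pieceE[OF u])
    have "cl \<phi> (\<ominus> w) \<otimes>\<^bsub>piece \<phi>\<^esub> u = \<one>\<^bsub>piece \<phi>\<^esub>"
      unfolding w(3) piece_one_cl piece_mult[OF R_minus[OF w(2)] w(2)]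
      by (simp only: l_neg[OF R_sub[OF w(2)]])
    moreover have "cl \<phi> (\<ominus> w) \<in> carrier (piece \<phi>)"
      unfolding piece_carrier by (rule imageI[OF Fe_minus[OF w(1)]])
    ultimately show ?thesis by (rule bexI)
  qed
qed

lemma piece_inv: "w \<in> Fe \<phi> \<Longrightarrow> inv\<^bsub>piece \<phi>\<^esub> (cl \<phi> w) = cl \<phi> (\<ominus> w)"
proof -
  assume w: "w \<in> Fe \<phi>"
  interpret p: comm_group "piece \<phi>" by (rule piece_comm_group)
  have "cl \<phi> (\<ominus> w) \<otimes>\<^bsub>piece \<phi>\<^esub> cl \<phi> w = \<one>\<^bsub>piece \<phi>\<^esub>"
    unfolding piece_one_cl piece_mult[OF R_minus[OF Fe_R[OF w]] Fe_R[OF w]]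
    by (simp only: l_neg[OF Fe_carrier[OF w]])
  moreover have "cl \<phi> w \<in> carrier (piece \<phi>)" "cl \<phi> (\<ominus> w) \<in> carrier (piece \<phi>)"
    unfolding piece_carrier by (rule imageI[OF w] imageI[OF Fe_minus[OF w]])+
  ultimately show ?thesis by (rule p.inv_equality)
qed

lemma rcoset_mult_cl:
  assumes "w \<in> Fe \<phi>" "v \<in> Fe \<psi>"
  shows "rcoset_mult K (Fg (\<phi> + \<psi>)) (cl \<phi> w) (cl \<psi> v) = cl (\<phi> + \<psi>) (w \<otimes> v)"
proof -
  have *: "cl (\<phi> + \<psi>) (a \<otimes> b) = cl (\<phi> + \<psi>) (w \<otimes> v)" if ab: "a \<in> cl \<phi> w" "b \<in> cl \<psi> v" for a b
  proof -
    obtain h h' where h: "h \<in> Fg \<phi>" "a = h \<oplus> w" "h' \<in> Fg \<psi>" "b = h' \<oplus> v" using ab unfolding cl_iff by blast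
    have c: "h \<in> carrier K" "h' \<in> carrier K" "w \<in> carrier K" "v \<in> carrier K"
      using h assms Fg_Fe Fe_carrier by auto
    have F: "a \<in> Fe \<phi>" "b \<in> Fe \<psi>" using h assms Fg_Fe Fe_add by auto
    have "a \<otimes> b \<ominus> w \<otimes> v = h \<otimes> b \<oplus> w \<otimes> h'" unfolding h(2,4) using c by algebra
    then have "a \<otimes> b \<ominus> w \<otimes> v \<in> Fg (\<phi> + \<psi>)"
      using Fg_add[OF Fg_mult[OF h(1) F(2)] Fg_mult'[OF assms(1) h(3)]] by simp
    then show ?thesis using F assms by (intro cl_eqI) (auto intro: R_mult Fe_R)
  qed
  have "w \<in> cl \<phi> w" "v \<in> cl \<psi> v" using assms by (auto intro: cl_self Fe_R)
  then have ne: "cl \<phi> w \<noteq> {}" "cl \<psi> v \<noteq> {}" by blast+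
  have "rcoset_mult K (Fg (\<phi> + \<psi>)) (cl \<phi> w) (cl \<psi> v) = (\<Union>a\<in>cl \<phi> w. \<Union>b\<in>cl \<psi> v. cl (\<phi> + \<psi>) (w \<otimes> v))"
    unfolding rcoset_mult_def by (intro SUP_cong refl *)
  also have "\<dots> = cl (\<phi> + \<psi>) (w \<otimes> v)" by (simp only: UN_constant ne if_False)
  finally show ?thesis .
qed

lemma Gamma_v: "f \<in> carrier K \<Longrightarrow> f \<noteq> \<zero> \<Longrightarrow> \<nu> f \<in> \<Gamma>"
  by (simp add: value_group_def)

lemma Gamma_diff: "\<phi> \<in> \<Gamma> \<Longrightarrow> \<psi> \<in> \<Gamma> \<Longrightarrow> \<phi> - \<psi> \<in> \<Gamma>"
proof -
  assume "\<phi> \<in> \<Gamma>" "\<psi> \<in> \<Gamma>"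
  then obtain f g where "f \<in> carrier K" "f \<noteq> \<zero>" "\<phi> = \<nu> f" "g \<in> carrier K" "g \<noteq> \<zero>" "\<psi> = \<nu> g"
    unfolding value_group_def by blast
  then show ?thesis using Gamma_v[of "f \<otimes> inv g"] by (simp add: integral_iff)
qed

lemma Gamma_zero [simp]: "0 \<in> \<Gamma>"
  using Gamma_v[of \<one>] by simp

lemma gr_carrier:
  "F \<in> carrier gr \<longleftrightarrow> F \<in> (\<Pi>\<^sub>E \<phi>\<in>\<Gamma>. carrier (piece \<phi>)) \<and> finite {\<phi>\<in>\<Gamma>. F \<phi> \<noteq> Fg \<phi>}"
  unfolding gr_ring_def Let_def
  by (simp add: carrier_sum_group comm_group.axioms(2)[OF piece_comm_group] piece_one)

lemma gr_zero: "\<zero>\<^bsub>gr\<^esub> = (\<lambda>\<phi>\<in>\<Gamma>. Fg \<phi>)"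
  by (simp add: gr_ring_def Let_def piece_one)

lemma gr_add: "F \<oplus>\<^bsub>gr\<^esub> H = (\<lambda>\<phi>\<in>\<Gamma>. F \<phi> \<otimes>\<^bsub>piece \<phi>\<^esub> H \<phi>)"
  by (simp add: gr_ring_def Let_def)

lemma gr_mult: "F \<otimes>\<^bsub>gr\<^esub> H = (\<lambda>\<phi>\<in>\<Gamma>. finprod (piece \<phi>)
    (\<lambda>\<alpha>. rcoset_mult K (Fg \<phi>) (F \<alpha>) (H (\<phi> - \<alpha>))) {\<alpha>\<in>\<Gamma>. F \<alpha> \<noteq> Fg \<alpha> \<and> H (\<phi> - \<alpha>) \<noteq> Fg (\<phi> - \<alpha>)})"
  by (simp add: gr_ring_def Let_def piece_one)

lemma gr_one: "\<one>\<^bsub>gr\<^esub> = homog 0 \<one>"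
  by (simp add: gr_ring_def Let_def)

lemma gr_minus: "F \<in> carrier gr \<Longrightarrow> \<ominus>\<^bsub>gr\<^esub> F = (\<lambda>\<phi>\<in>\<Gamma>. inv\<^bsub>piece \<phi>\<^esub> (F \<phi>))"
proof -
  assume F: "F \<in> carrier gr"
  have *: "add_monoid gr = sum_group \<Gamma> (gr_piece K \<nu> R)"
    by (rule monoid.equality) (simp_all add: gr_ring_def Let_def)
  have F': "F \<in> carrier (sum_group \<Gamma> (gr_piece K \<nu> R))" using F by (simp add: gr_ring_def Let_def)
  show ?thesis unfolding a_inv_def *
    by (rule inv_sum_group[OF comm_group.axioms(2)[OF piece_comm_group] F'])
qed

lemma embed_at: "\<psi> \<in> \<Gamma> \<Longrightarrow> gr_embed K \<nu> R \<phi> C \<psi> = (if \<psi> = \<phi> then C else Fg \<psi>)"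
  by (simp add: gr_embed_def piece_one)

lemma homog_add:
  assumes "w \<in> Fe \<phi>" "v \<in> Fe \<phi>"
  shows "homog \<phi> w \<oplus>\<^bsub>gr\<^esub> homog \<phi> v = homog \<phi> (w \<oplus> v)"
proof
  fix \<psi>
  interpret p: comm_group "piece \<psi>" by (rule piece_comm_group)
  have "Fg \<psi> \<otimes>\<^bsub>piece \<psi>\<^esub> Fg \<psi> = Fg \<psi>" using p.r_one[OF p.one_closed] unfolding piece_one .
  then show "(homog \<phi> w \<oplus>\<^bsub>gr\<^esub> homog \<phi> v) \<psi> = homog \<phi> (w \<oplus> v) \<psi>"
    using assms by (cases "\<psi> \<in> \<Gamma>") (auto simp: gr_add embed_at piece_mult Fe_R gr_embed_def)
qed

lemma homog_mult:
  assumes w: "w \<in> Fe \<phi>" and v: "v \<in> Fe \<psi>" and \<phi>: "\<phi> \<in> \<Gamma>" and \<psi>: "\<psi> \<in> \<Gamma>"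
  shows "homog \<phi> w \<otimes>\<^bsub>gr\<^esub> homog \<psi> v = homog (\<phi> + \<psi>) (w \<otimes> v)"
proof
  fix \<chi>
  interpret p: comm_group "piece \<chi>" by (rule piece_comm_group)
  show "(homog \<phi> w \<otimes>\<^bsub>gr\<^esub> homog \<psi> v) \<chi> = homog (\<phi> + \<psi>) (w \<otimes> v) \<chi>"
  proof (cases "\<chi> \<in> \<Gamma>")
    case True
    let ?S = "{\<alpha>\<in>\<Gamma>. homog \<phi> w \<alpha> \<noteq> Fg \<alpha> \<and> homog \<psi> v (\<chi> - \<alpha>) \<noteq> Fg (\<chi> - \<alpha>)}"
    let ?f = "\<lambda>\<alpha>. rcoset_mult K (Fg \<chi>) (homog \<phi> w \<alpha>) (homog \<psi> v (\<chi> - \<alpha>))"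
    \<comment> \<open>At most one index contributes to the product. If a factor is trivial the index
      set is empty, and then the class of the product is trivial too.\<close>
    have sub: "\<alpha> = \<phi> \<and> \<chi> = \<phi> + \<psi> \<and> w \<notin> Fg \<phi> \<and> v \<notin> Fg \<psi>" if "\<alpha> \<in> ?S" for \<alpha>
    proof -
      have "\<alpha> \<in> \<Gamma>" "\<chi> - \<alpha> \<in> \<Gamma>" using that Gamma_diff[OF True] by auto
      then have "\<alpha> = \<phi>" "cl \<phi> w \<noteq> Fg \<phi>" "\<chi> - \<alpha> = \<psi>" "cl \<psi> v \<noteq> Fg \<psi>"
        using that by (auto simp: embed_at split: if_splits)
      then show ?thesis using cl_trivial by (auto simp: algebra_simps)
    qed
    show ?thesis
    proof (cases "\<chi> = \<phi> + \<psi> \<and> w \<notin> Fg \<phi> \<and> v \<notin> Fg \<psi>")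
      case t: True
      then have "?S = {\<phi>}"
        using sub \<phi> \<psi> w v by (auto simp: embed_at cl_trivial_iff Fe_R)
      moreover have "?f \<phi> = cl \<chi> (w \<otimes> v)"
        using t \<phi> \<psi> rcoset_mult_cl[OF w v] by (simp add: embed_at)
      moreover have "cl \<chi> (w \<otimes> v) \<in> carrier (piece \<chi>)"
        using Fe_mult[OF w v] t by (simp add: piece_carrier)
      ultimately have "finprod (piece \<chi>) ?f ?S = cl \<chi> (w \<otimes> v)" by simp
      then show ?thesis using True t by (simp add: gr_mult embed_at)
    next
      case f: False
      then have S: "?S = {}" using sub by blast
      have "(homog \<phi> w \<otimes>\<^bsub>gr\<^esub> homog \<psi> v) \<chi> = finprod (piece \<chi>) ?f ?S" using True by (simp add: gr_mult)
      then have l: "(homog \<phi> w \<otimes>\<^bsub>gr\<^esub> homog \<psi> v) \<chi> = Fg \<chi>" unfolding S p.finprod_empty piece_one .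
      have "cl \<chi> (w \<otimes> v) = Fg \<chi>" if "\<chi> = \<phi> + \<psi>"
        using that f w v Fg_mult Fg_mult' by (intro cl_trivial) auto
      then show ?thesis using l True by (simp add: embed_at)
    qed
  qed (simp add: gr_mult gr_embed_def)
qed

text \<open>Induction on a finite set D containing the support; the component in one degree is split
  off and replaced by the trivial class.\<close>

lemma gr_generated_by_homogeneous:
  assumes zero: "\<zero>\<^bsub>gr\<^esub> \<in> S" and add: "\<And>F H. F \<in> S \<Longrightarrow> H \<in> S \<Longrightarrow> F \<oplus>\<^bsub>gr\<^esub> H \<in> S"
    and homog: "\<And>\<phi> w. \<phi> \<in> \<Gamma> \<Longrightarrow> w \<in> Fe \<phi> \<Longrightarrow> homog \<phi> w \<in> S"
  shows "carrier gr \<subseteq> S"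
proof
  have *: "F \<in> S" if "finite D" "F \<in> carrier gr" "{\<phi>\<in>\<Gamma>. F \<phi> \<noteq> Fg \<phi>} \<subseteq> D" for D F
    using that
  proof (induction D arbitrary: F rule: finite_induct)
    case empty
    have "F = \<zero>\<^bsub>gr\<^esub>"
    proof
      fix \<psi> show "F \<psi> = \<zero>\<^bsub>gr\<^esub> \<psi>"
        using empty by (cases "\<psi> \<in> \<Gamma>") (auto simp: gr_zero gr_carrier PiE_iff extensional_def)
    qed
    then show ?case using zero by simp
  next
    case (insert \<phi> D)
    have PE: "F \<in> (\<Pi>\<^sub>E \<phi>\<in>\<Gamma>. carrier (piece \<phi>))" "finite {\<phi>\<in>\<Gamma>. F \<phi> \<noteq> Fg \<phi>}"
      using insert.prems(1) unfolding gr_carrier by auto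
    show ?case
    proof (cases "\<phi> \<in> \<Gamma>")
      case False
      then have "{\<phi>\<in>\<Gamma>. F \<phi> \<noteq> Fg \<phi>} \<subseteq> D" using insert.prems(2) by blast
      then show ?thesis using insert.IH insert.prems(1) by blast
    next
      case True
      obtain w where w: "w \<in> Fe \<phi>" "F \<phi> = cl \<phi> w"
        using PiE_mem[OF PE(1) True] unfolding piece_carrier by blast
      define F' where "F' = F(\<phi> := Fg \<phi>)"
      have one: "Fg \<psi> \<in> carrier (piece \<psi>)" for \<psi>
        using Fe_zero cl_zero[of \<psi>] unfolding piece_carrier by (metis image_eqI)
      have "F' \<in> (\<Pi>\<^sub>E \<phi>\<in>\<Gamma>. carrier (piece \<phi>))"
        using PE(1) True one[of \<phi>] by (auto simp: F'_def PiE_iff extensional_def)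
      moreover have sub: "{\<psi>\<in>\<Gamma>. F' \<psi> \<noteq> Fg \<psi>} \<subseteq> {\<psi>\<in>\<Gamma>. F \<psi> \<noteq> Fg \<psi>} - {\<phi>}" by (auto simp: F'_def)
      ultimately have "F' \<in> carrier gr" unfolding gr_carrier using PE(2) by (meson finite_Diff finite_subset)
      moreover have "{\<psi>\<in>\<Gamma>. F' \<psi> \<noteq> Fg \<psi>} \<subseteq> D" using sub insert.prems(2) by blast
      ultimately have "F' \<in> S" by (rule insert.IH)
      then have "homog \<phi> w \<oplus>\<^bsub>gr\<^esub> F' \<in> S" using homog[OF True w(1)] add by blast
      moreover have "homog \<phi> w \<oplus>\<^bsub>gr\<^esub> F' = F"
      proof
        fix \<psi>
        interpret p: comm_group "piece \<psi>" by (rule piece_comm_group)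
        show "(homog \<phi> w \<oplus>\<^bsub>gr\<^esub> F') \<psi> = F \<psi>"
        proof (cases "\<psi> \<in> \<Gamma>")
          case t: True
          have c: "F \<psi> \<in> carrier (piece \<psi>)" by (rule PiE_mem[OF PE(1) t])
          show ?thesis
          proof (cases "\<psi> = \<phi>")
            case True
            then show ?thesis using t w(2) p.r_one[OF c] unfolding gr_add by (simp add: embed_at F'_def piece_one)
          next
            case False
            then show ?thesis using t p.l_one[OF c] unfolding gr_add by (simp add: embed_at F'_def piece_one)
          qed
        next
          case False
          then show ?thesis using PE(1) by (simp add: gr_add PiE_iff extensional_def)
        qed
      qed
      ultimately show ?thesis by simp
    qed
  qed
  fix F assume "F \<in> carrier gr"
  then show "F \<in> S" using *[of "{\<phi>\<in>\<Gamma>. F \<phi> \<noteq> Fg \<phi>}" F] unfolding gr_carrier by blast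
qed

text \<open>Systems of subgroups compatible with the filtration; they cut out subrings of the graded ring
  that are used to separate a generator from the others.\<close>

definition graded_family :: "('g \<Rightarrow> 'a set) \<Rightarrow> bool" where
  "graded_family W \<longleftrightarrow> (\<forall>\<phi>. Fg \<phi> \<subseteq> W \<phi> \<and> W \<phi> \<subseteq> Fe \<phi>) \<and> R \<subseteq> W 0 \<and>
    (\<forall>\<phi>. \<forall>a\<in>W \<phi>. \<forall>b\<in>W \<phi>. a \<oplus> b \<in> W \<phi>) \<and> (\<forall>\<phi> \<psi>. \<forall>a\<in>W \<phi>. \<forall>b\<in>W \<psi>. a \<otimes> b \<in> W (\<phi> + \<psi>))"

text \<open>The graded subring with component W \<phi> / \<open>Fg \<phi>\<close> in degree \<phi>.
  As W contains \<open>Fg\<close>, having one representative in W means having all of them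
  there.\<close>

definition family_ring :: "('g \<Rightarrow> 'a set) \<Rightarrow> ('g \<Rightarrow> 'a set) set" where
  "family_ring W = {F \<in> carrier gr. \<forall>\<phi>\<in>\<Gamma>. F \<phi> \<in> cl \<phi> ` W \<phi>}"

context
  fixes W assumes W: "graded_family W"
begin

lemma W_Fe: "w \<in> W \<phi> \<Longrightarrow> w \<in> Fe \<phi>" and Fg_W: "w \<in> Fg \<phi> \<Longrightarrow> w \<in> W \<phi>"
  and W_base: "u \<in> R \<Longrightarrow> u \<in> W 0"
  and W_add: "w \<in> W \<phi> \<Longrightarrow> v \<in> W \<phi> \<Longrightarrow> w \<oplus> v \<in> W \<phi>"
  and W_mult: "w \<in> W \<phi> \<Longrightarrow> v \<in> W \<psi> \<Longrightarrow> w \<otimes> v \<in> W (\<phi> + \<psi>)"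
  using W unfolding graded_family_def by blast+

lemma W_minus: "w \<in> W \<phi> \<Longrightarrow> \<ominus> w \<in> W \<phi>"
proof -
  assume w: "w \<in> W \<phi>"
  have "(\<ominus> \<one>) \<otimes> w = \<ominus> w" using Fe_carrier[OF W_Fe[OF w]] by (simp add: l_minus)
  then show ?thesis using W_mult[OF W_base[of "\<ominus> \<one>"] w] R_minus by simp
qed

lemma homog_family: "\<phi> \<in> \<Gamma> \<Longrightarrow> w \<in> W \<phi> \<Longrightarrow> homog \<phi> w \<in> family_ring W"
proof -
  assume *: "\<phi> \<in> \<Gamma>" "w \<in> W \<phi>"
  have z: "Fg \<psi> \<in> cl \<psi> ` W \<psi>" for \<psi> using cl_zero[of \<psi>] Fg_W[OF Fg_zero] by (metis image_eqI)
  have at: "homog \<phi> w \<psi> \<in> cl \<psi> ` W \<psi>" if "\<psi> \<in> \<Gamma>" for \<psi> using * z by (simp add: embed_at[OF that])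
  then have "homog \<phi> w \<psi> \<in> carrier (piece \<psi>)" if "\<psi> \<in> \<Gamma>" for \<psi>
    using that W_Fe unfolding piece_carrier by blast
  then have "homog \<phi> w \<in> (\<Pi>\<^sub>E \<phi>\<in>\<Gamma>. carrier (piece \<phi>))" by (auto simp: PiE_iff gr_embed_def)
  moreover have "{\<psi>\<in>\<Gamma>. homog \<phi> w \<psi> \<noteq> Fg \<psi>} \<subseteq> {\<phi>}" by (auto simp: embed_at split: if_splits)
  then have "finite {\<psi>\<in>\<Gamma>. homog \<phi> w \<psi> \<noteq> Fg \<psi>}" by (rule finite_subset) simp
  ultimately show ?thesis using at unfolding family_ring_def gr_carrier by blast
qed

lemma family_ringI:
  assumes "\<And>\<phi>. \<phi> \<in> \<Gamma> \<Longrightarrow> F \<phi> \<in> cl \<phi> ` W \<phi>" "F \<in> extensional \<Gamma>" "finite {\<phi>\<in>\<Gamma>. F \<phi> \<noteq> Fg \<phi>}"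
  shows "F \<in> family_ring W"
proof -
  have "F \<phi> \<in> carrier (piece \<phi>)" if "\<phi> \<in> \<Gamma>" for \<phi>
    using assms(1)[OF that] W_Fe unfolding piece_carrier by blast
  then show ?thesis using assms unfolding family_ring_def gr_carrier PiE_iff by blast
qed

lemma family_add:
  assumes "F \<in> family_ring W" "H \<in> family_ring W" shows "F \<oplus>\<^bsub>gr\<^esub> H \<in> family_ring W"
proof (rule family_ringI)
  have fin: "finite {\<phi>\<in>\<Gamma>. F \<phi> \<noteq> Fg \<phi>}" "finite {\<phi>\<in>\<Gamma>. H \<phi> \<noteq> Fg \<phi>}"
    using assms unfolding family_ring_def gr_carrier by auto
  have one: "Fg \<phi> \<otimes>\<^bsub>piece \<phi>\<^esub> Fg \<phi> = Fg \<phi>" for \<phi>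
    using piece_mult[of \<zero> \<zero> \<phi>] by (simp add: cl_zero)
  have "{\<phi>\<in>\<Gamma>. (F \<oplus>\<^bsub>gr\<^esub> H) \<phi> \<noteq> Fg \<phi>} \<subseteq> {\<phi>\<in>\<Gamma>. F \<phi> \<noteq> Fg \<phi>} \<union> {\<phi>\<in>\<Gamma>. H \<phi> \<noteq> Fg \<phi>}"
    using one by (auto simp: gr_add)
  then show "finite {\<phi>\<in>\<Gamma>. (F \<oplus>\<^bsub>gr\<^esub> H) \<phi> \<noteq> Fg \<phi>}" using fin by (meson finite_Un finite_subset)
  show "F \<oplus>\<^bsub>gr\<^esub> H \<in> extensional \<Gamma>" by (simp add: gr_add)
  fix \<phi> assume \<phi>: "\<phi> \<in> \<Gamma>"
  obtain w v where wv: "F \<phi> = cl \<phi> w" "w \<in> W \<phi>" "H \<phi> = cl \<phi> v" "v \<in> W \<phi>"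
    using assms \<phi> unfolding family_ring_def by blast
  have "(F \<oplus>\<^bsub>gr\<^esub> H) \<phi> = cl \<phi> (w \<oplus> v)"
    using \<phi> wv Fe_R[OF W_Fe] by (simp add: gr_add piece_mult)
  then show "(F \<oplus>\<^bsub>gr\<^esub> H) \<phi> \<in> cl \<phi> ` W \<phi>" using W_add wv by blast
qed

lemma family_minus:
  assumes "F \<in> family_ring W" shows "\<ominus>\<^bsub>gr\<^esub> F \<in> family_ring W"
proof (rule family_ringI)
  have F: "F \<in> carrier gr" using assms unfolding family_ring_def by blast
  have at: "(\<ominus>\<^bsub>gr\<^esub> F) \<phi> = inv\<^bsub>piece \<phi>\<^esub> (F \<phi>)" if "\<phi> \<in> \<Gamma>" for \<phi> using that by (simp add: gr_minus[OF F])
  have one: "inv\<^bsub>piece \<phi>\<^esub> (Fg \<phi>) = Fg \<phi>" for \<phi> using piece_inv[of \<zero> \<phi>] by (simp add: cl_zero)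
  have "{\<phi>\<in>\<Gamma>. (\<ominus>\<^bsub>gr\<^esub> F) \<phi> \<noteq> Fg \<phi>} \<subseteq> {\<phi>\<in>\<Gamma>. F \<phi> \<noteq> Fg \<phi>}" using one at by auto
  then show "finite {\<phi>\<in>\<Gamma>. (\<ominus>\<^bsub>gr\<^esub> F) \<phi> \<noteq> Fg \<phi>}" using F unfolding gr_carrier by (meson finite_subset)
  show "\<ominus>\<^bsub>gr\<^esub> F \<in> extensional \<Gamma>" by (simp add: gr_minus[OF F])
  fix \<phi> assume \<phi>: "\<phi> \<in> \<Gamma>"
  obtain w where w: "F \<phi> = cl \<phi> w" "w \<in> W \<phi>" using assms \<phi> unfolding family_ring_def by blast
  have "(\<ominus>\<^bsub>gr\<^esub> F) \<phi> = cl \<phi> (\<ominus> w)" using at[OF \<phi>] w piece_inv[OF W_Fe] by simp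
  then show "(\<ominus>\<^bsub>gr\<^esub> F) \<phi> \<in> cl \<phi> ` W \<phi>" using W_minus w by blast
qed

lemma family_mult:
  assumes "F \<in> family_ring W" "H \<in> family_ring W" shows "F \<otimes>\<^bsub>gr\<^esub> H \<in> family_ring W"
proof (rule family_ringI)
  let ?S = "\<lambda>\<phi>. {\<alpha>\<in>\<Gamma>. F \<alpha> \<noteq> Fg \<alpha> \<and> H (\<phi> - \<alpha>) \<noteq> Fg (\<phi> - \<alpha>)}"
  let ?f = "\<lambda>\<phi> \<alpha>. rcoset_mult K (Fg \<phi>) (F \<alpha>) (H (\<phi> - \<alpha>))"
  have at: "(F \<otimes>\<^bsub>gr\<^esub> H) \<phi> = finprod (piece \<phi>) (?f \<phi>) (?S \<phi>)" if "\<phi> \<in> \<Gamma>" for \<phi> using that by (simp add: gr_mult)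
  \<comment> \<open>The support of a product lies among the sums of degrees from the two supports,
    hence is finite.\<close>
  let ?B = "(\<lambda>(a, b). a + b) ` ({\<phi>\<in>\<Gamma>. F \<phi> \<noteq> Fg \<phi>} \<times> {\<phi>\<in>\<Gamma>. H \<phi> \<noteq> Fg \<phi>})"
  have fin: "finite {\<phi>\<in>\<Gamma>. F \<phi> \<noteq> Fg \<phi>}" "finite {\<phi>\<in>\<Gamma>. H \<phi> \<noteq> Fg \<phi>}"
    using assms unfolding family_ring_def gr_carrier by auto
  have "{\<phi>\<in>\<Gamma>. (F \<otimes>\<^bsub>gr\<^esub> H) \<phi> \<noteq> Fg \<phi>} \<subseteq> ?B"
  proof
    fix \<phi> assume "\<phi> \<in> {\<phi>\<in>\<Gamma>. (F \<otimes>\<^bsub>gr\<^esub> H) \<phi> \<noteq> Fg \<phi>}"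
    then have \<phi>: "\<phi> \<in> \<Gamma>" "finprod (piece \<phi>) (?f \<phi>) (?S \<phi>) \<noteq> Fg \<phi>" using at by auto
    interpret p: comm_group "piece \<phi>" by (rule piece_comm_group)
    have "?S \<phi> \<noteq> {}"
    proof
      assume "?S \<phi> = {}"
      then have "finprod (piece \<phi>) (?f \<phi>) (?S \<phi>) = Fg \<phi>" by (simp only: p.finprod_empty piece_one)
      then show False using \<phi>(2) by contradiction
    qed
    then obtain a where a: "a \<in> \<Gamma>" "F a \<noteq> Fg a" "H (\<phi> - a) \<noteq> Fg (\<phi> - a)" by blast
    have "(a, \<phi> - a) \<in> {\<phi>\<in>\<Gamma>. F \<phi> \<noteq> Fg \<phi>} \<times> {\<phi>\<in>\<Gamma>. H \<phi> \<noteq> Fg \<phi>}"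
      using a Gamma_diff[OF \<phi>(1)] by simp
    moreover have "\<phi> = (\<lambda>(a, b). a + b) (a, \<phi> - a)" by simp
    ultimately show "\<phi> \<in> ?B" by (rule rev_image_eqI)
  qed
  then show "finite {\<phi>\<in>\<Gamma>. (F \<otimes>\<^bsub>gr\<^esub> H) \<phi> \<noteq> Fg \<phi>}" using fin by (meson finite_SigmaI finite_imageI finite_subset)
  show "F \<otimes>\<^bsub>gr\<^esub> H \<in> extensional \<Gamma>" by (simp add: gr_mult)
  fix \<phi> assume \<phi>: "\<phi> \<in> \<Gamma>"
  interpret p: comm_group "piece \<phi>" by (rule piece_comm_group)
  have f: "?f \<phi> a \<in> cl \<phi> ` W \<phi>" if a: "a \<in> \<Gamma>" for a
  proof -
    obtain w v where wv: "F a = cl a w" "w \<in> W a" "H (\<phi> - a) = cl (\<phi> - a) v" "v \<in> W (\<phi> - a)"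
      using assms a Gamma_diff[OF \<phi> a] unfolding family_ring_def by blast
    have "?f \<phi> a = cl \<phi> (w \<otimes> v)" using rcoset_mult_cl[OF W_Fe W_Fe, OF wv(2,4)] wv(1,3) by simp
    moreover have "w \<otimes> v \<in> W \<phi>" using W_mult[OF wv(2,4)] by simp
    ultimately show ?thesis by blast
  qed
  have sub: "cl \<phi> ` W \<phi> \<subseteq> carrier (piece \<phi>)" using W_Fe unfolding piece_carrier by blast
  have z: "\<one>\<^bsub>piece \<phi>\<^esub> \<in> cl \<phi> ` W \<phi>"
    unfolding piece_one_cl by (rule imageI[OF Fg_W[OF Fg_zero]])
  have fp: "finprod (piece \<phi>) (?f \<phi>) S \<in> cl \<phi> ` W \<phi>" if "S \<subseteq> \<Gamma>" for S
    using that
  proof (induction S rule: infinite_finite_induct)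
    case (insert a S)
    have "?f \<phi> \<in> S \<rightarrow> carrier (piece \<phi>)" "?f \<phi> a \<in> carrier (piece \<phi>)" using insert.prems f sub by auto
    then have e: "finprod (piece \<phi>) (?f \<phi>) (insert a S) = ?f \<phi> a \<otimes>\<^bsub>piece \<phi>\<^esub> finprod (piece \<phi>) (?f \<phi>) S"
      using insert.hyps by (intro p.finprod_insert)
    obtain w where w: "?f \<phi> a = cl \<phi> w" "w \<in> W \<phi>" using f insert.prems by blast
    obtain v where v: "finprod (piece \<phi>) (?f \<phi>) S = cl \<phi> v" "v \<in> W \<phi>" using insert by blast
    have "finprod (piece \<phi>) (?f \<phi>) (insert a S) = cl \<phi> (w \<oplus> v)"
      unfolding e w(1) v(1) using w v Fe_R[OF W_Fe] by (intro piece_mult)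
    then show ?case using W_add[OF w(2) v(2)] by blast
  next
    case (infinite S)
    show ?case unfolding p.finprod_infinite[OF infinite.hyps] by (rule z)
  next
    case empty
    show ?case unfolding p.finprod_empty by (rule z)
  qed
  have S: "?S \<phi> \<subseteq> \<Gamma>" by (rule Collect_restrict)
  have "finprod (piece \<phi>) (?f \<phi>) (?S \<phi>) \<in> cl \<phi> ` W \<phi>" by (rule fp[OF S])
  with at[OF \<phi>] show "(F \<otimes>\<^bsub>gr\<^esub> H) \<phi> \<in> cl \<phi> ` W \<phi>" by (rule ssubst)
qed

end

text \<open>Domination identifies m with the elements of R of positive value, so the structure map
  of the algebra starts from the degree zero piece.\<close>

lemma degree_zero_piece: "carrier (A Quot m) = cl 0 ` R"
proof -
  have "u \<in> m \<longleftrightarrow> u \<in> Fg 0" for u using m_iff[of u] m_R[of u] unfolding Fg_iff by blast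
  then have "m = Fg 0" by (rule Set.set_eqI)
  then show ?thesis by (auto simp: FactRing_def A_RCOSETS_def RCOSETS_def a_r_coset_def r_coset_def)
qed

text \<open>The family ring is closed under the ring operations and contains the constants, because
  W 0 contains R.\<close>

lemma subalgebra_family:
  assumes W: "graded_family W" and E: "E \<subseteq> family_ring W"
  shows "gr_subalgebra K \<nu> R m E \<subseteq> family_ring W"
proof
  have b: "homog 0 u \<in> family_ring W" if "u \<in> R" for u
    using homog_family[OF W Gamma_zero] W_base[OF W that] by blast
  fix F assume "F \<in> gr_subalgebra K \<nu> R m E"
  then show "F \<in> family_ring W" unfolding gr_subalgebra_def
  proof (induction rule: generate_ring.induct)
    case one then show ?case unfolding gr_one by (rule b) simp
  next
    case (incl h) then show ?case using b E unfolding degree_zero_piece by blast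
  qed (rule family_minus[OF W] family_add[OF W] family_mult[OF W]; assumption)+
qed

end

section \<open>Generators of the associated graded ring\<close>

context generating_sequence
begin

abbreviation "init_form f \<equiv> initial_form K \<nu> R f"

lemma Fe_self: "f \<in> R \<Longrightarrow> f \<in> Fe (\<nu> f)"
  by (simp add: Fe_iff geI R_sub)

lemma graded_family_Fe: "graded_family (\<lambda>\<phi>. Fe \<phi>)"
  unfolding graded_family_def
proof (intro conjI allI ballI subsetI)
  show "f \<in> Fe 0" if "f \<in> R" for f using that R_ge by (simp add: Fe_iff)
qed (auto intro: Fg_Fe Fe_add Fe_mult)

lemma homog_carrier: "\<phi> \<in> \<Gamma> \<Longrightarrow> w \<in> Fe \<phi> \<Longrightarrow> homog \<phi> w \<in> carrier gr"
  using homog_family[OF graded_family_Fe] unfolding family_ring_def by blast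

lemma initial_form_family:
  assumes "graded_family W" "f \<in> R" "f \<noteq> \<zero>" "f \<in> W (\<nu> f)" shows "init_form f \<in> family_ring W"
  unfolding initial_form_def using assms(2-4) R_sub by (intro homog_family[OF assms(1)] Gamma_v) auto

text \<open>If the initial form of f lay in the subalgebra, it would be the class of some w in W;
  since f - w has higher value it is in W too, and so would be f.\<close>

lemma initial_form_separated:
  assumes W: "graded_family W" and E: "E \<subseteq> family_ring W"
    and f: "f \<in> R" "f \<noteq> \<zero>" "f \<notin> W (\<nu> f)"
  shows "gr_subalgebra K \<nu> R m E \<noteq> carrier gr"
proof
  assume e: "gr_subalgebra K \<nu> R m E = carrier gr"
  have \<Gamma>: "\<nu> f \<in> \<Gamma>" using f R_sub by (intro Gamma_v) auto
  have "init_form f \<in> carrier gr" unfolding initial_form_def by (rule homog_carrier[OF \<Gamma> Fe_self[OF f(1)]])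
  then have "init_form f \<in> family_ring W" using subalgebra_family[OF W E] e by blast
  then have "init_form f (\<nu> f) \<in> cl (\<nu> f) ` W (\<nu> f)" using \<Gamma> unfolding family_ring_def by blast
  then have "cl (\<nu> f) f \<in> cl (\<nu> f) ` W (\<nu> f)" unfolding initial_form_def by (simp add: embed_at[OF \<Gamma>])
  then obtain w where w: "w \<in> W (\<nu> f)" "cl (\<nu> f) f = cl (\<nu> f) w" by blast
  have wR: "w \<in> R" by (rule Fe_R[OF W_Fe[OF W w(1)]])
  have d: "f \<ominus> w \<in> Fg (\<nu> f)" using cl_eqD[OF f(1) wR] cl_self[OF f(1), of "\<nu> f"] w(2) by simp
  have "f = w \<oplus> (f \<ominus> w)" using R_sub[OF f(1)] R_sub[OF wR] by algebra
  then have "f \<in> W (\<nu> f)" using W_add[OF W w(1) Fg_W[OF W d]] by simp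
  then show False using f(3) by contradiction
qed

section \<open>Generation of the graded ring\<close>

context
  fixes E :: "('g \<Rightarrow> 'a set) set" assumes E: "E \<subseteq> init_form ` (R - {\<zero>})"
begin

abbreviation "S \<equiv> gr_subalgebra K \<nu> R m E"

lemma S_carrier: "S \<subseteq> carrier gr"
proof -
  have "E \<subseteq> family_ring (\<lambda>\<phi>. Fe \<phi>)"
    using E Fe_self by (auto intro!: initial_form_family[OF graded_family_Fe])
  then show ?thesis using subalgebra_family[OF graded_family_Fe] unfolding family_ring_def by blast
qed

lemma S_base: "u \<in> R \<Longrightarrow> homog 0 u \<in> S"
  unfolding gr_subalgebra_def degree_zero_piece by (rule generate_ring.incl) blast

lemma S_incl: "F \<in> E \<Longrightarrow> F \<in> S"
  unfolding gr_subalgebra_def by (rule generate_ring.incl) blast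

lemma S_add: "w \<in> Fe \<phi> \<Longrightarrow> v \<in> Fe \<phi> \<Longrightarrow> homog \<phi> w \<in> S \<Longrightarrow> homog \<phi> v \<in> S \<Longrightarrow> homog \<phi> (w \<oplus> v) \<in> S"
  unfolding homog_add[symmetric] gr_subalgebra_def by (rule generate_ring.eng_add)

lemma S_mult: "w \<in> Fe \<phi> \<Longrightarrow> v \<in> Fe \<psi> \<Longrightarrow> \<phi> \<in> \<Gamma> \<Longrightarrow> \<psi> \<in> \<Gamma> \<Longrightarrow> homog \<phi> w \<in> S \<Longrightarrow> homog \<psi> v \<in> S
    \<Longrightarrow> homog (\<phi> + \<psi>) (w \<otimes> v) \<in> S"
  unfolding homog_mult[symmetric] gr_subalgebra_def by (rule generate_ring.eng_mult)

lemma homog_trivial: "w \<in> Fg \<phi> \<Longrightarrow> homog \<phi> w = \<zero>\<^bsub>gr\<^esub>"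
  by (rule ext) (simp add: gr_embed_def gr_zero cl_trivial piece_one)

lemma S_zero: "\<zero>\<^bsub>gr\<^esub> \<in> S"
  using S_base[OF R_zero] homog_trivial[OF Fg_zero] by simp

lemma S_trivial: "w \<in> Fg \<phi> \<Longrightarrow> homog \<phi> w \<in> S"
  by (simp add: homog_trivial S_zero)

lemma S_product:
  assumes "f \<in> R" "f \<noteq> \<zero>" "h \<in> R" "h \<noteq> \<zero>" "init_form f \<in> S" "init_form h \<in> S"
  shows "init_form (f \<otimes> h) \<in> S"
proof -
  have "f \<in> carrier K" "h \<in> carrier K" using assms R_sub by auto
  then show ?thesis
    using S_mult[OF Fe_self[OF assms(1)] Fe_self[OF assms(3)] Gamma_v Gamma_v] assms
    unfolding initial_form_def by simp
qed

lemma S_power: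
  assumes "f \<in> R" "f \<noteq> \<zero>" "init_form f \<in> S" shows "init_form (f [^] (e::nat)) \<in> S"
proof (induction e)
  case 0
  then show ?case using S_base[OF R_one] by (simp add: initial_form_def)
next
  case (Suc e)
  have "f [^] e \<noteq> \<zero>" using assms R_sub by (simp add: pow_nonzero)
  then show ?case using S_product[OF R_pow[OF assms(1)] _ assms(1,2) Suc assms(3)] by simp
qed

lemma S_finsum:
  assumes "finite B" "\<And>b. b \<in> B \<Longrightarrow> f b \<in> Fe \<phi>" "\<And>b. b \<in> B \<Longrightarrow> homog \<phi> (f b) \<in> S"
  shows "homog \<phi> (\<Oplus>b\<in>B. f b) \<in> S"
proof -
  have "(\<Oplus>b\<in>B. f b) \<in> Fe \<phi> \<and> homog \<phi> (\<Oplus>b\<in>B. f b) \<in> S"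
    using assms
  proof (induction B rule: finite_induct)
    case empty
    show ?case using S_trivial[OF Fg_zero] by simp
  next
    case (insert b B)
    have "f \<in> B \<rightarrow> carrier K" "f b \<in> carrier K" using insert.prems(1) Fe_carrier by auto
    then show ?case using insert by (auto intro: Fe_add S_add)
  qed
  then show ?thesis by blast
qed

context
  assumes x_E: "init_form x \<in> E" and P_E: "\<And>i. i \<in> J \<Longrightarrow> 1 < n i \<Longrightarrow> init_form (P i) \<in> E"
begin

text \<open>No term has smaller value than the whole normal form, so its initial form is the sum of
  the initial forms of the terms of minimal value.\<close>

lemma NF_initial_form: "1 \<le> i \<Longrightarrow> ok i \<Longrightarrow> s \<in> NF i \<Longrightarrow> s \<noteq> \<zero> \<Longrightarrow> init_form s \<in> S"
proof (induction i arbitrary: s rule: dec_induct)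
  case base
  obtain u a where u: "s = u \<otimes> x [^] (a::nat)" "u \<in> R" "u \<noteq> \<zero>" "\<nu> u = 0"
    using base(2,3) unfolding One_nat_def NF.simps by blast
  have "init_form u \<in> S" using S_base[OF u(2)] u(4) by (simp add: initial_form_def)
  moreover have "init_form (x [^] a) \<in> S" using S_incl[OF x_E] x_R x_nz by (intro S_power)
  moreover have "x [^] a \<noteq> \<zero>" using x_R x_nz R_sub by (simp add: pow_nonzero)
  ultimately show ?case unfolding u(1) by (intro S_product u(2,3) R_pow x_R)
next
  case (step i)
  have le: "enat i \<le> \<Omega>" using step.prems(1) ok_Suc by blast
  have oki: "ok i" by (rule ok_le[OF step.prems(1)]) simp
  have Pi: "P i \<in> R" "P i \<noteq> \<zero>" using P_R[OF le] P_nz[OF le] by auto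
  have iJ: "i \<in> J" using le step.hyps(1) by (simp add: J_def)
  obtain t B where t: "s = (\<Oplus>b\<in>{..<B}. t b \<otimes> P i [^] b)" "\<And>b. b < B \<Longrightarrow> t b \<in> NF i" "enat B \<le> n i"
    using NF_SucE[OF step.prems(2) step.hyps(1)] by blast
  let ?f = "\<lambda>b. t b \<otimes> P i [^] b"
  have tR: "t b \<in> R" if "b < B" for b using NF_R[OF oki t(2)[OF that]] .
  have fR: "?f b \<in> R" if "b < B" for b using tR[OF that] Pi by (intro R_mult R_pow)
  have le_f: "?f b = \<zero> \<or> \<nu> s \<le> \<nu> (?f b)" if "b < B" for b
  proof (cases "t b = \<zero>")
    case True
    then show ?thesis using Pi R_sub by simp
  next
    case False
    have "\<nu> s \<le> \<nu> (t b) + nat_multiple b (\<beta> i)"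
      by (rule NF_sum_le(2)[OF step.hyps(1) le t(2,3,1) that False])
    then show ?thesis using False Pi tR[OF that] R_sub by simp
  qed
  have "homog (\<nu> s) (?f b) \<in> S" if b: "b < B" for b
  proof (cases "?f b = \<zero> \<or> \<nu> s < \<nu> (?f b)")
    case True
    then show ?thesis using fR[OF b] by (intro S_trivial) (auto simp: val_gt_def)
  next
    case False
    then have nz: "t b \<noteq> \<zero>" and eq: "\<nu> s = \<nu> (?f b)" using le_f[OF b] Pi R_sub by auto
    have Pb: "init_form (P i [^] b) \<in> S"
    proof (cases "b = 0")
      case True
      then show ?thesis using S_base[OF R_one] by (simp add: initial_form_def)
    next
      case f: False
      have "1 < enat B" using b f by (simp add: one_enat_def)
      then have "1 < n i" using t(3) by (rule less_le_trans)
      then show ?thesis using S_power[OF Pi S_incl[OF P_E[OF iJ]]] by blast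
    qed
    have "P i [^] b \<noteq> \<zero>" using Pi R_sub by (simp add: pow_nonzero)
    then have "init_form (?f b) \<in> S"
      using step.IH[OF oki t(2)[OF b] nz] Pb by (intro S_product tR[OF b] nz R_pow Pi)
    then show ?thesis unfolding initial_form_def eq .
  qed
  moreover have "?f b \<in> Fe (\<nu> s)" if "b < B" for b
    using fR[OF that] le_f[OF that] by (auto simp: val_ge_def)
  ultimately show ?case unfolding initial_form_def using S_finsum[of "{..<B}" ?f "\<nu> s"] t(1) by simp
qed

lemma finv_initial_form:
  assumes "f \<in> R" "f \<noteq> \<zero>" "finv (\<nu> f)" shows "init_form f \<in> S"
proof -
  obtain i s where s: "1 \<le> i" "ok i" "s \<in> NF i" "s \<noteq> \<zero>" "\<nu> s = \<nu> f" "f \<ominus> s \<in> gt (\<nu> f)"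
    by (rule representation[OF assms])
  have sR: "s \<in> R" by (rule NF_R[OF s(2,3)])
  have "cl (\<nu> f) f = cl (\<nu> f) s" using s(6) assms(1) sR by (intro cl_eqI) (auto simp: Fg_iff R_diff)
  then show ?thesis using NF_initial_form[OF s(1-4)] s(5) by (simp add: initial_form_def)
qed

text \<open>Every nonzero homogeneous element is an initial form, and h takes care of the part of f
  that normal forms do not reach.\<close>

lemma gr_generated:
  assumes h: "h \<in> R" "h \<noteq> \<zero>" "init_form h \<in> E"
    and dec: "\<And>f. f \<in> R \<Longrightarrow> f \<noteq> \<zero> \<Longrightarrow> \<exists>k f'. f' \<in> R \<and> f' \<noteq> \<zero> \<and> finv (\<nu> f') \<and> f = h [^] (k::nat) \<otimes> f'"
  shows "S = carrier gr"
proof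
  have all: "init_form f \<in> S" if f: "f \<in> R" "f \<noteq> \<zero>" for f
  proof -
    obtain k f' where k: "f' \<in> R" "f' \<noteq> \<zero>" "finv (\<nu> f')" "f = h [^] (k::nat) \<otimes> f'"
      using dec[OF f] by blast
    have "h [^] k \<noteq> \<zero>" using h R_sub by (simp add: pow_nonzero)
    then show ?thesis unfolding k(4)
      using S_power[OF h(1,2) S_incl[OF h(3)]] finv_initial_form[OF k(1-3)]
      by (intro S_product R_pow h(1) k(1,2))
  qed
  show "carrier gr \<subseteq> S"
  proof (rule gr_generated_by_homogeneous)
    show "F \<oplus>\<^bsub>gr\<^esub> H \<in> S" if "F \<in> S" "H \<in> S" for F H
      using that unfolding gr_subalgebra_def by (rule generate_ring.eng_add)
    show "homog \<phi> w \<in> S" if w: "w \<in> Fe \<phi>" for \<phi> w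
    proof (cases "w \<in> Fg \<phi>")
      case False
      then have "w \<in> R" "w \<noteq> \<zero>" "\<nu> w = \<phi>" using w by (auto simp: val_ge_def val_gt_def)
      then show ?thesis using all[of w] by (simp add: initial_form_def)
    qed (rule S_trivial)
  qed (rule S_zero)
qed (rule S_carrier)

end

end

section \<open>Indispensability of the generators\<close>

lemma gr_subalgebra_mono: "E \<subseteq> E' \<Longrightarrow> gr_subalgebra K \<nu> R m E \<subseteq> gr_subalgebra K \<nu> R m E'"
proof
  assume E: "E \<subseteq> E'"
  fix F assume "F \<in> gr_subalgebra K \<nu> R m E"
  then show "F \<in> gr_subalgebra K \<nu> R m E'" unfolding gr_subalgebra_def
    by (induction rule: generate_ring.induct) (use E in \<open>auto intro: generate_ring.intros\<close>)
qed

text \<open>D says which nontrivial classes are allowed in a degree. Elements of higher value are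
  allowed throughout, so products need checking only for elements of exact value, and by
  commutativity sums only when D holds for the first summand.\<close>

lemma graded_familyI:
  assumes add: "\<And>\<phi> w v. w \<in> Fe \<phi> \<Longrightarrow> v \<in> Fe \<phi> \<Longrightarrow> D \<phi> w \<Longrightarrow> v \<in> Fg \<phi> \<or> D \<phi> v \<Longrightarrow> D \<phi> (w \<oplus> v)"
    and mult: "\<And>w v. w \<in> R \<Longrightarrow> w \<noteq> \<zero> \<Longrightarrow> v \<in> R \<Longrightarrow> v \<noteq> \<zero> \<Longrightarrow> D (\<nu> w) w \<Longrightarrow> D (\<nu> v) v \<Longrightarrow> D (\<nu> w + \<nu> v) (w \<otimes> v)"
    and base: "\<And>u. u \<in> R \<Longrightarrow> u \<noteq> \<zero> \<Longrightarrow> \<nu> u = 0 \<Longrightarrow> D 0 u"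
  shows "graded_family (\<lambda>\<phi>. {w \<in> Fe \<phi>. w \<in> Fg \<phi> \<or> D \<phi> w})" (is "graded_family ?W")
  unfolding graded_family_def
proof (intro conjI allI ballI subsetI)
  show "w \<in> ?W \<phi>" if "w \<in> Fg \<phi>" for \<phi> w using that Fg_Fe by simp
  show "w \<in> Fe \<phi>" if "w \<in> ?W \<phi>" for \<phi> w using that by simp
  show "u \<in> ?W 0" if u: "u \<in> R" for u
  proof (cases "u \<in> Fg 0")
    case False
    then have "u \<noteq> \<zero>" "\<nu> u = 0" using u R_ge[OF u] by (auto simp: val_gt_def ge_def)
    then show ?thesis using base[OF u] Fe_self[OF u] by simp
  qed (simp add: Fg_Fe)
  show "w \<oplus> v \<in> ?W \<phi>" if "w \<in> ?W \<phi>" "v \<in> ?W \<phi>" for \<phi> w v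
  proof -
    have F: "w \<in> Fe \<phi>" "v \<in> Fe \<phi>" using that by auto
    have c: "w \<oplus> v = v \<oplus> w" using Fe_carrier[OF F(1)] Fe_carrier[OF F(2)] by (rule a_comm)
    have "w \<oplus> v \<in> Fg \<phi> \<or> D \<phi> (w \<oplus> v)"
    proof (cases "w \<in> Fg \<phi>")
      case True
      show ?thesis
      proof (cases "v \<in> Fg \<phi>")
        case False
        then have "D \<phi> (v \<oplus> w)" using that True by (intro add[OF F(2,1)]) auto
        then show ?thesis unfolding c by blast
      qed (use True Fg_add in blast)
    next
      case False
      then have "D \<phi> (w \<oplus> v)" using that by (intro add[OF F]) auto
      then show ?thesis by blast
    qed
    then show ?thesis using Fe_add[OF F] by simp
  qed
  show "w \<otimes> v \<in> ?W (\<phi> + \<psi>)" if wv: "w \<in> ?W \<phi>" "v \<in> ?W \<psi>" for \<phi> \<psi> w v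
  proof -
    have F: "w \<in> Fe \<phi>" "v \<in> Fe \<psi>" using wv by auto
    have "w \<otimes> v \<in> Fg (\<phi> + \<psi>) \<or> D (\<phi> + \<psi>) (w \<otimes> v)"
    proof (cases "w \<in> Fg \<phi> \<or> v \<in> Fg \<psi>")
      case True
      then show ?thesis using Fg_mult[OF _ F(2)] Fg_mult'[OF F(1)] by blast
    next
      case False
      then have "w \<in> R" "w \<noteq> \<zero>" "\<nu> w = \<phi>" "v \<in> R" "v \<noteq> \<zero>" "\<nu> v = \<psi>"
        using F by (auto simp: val_ge_def val_gt_def)
      then show ?thesis using mult[of w v] False wv by simp
    qed
    then show ?thesis using Fe_mult[OF F] by simp
  qed
qed

lemma rational_add:
  assumes M: "M \<in> carrier K" "M \<noteq> \<zero>" "\<nu> M = \<phi>" and F: "w \<in> Fe \<phi>" "v \<in> Fe \<phi>"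
    and k: "res (w \<otimes> inv M) \<in> Kf i" "res (v \<otimes> inv M) \<in> Kf i"
  shows "res ((w \<oplus> v) \<otimes> inv M) \<in> Kf i"
proof -
  have iM: "inv M \<in> carrier K" "inv M \<in> ge (- \<phi>)" using M by (auto intro!: geI)
  have g: "w \<otimes> inv M \<in> ge 0" "v \<otimes> inv M \<in> ge 0"
    using ge_mult[OF _ iM(2), of _ \<phi>] F by (auto simp: Fe_iff)
  have "(w \<oplus> v) \<otimes> inv M = w \<otimes> inv M \<oplus> v \<otimes> inv M"
    using Fe_carrier[OF F(1)] Fe_carrier[OF F(2)] iM(1) by (rule l_distr)
  then show ?thesis using res_add[OF g] Kf_add[OF k] by simp
qed

lemma rational_trivial:
  assumes M: "M \<in> carrier K" "M \<noteq> \<zero>" "\<nu> M = \<phi>" and w: "w \<in> Fg \<phi>"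
  shows "res (w \<otimes> inv M) \<in> Kf i"
proof -
  have iM: "inv M \<in> ge (- \<phi>)" using M by (auto intro!: geI)
  have "w \<otimes> inv M \<in> gt 0" using gt_mult[OF _ iM, of w \<phi>] w by (simp add: Fg_iff)
  then show ?thesis using res_zero_iff[OF gt_ge] Kf_zero by simp
qed

text \<open>This is where \<open>n\<^sub>i > 1\<close> enters: otherwise \<open>P\<^sub>i\<close> would have a value in the group generated by the
  earlier elements and \<open>\<alpha>\<^sub>i\<close> would lie in the previous field.\<close>

lemma P_not_rational:
  assumes i: "i \<in> J" "1 < n i" and M: "M \<in> Mon i" "\<nu> M = \<beta> i"
  shows "res (P i \<otimes> inv M) \<notin> Kf i"
proof
  assume r: "res (P i \<otimes> inv M) \<in> Kf i"
  have i1: "1 \<le> i" "enat i \<le> \<Omega>" using J_D[OF i(1)] by auto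
  have oki: "ok i" using i1 ok_Suc ok_le le_SucI by blast
  have "\<beta> i \<in> G i" using Mon_v[OF oki M(1)] M(2) by simp
  then have "\<not> 1 < nbar i" using beta_notin_G[OF i(1)] by blast
  then have N: "nbar i = enat 1" by (rule nbar_le_1[OF i(1)])
  obtain w U where U: "U = monomial K P i w" "\<nu> U = nat_multiple 1 (\<beta> i)" "\<alpha> i = res (P i [^] (1::nat) \<otimes> inv U)"
    by (rule step_fin[OF i1 N]) blast
  have Pi: "P i \<in> carrier K" "P i \<noteq> \<zero>" using P_carrier P_nz i1 by auto
  have "rational i (P i)" unfolding rational_def using r M by blast
  moreover have "U \<in> Mon i" unfolding U(1) by (rule monomial_Mon[OF oki])
  ultimately have a: "\<alpha> i \<in> Kf i"
    using rational_all[OF oki Pi, of U] U(2,3) Pi by simp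
  interpret L: field L by (rule L.field_axioms)
  have "extension_degree L (Kf (Suc i)) (Kf i) = 1"
    using L.degree_one_iff[OF Kf_subfield[OF oki] alpha_closed[OF i1] Kf_Suc'[OF i1]] a by blast
  then have "d i = 1" using d_def[OF i1 N] by simp
  then have "n i = 1" using n_eq[OF i1] N by (simp add: one_enat_def)
  then show False using i(2) by simp
qed

definition gens :: "'a set \<Rightarrow> 'a set" where
  "gens H = {x} \<union> {P i | i. i \<in> J \<and> 1 < n i} \<union> H"

context
  fixes H :: "'a set"
  assumes H: "H = {} \<or> (\<exists>h. H = {h} \<and> h \<in> R \<and> h \<noteq> \<zero> \<and> \<not> finv (\<nu> h) \<and> (\<forall>i\<in>J. finv (\<beta> i)))"
begin

lemma H_D:
  assumes "h \<in> H"
  shows "h \<in> R" "h \<noteq> \<zero>" "\<nu> x < \<nu> h" "\<not> finv (\<nu> h)" "\<And>i. i \<in> J \<Longrightarrow> \<beta> i < \<nu> h" "\<And>i. i \<in> J \<Longrightarrow> finv (\<beta> i)"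
proof -
  have h: "h \<in> R" "h \<noteq> \<zero>" "\<not> finv (\<nu> h)" "\<forall>i\<in>J. finv (\<beta> i)" using H assms by auto
  then show "h \<in> R" "h \<noteq> \<zero>" "\<not> finv (\<nu> h)" "\<And>i. i \<in> J \<Longrightarrow> finv (\<beta> i)" by auto
  show "\<nu> x < \<nu> h" using finv_le[OF finv_x, of "\<nu> h"] h(3) by (meson not_less)
  show "\<beta> i < \<nu> h" if "i \<in> J" for i using finv_le[of "\<beta> i" "\<nu> h"] h(3,4) that by (meson not_less)
qed

lemma gens_cases:
  assumes "f \<in> gens H"
  obtains "f = x" | i where "f = P i" "i \<in> J" "1 < n i" | "f \<in> H"
  using assms unfolding gens_def by blast

lemma gens_R: "f \<in> gens H \<Longrightarrow> f \<in> R \<and> f \<noteq> \<zero>"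
proof (erule gens_cases)
  show "f \<in> R \<and> f \<noteq> \<zero>" if "f = P i" "i \<in> J" for i
    using P_R[of i] P_nz[of i] J_D[OF that(2)] that(1) by simp
qed (simp_all add: x_R x_nz H_D(1,2))

text \<open>Deleting the initial form of e deletes every element sharing it, so it suffices to place
  all generators other than e itself into W.\<close>

lemma separate:
  assumes "graded_family W" "e \<in> R" "e \<noteq> \<zero>" "e \<notin> W (\<nu> e)"
    and "\<And>f. f \<in> gens H \<Longrightarrow> f \<noteq> e \<Longrightarrow> f \<in> W (\<nu> f)"
  shows "gr_subalgebra K \<nu> R m (init_form ` gens H - {init_form e}) \<noteq> carrier gr"
proof (rule initial_form_separated[OF assms(1) _ assms(2-4)])
  show "init_form ` gens H - {init_form e} \<subseteq> family_ring W"
    using assms(5) gens_R by (auto intro!: initial_form_family[OF assms(1)])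
qed

text \<open>Up to degree \<nu>(P_i) the family admits only multiples of Laurent monomials in earlier
  elements with coefficients from \<open>Kf i\<close>; above it, everything. Earlier generators
  satisfy this, later ones and H have larger degree, and \<open>P_not_rational\<close> excludes
  P_i.\<close>

lemma P_indispensable:
  assumes i: "i \<in> J" "1 < n i"
  shows "gr_subalgebra K \<nu> R m (init_form ` gens H - {init_form (P i)}) \<noteq> carrier gr"
proof -
  have i1: "1 \<le> i" "enat i \<le> \<Omega>" using J_D[OF i(1)] by auto
  have oki: "ok i" using i1 ok_Suc ok_le le_SucI by blast
  define D where "D \<phi> w \<longleftrightarrow> \<beta> i < \<phi> \<or> (\<exists>M\<in>Mon i. \<nu> M = \<phi> \<and> res (w \<otimes> inv M) \<in> Kf i)" for \<phi> w
  have Pi: "P i \<in> R" "P i \<noteq> \<zero>" using P_R P_nz i1 by auto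
  have Mc: "M \<in> carrier K" "M \<noteq> \<zero>" if "M \<in> Mon i" for M using Mon_nz[OF oki that] by auto
  have "graded_family (\<lambda>\<phi>. {w \<in> Fe \<phi>. w \<in> Fg \<phi> \<or> D \<phi> w})"
  proof (rule graded_familyI)
    show "D 0 u" if u: "u \<in> R" for u
    proof -
      have "res (u \<otimes> inv \<one>) \<in> Kf i" using res_R_Kf[OF u] R_sub[OF u] by simp
      then show ?thesis unfolding D_def using Mon_one by force
    qed
  next
    fix w v assume w: "w \<in> R" "w \<noteq> \<zero>" "D (\<nu> w) w" and v: "v \<in> R" "v \<noteq> \<zero>" "D (\<nu> v) v"
    have nn: "0 \<le> \<nu> w" "0 \<le> \<nu> v" using R_ge w v by (auto simp: ge_def)
    show "D (\<nu> w + \<nu> v) (w \<otimes> v)"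
    proof (cases "\<beta> i < \<nu> w \<or> \<beta> i < \<nu> v")
      case True
      then have "\<beta> i < \<nu> w + \<nu> v" using nn by (auto intro: less_le_trans[of _ "\<nu> w"] less_le_trans[of _ "\<nu> v"])
      then show ?thesis unfolding D_def by blast
    next
      case False
      obtain M where M: "M \<in> Mon i" "\<nu> M = \<nu> w" "res (w \<otimes> inv M) \<in> Kf i"
        using False w(3) unfolding D_def by blast
      obtain N where N: "N \<in> Mon i" "\<nu> N = \<nu> v" "res (v \<otimes> inv N) \<in> Kf i"
        using False v(3) unfolding D_def by blast
      have c: "w \<in> carrier K" "v \<in> carrier K" "inv M \<in> carrier K" "inv N \<in> carrier K"
        using w v R_sub Mc M N by auto
      have "(w \<otimes> v) \<otimes> (inv M \<otimes> inv N) = (w \<otimes> inv M) \<otimes> (v \<otimes> inv N)" using c by algebra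
      then have e: "(w \<otimes> v) \<otimes> inv (M \<otimes> N) = (w \<otimes> inv M) \<otimes> (v \<otimes> inv N)"
        using inv_mult[OF Mc[OF M(1)] Mc[OF N(1)]] by simp
      have g: "w \<otimes> inv M \<in> ge 0" "v \<otimes> inv N \<in> ge 0"
        using c w v M N Mc by (auto intro!: geI)
      have "res ((w \<otimes> v) \<otimes> inv (M \<otimes> N)) \<in> Kf i" unfolding e res_mult[OF g] by (rule Kf_mult[OF M(3) N(3)])
      moreover have "\<nu> (M \<otimes> N) = \<nu> w + \<nu> v" using Mc[OF M(1)] Mc[OF N(1)] M(2) N(2) by simp
      ultimately show ?thesis unfolding D_def using Mon_mult[OF oki M(1) N(1)] by blast
    qed
  next
    fix \<phi> w v assume F: "w \<in> Fe \<phi>" "v \<in> Fe \<phi>" and w: "D \<phi> w" and v: "v \<in> Fg \<phi> \<or> D \<phi> v"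
    show "D \<phi> (w \<oplus> v)"
    proof (cases "\<beta> i < \<phi>")
      case False
      then obtain M where M: "M \<in> Mon i" "\<nu> M = \<phi>" "res (w \<otimes> inv M) \<in> Kf i"
        using w unfolding D_def by blast
      have "res (v \<otimes> inv M) \<in> Kf i"
      proof (cases "v \<in> Fg \<phi>")
        case True
        then show ?thesis by (rule rational_trivial[OF Mc[OF M(1)] M(2)])
      next
        case f: False
        then obtain N where N: "N \<in> Mon i" "\<nu> N = \<phi>" "res (v \<otimes> inv N) \<in> Kf i"
          using v False unfolding D_def by blast
        have vv: "v \<noteq> \<zero>" "\<nu> v = \<phi>" using f F(2) by (auto simp: val_ge_def val_gt_def)
        have "rational i v" unfolding rational_def using N vv by auto
        then show ?thesis using rational_all[OF oki Fe_carrier[OF F(2)] vv(1)] M vv by simp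
      qed
      then show ?thesis unfolding D_def using rational_add[OF Mc[OF M(1)] M(2) F M(3)] M by blast
    qed (simp add: D_def)
  qed
  moreover have "\<not> D (\<beta> i) (P i)" unfolding D_def using P_not_rational[OF i] by auto
  then have "P i \<notin> {w \<in> Fe (\<beta> i). w \<in> Fg (\<beta> i) \<or> D (\<beta> i) w}" using Pi by (auto simp: val_gt_def)
  moreover have early: "P j \<in> {w \<in> Fe (\<beta> j). w \<in> Fg (\<beta> j) \<or> D (\<beta> j) w}" if "j < i" for j
  proof -
    have Mj: "P j \<in> Mon i" by (rule P_Mon[OF oki that])
    have "P j \<otimes> inv (P j) = \<one>" using Mc[OF Mj] by simp
    then have "res (P j \<otimes> inv (P j)) \<in> Kf i" using res_R_Kf[OF R_one] by simp
    moreover have "P j \<in> R" using P_R that i1(2) by (meson enat_ord_simps(2) less_imp_le order_trans)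
    ultimately show ?thesis using Fe_self Mj unfolding D_def by blast
  qed
  have "f \<in> {w \<in> Fe (\<nu> f). w \<in> Fg (\<nu> f) \<or> D (\<nu> f) w}" if f: "f \<in> gens H" "f \<noteq> P i" for f
  proof -
    have late: ?thesis if "\<beta> i < \<nu> f" using that Fe_self gens_R[OF f(1)] by (auto simp: D_def)
    show ?thesis
    proof (rule gens_cases[OF f(1)])
      show ?thesis if "f = x" using early[of 0] i1 that by simp
      show ?thesis if j: "f = P j" "j \<in> J" for j
      proof (cases "j < i")
        case True
        then show ?thesis using early j(1) by simp
      next
        case False
        then have "i < j" using f(2) j(1) by (cases "j = i") auto
        then show ?thesis using beta_mono[OF i1(1)] J_D[OF j(2)] late j(1) by simp
      qed
      show ?thesis if "f \<in> H" by (rule late[OF H_D(5)[OF that i(1)]])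
    qed
  qed
  ultimately show ?thesis using Pi by (intro separate[of "\<lambda>\<phi>. {w \<in> Fe \<phi>. w \<in> Fg \<phi> \<or> D \<phi> w}"])
qed

lemma x_indispensable: "gr_subalgebra K \<nu> R m (init_form ` gens H - {init_form x}) \<noteq> carrier gr"
proof -
  define D where "D \<phi> w \<longleftrightarrow> \<nu> x < \<phi> \<or> \<phi> = 0 \<or> (1 < n 1 \<and> \<phi> = \<nu> y \<and> res (w \<otimes> inv y) \<in> Kf 1)" for \<phi> w
  have J1: "1 \<in> J" using Omega_ge by (simp add: J_def one_enat_def)
  have P1: "P 1 = y" using P_1 by simp
  have ok1: "ok 1" using J_D[OF J1] ok_Suc ok_le le_SucI by blast
  have yc: "y \<in> carrier K" "y \<noteq> \<zero>" "\<nu> x \<le> \<nu> y" using y_R y_nz R_sub v_y_ge by auto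
  have "graded_family (\<lambda>\<phi>. {w \<in> Fe \<phi>. w \<in> Fg \<phi> \<or> D \<phi> w})"
  proof (rule graded_familyI)
    fix w v assume w: "w \<in> R" "w \<noteq> \<zero>" "D (\<nu> w) w" and v: "v \<in> R" "v \<noteq> \<zero>" "D (\<nu> v) v"
    have nn: "0 \<le> \<nu> w" "0 \<le> \<nu> v" using R_ge w v by (auto simp: ge_def)
    have c: "w \<in> carrier K" "v \<in> carrier K" using w v R_sub by auto
    have y: "res (a \<otimes> b \<otimes> inv y) \<in> Kf 1"
      if a: "a \<in> R" and b: "b \<in> carrier K" "b \<noteq> \<zero>" "\<nu> b = \<nu> y" "res (b \<otimes> inv y) \<in> Kf 1" for a b
    proof -
      have iy: "inv y \<in> carrier K" using yc by auto
      have "a \<otimes> b \<otimes> inv y = a \<otimes> (b \<otimes> inv y)" using R_sub[OF a] b iy by (simp add: m_assoc)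
      moreover have "b \<otimes> inv y \<in> ge 0" using b yc iy by (intro geI) auto
      ultimately show ?thesis using res_mult[OF R_ge[OF a]] Kf_mult[OF res_R_Kf[OF a] b(4)] by simp
    qed
    consider "\<nu> x < \<nu> w \<or> \<nu> x < \<nu> v" | "\<nu> w = 0" "\<nu> v = 0"
      | "\<nu> w = 0" "1 < n 1" "\<nu> v = \<nu> y" "res (v \<otimes> inv y) \<in> Kf 1"
      | "\<nu> v = 0" "1 < n 1" "\<nu> w = \<nu> y" "res (w \<otimes> inv y) \<in> Kf 1"
      | "\<nu> w = \<nu> y" "\<nu> v = \<nu> y"
      using w(3) v(3) unfolding D_def by blast
    then show "D (\<nu> w + \<nu> v) (w \<otimes> v)"
    proof cases
      case 1
      then have "\<nu> x < \<nu> w + \<nu> v" using nn by (auto intro: less_le_trans[of _ "\<nu> w"] less_le_trans[of _ "\<nu> v"])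
      then show ?thesis unfolding D_def by blast
    next
      case 2
      then show ?thesis unfolding D_def by simp
    next
      case 3
      then show ?thesis unfolding D_def using y[OF w(1) c(2) v(2)] by simp
    next
      case 4
      then show ?thesis unfolding D_def using y[OF v(1) c(1) w(2)] m_comm[OF c] by simp
    next
      case 5
      have "0 < \<nu> y" using v_x_pos yc(3) by (rule less_le_trans)
      then have "\<nu> x < \<nu> w + \<nu> v" unfolding 5 using yc(3) by (rule add_strict_increasing)
      then show ?thesis unfolding D_def by blast
    qed
  next
    fix \<phi> w v assume F: "w \<in> Fe \<phi>" "v \<in> Fe \<phi>" and w: "D \<phi> w" and v: "v \<in> Fg \<phi> \<or> D \<phi> v"
    show "D \<phi> (w \<oplus> v)"
    proof (cases "\<nu> x < \<phi> \<or> \<phi> = 0")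
      case False
      then have y: "1 < n 1" "\<nu> y = \<phi>" "res (w \<otimes> inv y) \<in> Kf 1" using w unfolding D_def by auto
      have "res (v \<otimes> inv y) \<in> Kf 1"
        using v False rational_trivial[OF yc(1,2) y(2)] unfolding D_def by blast
      then show ?thesis unfolding D_def using rational_add[OF yc(1,2) y(2) F y(3)] y by blast
    qed (auto simp: D_def)
  qed (simp add: D_def)
  moreover have "\<not> D (\<nu> x) x"
  proof
    assume "D (\<nu> x) x"
    then have y: "1 < n 1" "\<nu> x = \<nu> y" "res (x \<otimes> inv y) \<in> Kf 1" using v_x_pos unfolding D_def by auto
    have xM: "x \<in> Mon 1" using P_Mon[OF ok1, of 0] by simp
    have nr: "res (y \<otimes> inv x) \<notin> Kf 1" using P_not_rational[OF J1 y(1) xM] y(2) P1 by simp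
    have c: "x \<in> carrier K" "x \<noteq> \<zero>" "inv x \<in> carrier K" "inv y \<in> carrier K"
      using x_R x_nz R_sub yc by auto
    have q: "x \<otimes> inv y \<in> carrier K" "x \<otimes> inv y \<noteq> \<zero>" "\<nu> (x \<otimes> inv y) = 0"
      using c yc y(2) by (auto simp: integral_iff)
    have "(x \<otimes> inv y) \<otimes> (y \<otimes> inv x) = (x \<otimes> inv x) \<otimes> (y \<otimes> inv y)" using c yc by algebra
    then have "(x \<otimes> inv y) \<otimes> (y \<otimes> inv x) = \<one>" using c yc by simp
    then have "inv (x \<otimes> inv y) = y \<otimes> inv x" using c yc by (intro comm_inv_char) auto
    then have "res (y \<otimes> inv x) = inv\<^bsub>L\<^esub> res (x \<otimes> inv y)" using res_inv[OF q] by simp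
    then show False using nr Kf_inv[OF y(3) res_nonzero[OF q]] by simp
  qed
  then have "x \<notin> {w \<in> Fe (\<nu> x). w \<in> Fg (\<nu> x) \<or> D (\<nu> x) w}" using x_nz by (auto simp: val_gt_def)
  moreover have "f \<in> {w \<in> Fe (\<nu> f). w \<in> Fg (\<nu> f) \<or> D (\<nu> f) w}" if f: "f \<in> gens H" "f \<noteq> x" for f
  proof -
    have late: ?thesis if "\<nu> x < \<nu> f" using that Fe_self gens_R[OF f(1)] by (auto simp: D_def)
    show ?thesis
    proof (rule gens_cases[OF f(1)])
      fix j assume 1: "f = P j" "j \<in> J" "1 < n j"
      have j: "1 \<le> j" "enat j \<le> \<Omega>" using J_D[OF 1(2)] by auto
      show ?thesis
      proof (cases "j = 1")
        case True
        have "y \<otimes> inv y = \<one>" using yc by simp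
        then have "res (y \<otimes> inv y) \<in> Kf 1" using res_R_Kf[OF R_one] by simp
        then show ?thesis using 1 True P1 Fe_self[OF y_R] unfolding D_def by simp
      next
        case False
        then have "\<nu> y < \<beta> j" using beta_mono[of 1 j] j P1 by simp
        then show ?thesis using late yc(3) 1(1) by simp
      qed
    next
      show ?thesis if "f \<in> H" by (rule late[OF H_D(3)[OF that]])
    qed (use f(2) in blast)
  qed
  ultimately show ?thesis using x_R x_nz by (intro separate[of "\<lambda>\<phi>. {w \<in> Fe \<phi>. w \<in> Fg \<phi> \<or> D \<phi> w}"])
qed

text \<open>The degrees bounded by a multiple of \<nu>(x) are closed under sums and contain the
  degrees of all generators except h.\<close>

lemma H_indispensable:
  assumes h: "h \<in> H" shows "gr_subalgebra K \<nu> R m (init_form ` gens H - {init_form h}) \<noteq> carrier gr"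
proof -
  have "graded_family (\<lambda>\<phi>. {w \<in> Fe \<phi>. w \<in> Fg \<phi> \<or> finv \<phi>})"
    by (rule graded_familyI) (auto intro: finv_add finv_zero)
  moreover have "h \<notin> {w \<in> Fe (\<nu> h). w \<in> Fg (\<nu> h) \<or> finv (\<nu> h)}"
    using H_D(2,4)[OF h] by (auto simp: val_gt_def)
  moreover have "f \<in> {w \<in> Fe (\<nu> f). w \<in> Fg (\<nu> f) \<or> finv (\<nu> f)}" if f: "f \<in> gens H" "f \<noteq> h" for f
  proof -
    have "f \<notin> H" using H h f(2) by auto
    then have "finv (\<nu> f)" by (cases rule: gens_cases[OF f(1)]) (use finv_x H_D(6)[OF h] in auto)
    then show ?thesis using Fe_self gens_R[OF f(1)] by simp
  qed
  ultimately show ?thesis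
    using H_D(1,2)[OF h] by (intro separate[of "\<lambda>\<phi>. {w \<in> Fe \<phi>. w \<in> Fg \<phi> \<or> finv \<phi>}"])
qed

lemma initial_forms_minimally_generate:
  assumes h: "h \<in> gens H"
    and dec: "\<And>f. f \<in> R \<Longrightarrow> f \<noteq> \<zero> \<Longrightarrow> \<exists>k f'. f' \<in> R \<and> f' \<noteq> \<zero> \<and> finv (\<nu> f') \<and> f = h [^] (k::nat) \<otimes> f'"
  shows "minimally_generates (gr_subalgebra K \<nu> R m) (init_form ` gens H) (carrier gr)"
proof (rule minimally_generatesI[of "gr_subalgebra K \<nu> R m", OF _ gr_subalgebra_mono])
  show "gr_subalgebra K \<nu> R m (init_form ` gens H) = carrier gr"
  proof (rule gr_generated)
    show "init_form ` gens H \<subseteq> init_form ` (R - {\<zero>})" using gens_R by blast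
    show "init_form x \<in> init_form ` gens H" by (simp add: gens_def)
    show "init_form (P i) \<in> init_form ` gens H" if "i \<in> J" "1 < n i" for i using that unfolding gens_def by blast
  qed (use h gens_R[OF h] dec in auto)
  fix e assume "e \<in> init_form ` gens H"
  then obtain f where f: "f \<in> gens H" "e = init_form f" by blast
  show "gr_subalgebra K \<nu> R m (init_form ` gens H - {e}) \<noteq> carrier gr"
    unfolding f(2) by (rule gens_cases[OF f(1)]) (simp_all add: x_indispensable P_indispensable H_indispensable)
qed

end

lemma init_form_gens: "init_form ` gens H = {init_form x} \<union> {init_form (P i) | i. i \<in> J \<and> 1 < n i} \<union> init_form ` H"
  unfolding gens_def by blast

text \<open>The common core of the three cases, which differ in the element h used for dividing and
  in whether it has to be added as a generator.\<close>

lemma generated_structure: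
  assumes fin: "finite {i \<in> J. 1 < n i}"
    and H: "H = {} \<or> (\<exists>h. H = {h} \<and> h \<in> R \<and> h \<noteq> \<zero> \<and> \<not> finv (\<nu> h) \<and> (\<forall>i\<in>J. finv (\<beta> i)))"
    and h: "h \<in> gens H" "H \<subseteq> {h}" "\<nu> h \<in> nat_combinations (VG \<union> \<nu> ` H)"
    and dec: "\<And>f. f \<in> R \<Longrightarrow> f \<noteq> \<zero> \<Longrightarrow> \<exists>k f'. f' \<in> R \<and> f' \<noteq> \<zero> \<and> finv (\<nu> f') \<and> f = h [^] (k::nat) \<otimes> f'"
  shows "finite (init_form ` gens H)"
    "minimally_generates (gr_subalgebra K \<nu> R m) (init_form ` gens H) (carrier gr)"
    "finite (VG \<union> \<nu> ` H)"
    "minimally_generates nat_combinations (VG \<union> \<nu> ` H) (value_semigroup K \<nu> R)"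
proof -
  have hR: "h \<in> R" "h \<noteq> \<zero>" using gens_R[OF H h(1)] by auto
  have finH: "finite H" using H by auto
  have "{P i | i. i \<in> J \<and> 1 < n i} = P ` {i \<in> J. 1 < n i}" by blast
  then have "finite (gens H)" unfolding gens_def using fin finH by simp
  then show "finite (init_form ` gens H)" by (rule finite_imageI)
  show "minimally_generates (gr_subalgebra K \<nu> R m) (init_form ` gens H) (carrier gr)"
    by (rule initial_forms_minimally_generate[OF H h(1) dec])
  have "{\<beta> i | i. i \<in> J \<and> 1 < nbar i} \<subseteq> (\<lambda>i. \<beta> i) ` {i \<in> J. 1 < n i}"
    using nbar_le_n less_le_trans by blast
  then have "finite {\<beta> i | i. i \<in> J \<and> 1 < nbar i}" using fin by (meson finite_imageI finite_subset)
  then show "finite (VG \<union> \<nu> ` H)" unfolding VG_def using finH by simp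
  have "\<nu> ` H \<subseteq> {\<nu> h}" using h(2) by blast
  then have gen: "nat_combinations (VG \<union> \<nu> ` H) = value_semigroup K \<nu> R"
    by (rule value_semigroup_generated[OF _ hR h(3) dec])
  have "\<nu> ` H = {} \<or> (\<exists>\<gamma>. \<nu> ` H = {\<gamma>} \<and> \<not> finv \<gamma> \<and> (\<forall>i\<in>J. finv (\<beta> i)))" using H by auto
  then show "minimally_generates nat_combinations (VG \<union> \<nu> ` H) (value_semigroup K \<nu> R)"
    using gen by (rule values_minimally_generate)
qed

lemma finite_J:
  assumes "\<Omega> = enat r" shows "finite {i \<in> J. 1 < n i}"
proof (rule finite_subset)
  show "{i \<in> J. 1 < n i} \<subseteq> {..r}"
  proof
    fix i assume "i \<in> {i \<in> J. 1 < n i}"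
    then have "enat i \<le> \<Omega>" using J_D by blast
    then show "i \<in> {..r}" unfolding assms by simp
  qed
qed simp

end

section \<open>The three cases\<close>

context rank_two_sequence
begin

lemma contraction_maximal:
  assumes xI: "x \<in> I"
  shows "I \<inter> R = m" "finite (init_form ` gens {})"
    "minimally_generates (gr_subalgebra K \<nu> R m) (init_form ` gens {}) (carrier gr)"
    "finite VG" "minimally_generates nat_combinations VG (value_semigroup K \<nu> R)"
    "carrier L = KK"
proof -
  obtain r where r: "\<Omega> = enat r" using Omega_finite[OF xI] by blast
  have fv: "finv (\<nu> f)" if "f \<in> R" "f \<noteq> \<zero>" for f using all_finv[OF xI R_sub[OF that(1)] that(2)] .
  \<comment> \<open>All values are bounded by multiples of \<nu>(x), so the exponent 0 serves; x
    takes the place of h because it is a generator anyway.\<close>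
  have dec: "\<exists>k f'. f' \<in> R \<and> f' \<noteq> \<zero> \<and> finv (\<nu> f') \<and> f = x [^] (k::nat) \<otimes> f'"
    if f: "f \<in> R" "f \<noteq> \<zero>" for f
    by (rule exI[of _ 0], rule exI[of _ f]) (simp add: f fv R_sub)
  have xc: "\<nu> x \<in> nat_combinations (VG \<union> \<nu> ` {})" by (rule nat_combinations_base) (simp add: VG_def)
  have xg: "x \<in> gens {}" by (simp add: gens_def)
  note S = generated_structure[OF finite_J[OF r] disjI1[OF refl] xg empty_subsetI xc dec]
  show "finite (init_form ` gens {})" by (rule S(1))
  show "minimally_generates (gr_subalgebra K \<nu> R m) (init_form ` gens {}) (carrier gr)" by (rule S(2))
  show "finite VG" using S(3) by simp
  show "minimally_generates nat_combinations VG (value_semigroup K \<nu> R)" using S(4) by simp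
  show "I \<inter> R = m" by (rule I_R_eq_m[OF xI])
  show "carrier L = KK"
  proof (rule residue_field_eq)
    fix f assume f: "f \<in> carrier K" "f \<noteq> \<zero>"
    obtain a b where ab: "a \<in> R" "a \<noteq> \<zero>" "b \<in> R" "b \<noteq> \<zero>" "f = a \<otimes> inv b" by (rule fraction[OF f])
    then show "\<exists>a b. a \<in> R \<and> a \<noteq> \<zero> \<and> finv (\<nu> a) \<and> b \<in> R \<and> b \<noteq> \<zero> \<and> finv (\<nu> b) \<and> f = a \<otimes> inv b"
      using fv by blast
  qed
qed

context
  assumes xI: "x \<notin> I"
begin

lemma residue_field_adjoin: "carrier L = KK"
proof (rule residue_field_eq)
  fix f assume f: "f \<in> carrier K" "f \<noteq> \<zero>" "\<nu> f = 0"
  show "\<exists>a b. a \<in> R \<and> a \<noteq> \<zero> \<and> finv (\<nu> a) \<and> b \<in> R \<and> b \<noteq> \<zero> \<and> finv (\<nu> b) \<and> f = a \<otimes> inv b"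
    by (rule unit_fraction[OF xI f]) blast
qed

lemma contraction_by_last:
  assumes r: "\<Omega> = enat r"
  shows "finite (init_form ` gens {})"
    "minimally_generates (gr_subalgebra K \<nu> R m) (init_form ` gens {}) (carrier gr)"
    "finite VG" "minimally_generates nat_combinations VG (value_semigroup K \<nu> R)"
proof -
  have Om: "enat r \<le> \<Omega>" using r by simp
  have "enat 1 \<le> enat r" using Omega_ge unfolding r by (simp add: one_enat_def)
  then have rJ: "r \<in> J" using Om by (simp add: J_def)
  \<comment> \<open>n is infinite at \<Omega>, so the generator of I \<inter> R is already among the
    initial forms listed and H stays empty.\<close>
  have "1 < n r" by (simp add: n_Omega[OF r])
  then have Pg: "P r \<in> gens {}" using rJ unfolding gens_def by blast
  have c: "\<beta> r \<in> nat_combinations (VG \<union> \<nu> ` {})" using beta_combination[OF Om] by simp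
  have dec: "\<exists>k f'. f' \<in> R \<and> f' \<noteq> \<zero> \<and> finv (\<nu> f') \<and> f = P r [^] (k::nat) \<otimes> f'"
    if f: "f \<in> R" "f \<noteq> \<zero>" for f
    by (rule decompose[OF xI P_R[OF Om] P_nz[OF Om] last_generates[OF xI r] f]) blast
  note S = generated_structure[OF finite_J[OF r] disjI1[OF refl] Pg empty_subsetI c dec]
  show "finite (init_form ` gens {})" by (rule S(1))
  show "minimally_generates (gr_subalgebra K \<nu> R m) (init_form ` gens {}) (carrier gr)" by (rule S(2))
  show "finite VG" using S(3) by simp
  show "minimally_generates nat_combinations VG (value_semigroup K \<nu> R)" using S(4) by simp
qed

lemma contraction_by_extra:
  assumes Om: "\<Omega> = \<infinity>" and g: "g \<in> I" "g \<in> R" "g \<noteq> \<zero>" "I \<inter> R = PIdl\<^bsub>A\<^esub> g"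
  shows "finite (init_form ` gens {g})"
    "minimally_generates (gr_subalgebra K \<nu> R m) (init_form ` gens {g}) (carrier gr)"
    "finite (VG \<union> {\<nu> g})" "minimally_generates nat_combinations (VG \<union> {\<nu> g}) (value_semigroup K \<nu> R)"
proof -
  have fin: "finite {i \<in> J. 1 < n i}"
    by (rule finite_subset[OF _ finite_generators[OF xI Om]]) (auto simp: J_def)
  have "\<not> finv (\<nu> g)" using I_iff[OF xI R_sub[OF g(2)] g(3)] g(1) by simp
  moreover have "finv (\<beta> i)" for i by (rule finv_beta_lt) (simp add: Om)
  ultimately have H: "{g} = {} \<or> (\<exists>h. {g} = {h} \<and> h \<in> R \<and> h \<noteq> \<zero> \<and> \<not> finv (\<nu> h) \<and> (\<forall>i\<in>J. finv (\<beta> i)))"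
    using g(2,3) by simp
  have c: "\<nu> g \<in> nat_combinations (VG \<union> \<nu> ` {g})" by (rule nat_combinations_base) simp
  have gg: "g \<in> gens {g}" by (simp add: gens_def)
  have dec: "\<exists>k f'. f' \<in> R \<and> f' \<noteq> \<zero> \<and> finv (\<nu> f') \<and> f = g [^] (k::nat) \<otimes> f'"
    if f: "f \<in> R" "f \<noteq> \<zero>" for f
    by (rule decompose[OF xI g(2-4) f]) blast
  note S = generated_structure[OF fin H gg subset_refl c dec]
  show "finite (init_form ` gens {g})" by (rule S(1))
  show "minimally_generates (gr_subalgebra K \<nu> R m) (init_form ` gens {g}) (carrier gr)" by (rule S(2))
  show "finite (VG \<union> {\<nu> g})" using S(3) by simp
  show "minimally_generates nat_combinations (VG \<union> {\<nu> g}) (value_semigroup K \<nu> R)" using S(4) by simp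
qed

end

end

theorem theorem4p12:
  fixes K :: "('a, 'b) ring_scheme"
    and R m I CS :: "'a set"
    and x y :: 'a
    and \<nu> :: "'a \<Rightarrow> 'g::linordered_ab_group_add"
    and P :: "nat \<Rightarrow> 'a"
    and \<Omega> :: enat
    and nbar d n :: "nat \<Rightarrow> enat"
    and \<alpha> :: "nat \<Rightarrow> 'a set"
  assumes quotient_field: "quotient_field K R"
    and regular: "regular_local_ring (K\<lparr>carrier := R\<rparr>) m"
    and dim_two: "krull_dim (K\<lparr>carrier := R\<rparr>) = 2"
    and coefficient_set: "coefficient_set (K\<lparr>carrier := R\<rparr>) m CS"
    and parameters: "x \<in> R" "y \<in> R" "m = Idl\<^bsub>K\<lparr>carrier := R\<rparr>\<^esub> {x, y}"
    and valuation: "valuation K \<nu>"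
    and rank_two: "valuation_rank K \<nu> = 2"
    and dominates: "dominates K \<nu> R m"
    and value_x: "\<nu> x = ideal_value K \<nu> m"
    and algorithm: "algorithm_run K \<nu> R CS x y P \<Omega> nbar d n \<alpha>"
    and I: "height_one_prime (valuation_ring K \<nu>) I"
  shows
    "let J = {i. 1 \<le> i \<and> enat i \<le> \<Omega>};
         in_gens = {initial_form K \<nu> R x} \<union> {initial_form K \<nu> R (P i) | i. i \<in> J \<and> 1 < n i};
         val_gens = {\<nu> x} \<union> {\<nu> (P i) | i. i \<in> J \<and> 1 < nbar i}
     in
     (I \<inter> R = m
      \<and> finite in_gens
      \<and> minimally_generates (gr_subalgebra K \<nu> R m) in_gens (carrier (gr_ring K \<nu> R))
      \<and> finite val_gens
      \<and> minimally_generates nat_combinations val_gens (value_semigroup K \<nu> R)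
      \<and> carrier (residue_field K \<nu>) = residue_adjoin K \<nu> R \<alpha> {i \<in> J. 1 < d i})
    \<or>
     (\<exists>N. \<Omega> = enat N \<and> I \<inter> R = PIdl\<^bsub>K\<lparr>carrier := R\<rparr>\<^esub> P N
      \<and> height_one_prime (K\<lparr>carrier := R\<rparr>) (I \<inter> R)
      \<and> finite in_gens
      \<and> minimally_generates (gr_subalgebra K \<nu> R m) in_gens (carrier (gr_ring K \<nu> R))
      \<and> finite val_gens
      \<and> minimally_generates nat_combinations val_gens (value_semigroup K \<nu> R)
      \<and> carrier (residue_field K \<nu>) = residue_adjoin K \<nu> R \<alpha> {i \<in> J. 1 < d i})
    \<or>
     (\<exists>g\<in>R. I \<inter> R = PIdl\<^bsub>K\<lparr>carrier := R\<rparr>\<^esub> g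
      \<and> height_one_prime (K\<lparr>carrier := R\<rparr>) (I \<inter> R)
      \<and> finite (in_gens \<union> {initial_form K \<nu> R g})
      \<and> minimally_generates (gr_subalgebra K \<nu> R m) (in_gens \<union> {initial_form K \<nu> R g})
          (carrier (gr_ring K \<nu> R))
      \<and> finite (val_gens \<union> {\<nu> g})
      \<and> minimally_generates nat_combinations (val_gens \<union> {\<nu> g}) (value_semigroup K \<nu> R)
      \<and> carrier (residue_field K \<nu>) = residue_adjoin K \<nu> R \<alpha> {i \<in> J. 1 < d i})"
proof -
  have "field K" using quotient_field by (simp add: quotient_field_def)
  moreover have "CS \<subseteq> R" using coefficient_set by (simp add: coefficient_set_def)
  ultimately interpret rank_two_sequence K \<nu> R m CS x y P \<Omega> nbar d n \<alpha> I
    using assms by (intro rank_two_sequence.intro generating_sequence.intro generating_sequence_axioms.intro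
        rank_two_valuation.intro rank_two_valuation_axioms.intro valued_field.intro valued_field_axioms.intro)
  define in_gens where "in_gens = {initial_form K \<nu> R x} \<union> {initial_form K \<nu> R (P i) | i. i \<in> J \<and> 1 < n i}"
  have in_gens: "init_form ` gens H = in_gens \<union> init_form ` H" for H
    unfolding in_gens_def by (rule init_form_gens)
  have J': "{i. 1 \<le> i \<and> enat i \<le> \<Omega>} = J" by (simp add: J_def)
  note goal_simps = Let_def J' in_gens_def[symmetric] VG_def[symmetric]
  show ?thesis
  \<comment> \<open>x \<in> I leads to the first case; otherwise the second or the third holds
    according to whether the run stops.\<close>
  proof (cases "x \<in> I")
    case True
    note S = contraction_maximal[OF True, unfolded in_gens image_empty Un_empty_right]
    show ?thesis unfolding goal_simps by (intro disjI1 conjI S)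
  next
    case xI: False
    show ?thesis
    proof (cases \<Omega>)
      case (enat r)
      note S = contraction_by_last[OF xI enat, unfolded in_gens image_empty Un_empty_right]
      show ?thesis unfolding goal_simps
        by (intro disjI2 disjI1 exI[of _ r] conjI enat last_generates[OF xI enat] contraction_height_one[OF xI]
            S residue_field_adjoin[OF xI])
    next
      case infinity
      obtain g where g: "g \<in> I" "g \<in> R" "g \<noteq> \<zero>\<^bsub>K\<^esub>" "I \<inter> R = PIdl\<^bsub>A\<^esub> g"
        by (rule contraction_principal[OF xI])
      note S = contraction_by_extra[OF xI infinity g, unfolded in_gens image_insert image_empty]
      show ?thesis unfolding goal_simps
        by (intro disjI2 bexI[of _ g] conjI g contraction_height_one[OF xI] S residue_field_adjoin[OF xI])
    qed
  qed
qed

end
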